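(* Let $p$ be an odd prime and let $G$ be a finite elementary abelian $p$-group of order $p^n$. There are exactly $\left\lfloor\frac{3n+2}{2}\right\rfloor$ isomorphism types (as Hopf algebras) of commutative Hopf algebra extensions of $\Bbbk C_p$ by $\Bbbk^G$.
   Context: $\Bbbk$ is an algebraically closed field of characteristic $0$, $C_p$ the cyclic group of order $p$, $\Bbbk^G$ the Hopf algebra of functions on $G$ (dual of $\Bbbk G$). A Hopf algebra $H$ is an extension of $\Bbbk C_p$ by $\Bbbk^G$ if there is a sequence of Hopf algebra maps $\Bbbk^G\xrightarrow{\iota}H\xrightarrow{\pi}\Bbbk C_p$ with $\iota$ injective, $\pi$ surjective, $\iota(\Bbbk^G)$ normal in $H$ and $\ker\pi=\iota(\Bbbk^G)^+H$, where $A^+=\ker\varepsilon_A$. The extension is commutative if $H$ is commutative. *)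

theory Defs
  imports "HOL-Algebra.Algebra"
begin

definition linear_map ::
    "('k, 'm) ring_scheme \<Rightarrow> ('k, 'v, 'x) module_scheme \<Rightarrow> ('k, 'w, 'y) module_scheme \<Rightarrow> ('v \<Rightarrow> 'w) \<Rightarrow> bool" where
  "linear_map K V W f \<longleftrightarrow>
     f \<in> carrier V \<rightarrow> carrier W \<and>
     (\<forall>x\<in>carrier V. \<forall>y\<in>carrier V. f (x \<oplus>\<^bsub>V\<^esub> y) = f x \<oplus>\<^bsub>W\<^esub> f y) \<and>
     (\<forall>c\<in>carrier K. \<forall>x\<in>carrier V. f (c \<odot>\<^bsub>V\<^esub> x) = c \<odot>\<^bsub>W\<^esub> f x)"

definition span_in ::
    "('k, 'm) ring_scheme \<Rightarrow> ('k, 'v, 'x) module_scheme \<Rightarrow> 'v set \<Rightarrow> 'v set" where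
  "span_in K V S = (\<lambda>N. submodule N K V) hull S"

text \<open>The library's locale \<open>algebra\<close> forces the algebra to be commutative.\<close>

locale assoc_algebra = field K + module K A + A: ring A
  for K (structure) and A (structure) +
  assumes smult_mult_left: "\<lbrakk>c \<in> carrier K; x \<in> carrier A; y \<in> carrier A\<rbrakk> \<Longrightarrow>
      (c \<odot>\<^bsub>A\<^esub> x) \<otimes>\<^bsub>A\<^esub> y = c \<odot>\<^bsub>A\<^esub> (x \<otimes>\<^bsub>A\<^esub> y)"
    and smult_mult_right: "\<lbrakk>c \<in> carrier K; x \<in> carrier A; y \<in> carrier A\<rbrakk> \<Longrightarrow>
      x \<otimes>\<^bsub>A\<^esub> (c \<odot>\<^bsub>A\<^esub> y) = c \<odot>\<^bsub>A\<^esub> (x \<otimes>\<^bsub>A\<^esub> y)"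


section \<open>Tensor products\<close>

text \<open>The vector space with basis \<open>I\<close>: finitely supported functions on \<open>I\<close>, extended by zero.
  Vector spaces are library modules, so their (meaningless) ring multiplication and unit are left
  unspecified.\<close>

definition free_space :: "('k, 'm) ring_scheme \<Rightarrow> 'i set \<Rightarrow> ('k, 'i \<Rightarrow> 'k) module" where
  "free_space K I =
     \<lparr>carrier = {f. finite {i. f i \<noteq> \<zero>\<^bsub>K\<^esub>} \<and> (\<forall>i. f i \<in> carrier K) \<and> (\<forall>i. i \<notin> I \<longrightarrow> f i = \<zero>\<^bsub>K\<^esub>)},
      monoid.mult = undefined, one = undefined,
      ring.zero = (\<lambda>_. \<zero>\<^bsub>K\<^esub>), ring.add = (\<lambda>f g i. f i \<oplus>\<^bsub>K\<^esub> g i),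
      smult = (\<lambda>c f i. c \<otimes>\<^bsub>K\<^esub> f i)\<rparr>"

definition basis_vector :: "('k, 'm) ring_scheme \<Rightarrow> 'i \<Rightarrow> 'i \<Rightarrow> 'k" where
  "basis_vector K i = (\<lambda>j. if j = i then \<one>\<^bsub>K\<^esub> else \<zero>\<^bsub>K\<^esub>)"

text \<open>\<open>A \<otimes> B\<close> is the free vector space on \<open>A \<times> B\<close> modulo the bilinearity relations; its
  elements are cosets.\<close>

definition tensor_relations ::
    "('k, 'm) ring_scheme \<Rightarrow> ('k, 'a, 'x) module_scheme \<Rightarrow> ('k, 'b, 'y) module_scheme \<Rightarrow> ('a \<times> 'b \<Rightarrow> 'k) set" where
  "tensor_relations K A B =
     (let F = free_space K (carrier A \<times> carrier B); e = basis_vector K in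
       {e (a \<oplus>\<^bsub>A\<^esub> a', b) \<ominus>\<^bsub>F\<^esub> (e (a, b) \<oplus>\<^bsub>F\<^esub> e (a', b)) | a a' b.
          a \<in> carrier A \<and> a' \<in> carrier A \<and> b \<in> carrier B} \<union>
       {e (a, b \<oplus>\<^bsub>B\<^esub> b') \<ominus>\<^bsub>F\<^esub> (e (a, b) \<oplus>\<^bsub>F\<^esub> e (a, b')) | a b b'.
          a \<in> carrier A \<and> b \<in> carrier B \<and> b' \<in> carrier B} \<union>
       {e (c \<odot>\<^bsub>A\<^esub> a, b) \<ominus>\<^bsub>F\<^esub> c \<odot>\<^bsub>F\<^esub> e (a, b) | c a b.
          c \<in> carrier K \<and> a \<in> carrier A \<and> b \<in> carrier B} \<union>
       {e (a, c \<odot>\<^bsub>B\<^esub> b) \<ominus>\<^bsub>F\<^esub> c \<odot>\<^bsub>F\<^esub> e (a, b) | c a b.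
          c \<in> carrier K \<and> a \<in> carrier A \<and> b \<in> carrier B})"

definition tensor_null ::
    "('k, 'm) ring_scheme \<Rightarrow> ('k, 'a, 'x) module_scheme \<Rightarrow> ('k, 'b, 'y) module_scheme \<Rightarrow> ('a \<times> 'b \<Rightarrow> 'k) set" where
  "tensor_null K A B =
     span_in K (free_space K (carrier A \<times> carrier B)) (tensor_relations K A B)"

definition tensor_space ::
    "('k, 'm) ring_scheme \<Rightarrow> ('k, 'a, 'x) module_scheme \<Rightarrow> ('k, 'b, 'y) module_scheme \<Rightarrow>
     ('k, ('a \<times> 'b \<Rightarrow> 'k) set) module" where
  "tensor_space K A B =
     (let F = free_space K (carrier A \<times> carrier B); N = tensor_null K A B in
       \<lparr>carrier = a_rcosets\<^bsub>F\<^esub> N,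
        monoid.mult = undefined, one = undefined,
        ring.zero = N, ring.add = set_add F,
        smult = (\<lambda>c u. \<Union>f\<in>u. N +>\<^bsub>F\<^esub> (c \<odot>\<^bsub>F\<^esub> f))\<rparr>)"

definition tensor ::
    "('k, 'm) ring_scheme \<Rightarrow> ('k, 'a, 'x) module_scheme \<Rightarrow> ('k, 'b, 'y) module_scheme \<Rightarrow>
     'a \<Rightarrow> 'b \<Rightarrow> ('a \<times> 'b \<Rightarrow> 'k) set" where
  "tensor K A B a b =
     tensor_null K A B +>\<^bsub>free_space K (carrier A \<times> carrier B)\<^esub> basis_vector K (a, b)"

text \<open>The linear map \<open>A \<otimes> B \<rightarrow> V\<close> induced by a bilinear map \<open>\<beta>\<close>; bilinearity makes the value
  independent of the chosen representative of the coset.\<close>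

definition tensor_lift ::
    "('k, 'm) ring_scheme \<Rightarrow> ('k, 'v, 'x) module_scheme \<Rightarrow> ('a \<Rightarrow> 'b \<Rightarrow> 'v) \<Rightarrow>
     ('a \<times> 'b \<Rightarrow> 'k) set \<Rightarrow> 'v" where
  "tensor_lift K V \<beta> u =
     (let f = (SOME f. f \<in> u) in
       \<Oplus>\<^bsub>V\<^esub> i \<in> {i. f i \<noteq> \<zero>\<^bsub>K\<^esub>}. f i \<odot>\<^bsub>V\<^esub> \<beta> (fst i) (snd i))"

text \<open>\<open>f \<otimes> g\<close>, where \<open>A\<close> and \<open>B\<close> are the codomains of \<open>f\<close> and \<open>g\<close>.\<close>

definition tensor_map ::
    "('k, 'm) ring_scheme \<Rightarrow> ('k, 'a, 'x) module_scheme \<Rightarrow> ('k, 'b, 'y) module_scheme \<Rightarrow>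
     ('c \<Rightarrow> 'a) \<Rightarrow> ('d \<Rightarrow> 'b) \<Rightarrow> ('c \<times> 'd \<Rightarrow> 'k) set \<Rightarrow> ('a \<times> 'b \<Rightarrow> 'k) set" where
  "tensor_map K A B f g =
     tensor_lift K (tensor_space K A B) (\<lambda>c d. tensor K A B (f c) (g d))"

text \<open>The canonical map \<open>(A \<otimes> B) \<otimes> C \<rightarrow> A \<otimes> (B \<otimes> C)\<close>.\<close>

definition tensor_assoc ::
    "('k, 'm) ring_scheme \<Rightarrow> ('k, 'a, 'x) module_scheme \<Rightarrow> ('k, 'b, 'y) module_scheme \<Rightarrow>
     ('k, 'c, 'z) module_scheme \<Rightarrow>
     (('a \<times> 'b \<Rightarrow> 'k) set \<times> 'c \<Rightarrow> 'k) set \<Rightarrow> ('a \<times> ('b \<times> 'c \<Rightarrow> 'k) set \<Rightarrow> 'k) set" where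
  "tensor_assoc K A B C =
     (let BC = tensor_space K B C; T = tensor_space K A BC in
       tensor_lift K T (\<lambda>u c. tensor_lift K T (\<lambda>a b. tensor K A BC a (tensor K B C b c)) u))"

definition tensor_algebra ::
    "('k, 'm) ring_scheme \<Rightarrow> ('k, 'a, 'x) module_scheme \<Rightarrow> ('k, 'b, 'y) module_scheme \<Rightarrow>
     ('k, ('a \<times> 'b \<Rightarrow> 'k) set) module" where
  "tensor_algebra K A B =
     (let T = tensor_space K A B in
       T\<lparr>monoid.mult := (\<lambda>u v. tensor_lift K T (\<lambda>a b.
           tensor_lift K T (\<lambda>a' b'. tensor K A B (a \<otimes>\<^bsub>A\<^esub> a') (b \<otimes>\<^bsub>B\<^esub> b')) v) u),
         one := tensor K A B \<one>\<^bsub>A\<^esub> \<one>\<^bsub>B\<^esub>\<rparr>)"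


section \<open>Hopf algebras\<close>

record ('k, 'h) hopf_data = "('k, 'h) module" +
  comult :: "'h \<Rightarrow> ('h \<times> 'h \<Rightarrow> 'k) set"
  counit :: "'h \<Rightarrow> 'k"
  antipode :: "'h \<Rightarrow> 'h"

locale hopf_algebra = assoc_algebra K H
  for K :: "('k, 'm) ring_scheme" (structure) and H :: "('k, 'h) hopf_data" (structure) +
  assumes comult_linear: "linear_map K H (tensor_space K H H) (comult H)"
    and comult_ring_hom: "comult H \<in> ring_hom H (tensor_algebra K H H)"
    and counit_ring_hom: "counit H \<in> ring_hom H K"
    and counit_smult: "\<lbrakk>c \<in> carrier K; h \<in> carrier H\<rbrakk> \<Longrightarrow> counit H (c \<odot>\<^bsub>H\<^esub> h) = c \<otimes>\<^bsub>K\<^esub> counit H h"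
    and antipode_linear: "linear_map K H H (antipode H)"
    and coassoc: "h \<in> carrier H \<Longrightarrow>
      tensor_assoc K H H H (tensor_map K (tensor_space K H H) H (comult H) id (comult H h)) =
      tensor_map K H (tensor_space K H H) id (comult H) (comult H h)"
    and counit_left: "h \<in> carrier H \<Longrightarrow>
      tensor_lift K H (\<lambda>a b. counit H a \<odot>\<^bsub>H\<^esub> b) (comult H h) = h"
    and counit_right: "h \<in> carrier H \<Longrightarrow>
      tensor_lift K H (\<lambda>a b. counit H b \<odot>\<^bsub>H\<^esub> a) (comult H h) = h"
    and antipode_left: "h \<in> carrier H \<Longrightarrow>
      tensor_lift K H (\<lambda>a b. antipode H a \<otimes>\<^bsub>H\<^esub> b) (comult H h) = counit H h \<odot>\<^bsub>H\<^esub> \<one>\<^bsub>H\<^esub>"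
    and antipode_right: "h \<in> carrier H \<Longrightarrow>
      tensor_lift K H (\<lambda>a b. a \<otimes>\<^bsub>H\<^esub> antipode H b) (comult H h) = counit H h \<odot>\<^bsub>H\<^esub> \<one>\<^bsub>H\<^esub>"

definition hopf_hom ::
    "('k, 'm) ring_scheme \<Rightarrow> ('k, 'a) hopf_data \<Rightarrow> ('k, 'b) hopf_data \<Rightarrow> ('a \<Rightarrow> 'b) set" where
  "hopf_hom K A B = {f. linear_map K A B f \<and> f \<in> ring_hom A B \<and>
     (\<forall>x\<in>carrier A. comult B (f x) = tensor_map K B B f f (comult A x)) \<and>
     (\<forall>x\<in>carrier A. counit B (f x) = counit A x) \<and>
     (\<forall>x\<in>carrier A. antipode B (f x) = f (antipode A x))}"

definition hopf_isomorphic ::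
    "('k, 'm) ring_scheme \<Rightarrow> ('k, 'a) hopf_data \<Rightarrow> ('k, 'b) hopf_data \<Rightarrow> bool" where
  "hopf_isomorphic K A B \<longleftrightarrow> hopf_algebra K A \<and> hopf_algebra K B \<and>
     (\<exists>f \<in> hopf_hom K A B. bij_betw f (carrier A) (carrier B))"

text \<open>The convolution product on \<open>\<Bbbk>G\<close> is written on finitely supported functions, and the group
  element \<open>x\<close> is \<open>basis_vector K x\<close>.\<close>

definition group_algebra :: "('k, 'm) ring_scheme \<Rightarrow> ('g, 'n) monoid_scheme \<Rightarrow> ('k, 'g \<Rightarrow> 'k) module" where
  "group_algebra K G =
     (let F = free_space K (carrier G) in
       F\<lparr>monoid.mult := (\<lambda>f g. \<Oplus>\<^bsub>F\<^esub> x \<in> {x. f x \<noteq> \<zero>\<^bsub>K\<^esub>}. \<Oplus>\<^bsub>F\<^esub> y \<in> {y. g y \<noteq> \<zero>\<^bsub>K\<^esub>}.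
           (f x \<otimes>\<^bsub>K\<^esub> g y) \<odot>\<^bsub>F\<^esub> basis_vector K (x \<otimes>\<^bsub>G\<^esub> y)),
         one := basis_vector K \<one>\<^bsub>G\<^esub>\<rparr>)"

definition group_hopf :: "('k, 'm) ring_scheme \<Rightarrow> ('g, 'n) monoid_scheme \<Rightarrow> ('k, 'g \<Rightarrow> 'k) hopf_data" where
  "group_hopf K G =
     (let A = group_algebra K G; T = tensor_space K A A in
       module.extend A (hopf_data.fields
         (\<lambda>f. \<Oplus>\<^bsub>T\<^esub> x \<in> {x. f x \<noteq> \<zero>\<^bsub>K\<^esub>}. f x \<odot>\<^bsub>T\<^esub> tensor K A A (basis_vector K x) (basis_vector K x))
         (\<lambda>f. \<Oplus>\<^bsub>K\<^esub> x \<in> {x. f x \<noteq> \<zero>\<^bsub>K\<^esub>}. f x)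
         (\<lambda>f. \<Oplus>\<^bsub>A\<^esub> x \<in> {x. f x \<noteq> \<zero>\<^bsub>K\<^esub>}. f x \<odot>\<^bsub>A\<^esub> basis_vector K (inv\<^bsub>G\<^esub> x))))"

definition function_algebra :: "('k, 'm) ring_scheme \<Rightarrow> ('g, 'n) monoid_scheme \<Rightarrow> ('k, 'g \<Rightarrow> 'k) module" where
  "function_algebra K G =
     \<lparr>carrier = carrier G \<rightarrow>\<^sub>E carrier K,
      monoid.mult = (\<lambda>f g. \<lambda>x\<in>carrier G. f x \<otimes>\<^bsub>K\<^esub> g x), one = (\<lambda>x\<in>carrier G. \<one>\<^bsub>K\<^esub>),
      ring.zero = (\<lambda>x\<in>carrier G. \<zero>\<^bsub>K\<^esub>), ring.add = (\<lambda>f g. \<lambda>x\<in>carrier G. f x \<oplus>\<^bsub>K\<^esub> g x),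
      smult = (\<lambda>c f. \<lambda>x\<in>carrier G. c \<otimes>\<^bsub>K\<^esub> f x)\<rparr>"

text \<open>The Hopf algebra \<open>\<Bbbk>\<^sup>G\<close> of functions on a finite group. Under
  \<open>\<Bbbk>\<^sup>G \<otimes> \<Bbbk>\<^sup>G \<cong> \<Bbbk>\<^bsup>G \<times> G\<^esup>\<close> the coproduct \<open>\<Delta> f\<close> is \<open>(x, y) \<mapsto> f (x y)\<close>, expanded
  below in the indicator functions \<open>d x\<close>.\<close>

definition function_hopf :: "('k, 'm) ring_scheme \<Rightarrow> ('g, 'n) monoid_scheme \<Rightarrow> ('k, 'g \<Rightarrow> 'k) hopf_data" where
  "function_hopf K G =
     (let A = function_algebra K G; T = tensor_space K A A;
          d = (\<lambda>x. restrict (basis_vector K x) (carrier G)) in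
       module.extend A (hopf_data.fields
         (\<lambda>f. \<Oplus>\<^bsub>T\<^esub> z \<in> carrier G \<times> carrier G.
            f (fst z \<otimes>\<^bsub>G\<^esub> snd z) \<odot>\<^bsub>T\<^esub> tensor K A A (d (fst z)) (d (snd z)))
         (\<lambda>f. f \<one>\<^bsub>G\<^esub>)
         (\<lambda>f. \<lambda>x\<in>carrier G. f (inv\<^bsub>G\<^esub> x))))"


section \<open>Extensions\<close>

text \<open>Stability under both adjoint actions, \<open>h\<^sub>1 a S(h\<^sub>2) \<in> A\<close> and \<open>S(h\<^sub>1) a h\<^sub>2 \<in> A\<close>.\<close>

definition normal_hopf_subset :: "('k, 'm) ring_scheme \<Rightarrow> ('k, 'h) hopf_data \<Rightarrow> 'h set \<Rightarrow> bool" where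
  "normal_hopf_subset K H A \<longleftrightarrow>
     (\<forall>h\<in>carrier H. \<forall>a\<in>A.
        tensor_lift K H (\<lambda>x y. x \<otimes>\<^bsub>H\<^esub> a \<otimes>\<^bsub>H\<^esub> antipode H y) (comult H h) \<in> A \<and>
        tensor_lift K H (\<lambda>x y. antipode H x \<otimes>\<^bsub>H\<^esub> a \<otimes>\<^bsub>H\<^esub> y) (comult H h) \<in> A)"

text \<open>\<open>A\<^sup>+ H\<close>, for a Hopf subalgebra \<open>A\<close> of \<open>H\<close>.\<close>

definition augmentation_ideal_span :: "('k, 'm) ring_scheme \<Rightarrow> ('k, 'h) hopf_data \<Rightarrow> 'h set \<Rightarrow> 'h set" where
  "augmentation_ideal_span K H A =
     span_in K H {a \<otimes>\<^bsub>H\<^esub> h | a h. a \<in> A \<and> counit H a = \<zero>\<^bsub>K\<^esub> \<and> h \<in> carrier H}"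

text \<open>\<open>H\<close> is an extension of \<open>B\<close> by \<open>A\<close>.\<close>

definition hopf_extension ::
    "('k, 'm) ring_scheme \<Rightarrow> ('k, 'a) hopf_data \<Rightarrow> ('k, 'h) hopf_data \<Rightarrow> ('k, 'b) hopf_data \<Rightarrow> bool" where
  "hopf_extension K A H B \<longleftrightarrow> hopf_algebra K H \<and>
     (\<exists>\<iota> \<in> hopf_hom K A H. \<exists>\<pi> \<in> hopf_hom K H B.
        inj_on \<iota> (carrier A) \<and>
        \<pi> ` carrier H = carrier B \<and>
        normal_hopf_subset K H (\<iota> ` carrier A) \<and>
        a_kernel H B \<pi> = augmentation_ideal_span K H (\<iota> ` carrier A))"

text \<open>The type \<open>'h\<close> of the elements of \<open>H\<close> is a parameter. Isomorphism classes can only be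
  collected into a set within one such type, so a count of isomorphism types has to be made in a
  fixed type that is large enough to contain a copy of every extension. No finite-dimensionality
  of \<open>H\<close> is assumed.\<close>

definition commutative_extensions ::
    "('k, 'm) ring_scheme \<Rightarrow> ('g, 'n) monoid_scheme \<Rightarrow> nat \<Rightarrow> ('k, 'h) hopf_data set" where
  "commutative_extensions K G p =
     {H. hopf_extension K (function_hopf K G) H (group_hopf K (integer_mod_group p)) \<and> cring H}"

definition hopf_iso_rel :: "('k, 'm) ring_scheme \<Rightarrow> ('k, 'h) hopf_data rel" where
  "hopf_iso_rel K = {(A, B). hopf_isomorphic K A B}"

end

theory Submission
  imports Defs "HOL-Number_Theory.Residues"
begin

text \<open>Let \<open>H\<close> be a commutative extension. The map \<open>\<pi>\<close> makes \<open>H\<close> a comodule over \<open>\<Bbbk>C\<^sub>p\<close>, hence a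
  \<open>\<int>/p\<close>-graded algebra whose component of degree zero is \<open>\<iota>(\<Bbbk>\<^sup>G)\<close>. On each block \<open>\<iota>(\<delta>\<^sub>x)H\<close> the antipode identity produces a unit of
  degree one, which may be scaled to satisfy \<open>u\<^sup>p = 1\<close>, so the block splits into \<open>p\<close> copies of \<open>\<Bbbk>\<close>.
  Therefore \<open>H \<cong> \<Bbbk>\<^sup>L\<close> for the group \<open>L\<close> of characters of \<open>H\<close>, where \<open>L\<close> has order \<open>p\<^bsup>n+1\<^esup>\<close> and maps
  onto \<open>G\<close>; conversely every such \<open>L\<close> gives an extension, and \<open>\<Bbbk>\<^sup>L\<close> determines \<open>L\<close>.

  The kernel of \<open>L \<rightarrow> G\<close> is central of order \<open>p\<close>, generated by \<open>z\<close> say. Commutators define an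
  alternating form on \<open>G\<close> with values in \<open>\<langle>z\<rangle>\<close>, of rank \<open>2r\<close>, and since \<open>p\<close> is odd the \<open>p\<close>-th power map is a
  linear form on \<open>G\<close>. The pair is classified by \<open>r\<close> and by whether the linear form is zero, non-zero on
  the radical of the alternating form, or non-zero but trivial on the radical. Counting the possibilities
  \<open>0 \<le> 2r \<le> n\<close>, \<open>2r < n\<close> and \<open>0 < 2r \<le> n\<close> gives \<open>n + 1 + \<lfloor>n/2\<rfloor>\<close>.\<close>

section \<open>Linear and bilinear maps\<close>

text \<open>\<open>H\<close> is not assumed finite-dimensional, so counting dimensions cannot show
  that the coinvariants are the functions on \<open>G\<close>. The way round is \<open>e1\<close>,
  the image of the point mass at the identity: it annihilates the kernel of \<pi>, so
  \<open>e1 H\<close> is a quotient of the group algebra of the cyclic group. Evaluating a threefold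
  coproduct with \<open>e1\<close> inserted in two ways carries this finiteness to every block.
  Tensors are cosets, so Hopf identities are mostly proved in evaluated form: a multilinear map is
  applied to an iterated coproduct, and tensors are compared through separating linear forms. On the
  group side, linear algebra modulo \<open>p\<close> is done inside \<open>L\<close> on subgroups
  containing \<open>z\<close>; no quotient space is formed. The three cases share one family of
  model groups on tuples indexed by \<open>0..n\<close>, where coordinate \<open>k\<close> carries
  \<open>z\<close> and \<open>k\<close> is \<open>n\<close>, \<open>n - 1\<close> or
  \<open>0\<close>. Isomorphism concerns \<open>H\<close> alone and forgets \<iota> and \<pi>. What
  is counted is therefore groups \<open>L\<close> that map onto \<open>G\<close>, not extension
  classes, and every model group has such a map.\<close>

lemma linear_mapI:
 assumes "!!x. x \<in> carrier V ==> f x \<in> carrier W"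
  and "!!x y. x \<in> carrier V ==> y \<in> carrier V ==> f (x \<oplus>\<^bsub>V\<^esub> y) = f x \<oplus>\<^bsub>W\<^esub> f y"
  and "!!c x. c \<in> carrier K ==> x \<in> carrier V ==> f (c \<odot>\<^bsub>V\<^esub> x) = c \<odot>\<^bsub>W\<^esub> f x"
 shows "linear_map K V W f"
 using assms unfolding linear_map_def by auto

lemma linear_map_closed: "linear_map K V W f ==> x \<in> carrier V ==> f x \<in> carrier W"
 and linear_map_add: "linear_map K V W f ==> x \<in> carrier V ==> y \<in> carrier V ==>
  f (x \<oplus>\<^bsub>V\<^esub> y) = f x \<oplus>\<^bsub>W\<^esub> f y"
 and linear_map_smult: "linear_map K V W f ==> c \<in> carrier K ==> x \<in> carrier V ==>
  f (c \<odot>\<^bsub>V\<^esub> x) = c \<odot>\<^bsub>W\<^esub> f x"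
 unfolding linear_map_def by auto

lemma linear_map_zero:
 assumes "module K V" "module K W" "linear_map K V W f"
 shows "f \<zero>\<^bsub>V\<^esub> = \<zero>\<^bsub>W\<^esub>"
proof -
 interpret V: module K V by fact
 interpret W: module K W by fact
 have "f (\<zero>\<^bsub>K\<^esub> \<odot>\<^bsub>V\<^esub> \<zero>\<^bsub>V\<^esub>) = \<zero>\<^bsub>K\<^esub> \<odot>\<^bsub>W\<^esub> f \<zero>\<^bsub>V\<^esub>"
  using assms(3) by (intro linear_map_smult) auto
 then show ?thesis using linear_map_closed[OF assms(3)] by simp
qed

lemma linear_map_finsum:
 assumes "module K V" "module K W" "linear_map K V W f" "finite S" "g \<in> S \<rightarrow> carrier V"
 shows "f (\<Oplus>\<^bsub>V\<^esub>i\<in>S. g i) = (\<Oplus>\<^bsub>W\<^esub>i\<in>S. f (g i))"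
proof -
 interpret V: module K V by fact
 interpret W: module K W by fact
 show ?thesis using assms(4,5)
 proof (induction S)
  case empty
  then show ?case using linear_map_zero[OF assms(1-3)] by simp
 next
  case (insert x S)
  then have "!!i. i \<in> insert x S ==> f (g i) \<in> carrier W"
   using linear_map_closed[OF assms(3)] by blast
  with insert show ?case
   using linear_map_add[OF assms(3)] by (subst V.finsum_insert W.finsum_insert; auto simp: Pi_iff)+
 qed
qed

lemma linear_map_cong:
 assumes "module K V" "linear_map K V W f" "!!x. x \<in> carrier V ==> f x = g x"
 shows "linear_map K V W g"
proof -
 interpret V: module K V by fact
 show ?thesis using assms(2,3) unfolding linear_map_def by (auto simp: Pi_iff)
qed

lemma linear_map_comp:
 "linear_map K V W f ==> linear_map K U V g ==> linear_map K U W (%x. f (g x))"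
 unfolding linear_map_def by (auto simp: Pi_iff)

lemma linear_map_id: "linear_map K V V (%x. x)"
 by (rule linear_mapI) auto

lemma linear_map_add_fun:
 assumes "module K W" "linear_map K V W f" "linear_map K V W g"
 shows "linear_map K V W (%x. f x \<oplus>\<^bsub>W\<^esub> g x)"
proof -
 interpret W: module K W by fact
 note l = linear_map_closed[OF assms(2)] linear_map_closed[OF assms(3)]
  linear_map_add[OF assms(2)] linear_map_add[OF assms(3)]
  linear_map_smult[OF assms(2)] linear_map_smult[OF assms(3)]
 show ?thesis
  by (rule linear_mapI) (auto simp: l W.a_ac W.smult_r_distr)
qed

lemma linear_map_smult_fun:
 assumes "module K W" "c \<in> carrier K" "linear_map K V W f"
 shows "linear_map K V W (%x. c \<odot>\<^bsub>W\<^esub> f x)"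
proof -
 interpret W: module K W by fact
 note l = linear_map_closed[OF assms(3)] linear_map_add[OF assms(3)] linear_map_smult[OF assms(3)]
 show ?thesis using assms(2)
  by (intro linear_mapI) (auto simp: l W.smult_r_distr W.R.m_comm simp flip: W.smult_assoc1)
qed

lemma linear_map_zero_fun: "module K W ==> linear_map K V W (%x. \<zero>\<^bsub>W\<^esub>)"
proof -
 assume "module K W"
 interpret W: module K W by fact
 show ?thesis by (rule linear_mapI) auto
qed

lemma linear_map_finsum_fun:
 assumes "module K W" "finite S" "!!i. i \<in> S ==> linear_map K V W (f i)"
 shows "linear_map K V W (%x. \<Oplus>\<^bsub>W\<^esub>i\<in>S. f i x)"
proof -
 interpret W: module K W by fact
 have c: "!!i x. i \<in> S ==> x \<in> carrier V ==> f i x \<in> carrier W"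
  using assms(3) linear_map_closed by metis
 show ?thesis
 proof (rule linear_mapI)
  fix x y assume xy: "x \<in> carrier V" "y \<in> carrier V"
  have "(\<Oplus>\<^bsub>W\<^esub>i\<in>S. f i (x \<oplus>\<^bsub>V\<^esub> y)) = (\<Oplus>\<^bsub>W\<^esub>i\<in>S. f i x \<oplus>\<^bsub>W\<^esub> f i y)"
   using xy assms(3) c by (intro W.finsum_cong') (auto intro: linear_map_add)
  also have "... = (\<Oplus>\<^bsub>W\<^esub>i\<in>S. f i x) \<oplus>\<^bsub>W\<^esub> (\<Oplus>\<^bsub>W\<^esub>i\<in>S. f i y)"
   using xy c by (intro W.finsum_addf) auto
  finally show "(\<Oplus>\<^bsub>W\<^esub>i\<in>S. f i (x \<oplus>\<^bsub>V\<^esub> y)) = (\<Oplus>\<^bsub>W\<^esub>i\<in>S. f i x) \<oplus>\<^bsub>W\<^esub> (\<Oplus>\<^bsub>W\<^esub>i\<in>S. f i y)" .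
 next
  fix a x assume ax: "a \<in> carrier K" "x \<in> carrier V"
  have "(\<Oplus>\<^bsub>W\<^esub>i\<in>S. f i (a \<odot>\<^bsub>V\<^esub> x)) = (\<Oplus>\<^bsub>W\<^esub>i\<in>S. a \<odot>\<^bsub>W\<^esub> f i x)"
   using ax assms(3) c by (intro W.finsum_cong') (auto intro: linear_map_smult)
  also have "... = a \<odot>\<^bsub>W\<^esub> (\<Oplus>\<^bsub>W\<^esub>i\<in>S. f i x)"
   using ax c assms(2)
   by (intro linear_map_finsum[OF assms(1,1) linear_map_smult_fun[OF assms(1) ax(1) linear_map_id], symmetric]) auto
  finally show "(\<Oplus>\<^bsub>W\<^esub>i\<in>S. f i (a \<odot>\<^bsub>V\<^esub> x)) = a \<odot>\<^bsub>W\<^esub> (\<Oplus>\<^bsub>W\<^esub>i\<in>S. f i x)" .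
 qed (auto intro!: W.finsum_closed simp: c)
qed

lemma (in module) finsum_smult_rdistr:
 assumes "finite S" "a \<in> carrier R" "g \<in> S \<rightarrow> carrier M"
 shows "a \<odot>\<^bsub>M\<^esub> (\<Oplus>\<^bsub>M\<^esub>i\<in>S. g i) = (\<Oplus>\<^bsub>M\<^esub>i\<in>S. a \<odot>\<^bsub>M\<^esub> g i)"
 by (rule linear_map_finsum[OF module_axioms module_axioms
    linear_map_smult_fun[OF module_axioms assms(2) linear_map_id] assms(1,3)])

lemma linear_map_kernel_submodule:
 assumes "module K V" "module K W" "linear_map K V W f"
 shows "submodule {x \<in> carrier V. f x = \<zero>\<^bsub>W\<^esub>} K V"
proof -
 interpret V: module K V by fact
 interpret W: module K W by fact
 note z = linear_map_zero[OF assms]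
 have m: "f (\<ominus>\<^bsub>V\<^esub> x) = \<ominus>\<^bsub>W\<^esub> f x" if "x \<in> carrier V" for x
 proof -
  have "f x \<oplus>\<^bsub>W\<^esub> f (\<ominus>\<^bsub>V\<^esub> x) = \<zero>\<^bsub>W\<^esub>"
   using that z by (simp add: V.r_neg flip: linear_map_add[OF assms(3)])
  then show ?thesis
   using that linear_map_closed[OF assms(3)] by (metis V.a_inv_closed W.add.inv_equality W.a_comm)
 qed
 show ?thesis
  by (rule V.submoduleI)
   (auto simp: z m linear_map_add[OF assms(3)] linear_map_smult[OF assms(3)])
qed

lemma span_in_submodule:
 assumes "module K V" "S \<subseteq> carrier V"
 shows "submodule (span_in K V S) K V"
proof -
 interpret V: module K V by fact
 let ?F = "{t. submodule t K V \<and> S \<subseteq> t}"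
 have ne: "carrier V \<in> ?F" using assms(2) V.carrier_is_submodule by auto
 note E = V.submoduleE
 have "submodule (\<Inter>?F) K V"
 proof (rule V.submoduleI)
  show "\<Inter>?F \<subseteq> carrier V" using ne by blast
  show "\<zero>\<^bsub>V\<^esub> \<in> \<Inter>?F"
   using subgroup.one_closed[OF submodule.axioms(1)] by fastforce
 qed (auto intro: E)
 then show ?thesis unfolding span_in_def hull_def .
qed

lemma span_in_superset: "S \<subseteq> span_in K V S"
 unfolding span_in_def by (rule hull_subset)

lemma span_in_minimal: "S \<subseteq> T ==> submodule T K V ==> span_in K V S \<subseteq> T"
 unfolding span_in_def by (rule hull_minimal)


section \<open>Free vector spaces and linear extension\<close>

lemma free_space_simps [simp]:
 "f \<in> carrier (free_space K I) \<longleftrightarrow> finite {i. f i ~= \<zero>\<^bsub>K\<^esub>} \<and> (\<forall>i. f i \<in> carrier K) \<and> (\<forall>i. i \<notin> I --> f i = \<zero>\<^bsub>K\<^esub>)"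
 "\<zero>\<^bsub>free_space K I\<^esub> = (%_. \<zero>\<^bsub>K\<^esub>)"
 "f \<oplus>\<^bsub>free_space K I\<^esub> g = (%i. f i \<oplus>\<^bsub>K\<^esub> g i)"
 "c \<odot>\<^bsub>free_space K I\<^esub> f = (%i. c \<otimes>\<^bsub>K\<^esub> f i)"
 by (auto simp: free_space_def)

lemma free_space_module:
 fixes K :: "('k, 'm) ring_scheme" and I :: "'i set"
 assumes "cring K"
 shows "module K (free_space K I)"
proof -
 interpret K: cring K by fact
 have fin: "finite {i. f i \<oplus>\<^bsub>K\<^esub> g i ~= \<zero>\<^bsub>K\<^esub>}"
  if "finite {i. f i ~= \<zero>\<^bsub>K\<^esub>}" "finite {i. g i ~= \<zero>\<^bsub>K\<^esub>}" for f g :: "'i => 'k"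
  by (rule finite_subset[OF _ finite_UnI[OF that]]) auto
 have fin2: "finite {i. c \<otimes>\<^bsub>K\<^esub> f i ~= \<zero>\<^bsub>K\<^esub>}"
  if "finite {i. f i ~= \<zero>\<^bsub>K\<^esub>}" "c \<in> carrier K" for f :: "'i => 'k" and c
  by (rule finite_subset[OF _ that(1)]) (use that in auto)
 have "abelian_group (free_space K I)"
 proof (rule abelian_groupI)
  fix f assume f: "f \<in> carrier (free_space K I)"
  then have eq: "{i. \<ominus>\<^bsub>K\<^esub> f i ~= \<zero>\<^bsub>K\<^esub>} = {i. f i ~= \<zero>\<^bsub>K\<^esub>}"
   by (auto simp: K.add.inv_eq_1_iff)
  have "(%i. \<ominus>\<^bsub>K\<^esub> f i) \<in> carrier (free_space K I)"
   using f by (simp add: eq)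
  then show "\<exists>g\<in>carrier (free_space K I). g \<oplus>\<^bsub>free_space K I\<^esub> f = \<zero>\<^bsub>free_space K I\<^esub>"
   using f by (intro bexI[of _ "%i. \<ominus>\<^bsub>K\<^esub> f i"]) (auto simp: K.l_neg)
 qed (auto simp: K.a_ac fin)
 then show ?thesis
  by (intro moduleI) (auto simp: assms fin2 K.l_distr K.r_distr K.m_assoc)
qed

lemma basis_vector_closed:
 "cring K ==> i \<in> I ==> basis_vector K i \<in> carrier (free_space K I)"
 using cring.cring_simprules(2,6)[of K]
 by (auto simp: basis_vector_def elim!: finite_subset[rotated, where B="{i}"] intro: finite_subset[where B="{i}"])

text \<open>On a representative of a coset this is the sum that \<open>tensor_lift\<close>
  evaluates.\<close>

definition lin_ext ::
  "('k, 'm) ring_scheme => ('k, 'v, 'x) module_scheme => ('i => 'v) => ('i => 'k) => 'v" where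
 "lin_ext K V \<beta> f = (\<Oplus>\<^bsub>V\<^esub> i \<in> {i. f i ~= \<zero>\<^bsub>K\<^esub>}. f i \<odot>\<^bsub>V\<^esub> \<beta> i)"

text \<open>Supports change under addition and scaling; over a common finite superset the sums
  become comparable, since the extra summands have coefficient zero.\<close>

lemma lin_ext_superset:
 assumes "module K V" "f \<in> carrier (free_space K I)" "finite S" "{i. f i ~= \<zero>\<^bsub>K\<^esub>} \<subseteq> S"
  "!!i. i \<in> S ==> \<beta> i \<in> carrier V"
 shows "lin_ext K V \<beta> f = (\<Oplus>\<^bsub>V\<^esub> i \<in> S. f i \<odot>\<^bsub>V\<^esub> \<beta> i)"
proof -
 interpret V: module K V by fact
 show ?thesis unfolding lin_ext_def
  using assms(2-) by (intro V.add.finprod_mono_neutral_cong_left) auto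
qed

lemma lin_ext_linear:
 assumes "module K V" "!!i. i \<in> I ==> \<beta> i \<in> carrier V"
 shows "linear_map K (free_space K I) V (lin_ext K V \<beta>)"
proof -
 interpret V: module K V by fact
 interpret F: module K "free_space K I" by (rule free_space_module) (rule V.is_cring)
 show ?thesis
 proof (rule linear_mapI)
  fix f assume f: "f \<in> carrier (free_space K I)"
  then show "lin_ext K V \<beta> f \<in> carrier V"
   using assms(2) unfolding lin_ext_def by (intro V.finsum_closed) auto
  fix c assume c: "c \<in> carrier K"
  let ?S = "{i. f i ~= \<zero>\<^bsub>K\<^esub>}"
  have S: "finite ?S" "!!i. i \<in> ?S ==> \<beta> i \<in> carrier V" using f assms(2) by auto
  have "lin_ext K V \<beta> (c \<odot>\<^bsub>free_space K I\<^esub> f) = (\<Oplus>\<^bsub>V\<^esub> i \<in> ?S. (c \<odot>\<^bsub>free_space K I\<^esub> f) i \<odot>\<^bsub>V\<^esub> \<beta> i)"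
   using f c by (intro lin_ext_superset[OF assms(1) F.smult_closed[OF c f] S(1) _ S(2)]) auto
  also have "... = (\<Oplus>\<^bsub>V\<^esub> i \<in> ?S. c \<odot>\<^bsub>V\<^esub> (f i \<odot>\<^bsub>V\<^esub> \<beta> i))"
   using f c S(2) by (intro V.finsum_cong') (auto simp: V.smult_assoc1)
  also have "... = c \<odot>\<^bsub>V\<^esub> (\<Oplus>\<^bsub>V\<^esub> i \<in> ?S. f i \<odot>\<^bsub>V\<^esub> \<beta> i)"
   using f c S by (intro V.finsum_smult_rdistr[symmetric]) auto
  finally show "lin_ext K V \<beta> (c \<odot>\<^bsub>free_space K I\<^esub> f) = c \<odot>\<^bsub>V\<^esub> lin_ext K V \<beta> f"
   unfolding lin_ext_def .
 next
  fix f g assume f: "f \<in> carrier (free_space K I)" and g: "g \<in> carrier (free_space K I)"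
  let ?S = "{i. f i ~= \<zero>\<^bsub>K\<^esub>} \<union> {i. g i ~= \<zero>\<^bsub>K\<^esub>}"
  have S: "finite ?S" "!!i. i \<in> ?S ==> \<beta> i \<in> carrier V"
  proof -
   show "finite ?S" using f g by simp
   fix i assume "i \<in> ?S"
   then have "i \<in> I" using f g by (auto simp: free_space_simps(1))
   then show "\<beta> i \<in> carrier V" by (rule assms(2))
  qed
  have "lin_ext K V \<beta> (f \<oplus>\<^bsub>free_space K I\<^esub> g) = (\<Oplus>\<^bsub>V\<^esub> i \<in> ?S. (f i \<oplus>\<^bsub>K\<^esub> g i) \<odot>\<^bsub>V\<^esub> \<beta> i)"
   using f g by (subst lin_ext_superset[OF assms(1) F.a_closed[OF f g] S(1) _ S(2)]) auto
  also have "... = (\<Oplus>\<^bsub>V\<^esub> i \<in> ?S. f i \<odot>\<^bsub>V\<^esub> \<beta> i \<oplus>\<^bsub>V\<^esub> g i \<odot>\<^bsub>V\<^esub> \<beta> i)"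
   using f g S(2) by (intro V.finsum_cong') (auto simp: V.smult_l_distr)
  also have "... = (\<Oplus>\<^bsub>V\<^esub> i \<in> ?S. f i \<odot>\<^bsub>V\<^esub> \<beta> i) \<oplus>\<^bsub>V\<^esub> (\<Oplus>\<^bsub>V\<^esub> i \<in> ?S. g i \<odot>\<^bsub>V\<^esub> \<beta> i)"
   using f g S by (intro V.finsum_addf) auto
  also have "(\<Oplus>\<^bsub>V\<^esub> i \<in> ?S. f i \<odot>\<^bsub>V\<^esub> \<beta> i) = lin_ext K V \<beta> f"
   by (rule lin_ext_superset[OF assms(1) f S(1) _ S(2), symmetric]) auto
  also have "(\<Oplus>\<^bsub>V\<^esub> i \<in> ?S. g i \<odot>\<^bsub>V\<^esub> \<beta> i) = lin_ext K V \<beta> g"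
   by (rule lin_ext_superset[OF assms(1) g S(1) _ S(2), symmetric]) auto
  finally show "lin_ext K V \<beta> (f \<oplus>\<^bsub>free_space K I\<^esub> g) = lin_ext K V \<beta> f \<oplus>\<^bsub>V\<^esub> lin_ext K V \<beta> g" .
 qed
qed

lemma lin_ext_basis:
 assumes "module K V" "\<beta> i \<in> carrier V"
 shows "lin_ext K V \<beta> (basis_vector K i) = \<beta> i"
proof -
 interpret V: module K V by fact
 have "lin_ext K V \<beta> (basis_vector K i) = (\<Oplus>\<^bsub>V\<^esub> j \<in> {i}. basis_vector K i j \<odot>\<^bsub>V\<^esub> \<beta> j)"
  using assms by (intro lin_ext_superset[OF assms(1) basis_vector_closed[of _ _ UNIV]])
   (auto simp: basis_vector_def V.is_cring)
 then show ?thesis using assms by (simp add: basis_vector_def)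
qed

lemma free_space_expand:
 assumes "cring K" "f \<in> carrier (free_space K I)" "finite S" "{i. f i ~= \<zero>\<^bsub>K\<^esub>} \<subseteq> S" "S \<subseteq> I"
 shows "f = (\<Oplus>\<^bsub>free_space K I\<^esub> i \<in> S. f i \<odot>\<^bsub>free_space K I\<^esub> basis_vector K i)"
proof -
 interpret K: cring K by fact
 interpret F: module K "free_space K I" by (rule free_space_module) (rule K.is_cring)
 note bc = basis_vector_closed[OF K.is_cring, of _ I]
 have ev: "(\<Oplus>\<^bsub>free_space K I\<^esub> i \<in> T. g i) j = (\<Oplus>\<^bsub>K\<^esub> i \<in> T. g i j)"
  if "finite T" "!!i. i \<in> T ==> g i \<in> carrier (free_space K I)" for T g j
  using that
 proof (induction T)
  case (insert x T)
  then show ?case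
   by (subst F.finsum_insert K.finsum_insert; auto simp: Pi_iff)+
 qed simp
 have cl: "f i \<odot>\<^bsub>free_space K I\<^esub> basis_vector K i \<in> carrier (free_space K I)" if "i \<in> S" for i
  using that assms(2,5) bc by (intro F.smult_closed) (auto simp del: free_space_simps(4) simp: subset_iff)
 show ?thesis
 proof
  fix j
  have "(\<Oplus>\<^bsub>free_space K I\<^esub> i \<in> S. f i \<odot>\<^bsub>free_space K I\<^esub> basis_vector K i) j
    = (\<Oplus>\<^bsub>K\<^esub> i \<in> S. f i \<otimes>\<^bsub>K\<^esub> basis_vector K i j)"
   using ev[OF assms(3) cl] by simp
  also have "... = (\<Oplus>\<^bsub>K\<^esub> i \<in> S. if j = i then f i else \<zero>\<^bsub>K\<^esub>)"
   using assms(2) by (intro K.finsum_cong') (auto simp: basis_vector_def)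
  also have "... = f j"
  proof (cases "j \<in> S")
   case True
   then show ?thesis using assms(2,3) by (subst K.finsum_singleton) auto
  next
   case False
   then have "(\<Oplus>\<^bsub>K\<^esub> i \<in> S. if j = i then f i else \<zero>\<^bsub>K\<^esub>) = (\<Oplus>\<^bsub>K\<^esub> i \<in> S. \<zero>\<^bsub>K\<^esub>)"
    by (intro K.finsum_cong') auto
   moreover have "f j = \<zero>\<^bsub>K\<^esub>" using False assms(4) by blast
   ultimately show ?thesis by simp
  qed
  finally show "f j = (\<Oplus>\<^bsub>free_space K I\<^esub> i \<in> S. f i \<odot>\<^bsub>free_space K I\<^esub> basis_vector K i) j" ..
 qed
qed


section \<open>Bilinear maps and the universal property of the tensor product\<close>

definition bilinear_map ::
  "('k, 'm) ring_scheme => ('k, 'a, 'x) module_scheme => ('k, 'b, 'y) module_scheme =>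
   ('k, 'v, 'z) module_scheme => ('a => 'b => 'v) => bool" where
 "bilinear_map K A B V \<beta> \<longleftrightarrow>
   (\<forall>a\<in>carrier A. linear_map K B V (\<beta> a)) \<and> (\<forall>b\<in>carrier B. linear_map K A V (%a. \<beta> a b))"

lemma bilinear_mapI:
 assumes "!!a. a \<in> carrier A ==> linear_map K B V (\<beta> a)"
  "!!b. b \<in> carrier B ==> linear_map K A V (%a. \<beta> a b)"
 shows "bilinear_map K A B V \<beta>"
 using assms unfolding bilinear_map_def by blast

lemma bilinear_map_left: "bilinear_map K A B V \<beta> ==> b \<in> carrier B ==> linear_map K A V (%a. \<beta> a b)"
 and bilinear_map_right: "bilinear_map K A B V \<beta> ==> a \<in> carrier A ==> linear_map K B V (\<beta> a)"
 and bilinear_map_closed: "bilinear_map K A B V \<beta> ==> a \<in> carrier A ==> b \<in> carrier B ==> \<beta> a b \<in> carrier V"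
 unfolding bilinear_map_def by (auto dest: linear_map_closed)

locale tensor_product = A: module K A + B: module K B
 for K :: "('k, 'm) ring_scheme" and A :: "('k, 'a, 'x) module_scheme" and B :: "('k, 'b, 'y) module_scheme"
begin

abbreviation "F \<equiv> free_space K (carrier A \<times> carrier B)"
abbreviation "N \<equiv> tensor_null K A B"
abbreviation "T \<equiv> tensor_space K A B"

sublocale F: module K F
 by (rule free_space_module) (rule A.is_cring)

lemma basis_closed: "a \<in> carrier A ==> b \<in> carrier B ==> basis_vector K (a, b) \<in> carrier F"
 by (rule basis_vector_closed[OF A.is_cring]) auto

lemma relations_closed: "tensor_relations K A B \<subseteq> carrier F"
 unfolding tensor_relations_def Let_def
 by (auto simp del: free_space_simps intro!: F.minus_closed F.a_closed F.smult_closed basis_closed)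

lemma null_submodule: "submodule N K F"
 unfolding tensor_null_def by (rule span_in_submodule[OF F.module_axioms relations_closed])

sublocale N: submodule N K F by (rule null_submodule)

sublocale Q: abelian_subgroup N F
 by (rule abelian_subgroupI3)
  (auto intro: additive_subgroupI N.subgroup_axioms F.abelian_group_axioms)

lemma coset_eq:
 assumes "x \<in> carrier F" "y \<in> carrier F" "x \<ominus>\<^bsub>F\<^esub> y \<in> N"
 shows "N +>\<^bsub>F\<^esub> x = N +>\<^bsub>F\<^esub> y"
proof -
 have "x = (x \<ominus>\<^bsub>F\<^esub> y) \<oplus>\<^bsub>F\<^esub> y"
  using assms(1,2) by (simp del: free_space_simps add: F.minus_eq F.a_assoc F.l_neg)
 also have "... \<in> N +>\<^bsub>F\<^esub> y"
  using assms Q.a_subset by (intro F.a_rcosI) auto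
 finally show ?thesis using Q.a_repr_independence'[OF _ assms(2)] by blast
qed

lemma carrier_T: "carrier T = a_rcosets\<^bsub>F\<^esub> N"
 and zero_T: "\<zero>\<^bsub>T\<^esub> = N"
 and add_T: "add T = set_add F"
 by (simp_all add: tensor_space_def Let_def)

lemma T_cases:
 assumes "u \<in> carrier T"
 obtains f where "f \<in> carrier F" "u = N +>\<^bsub>F\<^esub> f"
 using assms unfolding carrier_T A_RCOSETS_def' by auto

lemma coset_closed: "f \<in> carrier F ==> N +>\<^bsub>F\<^esub> f \<in> carrier T"
 unfolding carrier_T A_RCOSETS_def' by auto

lemma coset_add: "f \<in> carrier F ==> g \<in> carrier F ==>
  (N +>\<^bsub>F\<^esub> f) \<oplus>\<^bsub>T\<^esub> (N +>\<^bsub>F\<^esub> g) = N +>\<^bsub>F\<^esub> (f \<oplus>\<^bsub>F\<^esub> g)"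
 unfolding add_T by (rule Q.a_rcos_sum)

lemma coset_smult:
 assumes "c \<in> carrier K" "f \<in> carrier F"
 shows "c \<odot>\<^bsub>T\<^esub> (N +>\<^bsub>F\<^esub> f) = N +>\<^bsub>F\<^esub> (c \<odot>\<^bsub>F\<^esub> f)"
proof -
 have "N +>\<^bsub>F\<^esub> (c \<odot>\<^bsub>F\<^esub> g) = N +>\<^bsub>F\<^esub> (c \<odot>\<^bsub>F\<^esub> f)" if "g \<in> N +>\<^bsub>F\<^esub> f" for g
 proof -
  from that obtain m where m: "m \<in> N" "g = m \<oplus>\<^bsub>F\<^esub> f"
   unfolding a_r_coset_def' by auto
  have mF: "m \<in> carrier F" using m Q.a_subset by blast
  have "c \<odot>\<^bsub>F\<^esub> g = c \<odot>\<^bsub>F\<^esub> m \<oplus>\<^bsub>F\<^esub> c \<odot>\<^bsub>F\<^esub> f"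
   unfolding m(2) using F.smult_r_distr[OF assms(1) mF assms(2)] .
  also have "... \<in> N +>\<^bsub>F\<^esub> (c \<odot>\<^bsub>F\<^esub> f)"
   using assms m Q.a_subset N.smult_closed F.smult_closed[OF assms] by (intro F.a_rcosI) auto
  finally show ?thesis
   using Q.a_repr_independence'[OF _ F.smult_closed[OF assms]] by blast
 qed
 moreover have "f \<in> N +>\<^bsub>F\<^esub> f" using assms Q.a_rcos_self by blast
 ultimately have "(\<Union>g\<in>N +>\<^bsub>F\<^esub> f. N +>\<^bsub>F\<^esub> (c \<odot>\<^bsub>F\<^esub> g)) = N +>\<^bsub>F\<^esub> (c \<odot>\<^bsub>F\<^esub> f)" by blast
 then show ?thesis unfolding tensor_space_def Let_def module.simps .
qed

sublocale T: module K T
proof (rule moduleI)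
 interpret Q: comm_group "F A_Mod N" by (rule Q.a_factorgroup_is_comm_group)
 have eq: "carrier T = carrier (F A_Mod N)" "add T = monoid.mult (F A_Mod N)" "\<zero>\<^bsub>T\<^esub> = one (F A_Mod N)"
  by (simp_all add: A_FactGroup_def' carrier_T zero_T add_T)
 show "abelian_group T"
  by (rule abelian_groupI; unfold eq)
   (auto simp del: add_A_FactGroup simp: Q.m_ac intro: Q.l_inv_ex)
next
 fix c c' u v assume c: "c \<in> carrier K" "c' \<in> carrier K" and u: "u \<in> carrier T" and v: "v \<in> carrier T"
 from u v obtain f g where f: "f \<in> carrier F" "u = N +>\<^bsub>F\<^esub> f" and g: "g \<in> carrier F" "v = N +>\<^bsub>F\<^esub> g"
  by (metis T_cases)
 note c' = A.R.m_closed[OF c] A.R.a_closed[OF c] F.smult_closed[OF c(1) f(1)] F.smult_closed[OF c(2) f(1)]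
  F.smult_closed[OF c(1) g(1)] F.a_closed[OF f(1) g(1)]
 show "c \<odot>\<^bsub>T\<^esub> u \<in> carrier T"
  unfolding f(2) coset_smult[OF c(1) f(1)] by (rule coset_closed[OF c'(3)])
 show "(c \<oplus>\<^bsub>K\<^esub> c') \<odot>\<^bsub>T\<^esub> u = c \<odot>\<^bsub>T\<^esub> u \<oplus>\<^bsub>T\<^esub> c' \<odot>\<^bsub>T\<^esub> u"
  unfolding f(2) coset_smult[OF c(1) f(1)] coset_smult[OF c(2) f(1)] coset_smult[OF c'(2) f(1)]
   coset_add[OF c'(3,4)] F.smult_l_distr[OF c f(1)] ..
 show "c \<odot>\<^bsub>T\<^esub> (u \<oplus>\<^bsub>T\<^esub> v) = c \<odot>\<^bsub>T\<^esub> u \<oplus>\<^bsub>T\<^esub> c \<odot>\<^bsub>T\<^esub> v"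
  unfolding f(2) g(2) coset_add[OF f(1) g(1)] coset_smult[OF c(1) f(1)] coset_smult[OF c(1) g(1)]
   coset_smult[OF c(1) c'(6)] coset_add[OF c'(3,5)] F.smult_r_distr[OF c(1) f(1) g(1)] ..
 show "(c \<otimes>\<^bsub>K\<^esub> c') \<odot>\<^bsub>T\<^esub> u = c \<odot>\<^bsub>T\<^esub> (c' \<odot>\<^bsub>T\<^esub> u)"
  unfolding f(2) coset_smult[OF c(2) f(1)] coset_smult[OF c(1) c'(4)] coset_smult[OF c'(1) f(1)]
   F.smult_assoc1[OF c f(1)] ..
next
 fix u assume u: "u \<in> carrier T"
 then obtain f where f: "f \<in> carrier F" "u = N +>\<^bsub>F\<^esub> f" by (rule T_cases)
 show "\<one>\<^bsub>K\<^esub> \<odot>\<^bsub>T\<^esub> u = u"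
  by (simp only: f(2) coset_smult[OF A.R.one_closed f(1)] F.smult_one[OF f(1)])
qed (rule A.is_cring)

lemma coset_linear: "linear_map K F T (%f. N +>\<^bsub>F\<^esub> f)"
 by (rule linear_mapI) (auto simp del: free_space_simps intro: coset_closed simp: coset_add coset_smult)

lemma relation_coset:
 "x \<ominus>\<^bsub>F\<^esub> y \<in> tensor_relations K A B ==> x \<in> carrier F ==> y \<in> carrier F ==>
  N +>\<^bsub>F\<^esub> x = N +>\<^bsub>F\<^esub> y"
 by (rule coset_eq) (auto simp del: free_space_simps simp: tensor_null_def intro: subsetD[OF span_in_superset])

lemma tensor_bilinear: "bilinear_map K A B T (tensor K A B)"
proof (intro bilinear_mapI linear_mapI)
 fix a b assume ab: "a \<in> carrier A" "b \<in> carrier B"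
 show "tensor K A B a b \<in> carrier T" "tensor K A B a b \<in> carrier T"
  using ab unfolding tensor_def by (simp_all del: free_space_simps add: coset_closed basis_closed)
 fix c assume c: "c \<in> carrier K"
 note b = basis_closed[OF ab]
 show "tensor K A B a (c \<odot>\<^bsub>B\<^esub> b) = c \<odot>\<^bsub>T\<^esub> tensor K A B a b"
  unfolding tensor_def coset_smult[OF c b] using ab c
  by (intro relation_coset F.smult_closed basis_closed) (auto simp: tensor_relations_def Let_def simp del: free_space_simps)
 show "tensor K A B (c \<odot>\<^bsub>A\<^esub> a) b = c \<odot>\<^bsub>T\<^esub> tensor K A B a b"
  unfolding tensor_def coset_smult[OF c b] using ab c
  by (intro relation_coset F.smult_closed basis_closed) (auto simp: tensor_relations_def Let_def simp del: free_space_simps)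
next
 fix a b b' assume ab: "a \<in> carrier A" "b \<in> carrier B" "b' \<in> carrier B"
 show "tensor K A B a (b \<oplus>\<^bsub>B\<^esub> b') = tensor K A B a b \<oplus>\<^bsub>T\<^esub> tensor K A B a b'"
  unfolding tensor_def coset_add[OF basis_closed[OF ab(1,2)] basis_closed[OF ab(1,3)]] using ab
  by (intro relation_coset F.a_closed basis_closed) (auto simp: tensor_relations_def Let_def simp del: free_space_simps)
next
 fix b a a' assume ab: "b \<in> carrier B" "a \<in> carrier A" "a' \<in> carrier A"
 show "tensor K A B (a \<oplus>\<^bsub>A\<^esub> a') b = tensor K A B a b \<oplus>\<^bsub>T\<^esub> tensor K A B a' b"
  unfolding tensor_def coset_add[OF basis_closed[OF ab(2,1)] basis_closed[OF ab(3,1)]] using ab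
  by (intro relation_coset F.a_closed basis_closed) (auto simp: tensor_relations_def Let_def simp del: free_space_simps)
qed

lemmas tensor_closed = bilinear_map_closed[OF tensor_bilinear]

lemma tensor_expand:
 assumes "u \<in> carrier T"
 obtains S f where "finite S" "S \<subseteq> carrier A \<times> carrier B" "!!i. f i \<in> carrier K"
  "u = (\<Oplus>\<^bsub>T\<^esub> i \<in> S. f i \<odot>\<^bsub>T\<^esub> tensor K A B (fst i) (snd i))"
proof -
 from assms obtain f where f: "f \<in> carrier F" "u = N +>\<^bsub>F\<^esub> f" by (rule T_cases)
 let ?S = "{i. f i ~= \<zero>\<^bsub>K\<^esub>}"
 have S: "finite ?S" "?S \<subseteq> carrier A \<times> carrier B" and fK: "!!i. f i \<in> carrier K"
  using f(1) by auto
 have b: "basis_vector K i \<in> carrier F" if "i \<in> ?S" for i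
  using that S(2) by (intro basis_vector_closed[OF A.is_cring]) auto
 have "u = N +>\<^bsub>F\<^esub> (\<Oplus>\<^bsub>F\<^esub> i \<in> ?S. f i \<odot>\<^bsub>F\<^esub> basis_vector K i)"
  unfolding f(2) using free_space_expand[OF A.is_cring f(1) S(1) _ S(2)] by simp
 also have "... = (\<Oplus>\<^bsub>T\<^esub> i \<in> ?S. N +>\<^bsub>F\<^esub> (f i \<odot>\<^bsub>F\<^esub> basis_vector K i))"
  using b fK by (intro linear_map_finsum[OF F.module_axioms T.module_axioms coset_linear S(1)]) 
   (auto simp del: free_space_simps intro: F.smult_closed)
 also have "... = (\<Oplus>\<^bsub>T\<^esub> i \<in> ?S. f i \<odot>\<^bsub>T\<^esub> tensor K A B (fst i) (snd i))"
  using b fK by (intro T.finsum_cong')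
   (auto simp del: free_space_simps simp: tensor_def coset_smult intro!: T.smult_closed coset_closed)
 finally show ?thesis using that[OF S, of f] fK by blast
qed

text \<open>By \<open>tensor_expand\<close> every coset is a finite combination of pure tensors, so
  it suffices to test there. This takes the place of induction on tensors throughout.\<close>

lemma linear_maps_eq:
 assumes "module K V" "linear_map K T V \<phi>" "linear_map K T V \<psi>"
  and "!!a b. a \<in> carrier A ==> b \<in> carrier B ==> \<phi> (tensor K A B a b) = \<psi> (tensor K A B a b)"
  and u: "u \<in> carrier T"
 shows "\<phi> u = \<psi> u"
proof -
 interpret V: module K V by fact
 from u obtain S f where S: "finite S" "S \<subseteq> carrier A \<times> carrier B" "!!i. f i \<in> carrier K"
  and u: "u = (\<Oplus>\<^bsub>T\<^esub> i \<in> S. f i \<odot>\<^bsub>T\<^esub> tensor K A B (fst i) (snd i))"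
  by (rule tensor_expand) blast
 have c: "tensor K A B (fst i) (snd i) \<in> carrier T" if "i \<in> S" for i
  using that S(2) by (intro tensor_closed) auto
 have c': "(%i. f i \<odot>\<^bsub>T\<^esub> tensor K A B (fst i) (snd i)) \<in> S \<rightarrow> carrier T"
  using c S(3) by auto
 have "\<phi> (f i \<odot>\<^bsub>T\<^esub> tensor K A B (fst i) (snd i)) = \<psi> (f i \<odot>\<^bsub>T\<^esub> tensor K A B (fst i) (snd i))"
  if "i \<in> S" for i
  using that S(2) assms(4)[of "fst i" "snd i"]
  by (auto simp: linear_map_smult[OF assms(2) S(3) c] linear_map_smult[OF assms(3) S(3) c])
 moreover have "\<psi> (f i \<odot>\<^bsub>T\<^esub> tensor K A B (fst i) (snd i)) \<in> carrier V" if "i \<in> S" for i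
  using that c' linear_map_closed[OF assms(3)] by blast
 ultimately show ?thesis
  unfolding u linear_map_finsum[OF T.module_axioms assms(1,2) S(1) c']
   linear_map_finsum[OF T.module_axioms assms(1,3) S(1) c'] by (intro V.finsum_cong') auto
qed

end

context tensor_product
begin

text \<open>The universal property. The linear extension of \<beta> annihilates the bilinearity
  relations and hence the submodule they span, so it is constant on cosets and
  \<open>tensor_lift\<close> may evaluate it on whichever representative \<open>SOME\<close>
  picks.\<close>

lemma
 assumes V: "module K V" and \<beta>: "bilinear_map K A B V \<beta>"
 shows lift_linear: "linear_map K T V (tensor_lift K V \<beta>)"
  and lift_tensor: "a \<in> carrier A ==> b \<in> carrier B ==> tensor_lift K V \<beta> (tensor K A B a b) = \<beta> a b"
proof -
 interpret V: module K V by fact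
 let ?b = "%i. \<beta> (fst i) (snd i)"
 let ?L = "lin_ext K V ?b"
 have bc: "!!i. i \<in> carrier A \<times> carrier B ==> ?b i \<in> carrier V"
  using bilinear_map_closed[OF \<beta>] by auto
 have L: "linear_map K F V ?L" by (rule lin_ext_linear[OF V bc])
 have Lb: "?L (basis_vector K (a, b)) = \<beta> a b" if "a \<in> carrier A" "b \<in> carrier B" for a b
  using lin_ext_basis[OF V, of ?b "(a, b)"] bc[of "(a, b)"] that by simp
 note ker = linear_map_kernel_submodule[OF F.module_axioms V L]
 have min: "?L (x \<ominus>\<^bsub>F\<^esub> y) = \<zero>\<^bsub>V\<^esub>" if "x \<in> carrier F" "y \<in> carrier F" "?L x = ?L y" for x y
 proof -
  note c = linear_map_closed[OF L F.minus_closed[OF that(1,2)]] linear_map_closed[OF L that(2)]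
  have "(x \<ominus>\<^bsub>F\<^esub> y) \<oplus>\<^bsub>F\<^esub> y = x"
   using that(1,2) by (simp del: free_space_simps add: F.minus_eq F.a_assoc F.l_neg)
  then have "?L (x \<ominus>\<^bsub>F\<^esub> y) \<oplus>\<^bsub>V\<^esub> ?L y = \<zero>\<^bsub>V\<^esub> \<oplus>\<^bsub>V\<^esub> ?L y"
   using linear_map_add[OF L F.minus_closed[OF that(1,2)] that(2)] that(3) V.l_zero[OF c(2)] by argo
  then show ?thesis using V.add.right_cancel[OF c(2) c(1) V.zero_closed] by blast
 qed
 note l = linear_map_add[OF L] linear_map_smult[OF L] Lb basis_closed
  linear_map_add[OF bilinear_map_left[OF \<beta>]] linear_map_add[OF bilinear_map_right[OF \<beta>]]
  linear_map_smult[OF bilinear_map_left[OF \<beta>]] linear_map_smult[OF bilinear_map_right[OF \<beta>]]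
 have "tensor_relations K A B \<subseteq> {x \<in> carrier F. ?L x = \<zero>\<^bsub>V\<^esub>}"
  using relations_closed
  unfolding tensor_relations_def Let_def
  by (auto simp del: free_space_simps intro!: min F.a_closed F.smult_closed basis_closed simp: l)
 then have N0: "?L x = \<zero>\<^bsub>V\<^esub>" if "x \<in> N" for x
  using span_in_minimal[OF _ ker] that unfolding tensor_null_def by blast
 have lift: "tensor_lift K V \<beta> (N +>\<^bsub>F\<^esub> f) = ?L f" if f: "f \<in> carrier F" for f
 proof -
  have "(SOME g. g \<in> N +>\<^bsub>F\<^esub> f) \<in> N +>\<^bsub>F\<^esub> f"
   using Q.a_rcos_self[OF f] by (rule someI[where P="%g. g \<in> N +>\<^bsub>F\<^esub> f"])
  then obtain m where m: "m \<in> N" "(SOME g. g \<in> N +>\<^bsub>F\<^esub> f) = m \<oplus>\<^bsub>F\<^esub> f"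
   unfolding a_r_coset_def' by auto
  have mF: "m \<in> carrier F" using m Q.a_subset by blast
  have "?L (m \<oplus>\<^bsub>F\<^esub> f) = ?L f"
   using linear_map_add[OF L mF f] N0[OF m(1)] linear_map_closed[OF L f] by simp
  then show ?thesis unfolding tensor_lift_def Let_def m(2) lin_ext_def .
 qed
 show "linear_map K T V (tensor_lift K V \<beta>)"
 proof (rule linear_mapI)
  fix u assume "u \<in> carrier T"
  then obtain f where f: "f \<in> carrier F" "u = N +>\<^bsub>F\<^esub> f" by (rule T_cases)
  show "tensor_lift K V \<beta> u \<in> carrier V"
   unfolding f(2) lift[OF f(1)] by (rule linear_map_closed[OF L f(1)])
  fix c assume c: "c \<in> carrier K"
  show "tensor_lift K V \<beta> (c \<odot>\<^bsub>T\<^esub> u) = c \<odot>\<^bsub>V\<^esub> tensor_lift K V \<beta> u"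
   unfolding f(2) coset_smult[OF c f(1)] lift[OF f(1)] lift[OF F.smult_closed[OF c f(1)]]
   by (rule linear_map_smult[OF L c f(1)])
 next
  fix u v assume u: "u \<in> carrier T" and v: "v \<in> carrier T"
  from u v obtain f g where f: "f \<in> carrier F" "u = N +>\<^bsub>F\<^esub> f" and g: "g \<in> carrier F" "v = N +>\<^bsub>F\<^esub> g"
   by (metis T_cases)

  show "tensor_lift K V \<beta> (u \<oplus>\<^bsub>T\<^esub> v) = tensor_lift K V \<beta> u \<oplus>\<^bsub>V\<^esub> tensor_lift K V \<beta> v"
   unfolding f(2) g(2) coset_add[OF f(1) g(1)] lift[OF f(1)] lift[OF g(1)] lift[OF F.a_closed[OF f(1) g(1)]]
   by (rule linear_map_add[OF L f(1) g(1)])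
 qed
 show "tensor_lift K V \<beta> (tensor K A B a b) = \<beta> a b" if "a \<in> carrier A" "b \<in> carrier B"
  using that unfolding tensor_def by (simp del: free_space_simps add: lift basis_closed Lb)
qed

text \<open>Rewriting under a lift, where equality is known on the carriers only; bilinearity passes
  from \<beta> to \<beta>' because the two agree there.\<close>

lemma lift_cong:
 assumes "u \<in> carrier T" "!!a b. a \<in> carrier A ==> b \<in> carrier B ==> \<beta> a b = \<beta>' a b" "module K V"
  "bilinear_map K A B V \<beta>"
 shows "tensor_lift K V \<beta> u = tensor_lift K V \<beta>' u"
proof -
 have \<beta>': "bilinear_map K A B V \<beta>'"
 proof (rule bilinear_mapI)
  show "linear_map K B V (\<beta>' a)" if "a \<in> carrier A" for a
   by (rule linear_map_cong[OF B.module_axioms bilinear_map_right[OF assms(4) that] assms(2)[OF that]])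
  show "linear_map K A V (%a. \<beta>' a b)" if "b \<in> carrier B" for b
   by (rule linear_map_cong[OF A.module_axioms bilinear_map_left[OF assms(4) that] assms(2)[OF _ that]])
 qed
 show ?thesis
  by (rule linear_maps_eq[OF assms(3) lift_linear[OF assms(3,4)] lift_linear[OF assms(3) \<beta>'] _ assms(1)])
   (simp add: lift_tensor[OF assms(3,4)] lift_tensor[OF assms(3) \<beta>'] assms(2))
qed

lemma lift_comp:
 assumes "module K V" "module K W" "bilinear_map K A B V \<beta>" "linear_map K V W g" "u \<in> carrier T"
 shows "g (tensor_lift K V \<beta> u) = tensor_lift K W (%a b. g (\<beta> a b)) u"
proof -
 have b: "bilinear_map K A B W (%a b. g (\<beta> a b))"
  using assms(3,4) unfolding bilinear_map_def by (auto intro: linear_map_comp)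
 show ?thesis
  by (rule linear_maps_eq[OF assms(2) linear_map_comp[OF assms(4) lift_linear[OF assms(1,3)]]
     lift_linear[OF assms(2) b] _ assms(5)])
   (simp add: lift_tensor[OF assms(1,3)] lift_tensor[OF assms(2) b])
qed

end

section \<open>Linear forms and iterated tensor products\<close>

lemma module_tensor_space: "module K A ==> module K B ==> module K (tensor_space K A B)"
proof -
 assume "module K A" "module K B"
 then interpret tensor_product K A B by (rule tensor_product.intro)
 show ?thesis by (rule T.module_axioms)
qed

text \<open>A ring record has no \<open>smult\<close>; with this wrapper linear forms and
  scalar-valued lifts fall under the results on modules.\<close>

definition scalar_module :: "('k, 'm) ring_scheme => ('k, 'k) module" where
 "scalar_module K = \<lparr>carrier = carrier K, monoid.mult = monoid.mult K, one = one K,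
   ring.zero = ring.zero K, ring.add = ring.add K, smult = monoid.mult K\<rparr>"

lemma scalar_module_simps [simp]:
 "carrier (scalar_module K) = carrier K" "add (scalar_module K) = add K"
 "\<zero>\<^bsub>scalar_module K\<^esub> = \<zero>\<^bsub>K\<^esub>" "smult (scalar_module K) = monoid.mult K"
 by (simp_all add: scalar_module_def)

lemma finsum_scalar_module [simp]: "finsum (scalar_module K) f S = finsum K f S"
 by (simp add: finsum_def finprod_def scalar_module_def)

lemma module_scalar_module: "cring K ==> module K (scalar_module K)"
proof -
 assume "cring K"
 then interpret K: cring K .
 have "abelian_group (scalar_module K)"
  by (rule abelian_groupI) (auto simp: K.a_ac intro: K.add.l_inv_ex)
 then show ?thesis by (intro moduleI) (auto simp: K.is_cring K.l_distr K.r_distr K.m_assoc)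
qed

abbreviation linear_form ::
  "('k, 'm) ring_scheme => ('k, 'v, 'x) module_scheme => ('v => 'k) => bool" where
 "linear_form K V \<equiv> linear_map K V (scalar_module K)"

lemma linear_map_form_smult:
 assumes "module K W" "linear_form K V \<phi>" "w \<in> carrier W"
 shows "linear_map K V W (%x. \<phi> x \<odot>\<^bsub>W\<^esub> w)"
proof -
 interpret W: module K W by fact
 show ?thesis using assms(3)
  by (intro linear_mapI)
   (use linear_map_closed[OF assms(2)] linear_map_add[OF assms(2)] linear_map_smult[OF assms(2)] in
    \<open>auto simp: W.smult_l_distr W.smult_assoc1\<close>)
qed

lemma bilinear_map_comp:
 assumes "bilinear_map K A B V \<beta>" "linear_map K C A f" "linear_map K D B g"
 shows "bilinear_map K C D V (%c d. \<beta> (f c) (g d))"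
 using assms by (intro bilinear_mapI)
  (auto intro: linear_map_comp[OF bilinear_map_left] linear_map_comp[OF bilinear_map_right] dest: linear_map_closed)

lemma bilinear_map_post:
 "bilinear_map K A B V \<beta> ==> linear_map K V W g ==> bilinear_map K A B W (%a b. g (\<beta> a b))"
 unfolding bilinear_map_def by (auto intro: linear_map_comp)

definition trilinear_map ::
  "('k, 'm) ring_scheme => ('k, 'a, 'x) module_scheme => ('k, 'b, 'y) module_scheme =>
   ('k, 'c, 'u) module_scheme => ('k, 'v, 'z) module_scheme => ('a => 'b => 'c => 'v) => bool" where
 "trilinear_map K A B C V \<gamma> \<longleftrightarrow>
   (\<forall>a\<in>carrier A. bilinear_map K B C V (\<gamma> a)) \<and>
   (\<forall>b\<in>carrier B. \<forall>c\<in>carrier C. linear_map K A V (%a. \<gamma> a b c))"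

lemma trilinear_mapI:
 assumes "!!b c. b \<in> carrier B ==> c \<in> carrier C ==> linear_map K A V (%a. \<gamma> a b c)"
  "!!a c. a \<in> carrier A ==> c \<in> carrier C ==> linear_map K B V (%b. \<gamma> a b c)"
  "!!a b. a \<in> carrier A ==> b \<in> carrier B ==> linear_map K C V (%c. \<gamma> a b c)"
 shows "trilinear_map K A B C V \<gamma>"
 using assms unfolding trilinear_map_def bilinear_map_def by blast

lemma trilinear_map_bilinear:
 assumes "trilinear_map K A B C V \<gamma>"
 shows "a \<in> carrier A ==> bilinear_map K B C V (\<gamma> a)"
  and "c \<in> carrier C ==> bilinear_map K A B V (%a b. \<gamma> a b c)"
  and "b \<in> carrier B ==> bilinear_map K A C V (%a c. \<gamma> a b c)"
 using assms unfolding trilinear_map_def bilinear_map_def by blast+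

context tensor_product
begin

text \<open>One expansion of \<open>u\<close> into pure tensors serves for all \<open>x\<close>;
  along it the lift is a finite combination of values \<open>\<gamma> x a b\<close>, each linear in
  \<open>x\<close>.\<close>

lemma lift_param:
 assumes V: "module K V" and \<gamma>: "!!x. x \<in> carrier U ==> bilinear_map K A B V (\<gamma> x)"
  and \<gamma>': "!!a b. a \<in> carrier A ==> b \<in> carrier B ==> linear_map K U V (%x. \<gamma> x a b)"
  and U: "module K U" and u: "u \<in> carrier T"
 shows "linear_map K U V (%x. tensor_lift K V (\<gamma> x) u)"
proof -
 interpret V: module K V by fact
 from u obtain S f where S: "finite S" "S \<subseteq> carrier A \<times> carrier B" "!!i. f i \<in> carrier K"
  and u: "u = (\<Oplus>\<^bsub>T\<^esub> i \<in> S. f i \<odot>\<^bsub>T\<^esub> tensor K A B (fst i) (snd i))"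
  by (rule tensor_expand) blast
 have c: "tensor K A B (fst i) (snd i) \<in> carrier T" "fst i \<in> carrier A" "snd i \<in> carrier B" if "i \<in> S" for i
  using that S(2) by (auto intro!: tensor_closed)
 have "tensor_lift K V (\<gamma> x) u = (\<Oplus>\<^bsub>V\<^esub> i \<in> S. f i \<odot>\<^bsub>V\<^esub> \<gamma> x (fst i) (snd i))" if x: "x \<in> carrier U" for x
 proof -
  note L = lift_linear[OF V \<gamma>[OF x]]
  have "tensor_lift K V (\<gamma> x) u = (\<Oplus>\<^bsub>V\<^esub> i \<in> S. tensor_lift K V (\<gamma> x) (f i \<odot>\<^bsub>T\<^esub> tensor K A B (fst i) (snd i)))"
   unfolding u using c S by (intro linear_map_finsum[OF T.module_axioms V L]) auto
  also have "... = (\<Oplus>\<^bsub>V\<^esub> i \<in> S. f i \<odot>\<^bsub>V\<^esub> \<gamma> x (fst i) (snd i))"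
   using c S bilinear_map_closed[OF \<gamma>[OF x]]
   by (intro V.finsum_cong') (auto simp: linear_map_smult[OF L] lift_tensor[OF V \<gamma>[OF x]])
  finally show ?thesis .
 qed
 moreover have "linear_map K U V (%x. \<Oplus>\<^bsub>V\<^esub> i \<in> S. f i \<odot>\<^bsub>V\<^esub> \<gamma> x (fst i) (snd i))"
  using S c by (intro linear_map_finsum_fun linear_map_smult_fun V \<gamma>') auto
 ultimately show ?thesis using linear_map_cong[OF U] by (metis (no_types, lifting))
qed

end

lemma lift_bilinear_right:
 assumes "module K A" "module K B" "module K C" "module K V" "trilinear_map K A B C V \<gamma>"
 shows "bilinear_map K A (tensor_space K B C) V (%a w. tensor_lift K V (\<gamma> a) w)"
proof -
 interpret BC: tensor_product K B C by (intro tensor_product.intro assms)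
 note t = trilinear_map_bilinear[OF assms(5)]
 show ?thesis
  by (intro bilinear_mapI BC.lift_param BC.lift_linear assms t)
   (use t(2) in \<open>auto dest: bilinear_map_left\<close>)
qed

lemma lift_bilinear_left:
 assumes "module K A" "module K B" "module K C" "module K V" "trilinear_map K A B C V \<gamma>"
 shows "bilinear_map K (tensor_space K A B) C V (%w c. tensor_lift K V (%a b. \<gamma> a b c) w)"
proof -
 interpret AB: tensor_product K A B by (intro tensor_product.intro assms)
 note t = trilinear_map_bilinear[OF assms(5)]
 show ?thesis
  by (intro bilinear_mapI AB.lift_param AB.lift_linear assms t)
   (use t(1) in \<open>auto dest: bilinear_map_right\<close>)
qed

lemma tensor_trilinear:
 assumes "module K A" "module K B" "module K C"
 shows "trilinear_map K A B C (tensor_space K A (tensor_space K B C))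
  (%a b c. tensor K A (tensor_space K B C) a (tensor K B C b c))"
proof -
 interpret BC: tensor_product K B C by (intro tensor_product.intro assms)
 interpret A: tensor_product K A "tensor_space K B C"
  by (intro tensor_product.intro assms module_tensor_space)
 show ?thesis
  by (intro trilinear_mapI)
   (auto intro: linear_map_comp[OF bilinear_map_right[OF A.tensor_bilinear]] bilinear_map_left[OF A.tensor_bilinear]
     bilinear_map_left[OF BC.tensor_bilinear] bilinear_map_right[OF BC.tensor_bilinear] BC.tensor_closed)
qed

text \<open>Testing on pure tensors in the outer and then in the inner factor reduces both sides to
  \<open>\<gamma> a b c\<close>. This turns coassociativity, an equation of cosets, into an equation
  of iterated lifts.\<close>

lemma lift_tensor_assoc:
 assumes M: "module K A" "module K B" "module K C" "module K V" and \<gamma>: "trilinear_map K A B C V \<gamma>"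
  and u: "u \<in> carrier (tensor_space K (tensor_space K A B) C)"
 shows "tensor_lift K V (%a w. tensor_lift K V (\<gamma> a) w) (tensor_assoc K A B C u) =
  tensor_lift K V (%w c. tensor_lift K V (%a b. \<gamma> a b c) w) u"
proof -
 let ?AB = "tensor_space K A B" and ?BC = "tensor_space K B C"
 let ?T = "tensor_space K A ?BC"
 interpret BC: tensor_product K B C by (intro tensor_product.intro M)
 interpret AB: tensor_product K A B by (intro tensor_product.intro M)
 interpret L: tensor_product K A ?BC by (intro tensor_product.intro M module_tensor_space)
 interpret R: tensor_product K ?AB C by (intro tensor_product.intro M module_tensor_space)
 let ?g = "%a b c. tensor K A ?BC a (tensor K B C b c)"
 note t = tensor_trilinear[OF M(1-3)]
 note bl = lift_bilinear_left[OF M(1-3) L.T.module_axioms t]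
 note br' = lift_bilinear_right[OF M \<gamma>]
 note bl' = lift_bilinear_left[OF M \<gamma>]
 have as: "tensor_assoc K A B C = tensor_lift K ?T (%u c. tensor_lift K ?T (%a b. ?g a b c) u)"
  by (simp add: tensor_assoc_def Let_def)
 note la = R.lift_linear[OF L.T.module_axioms bl]
 let ?\<Phi> = "tensor_lift K V (%a w. tensor_lift K V (\<gamma> a) w)"
 note l\<Phi> = L.lift_linear[OF M(4) br']
 show ?thesis
 proof (rule R.linear_maps_eq[OF M(4) _ R.lift_linear[OF M(4) bl'] _ u])
  show "linear_map K (tensor_space K ?AB C) V (%u. ?\<Phi> (tensor_assoc K A B C u))"
   unfolding as by (rule linear_map_comp[OF l\<Phi> la])
  fix w c assume w: "w \<in> carrier ?AB" and c: "c \<in> carrier C"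
  note bt = trilinear_map_bilinear(2)[OF t c]
  note bt' = trilinear_map_bilinear(2)[OF \<gamma> c]
  have "?\<Phi> (tensor_lift K ?T (%a b. ?g a b c) w) = tensor_lift K V (%a b. \<gamma> a b c) w"
  proof (rule AB.linear_maps_eq[OF M(4) _ AB.lift_linear[OF M(4) bt'] _ w])
   show "linear_map K ?AB V (%w. ?\<Phi> (tensor_lift K ?T (%a b. ?g a b c) w))"
    by (rule linear_map_comp[OF l\<Phi> AB.lift_linear[OF L.T.module_axioms bt]])
   fix a b assume ab: "a \<in> carrier A" "b \<in> carrier B"
   show "?\<Phi> (tensor_lift K ?T (%a b. ?g a b c) (tensor K A B a b)) =
    tensor_lift K V (%a b. \<gamma> a b c) (tensor K A B a b)"
    using ab c
    by (simp add: AB.lift_tensor[OF L.T.module_axioms bt] AB.lift_tensor[OF M(4) bt']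
     L.lift_tensor[OF M(4) br'] BC.tensor_closed BC.lift_tensor[OF M(4) trilinear_map_bilinear(1)[OF \<gamma>]])
  qed
  then show "?\<Phi> (tensor_assoc K A B C (tensor K ?AB C w c)) =
    tensor_lift K V (%w c. tensor_lift K V (%a b. \<gamma> a b c) w) (tensor K ?AB C w c)"
   unfolding as by (simp add: R.lift_tensor[OF L.T.module_axioms bl w c] R.lift_tensor[OF M(4) bl' w c])
 qed
qed

lemma
 assumes M: "module K A" "module K B" "module K C" "module K D"
  and f: "linear_map K C A f" and g: "linear_map K D B g"
 shows tensor_map_linear: "linear_map K (tensor_space K C D) (tensor_space K A B) (tensor_map K A B f g)"
  and tensor_map_tensor: "c \<in> carrier C ==> d \<in> carrier D ==>
   tensor_map K A B f g (tensor K C D c d) = tensor K A B (f c) (g d)"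
  and lift_tensor_map: "module K V ==> bilinear_map K A B V \<beta> ==> u \<in> carrier (tensor_space K C D) ==>
   tensor_lift K V \<beta> (tensor_map K A B f g u) = tensor_lift K V (%c d. \<beta> (f c) (g d)) u"
proof -
 interpret AB: tensor_product K A B by (intro tensor_product.intro M)
 interpret CD: tensor_product K C D by (intro tensor_product.intro M)
 note b = bilinear_map_comp[OF AB.tensor_bilinear f g]
 show l: "linear_map K (tensor_space K C D) (tensor_space K A B) (tensor_map K A B f g)"
  unfolding tensor_map_def by (rule CD.lift_linear[OF AB.T.module_axioms b])
 show t: "tensor_map K A B f g (tensor K C D c d) = tensor K A B (f c) (g d)"
  if "c \<in> carrier C" "d \<in> carrier D" for c d
  unfolding tensor_map_def using CD.lift_tensor[OF AB.T.module_axioms b that] .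
 show "tensor_lift K V \<beta> (tensor_map K A B f g u) = tensor_lift K V (%c d. \<beta> (f c) (g d)) u"
  if V: "module K V" and \<beta>: "bilinear_map K A B V \<beta>" and u: "u \<in> carrier (tensor_space K C D)"
  by (rule CD.linear_maps_eq[OF V linear_map_comp[OF AB.lift_linear[OF V \<beta>] l]
     CD.lift_linear[OF V bilinear_map_comp[OF \<beta> f g]] _ u])
   (use linear_map_closed[OF f] linear_map_closed[OF g] in
    \<open>simp add: t AB.lift_tensor[OF V \<beta>] CD.lift_tensor[OF V bilinear_map_comp[OF \<beta> f g]]\<close>)
qed

lemma tensor_algebra_simps [simp]:
 "carrier (tensor_algebra K A B) = carrier (tensor_space K A B)"
 "add (tensor_algebra K A B) = add (tensor_space K A B)"
 "one (tensor_algebra K A B) = tensor K A B \<one>\<^bsub>A\<^esub> \<one>\<^bsub>B\<^esub>"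
 by (simp_all add: tensor_algebra_def Let_def)

lemma tensor_algebra_mult:
 "u \<otimes>\<^bsub>tensor_algebra K A B\<^esub> v = tensor_lift K (tensor_space K A B) (%a b.
   tensor_lift K (tensor_space K A B) (%a' b'. tensor K A B (a \<otimes>\<^bsub>A\<^esub> a') (b \<otimes>\<^bsub>B\<^esub> b')) v) u"
 by (simp add: tensor_algebra_def Let_def)

context assoc_algebra
begin

lemma mult_linear_right: "a \<in> carrier A ==> linear_map K A A (%x. a \<otimes>\<^bsub>A\<^esub> x)"
 by (rule linear_mapI) (auto simp: A.r_distr smult_mult_right)

lemma mult_linear_left: "a \<in> carrier A ==> linear_map K A A (%x. x \<otimes>\<^bsub>A\<^esub> a)"
 by (rule linear_mapI) (auto simp: A.l_distr smult_mult_left)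

end

lemma tensor_algebra_mult_bilinear:
 assumes A: "assoc_algebra K A" and B: "assoc_algebra K B"
  and v: "v \<in> carrier (tensor_space K A B)" and V: "module K V" and \<beta>: "bilinear_map K A B V \<beta>"
 shows "bilinear_map K A B V (%a b. tensor_lift K V (%a' b'. \<beta> (a \<otimes>\<^bsub>A\<^esub> a') (b \<otimes>\<^bsub>B\<^esub> b')) v)"
proof -
 interpret A: assoc_algebra K A by fact
 interpret B: assoc_algebra K B by fact
 interpret AB: tensor_product K A B by unfold_locales
 show ?thesis
  by (intro bilinear_mapI AB.lift_param[OF V _ _ _ v] A.module_axioms B.module_axioms
    bilinear_map_comp[OF \<beta> A.mult_linear_right B.mult_linear_right])
   (auto intro: linear_map_comp[OF bilinear_map_left[OF \<beta>]] linear_map_comp[OF bilinear_map_right[OF \<beta>]]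
     A.mult_linear_left B.mult_linear_left)
qed

lemma
 assumes A: "assoc_algebra K A" and B: "assoc_algebra K B"
  and u: "u \<in> carrier (tensor_space K A B)" and v: "v \<in> carrier (tensor_space K A B)"
 shows tensor_algebra_mult_closed: "u \<otimes>\<^bsub>tensor_algebra K A B\<^esub> v \<in> carrier (tensor_space K A B)"
  and lift_tensor_algebra_mult: "module K V ==> bilinear_map K A B V \<beta> ==>
   tensor_lift K V \<beta> (u \<otimes>\<^bsub>tensor_algebra K A B\<^esub> v) =
   tensor_lift K V (%a b. tensor_lift K V (%a' b'. \<beta> (a \<otimes>\<^bsub>A\<^esub> a') (b \<otimes>\<^bsub>B\<^esub> b')) v) u"
proof -
 interpret A: assoc_algebra K A by fact
 interpret B: assoc_algebra K B by fact
 interpret AB: tensor_product K A B by unfold_locales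
 let ?T = "tensor_space K A B"
 have b1T: "bilinear_map K A B ?T (%a' b'. tensor K A B (a \<otimes>\<^bsub>A\<^esub> a') (b \<otimes>\<^bsub>B\<^esub> b'))"
  if "a \<in> carrier A" "b \<in> carrier B" for a b
  using bilinear_map_comp[OF AB.tensor_bilinear A.mult_linear_right[OF that(1)] B.mult_linear_right[OF that(2)]] .
 note b2T = tensor_algebra_mult_bilinear[OF A B v AB.T.module_axioms AB.tensor_bilinear]
 show "u \<otimes>\<^bsub>tensor_algebra K A B\<^esub> v \<in> carrier (tensor_space K A B)"
  unfolding tensor_algebra_mult by (rule linear_map_closed[OF AB.lift_linear[OF AB.T.module_axioms b2T] u])
 show "tensor_lift K V \<beta> (u \<otimes>\<^bsub>tensor_algebra K A B\<^esub> v) =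
   tensor_lift K V (%a b. tensor_lift K V (%a' b'. \<beta> (a \<otimes>\<^bsub>A\<^esub> a') (b \<otimes>\<^bsub>B\<^esub> b')) v) u"
  if V: "module K V" and \<beta>: "bilinear_map K A B V \<beta>"
 proof -
  note l = AB.lift_linear[OF V \<beta>]
  have "tensor_lift K V \<beta> (u \<otimes>\<^bsub>tensor_algebra K A B\<^esub> v) =
   tensor_lift K V (%a b. tensor_lift K V \<beta> (tensor_lift K ?T (%a' b'. tensor K A B (a \<otimes>\<^bsub>A\<^esub> a') (b \<otimes>\<^bsub>B\<^esub> b')) v)) u"
   unfolding tensor_algebra_mult by (rule AB.lift_comp[OF AB.T.module_axioms V b2T l u])
  also have "... = tensor_lift K V (%a b. tensor_lift K V (%a' b'. \<beta> (a \<otimes>\<^bsub>A\<^esub> a') (b \<otimes>\<^bsub>B\<^esub> b')) v) u"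
  proof (rule AB.lift_cong[OF u _ V bilinear_map_post[OF b2T l]])
   fix a b assume ab: "a \<in> carrier A" "b \<in> carrier B"
   have "tensor_lift K V \<beta> (tensor_lift K ?T (%a' b'. tensor K A B (a \<otimes>\<^bsub>A\<^esub> a') (b \<otimes>\<^bsub>B\<^esub> b')) v) =
    tensor_lift K V (%a' b'. tensor_lift K V \<beta> (tensor K A B (a \<otimes>\<^bsub>A\<^esub> a') (b \<otimes>\<^bsub>B\<^esub> b'))) v"
    by (rule AB.lift_comp[OF AB.T.module_axioms V b1T[OF ab] l v])
   also have "... = tensor_lift K V (%a' b'. \<beta> (a \<otimes>\<^bsub>A\<^esub> a') (b \<otimes>\<^bsub>B\<^esub> b')) v"
    using ab by (intro AB.lift_cong[OF v _ V bilinear_map_post[OF b1T[OF ab] l]]) (simp add: AB.lift_tensor[OF V \<beta>])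
   finally show "tensor_lift K V \<beta> (tensor_lift K ?T (%a' b'. tensor K A B (a \<otimes>\<^bsub>A\<^esub> a') (b \<otimes>\<^bsub>B\<^esub> b')) v) =
    tensor_lift K V (%a' b'. \<beta> (a \<otimes>\<^bsub>A\<^esub> a') (b \<otimes>\<^bsub>B\<^esub> b')) v" .
  qed
  finally show ?thesis .
 qed
qed

section \<open>Hopf algebras\<close>

named_theorems linear_intros

lemmas [linear_intros] = linear_map_id linear_map_smult_fun linear_map_form_smult linear_map_add_fun

text \<open>A Fubini rule: both sides are linear in \<open>u\<close> and agree on pure tensors. It
  interchanges the coproducts of two different elements in \<open>antipode_mult\<close>.\<close>

lemma (in tensor_product) lift_swap:
 assumes M: "module K C" "module K D" "module K V"
  and b1: "!!a b. a \<in> carrier A ==> b \<in> carrier B ==> bilinear_map K C D V (\<mu> a b)"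
  and b2: "!!c d. c \<in> carrier C ==> d \<in> carrier D ==> bilinear_map K A B V (%a b. \<mu> a b c d)"
  and u: "u \<in> carrier T" and v: "v \<in> carrier (tensor_space K C D)"
 shows "tensor_lift K V (%a b. tensor_lift K V (\<mu> a b) v) u =
  tensor_lift K V (%c d. tensor_lift K V (%a b. \<mu> a b c d) u) v"
proof -
 interpret CD: tensor_product K C D by (intro tensor_product.intro M)
 have l1: "bilinear_map K A B V (%a b. tensor_lift K V (\<mu> a b) v)"
  by (intro bilinear_mapI CD.lift_param[OF M(3) _ _ _ v] A.module_axioms B.module_axioms b1
    bilinear_map_left[OF b2] bilinear_map_right[OF b2])
 have l2: "bilinear_map K C D V (%c d. tensor_lift K V (%a b. \<mu> a b c d) u)" if "u \<in> carrier T" for u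
  by (intro bilinear_mapI lift_param[OF M(3) _ _ _ that] M b2
    bilinear_map_left[OF b1] bilinear_map_right[OF b1])
 have l3: "linear_map K T V (%u. tensor_lift K V (%c d. tensor_lift K V (%a b. \<mu> a b c d) u) v)"
  by (rule CD.lift_param[OF M(3) l2 lift_linear[OF M(3) b2] T.module_axioms v])
 show ?thesis
 proof (rule linear_maps_eq[OF M(3) lift_linear[OF M(3) l1] l3 _ u])
  fix a b assume ab: "a \<in> carrier A" "b \<in> carrier B"
  show "tensor_lift K V (%a b. tensor_lift K V (\<mu> a b) v) (tensor K A B a b) =
   tensor_lift K V (%c d. tensor_lift K V (%a b. \<mu> a b c d) (tensor K A B a b)) v"
   unfolding lift_tensor[OF M(3) l1 ab]
   by (rule CD.lift_cong[OF v _ M(3) b1[OF ab]]) (simp add: lift_tensor[OF M(3) b2] ab)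
 qed
qed

section \<open>Sweedler calculus and translations by linear forms\<close>

context hopf_algebra
begin

abbreviation (input) H_mult (infixl \<open>\<star>\<close> 70) where "x \<star> y \<equiv> x \<otimes>\<^bsub>H\<^esub> y"
abbreviation (input) H_smult (infixl \<open>\<bullet>\<close> 70) where "c \<bullet> y \<equiv> c \<odot>\<^bsub>H\<^esub> y"

sublocale HH: tensor_product K H H
 by unfold_locales

lemma mod_H: "module K H" by unfold_locales
lemma mod_K: "module K (scalar_module K)" by (rule module_scalar_module) unfold_locales

text \<open>Sweedler notation: \<open>sw V \<beta> h\<close> is the sum of the values of \<beta> on
  the legs \<open>h1\<close>, \<open>h2\<close> of the coproduct of \<open>h\<close>.\<close>

abbreviation sw :: "('k, 'v, 'z) module_scheme => ('h => 'h => 'v) => 'h => 'v" where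
 "sw V \<beta> h \<equiv> tensor_lift K V \<beta> (comult H h)"

lemma comult_closed [simp]: "h \<in> carrier H ==> comult H h \<in> carrier (tensor_space K H H)"
 by (rule linear_map_closed[OF comult_linear])

lemma antipode_closed [simp]: "h \<in> carrier H ==> antipode H h \<in> carrier H"
 by (rule linear_map_closed[OF antipode_linear])

lemma counit_closed [simp]: "h \<in> carrier H ==> counit H h \<in> carrier K"
 using counit_ring_hom by (rule ring_hom_closed)

lemma counit_form: "linear_form K H (counit H)"
 by (rule linear_mapI) (auto simp: counit_smult ring_hom_add[OF counit_ring_hom])

lemma lin_mult_left [linear_intros]: "a \<in> carrier H ==> linear_map K V H f ==> linear_map K V H (%x. a \<star> f x)"
 by (rule linear_map_comp[OF mult_linear_right])

lemma lin_mult_right [linear_intros]: "a \<in> carrier H ==> linear_map K V H f ==> linear_map K V H (%x. f x \<star> a)"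
 by (rule linear_map_comp[OF mult_linear_left])

lemma lin_mult_left' [linear_intros]: "a \<in> carrier H ==> linear_map K H H ((\<star>) a)"
 by (rule mult_linear_right)

lemma lin_smult_left [linear_intros]: "c \<in> carrier K ==> linear_map K H H ((\<bullet>) c)"
 using linear_map_smult_fun[OF mod_H _ linear_map_id] .

lemma lin_scalar_left' [linear_intros]: "c \<in> carrier K ==> linear_form K (scalar_module K) ((\<otimes>\<^bsub>K\<^esub>) c)"
 using linear_map_smult_fun[OF mod_K _ linear_map_id] by simp

lemmas [linear_intros] = antipode_linear counit_form

lemma lin_antipode [linear_intros]: "linear_map K V H f ==> linear_map K V H (%x. antipode H (f x))"
 by (rule linear_map_comp[OF antipode_linear])

lemma lin_scalar_left [linear_intros]: "c \<in> carrier K ==> linear_form K V f ==> linear_form K V (%x. c \<otimes>\<^bsub>K\<^esub> f x)"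
 using linear_map_smult_fun[OF mod_K] by simp

lemma lin_scalar_right [linear_intros]: "c \<in> carrier K ==> linear_form K V f ==> linear_form K V (%x. f x \<otimes>\<^bsub>K\<^esub> c)"
 using linear_map_form_smult[OF mod_K] by simp

lemma sw_linear: "module K V ==> bilinear_map K H H V \<beta> ==> linear_map K H V (sw V \<beta>)"
 by (rule linear_map_comp[OF HH.lift_linear comult_linear])

lemma sw_closed: "module K V ==> bilinear_map K H H V \<beta> ==> h \<in> carrier H ==> sw V \<beta> h \<in> carrier V"
 by (rule linear_map_closed[OF sw_linear])

lemma sw_post:
 "module K V ==> module K W ==> bilinear_map K H H V \<beta> ==> linear_map K V W g ==> h \<in> carrier H ==>
  g (sw V \<beta> h) = sw W (%a b. g (\<beta> a b)) h"
 by (rule HH.lift_comp) simp_all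

lemma sw_cong:
 "module K V ==> bilinear_map K H H V \<beta> ==> h \<in> carrier H ==>
  (!!a b. a \<in> carrier H ==> b \<in> carrier H ==> \<beta> a b = \<beta>' a b) ==> sw V \<beta> h = sw V \<beta>' h"
 by (rule HH.lift_cong) simp_all

lemma sw_param:
 "module K V ==> (!!x. x \<in> carrier U ==> bilinear_map K H H V (\<gamma> x)) ==>
  (!!a b. a \<in> carrier H ==> b \<in> carrier H ==> linear_map K U V (%x. \<gamma> x a b)) ==>
  module K U ==> h \<in> carrier H ==> linear_map K U V (%x. sw V (\<gamma> x) h)"
 by (rule HH.lift_param) simp_all

text \<open>Coassociativity in evaluated form: \<gamma> is applied to legs \<open>h1\<close>,
  \<open>h2\<close>, \<open>h3\<close>, which arise by splitting either the first or the second leg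
  again.\<close>

lemma sw_coassoc:
 assumes V: "module K V" and \<gamma>: "trilinear_map K H H H V \<gamma>" and h: "h \<in> carrier H"
 shows "sw V (%a c. sw V (%x y. \<gamma> x y c) a) h = sw V (%a c. sw V (\<gamma> a) c) h"
proof -
 let ?T = "tensor_space K H H"
 have id: "linear_map K H H id" using linear_map_id by (simp add: id_def)
 note T = HH.T.module_axioms
 note l1 = tensor_map_linear[OF T mod_H mod_H mod_H comult_linear id]
 have "tensor_lift K V (%a w. tensor_lift K V (\<gamma> a) w)
   (tensor_assoc K H H H (tensor_map K ?T H (comult H) id (comult H h))) =
  tensor_lift K V (%w c. tensor_lift K V (%a b. \<gamma> a b c) w) (tensor_map K ?T H (comult H) id (comult H h))"
  by (rule lift_tensor_assoc[OF mod_H mod_H mod_H V \<gamma> linear_map_closed[OF l1 comult_closed[OF h]]])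
 also have "... = tensor_lift K V (%a c. sw V (%x y. \<gamma> x y (id c)) a) (comult H h)"
  by (rule lift_tensor_map[OF T mod_H mod_H mod_H comult_linear id V
     lift_bilinear_left[OF mod_H mod_H mod_H V \<gamma>] comult_closed[OF h]])
 finally have 1: "tensor_lift K V (%a w. tensor_lift K V (\<gamma> a) w)
   (tensor_assoc K H H H (tensor_map K ?T H (comult H) id (comult H h))) =
   tensor_lift K V (%a c. sw V (%x y. \<gamma> x y c) a) (comult H h)" by simp
 have "tensor_lift K V (%a w. tensor_lift K V (\<gamma> a) w) (tensor_map K H ?T id (comult H) (comult H h)) =
  tensor_lift K V (%a c. tensor_lift K V (\<gamma> (id a)) (comult H c)) (comult H h)"
  by (rule lift_tensor_map[OF mod_H T mod_H mod_H id comult_linear V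
     lift_bilinear_right[OF mod_H mod_H mod_H V \<gamma>] comult_closed[OF h]])
 with 1 show ?thesis by (simp add: coassoc[OF h])
qed

lemma sw_mult:
 assumes V: "module K V" and \<beta>: "bilinear_map K H H V \<beta>" and h: "h \<in> carrier H" "k \<in> carrier H"
 shows "sw V \<beta> (h \<star> k) = sw V (%a b. sw V (%a' b'. \<beta> (a \<star> a') (b \<star> b')) k) h"
 unfolding ring_hom_mult[OF comult_ring_hom h]
 by (rule lift_tensor_algebra_mult[OF _ _ _ _ V \<beta>]) (simp_all add: h assoc_algebra_axioms)

lemma sw_one:
 assumes V: "module K V" and \<beta>: "bilinear_map K H H V \<beta>"
 shows "sw V \<beta> \<one>\<^bsub>H\<^esub> = \<beta> \<one>\<^bsub>H\<^esub> \<one>\<^bsub>H\<^esub>"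
 using ring_hom_one[OF comult_ring_hom] HH.lift_tensor[OF V \<beta>] by simp

lemma antipode_one: "antipode H \<one>\<^bsub>H\<^esub> = \<one>\<^bsub>H\<^esub>"
proof -
 have "sw H (%a b. antipode H a \<star> b) \<one>\<^bsub>H\<^esub> = antipode H \<one>\<^bsub>H\<^esub> \<star> \<one>\<^bsub>H\<^esub>"
  by (rule sw_one[OF mod_H]) (intro bilinear_mapI linear_intros antipode_closed mod_H)
 then show ?thesis
  using antipode_left[OF A.one_closed] ring_hom_one[OF counit_ring_hom] by simp
qed

text \<open>The action of the dual algebra, \<open>h\<close> to \<open>h1 \<phi>(h2)\<close>. For
  functions on a group and \<phi> evaluation at \<open>y\<close> it sends \<open>f\<close> to the
  function with value \<open>f (x y)\<close> at \<open>x\<close>.\<close>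

definition right_translate :: "('h => 'k) => 'h => 'h" where
 "right_translate \<phi> h = sw H (%a b. \<phi> b \<bullet> a) h"

lemma translate_bilinear: "linear_form K H \<phi> ==> bilinear_map K H H H (%a b. \<phi> b \<bullet> a)"
 by (intro bilinear_mapI linear_intros mod_H) (auto dest: linear_map_closed)

lemma right_translate_linear: "linear_form K H \<phi> ==> linear_map K H H (right_translate \<phi>)"
 unfolding right_translate_def[abs_def] by (intro sw_linear mod_H translate_bilinear)

lemma right_translate_closed: "linear_form K H \<phi> ==> h \<in> carrier H ==> right_translate \<phi> h \<in> carrier H"
 by (rule linear_map_closed[OF right_translate_linear])

lemma form_right_translate:
 assumes "linear_form K H \<phi>" "linear_form K H \<psi>" "h \<in> carrier H"
 shows "\<phi> (right_translate \<psi> h) = sw (scalar_module K) (%a b. \<phi> a \<otimes>\<^bsub>K\<^esub> \<psi> b) h"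
proof -
 note c = linear_map_closed[OF assms(1), simplified] linear_map_closed[OF assms(2), simplified]
 have b: "bilinear_map K H H (scalar_module K) (%a b. \<phi> (\<psi> b \<bullet> a))"
  by (rule bilinear_map_post[OF translate_bilinear[OF assms(2)] assms(1)])
 have "\<phi> (right_translate \<psi> h) = sw (scalar_module K) (%a b. \<phi> (\<psi> b \<bullet> a)) h"
  unfolding right_translate_def
  by (rule sw_post[OF mod_H mod_K translate_bilinear[OF assms(2)] assms(1,3)])
 also have "... = sw (scalar_module K) (%a b. \<phi> a \<otimes>\<^bsub>K\<^esub> \<psi> b) h"
  by (rule sw_cong[OF mod_K b assms(3)])
   (simp add: linear_map_smult[OF assms(1)] c m_comm)
 finally show ?thesis .
qed

text \<open>By coassociativity both sides are \<open>h1 \<phi>(h2) \<psi>(h3)\<close>: translations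
  compose as forms convolve.\<close>

lemma right_translate_comp:
 assumes "linear_form K H \<phi>" "linear_form K H \<psi>" "h \<in> carrier H"
 shows "right_translate \<phi> (right_translate \<psi> h) = right_translate (%x. \<phi> (right_translate \<psi> x)) h"
proof -
 note c = linear_map_closed[OF assms(1), simplified] linear_map_closed[OF assms(2), simplified]
 note rl = right_translate_linear[OF assms(1)]
 let ?g = "%x y z. (\<phi> y \<otimes>\<^bsub>K\<^esub> \<psi> z) \<bullet> x"
 have tri: "trilinear_map K H H H H ?g"
  by (intro trilinear_mapI linear_intros mod_H) (auto intro: c linear_intros assms)
 note bi = trilinear_map_bilinear[OF tri]
 have "right_translate \<phi> (right_translate \<psi> h) = sw H (%a c. right_translate \<phi> (\<psi> c \<bullet> a)) h"
  unfolding right_translate_def[of \<psi>]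
  by (rule sw_post[OF mod_H mod_H translate_bilinear[OF assms(2)] rl assms(3)])
 also have "... = sw H (%a c. sw H (%x y. ?g x y c) a) h"
 proof (rule sw_cong[OF mod_H bilinear_map_post[OF translate_bilinear[OF assms(2)] rl] assms(3)])
  fix a c' assume a: "a \<in> carrier H" "c' \<in> carrier H"
  have "right_translate \<phi> (\<psi> c' \<bullet> a) = sw H (%x y. \<psi> c' \<bullet> (\<phi> y \<bullet> x)) a"
   unfolding linear_map_smult[OF rl c(2)[OF a(2)] a(1)] unfolding right_translate_def
   by (rule sw_post[OF mod_H mod_H translate_bilinear[OF assms(1)] linear_map_smult_fun[OF mod_H c(2)[OF a(2)] linear_map_id] a(1)])
  also have "... = sw H (%x y. ?g x y c') a"
   using a c by (intro sw_cong[OF mod_H bilinear_map_post[OF translate_bilinear[OF assms(1)]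
    linear_map_smult_fun[OF mod_H c(2)[OF a(2)] linear_map_id]]]) 
    (simp_all add: m_comm smult_assoc1[symmetric])
  finally show "right_translate \<phi> (\<psi> c' \<bullet> a) = sw H (%x y. ?g x y c') a" .
 qed
 also have "... = sw H (%a c. sw H (?g a) c) h" by (rule sw_coassoc[OF mod_H tri assms(3)])
 also have "... = right_translate (%x. \<phi> (right_translate \<psi> x)) h"
  unfolding right_translate_def[of "%x. \<phi> (right_translate \<psi> x)"]
 proof (rule sw_cong[OF mod_H _ assms(3)])
  show "bilinear_map K H H H (%a c. sw H (?g a) c)"
   by (intro bilinear_mapI sw_linear mod_H bi sw_param) (use bi(1,2) in \<open>auto dest: bilinear_map_left intro!: linear_intros mod_H assms c\<close>)
  fix a c' assume a: "a \<in> carrier H" "c' \<in> carrier H"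
  have b: "bilinear_map K H H (scalar_module K) (%y z. \<phi> y \<otimes>\<^bsub>K\<^esub> \<psi> z)"
   by (intro bilinear_mapI linear_intros assms c)
  show "sw H (?g a) c' = \<phi> (right_translate \<psi> c') \<bullet> a"
   unfolding form_right_translate[OF assms(1,2) a(2)]
   by (rule sw_post[OF mod_K mod_H b _ a(2), symmetric])
    (rule linear_map_form_smult[OF mod_H linear_map_id a(1)])
 qed
 finally show ?thesis .
qed

lemma right_translate_counit: "h \<in> carrier H ==> right_translate (counit H) h = h"
 unfolding right_translate_def by (rule counit_right)

text \<open>The left counit axiom absorbs the first leg. This yields the left unit law of the
  character group and the degrees in \<open>degree_one_element\<close>.\<close>

lemma counit_right_translate:
 assumes "linear_form K H \<psi>" "h \<in> carrier H"
 shows "counit H (right_translate \<psi> h) = \<psi> h"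
proof -
 note c = linear_map_closed[OF assms(1), simplified]
 have b: "bilinear_map K H H H (%a b. counit H a \<bullet> b)"
  by (intro bilinear_mapI linear_intros mod_H counit_form counit_closed)
 have "\<psi> h = \<psi> (sw H (%a b. counit H a \<bullet> b) h)" by (simp add: counit_left assms)
 also have "... = sw (scalar_module K) (%a b. \<psi> (counit H a \<bullet> b)) h"
  by (rule sw_post[OF mod_H mod_K b assms])
 also have "... = sw (scalar_module K) (%a b. counit H a \<otimes>\<^bsub>K\<^esub> \<psi> b) h"
  by (rule sw_cong[OF mod_K bilinear_map_post[OF b assms(1)] assms(2)]) (simp add: linear_map_smult[OF assms(1)])
 finally show ?thesis using form_right_translate[OF counit_form assms] by simp
qed

end

section \<open>Multiplicativity of the antipode\<close>

locale comm_hopf_algebra = hopf_algebra +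
 assumes H_comm: "x \<in> carrier H ==> y \<in> carrier H ==> x \<otimes>\<^bsub>H\<^esub> y = y \<otimes>\<^bsub>H\<^esub> x"
begin

sublocale HC: cring H
 by unfold_locales (rule H_comm)

text \<open>In Sweedler notation \<open>S(h1) h2 g(h3) = g(h)\<close>: by coassociativity the left
  antipode axiom collapses the first two legs. Read backwards, it inserts a cancelling pair in front
  of any linear expression.\<close>

lemma antipode_cancel:
 assumes g: "linear_map K H H g" and h: "h \<in> carrier H"
 shows "sw H (%a p. sw H (%s t. antipode H a \<star> s \<star> g t) p) h = g h"
proof -
 note gc = linear_map_closed[OF g]
 let ?g = "%a s t. antipode H a \<star> s \<star> g t"
 have tri: "trilinear_map K H H H H ?g"
  by (intro trilinear_mapI linear_intros g antipode_closed A.m_closed gc)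
 have b: "bilinear_map K H H H (%a s. antipode H a \<star> s)"
  by (intro bilinear_mapI linear_intros antipode_closed)
 have b1: "bilinear_map K H H H (%a b. counit H a \<bullet> b)"
  by (intro bilinear_mapI linear_intros mod_H counit_form counit_closed)
 have "sw H (%a p. sw H (?g a) p) h = sw H (%p t. sw H (%a s. ?g a s t) p) h"
  by (rule sw_coassoc[OF mod_H tri h, symmetric])
 also have "... = sw H (%p t. g (counit H p \<bullet> t)) h"
 proof (rule sw_cong[OF mod_H bilinear_map_post[OF b1 g] h, symmetric])
  fix p t assume p: "p \<in> carrier H" "t \<in> carrier H"
  have "sw H (%a s. ?g a s t) p = sw H (%a s. antipode H a \<star> s) p \<star> g t"
   by (rule sw_post[OF mod_H mod_H b mult_linear_left[OF gc[OF p(2)]] p(1), symmetric])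
  then show "g (counit H p \<bullet> t) = sw H (%a s. ?g a s t) p"
   using p gc by (simp add: antipode_left smult_mult_left linear_map_smult[OF g])
 qed
 also have "... = g (sw H (%p t. counit H p \<bullet> t) h)"
  by (rule sw_post[OF mod_H mod_H b1 g h, symmetric])
 finally show ?thesis by (simp add: counit_left h)
qed

text \<open>Insert \<open>S(h1) h2\<close> and then \<open>S(k1) k2\<close> in front of
  \<open>S(h3 k3)\<close>. Commutativity brings together \<open>h2 k2 S(h3 k3)\<close>, which the
  right antipode axiom reduces to counits, and \<open>S(h) S(k)\<close> remains.\<close>

lemma antipode_mult:
 assumes h: "h \<in> carrier H" and k: "k \<in> carrier H"
 shows "antipode H (h \<star> k) = antipode H h \<star> antipode H k"
proof -
 let ?S = "antipode H"
 note [simp] = h k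
 have ap: "bilinear_map K H H H (%s t. s \<star> ?S t)"
  by (intro bilinear_mapI linear_intros antipode_closed)
 have q: "bilinear_map K H H H (%s t. sw H (%s' t'. (x \<star> (s \<star> s')) \<star> ?S (t \<star> t')) q)"
  if "q \<in> carrier H" "x \<in> carrier H" for q x
  by (intro bilinear_mapI sw_param[OF mod_H _ _ mod_H that(1)])
   (auto intro!: bilinear_mapI linear_intros simp: that)
 have q': "bilinear_map K H H H (%s' t'. (x \<star> (s \<star> s')) \<star> ?S (t \<star> t'))"
  if "s \<in> carrier H" "t \<in> carrier H" "x \<in> carrier H" for s t x
  by (auto intro!: bilinear_mapI linear_intros simp: that)
 \<comment> \<open>The right antipode axiom for \<open>p \<star> q\<close>, spread over the two
   coproducts, with a spectator factor \<open>x\<close>.\<close>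
 have qq: "sw H (%s t. sw H (%s' t'. (x \<star> (s \<star> s')) \<star> ?S (t \<star> t')) q) p =
   (counit H p \<otimes>\<^bsub>K\<^esub> counit H q) \<bullet> x"
  if "p \<in> carrier H" "q \<in> carrier H" "x \<in> carrier H" for p q x
 proof -
  have b: "bilinear_map K H H H (%s t. (x \<star> s) \<star> ?S t)"
   using that by (intro bilinear_mapI linear_intros antipode_closed A.m_closed)
  have "sw H (%s t. (x \<star> s) \<star> ?S t) (p \<star> q) = x \<star> sw H (%s t. s \<star> ?S t) (p \<star> q)"
   using that
   by (subst sw_post[OF mod_H mod_H ap mult_linear_right]) (auto intro!: sw_cong[OF mod_H b] simp: A.m_assoc)
  also have "... = (counit H p \<otimes>\<^bsub>K\<^esub> counit H q) \<bullet> x"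
   using that by (simp add: antipode_right smult_mult_right ring_hom_mult[OF counit_ring_hom])
  finally show ?thesis using sw_mult[OF mod_H b that(1,2)] by simp
 qed
 have lS: "linear_map K H H (%t. ?S (t \<star> k))" by (intro linear_intros k)
 have b0: "bilinear_map K H H H (%a b. counit H b \<bullet> a)"
  by (rule translate_bilinear[OF counit_form])
 have "?S (h \<star> k) = sw H (%a p. sw H (%s t. ?S a \<star> s \<star> ?S (t \<star> k)) p) h"
  by (rule antipode_cancel[OF lS h, symmetric])
 also have "... = sw H (%a p. counit H p \<bullet> (?S a \<star> ?S k)) h"
 proof (rule sw_cong[OF mod_H _ h])
  have tri: "trilinear_map K H H H H (%a s t. ?S a \<star> s \<star> ?S (t \<star> k))"
   by (intro trilinear_mapI linear_intros antipode_closed A.m_closed k)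
  note bi = trilinear_map_bilinear[OF tri]
  show "bilinear_map K H H H (%a p. sw H (%s t. ?S a \<star> s \<star> ?S (t \<star> k)) p)"
   by (intro bilinear_mapI sw_linear[OF mod_H] bi sw_param[OF mod_H bi(1) _ mod_H])
    (auto intro!: linear_intros)
  fix a p assume a: "a \<in> carrier H" and p: "p \<in> carrier H"
  note [simp] = a p
  have "sw H (%s t. ?S a \<star> s \<star> ?S (t \<star> k)) p =
   sw H (%s t. sw H (%b q. sw H (%s' t'. (?S a \<star> ?S b \<star> (s \<star> s')) \<star> ?S (t \<star> t')) q) k) p"
  proof (rule sw_cong[OF mod_H bi(1)[OF a] p])
   fix s t assume s: "s \<in> carrier H" and t: "t \<in> carrier H"
   note [simp] = s t
   have lt: "linear_map K H H (%t'. ?S (t \<star> t'))" by (intro linear_intros t)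
   have tr: "trilinear_map K H H H H (%b s' t'. ?S b \<star> s' \<star> ?S (t \<star> t'))"
    by (intro trilinear_mapI linear_intros antipode_closed A.m_closed t)
   note bt = trilinear_map_bilinear[OF tr]
   have bq: "bilinear_map K H H H (%b q. sw H (%s' t'. ?S b \<star> s' \<star> ?S (t \<star> t')) q)"
    by (intro bilinear_mapI sw_linear[OF mod_H] bt sw_param[OF mod_H bt(1) _ mod_H])
     (auto intro!: linear_intros)
   have lm: "linear_map K H H (%x. ?S a \<star> s \<star> x)" by (rule mult_linear_right) simp
   have "?S a \<star> s \<star> ?S (t \<star> k) =
    ?S a \<star> s \<star> sw H (%b q. sw H (%s' t'. ?S b \<star> s' \<star> ?S (t \<star> t')) q) k"
    by (simp only: antipode_cancel[OF lt k])
   also have "... = sw H (%b q. ?S a \<star> s \<star> sw H (%s' t'. ?S b \<star> s' \<star> ?S (t \<star> t')) q) k"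
    by (rule sw_post[OF mod_H mod_H bq lm k])
   also have "... = sw H (%b q. sw H (%s' t'. (?S a \<star> ?S b \<star> (s \<star> s')) \<star> ?S (t \<star> t')) q) k"
   proof (rule sw_cong[OF mod_H bilinear_map_post[OF bq lm] k])
    fix b q assume b: "b \<in> carrier H" and q: "q \<in> carrier H"
    have "?S a \<star> s \<star> sw H (%s' t'. ?S b \<star> s' \<star> ?S (t \<star> t')) q =
     sw H (%s' t'. ?S a \<star> s \<star> (?S b \<star> s' \<star> ?S (t \<star> t'))) q"
     by (rule sw_post[OF mod_H mod_H bt(1)[OF b] lm q])
    also have "... = sw H (%s' t'. (?S a \<star> ?S b \<star> (s \<star> s')) \<star> ?S (t \<star> t')) q"
     using b by (intro sw_cong[OF mod_H bilinear_map_post[OF bt(1)[OF b] lm] q])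
      (simp add: HC.m_ac)
    finally show "?S a \<star> s \<star> sw H (%s' t'. ?S b \<star> s' \<star> ?S (t \<star> t')) q =
     sw H (%s' t'. (?S a \<star> ?S b \<star> (s \<star> s')) \<star> ?S (t \<star> t')) q" .
   qed
   finally show "?S a \<star> s \<star> ?S (t \<star> k) =
    sw H (%b q. sw H (%s' t'. (?S a \<star> ?S b \<star> (s \<star> s')) \<star> ?S (t \<star> t')) q) k" .
  qed
  \<comment> \<open>The sum over the legs of \<open>p\<close> moves inside the sum over the legs of
    \<open>k\<close>; there it meets the sum over the legs of \<open>q\<close>, and
    \<open>qq\<close> applies to both.\<close>
  also have "... = sw H (%b q. sw H (%s t. sw H (%s' t'. (?S a \<star> ?S b \<star> (s \<star> s')) \<star> ?S (t \<star> t')) q) p) k"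
  proof (rule HH.lift_swap[OF mod_H mod_H mod_H])
   fix s t assume s: "s \<in> carrier H" "t \<in> carrier H"
   show "bilinear_map K H H H (%b q. sw H (%s' t'. (?S a \<star> ?S b \<star> (s \<star> s')) \<star> ?S (t \<star> t')) q)"
    by (intro bilinear_mapI sw_linear[OF mod_H] sw_param[OF mod_H _ _ mod_H])
     (auto intro!: linear_intros bilinear_mapI simp: s)
  qed (use q in simp_all)
  also have "... = sw H (%b q. counit H p \<bullet> (?S a \<star> ?S (counit H q \<bullet> b))) k"
  proof (rule sw_cong[OF mod_H _ k, symmetric])
   show "bilinear_map K H H H (%b q. counit H p \<bullet> (?S a \<star> ?S (counit H q \<bullet> b)))"
    by (rule bilinear_map_post[OF b0]) (intro linear_intros mod_H counit_closed antipode_closed a p)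
  qed (simp add: qq linear_map_smult[OF antipode_linear] smult_mult_right smult_assoc1)
  also have "... = counit H p \<bullet> (?S a \<star> ?S (sw H (%b q. counit H q \<bullet> b) k))"
   by (rule sw_post[OF mod_H mod_H b0 _ k, symmetric])
     (intro linear_intros mod_H counit_closed antipode_closed a p)
  finally show "sw H (%s t. ?S a \<star> s \<star> ?S (t \<star> k)) p = counit H p \<bullet> (?S a \<star> ?S k)"
   by (simp add: counit_right)
 qed
 also have "... = sw H (%a p. ?S (counit H p \<bullet> a) \<star> ?S k) h"
  by (rule sw_cong[OF mod_H bilinear_map_post[OF b0] h, symmetric])
   (auto intro!: linear_intros simp: linear_map_smult[OF antipode_linear] smult_mult_left)
 also have "... = ?S (sw H (%a p. counit H p \<bullet> a) h) \<star> ?S k"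
  by (rule sw_post[OF mod_H mod_H b0 _ h, symmetric]) (intro linear_intros antipode_closed k)
 finally show ?thesis by (simp add: counit_right)
qed

end

section \<open>Characters and the group they form\<close>

definition characters :: "('k, 'm) ring_scheme => ('k, 'h, 'z) module_scheme => ('h => 'k) set" where
 "characters K H = {\<chi> \<in> extensional (carrier H). \<chi> \<in> ring_hom H K \<and> linear_form K H \<chi>}"

lemma characterD:
 assumes "\<chi> \<in> characters K H"
 shows "\<chi> \<in> ring_hom H K" "linear_form K H \<chi>" "\<chi> \<in> extensional (carrier H)"
  "x \<in> carrier H ==> \<chi> x \<in> carrier K"
  "x \<in> carrier H ==> y \<in> carrier H ==> \<chi> (x \<otimes>\<^bsub>H\<^esub> y) = \<chi> x \<otimes>\<^bsub>K\<^esub> \<chi> y"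
  "\<chi> \<one>\<^bsub>H\<^esub> = \<one>\<^bsub>K\<^esub>"
 using assms unfolding characters_def
 by (auto dest: ring_hom_closed ring_hom_mult ring_hom_one)

lemma characterI:
 assumes "module K H" "linear_form K H f" "f \<one>\<^bsub>H\<^esub> = \<one>\<^bsub>K\<^esub>" "ring H"
  and "!!x y. x \<in> carrier H ==> y \<in> carrier H ==> f (x \<otimes>\<^bsub>H\<^esub> y) = f x \<otimes>\<^bsub>K\<^esub> f y"
 shows "restrict f (carrier H) \<in> characters K H"
proof -
 interpret H: ring H by fact
 have "linear_form K H (restrict f (carrier H))"
  by (rule linear_map_cong[OF assms(1,2)]) simp
 moreover have "restrict f (carrier H) \<in> ring_hom H K"
  by (rule ring_hom_memI)
   (simp_all add: assms(3,5) linear_map_closed[OF assms(2), simplified] linear_map_add[OF assms(2), simplified])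
 ultimately show ?thesis by (simp add: characters_def)
qed

context hopf_algebra
begin

text \<open>The coproduct and \<chi> are both multiplicative, so translation by a character is an
  algebra endomorphism.\<close>

lemma right_translate_mult:
 assumes \<chi>: "\<chi> \<in> ring_hom H K" "linear_form K H \<chi>" and x: "x \<in> carrier H" and y: "y \<in> carrier H"
 shows "right_translate \<chi> (x \<star> y) = right_translate \<chi> x \<star> right_translate \<chi> y"
proof -
 note c = linear_map_closed[OF \<chi>(2), simplified]
 note tb = translate_bilinear[OF \<chi>(2)]
 have ry: "right_translate \<chi> y \<in> carrier H" by (rule right_translate_closed[OF \<chi>(2) y])
 have "right_translate \<chi> (x \<star> y) =
   sw H (%a b. sw H (%a' b'. \<chi> (b \<star> b') \<bullet> (a \<star> a')) y) x"
  unfolding right_translate_def by (rule sw_mult[OF mod_H tb x y])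
 also have "... = sw H (%a b. (\<chi> b \<bullet> a) \<star> right_translate \<chi> y) x"
 proof (rule sw_cong[OF mod_H bilinear_map_post[OF tb mult_linear_left[OF ry]] x, symmetric])
  fix a b assume ab: "a \<in> carrier H" "b \<in> carrier H"
  have ba: "\<chi> b \<bullet> a \<in> carrier H" using ab c by simp
  have "(\<chi> b \<bullet> a) \<star> right_translate \<chi> y = sw H (%a' b'. (\<chi> b \<bullet> a) \<star> (\<chi> b' \<bullet> a')) y"
   unfolding right_translate_def by (rule sw_post[OF mod_H mod_H tb mult_linear_right[OF ba] y])
  also have "... = sw H (%a' b'. \<chi> (b \<star> b') \<bullet> (a \<star> a')) y"
   using ab c by (intro sw_cong[OF mod_H bilinear_map_post[OF tb mult_linear_right[OF ba]] y])
    (simp add: ring_hom_mult[OF \<chi>(1)] smult_mult_left smult_mult_right smult_assoc1[symmetric] m_comm)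
  finally show "(\<chi> b \<bullet> a) \<star> right_translate \<chi> y =
    sw H (%a' b'. \<chi> (b \<star> b') \<bullet> (a \<star> a')) y" .
 qed
 also have "... = right_translate \<chi> x \<star> right_translate \<chi> y"
  unfolding right_translate_def[of \<chi> x] by (rule sw_post[OF mod_H mod_H tb mult_linear_left[OF ry] x, symmetric])
 finally show ?thesis .
qed

lemma right_translate_one:
 assumes \<chi>: "\<chi> \<in> ring_hom H K" "linear_form K H \<chi>"
 shows "right_translate \<chi> \<one>\<^bsub>H\<^esub> = \<one>\<^bsub>H\<^esub>"
 unfolding right_translate_def sw_one[OF mod_H translate_bilinear[OF \<chi>(2)]] ring_hom_one[OF \<chi>(1)] by simp

lemma right_translate_cong:
 assumes "linear_form K H \<phi>" "!!x. x \<in> carrier H ==> \<phi> x = \<psi> x" "h \<in> carrier H"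
 shows "right_translate \<phi> h = right_translate \<psi> h"
 unfolding right_translate_def
 by (rule sw_cong[OF mod_H translate_bilinear[OF assms(1)] assms(3)]) (simp add: assms(2))

text \<open>Convolution of characters, written through translation so that associativity comes from
  \<open>right_translate_comp\<close>. Restriction to the carrier makes equality of characters
  equality of functions, as counting them requires.\<close>

definition character_group :: "('h => 'k) monoid" where
 "character_group = \<lparr>carrier = characters K H,
   monoid.mult = (\<lambda>\<chi> \<psi>. restrict (%h. \<chi> (right_translate \<psi> h)) (carrier H)),
   one = restrict (counit H) (carrier H)\<rparr>"

lemma carrier_character_group [simp]: "carrier character_group = characters K H"
 and one_character_group: "\<one>\<^bsub>character_group\<^esub> = restrict (counit H) (carrier H)"
 and mult_character_group: "\<chi> \<otimes>\<^bsub>character_group\<^esub> \<psi> = restrict (%h. \<chi> (right_translate \<psi> h)) (carrier H)"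
 by (simp_all add: character_group_def)

lemma character_mult_apply:
 assumes "\<chi> \<in> characters K H" "\<psi> \<in> characters K H" "h \<in> carrier H"
 shows "(\<chi> \<otimes>\<^bsub>character_group\<^esub> \<psi>) h = sw (scalar_module K) (%a b. \<chi> a \<otimes>\<^bsub>K\<^esub> \<psi> b) h"
 using assms form_right_translate[OF characterD(2)[OF assms(1)] characterD(2)[OF assms(2)] assms(3)]
 by (simp add: mult_character_group)

end

text \<open>Composition with the antipode is multiplicative by \<open>antipode_mult\<close>, which
  is where commutativity enters; the left antipode axiom makes it a left inverse.\<close>

lemma (in comm_hopf_algebra) antipode_character:
 assumes a: "\<chi> \<in> characters K H"
 shows "restrict (%h. \<chi> (antipode H h)) (carrier H) \<in> characters K H"
  and "restrict (%h. \<chi> (antipode H h)) (carrier H) \<otimes>\<^bsub>character_group\<^esub> \<chi> = \<one>\<^bsub>character_group\<^esub>"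
proof -
 note \<chi> = characterD[OF a]
 let ?\<psi> = "restrict (%h. \<chi> (antipode H h)) (carrier H)"
 show \<psi>: "?\<psi> \<in> characters K H"
  by (rule characterI[OF mod_H linear_map_comp[OF \<chi>(2) antipode_linear]])
   (use A.ring_axioms in \<open>simp_all add: antipode_one antipode_mult \<chi>(5,6)\<close>)
 show "?\<psi> \<otimes>\<^bsub>character_group\<^esub> \<chi> = \<one>\<^bsub>character_group\<^esub>"
 proof (rule extensionalityI[of _ "carrier H"])
  fix h assume h: "h \<in> carrier H"
  have b: "bilinear_map K H H H (%a b. antipode H a \<star> b)"
   by (intro bilinear_mapI linear_intros antipode_closed)
  have "(?\<psi> \<otimes>\<^bsub>character_group\<^esub> \<chi>) h = sw (scalar_module K) (%a b. ?\<psi> a \<otimes>\<^bsub>K\<^esub> \<chi> b) h"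
   using character_mult_apply \<psi> a h by simp
  also have "... = sw (scalar_module K) (%a b. \<chi> (antipode H a \<star> b)) h"
   by (rule sw_cong[OF mod_K bilinear_map_post[OF b \<chi>(2)] h, symmetric]) (simp add: \<chi>(5))
  also have "... = \<chi> (sw H (%a b. antipode H a \<star> b) h)"
   by (rule sw_post[OF mod_H mod_K b \<chi>(2) h, symmetric])
  also have "... = counit H h"
   using h by (simp add: antipode_left linear_map_smult[OF \<chi>(2)] \<chi>(6))
  finally show "(?\<psi> \<otimes>\<^bsub>character_group\<^esub> \<chi>) h = \<one>\<^bsub>character_group\<^esub> h"
   using h by (simp add: one_character_group)
 qed (simp_all add: mult_character_group one_character_group)
qed

lemma (in comm_hopf_algebra) group_character_group: "group character_group"
proof (rule groupI)
 show "\<one>\<^bsub>character_group\<^esub> \<in> carrier character_group"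
  unfolding one_character_group carrier_character_group
  by (rule characterI[OF mod_H counit_form]) (use counit_ring_hom A.ring_axioms in \<open>auto simp: ring_hom_def\<close>)
next
 fix \<chi> \<psi> assume a: "\<chi> \<in> carrier character_group" "\<psi> \<in> carrier character_group"
 note \<chi> = characterD[OF a(1)[simplified]] and \<psi> = characterD[OF a(2)[simplified]]
 show "\<chi> \<otimes>\<^bsub>character_group\<^esub> \<psi> \<in> carrier character_group"
  unfolding mult_character_group carrier_character_group
  by (rule characterI[OF mod_H linear_map_comp[OF \<chi>(2) right_translate_linear[OF \<psi>(2)]]])
   (use A.ring_axioms in \<open>simp_all add: right_translate_one[OF \<psi>(1,2)] right_translate_mult[OF \<psi>(1,2)]
    \<chi>(5,6) right_translate_closed[OF \<psi>(2)]\<close>)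
next
 fix \<chi> \<psi> \<theta> assume a: "\<chi> \<in> carrier character_group" "\<psi> \<in> carrier character_group" "\<theta> \<in> carrier character_group"
 note \<chi> = characterD[OF a(1)[simplified]] and \<psi> = characterD[OF a(2)[simplified]]
  and \<theta> = characterD[OF a(3)[simplified]]
 note lf = linear_map_comp[OF \<psi>(2) right_translate_linear[OF \<theta>(2)]]
 show "\<chi> \<otimes>\<^bsub>character_group\<^esub> \<psi> \<otimes>\<^bsub>character_group\<^esub> \<theta> = \<chi> \<otimes>\<^bsub>character_group\<^esub> (\<psi> \<otimes>\<^bsub>character_group\<^esub> \<theta>)"
  unfolding mult_character_group
 proof (rule restrict_ext)
  fix h assume h: "h \<in> carrier H"
  have "right_translate (restrict (%h. \<psi> (right_translate \<theta> h)) (carrier H)) h =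
   right_translate (%h. \<psi> (right_translate \<theta> h)) h"
   by (rule right_translate_cong[OF lf _ h, symmetric]) simp
  then show "restrict (%h. \<chi> (right_translate \<psi> h)) (carrier H) (right_translate \<theta> h) =
   \<chi> (right_translate (restrict (%h. \<psi> (right_translate \<theta> h)) (carrier H)) h)"
   using h right_translate_closed[OF \<theta>(2) h] by (simp add: right_translate_comp[OF \<psi>(2) \<theta>(2)])
 qed
next
 fix \<chi> assume a: "\<chi> \<in> carrier character_group"
 note \<chi> = characterD[OF a[simplified]]
 show "\<one>\<^bsub>character_group\<^esub> \<otimes>\<^bsub>character_group\<^esub> \<chi> = \<chi>"
  unfolding mult_character_group one_character_group
  by (rule extensionalityI[OF restrict_extensional \<chi>(3)])
   (simp add: right_translate_closed[OF \<chi>(2)] counit_right_translate[OF \<chi>(2)])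
 show "\<exists>\<psi>\<in>carrier character_group. \<psi> \<otimes>\<^bsub>character_group\<^esub> \<chi> = \<one>\<^bsub>character_group\<^esub>"
  using antipode_character a by auto
qed

lemma (in comm_hopf_algebra) inv_character_group:
 "\<chi> \<in> characters K H ==> inv\<^bsub>character_group\<^esub> \<chi> = restrict (%h. \<chi> (antipode H h)) (carrier H)"
 using group.inv_equality[OF group_character_group antipode_character(2)] antipode_character(1) by simp


section \<open>Comparing tensors through linear forms\<close>

definition dual_system ::
  "('k, 'm) ring_scheme => ('k, 'v, 'x) module_scheme => 'i set => ('i => 'v => 'k) => ('i => 'v) => bool" where
 "dual_system K V I \<phi> d \<longleftrightarrow> finite I \<and> (\<forall>i\<in>I. linear_form K V (\<phi> i) \<and> d i \<in> carrier V) \<and>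
   (\<forall>v\<in>carrier V. v = (\<Oplus>\<^bsub>V\<^esub>i\<in>I. \<phi> i v \<odot>\<^bsub>V\<^esub> d i))"

lemma dual_system_eqI:
 assumes "module K V" "dual_system K V I \<phi> d" "u \<in> carrier V" "v \<in> carrier V" "!!i. i \<in> I ==> \<phi> i u = \<phi> i v"
 shows "u = v"
proof -
 interpret V: module K V by fact
 have D: "!!i. i \<in> I ==> linear_form K V (\<phi> i)" "!!i. i \<in> I ==> d i \<in> carrier V"
  "!!v. v \<in> carrier V ==> v = (\<Oplus>\<^bsub>V\<^esub>i\<in>I. \<phi> i v \<odot>\<^bsub>V\<^esub> d i)"
  using assms(2) unfolding dual_system_def by blast+
 have c: "\<phi> i v \<in> carrier K" if "i \<in> I" for i
  using linear_map_closed[OF D(1)[OF that] assms(4)] by simp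
 have "u = (\<Oplus>\<^bsub>V\<^esub>i\<in>I. \<phi> i u \<odot>\<^bsub>V\<^esub> d i)" by (rule D(3)[OF assms(3)])
 also have "... = (\<Oplus>\<^bsub>V\<^esub>i\<in>I. \<phi> i v \<odot>\<^bsub>V\<^esub> d i)"
  using c D(2) assms(5) by (intro V.finsum_cong') auto
 also have "... = v" by (rule D(3)[OF assms(4), symmetric])
 finally show ?thesis .
qed

text \<open>A tensor is the sum of \<open>d i \<otimes> w i\<close>, where \<open>w i\<close> comes
  from applying \<open>\<phi> i\<close> to the first factor; the forms \<open>\<psi> j\<close> then
  separate the \<open>w i\<close>. Coassociativity of \<open>function_hopf\<close> uses this with
  \<open>W\<close> itself a tensor square.\<close>

lemma tensor_eqI:
 assumes A: "module K A" and W: "module K W" and D: "dual_system K A I \<phi> d"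
  and \<psi>: "!!j. j \<in> J ==> linear_form K W (\<psi> j)"
  and sep: "!!w w'. w \<in> carrier W ==> w' \<in> carrier W ==> (!!j. j \<in> J ==> \<psi> j w = \<psi> j w') ==> w = w'"
  and u: "u \<in> carrier (tensor_space K A W)" and v: "v \<in> carrier (tensor_space K A W)"
  and eq: "!!i j. i \<in> I ==> j \<in> J ==>
   tensor_lift K (scalar_module K) (%a w. \<phi> i a \<otimes>\<^bsub>K\<^esub> \<psi> j w) u =
   tensor_lift K (scalar_module K) (%a w. \<phi> i a \<otimes>\<^bsub>K\<^esub> \<psi> j w) v"
 shows "u = v"
proof -
 interpret T: tensor_product K A W by (intro tensor_product.intro A W)
 have mK: "module K (scalar_module K)" by (rule module_scalar_module) (rule T.A.is_cring)
 have D': "!!i. i \<in> I ==> linear_form K A (\<phi> i)" "!!i. i \<in> I ==> d i \<in> carrier A" "finite I"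
  "!!v. v \<in> carrier A ==> v = (\<Oplus>\<^bsub>A\<^esub>i\<in>I. \<phi> i v \<odot>\<^bsub>A\<^esub> d i)"
  using D unfolding dual_system_def by blast+
 have c: "\<phi> i v \<in> carrier K" if "i \<in> I" "v \<in> carrier A" for i v
  using linear_map_closed[OF D'(1)[OF that(1)] that(2)] by simp
 have b: "bilinear_map K A W W (%a w. \<phi> i a \<odot>\<^bsub>W\<^esub> w)" if "i \<in> I" for i
  by (intro bilinear_mapI linear_map_form_smult[OF W] linear_map_smult_fun[OF W] D'(1)[OF that] linear_map_id c[OF that])
 let ?p = "%i. tensor_lift K W (%a w. \<phi> i a \<odot>\<^bsub>W\<^esub> w)"
 note lp = T.lift_linear[OF W b]
 have lt: "linear_map K T.T T.T (%u. tensor K A W (d i) (?p i u))" if "i \<in> I" for i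
  using that by (intro linear_map_comp[OF bilinear_map_right[OF T.tensor_bilinear] lp] D')
 have expand: "u = (\<Oplus>\<^bsub>T.T\<^esub>i\<in>I. tensor K A W (d i) (?p i u))" if "u \<in> carrier T.T" for u
 proof (rule T.linear_maps_eq[OF T.T.module_axioms linear_map_id
    linear_map_finsum_fun[OF T.T.module_axioms D'(3) lt] _ that])
  fix a w assume a: "a \<in> carrier A" and w: "w \<in> carrier W"
  note lw = bilinear_map_left[OF T.tensor_bilinear w]
  have "tensor K A W a w = tensor K A W (\<Oplus>\<^bsub>A\<^esub>i\<in>I. \<phi> i a \<odot>\<^bsub>A\<^esub> d i) w"
   using D'(4)[OF a] by simp
  also have "... = (\<Oplus>\<^bsub>T.T\<^esub>i\<in>I. tensor K A W (\<phi> i a \<odot>\<^bsub>A\<^esub> d i) w)"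
   by (rule linear_map_finsum[OF A T.T.module_axioms lw D'(3)]) (use c a D'(2) in auto)
  also have "... = (\<Oplus>\<^bsub>T.T\<^esub>i\<in>I. tensor K A W (d i) (?p i (tensor K A W a w)))"
  proof (rule T.T.finsum_cong'[OF refl])
   fix i assume i: "i \<in> I"
   show "tensor K A W (\<phi> i a \<odot>\<^bsub>A\<^esub> d i) w = tensor K A W (d i) (?p i (tensor K A W a w))"
    unfolding T.lift_tensor[OF W b[OF i] a w]
    by (simp add: linear_map_smult[OF lw c[OF i a] D'(2)[OF i]]
      linear_map_smult[OF bilinear_map_right[OF T.tensor_bilinear D'(2)[OF i]] c[OF i a] w])
  qed (use a w D'(2) linear_map_closed[OF lp] T.tensor_closed in \<open>auto simp: T.tensor_closed\<close>)
  finally show "tensor K A W a w = (\<Oplus>\<^bsub>T.T\<^esub>i\<in>I. tensor K A W (d i) (?p i (tensor K A W a w)))" .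
 qed
 have pe: "\<psi> j (?p i x) = tensor_lift K (scalar_module K) (%a w. \<phi> i a \<otimes>\<^bsub>K\<^esub> \<psi> j w) x"
  if "i \<in> I" "j \<in> J" "x \<in> carrier T.T" for i j x
 proof -
  have "\<psi> j (?p i x) = tensor_lift K (scalar_module K) (%a w. \<psi> j (\<phi> i a \<odot>\<^bsub>W\<^esub> w)) x"
   by (rule T.lift_comp[OF W mK b[OF that(1)] \<psi>[OF that(2)] that(3)])
  also have "... = tensor_lift K (scalar_module K) (%a w. \<phi> i a \<otimes>\<^bsub>K\<^esub> \<psi> j w) x"
   by (rule T.lift_cong[OF that(3) _ mK bilinear_map_post[OF b[OF that(1)] \<psi>[OF that(2)]]])
    (simp add: linear_map_smult[OF \<psi>[OF that(2)]] c[OF that(1)])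
  finally show ?thesis .
 qed
 have "?p i u = ?p i v" if i: "i \<in> I" for i
  by (rule sep[OF linear_map_closed[OF lp[OF i] u] linear_map_closed[OF lp[OF i] v]])
   (simp add: pe[OF i _ u] pe[OF i _ v] eq[OF i])
 then have "(\<Oplus>\<^bsub>T.T\<^esub>i\<in>I. tensor K A W (d i) (?p i u)) = (\<Oplus>\<^bsub>T.T\<^esub>i\<in>I. tensor K A W (d i) (?p i v))"
  by (intro T.T.finsum_cong') (use D'(2) linear_map_closed[OF lp v] in \<open>auto intro!: T.tensor_closed\<close>)
 then show ?thesis using expand[OF u] expand[OF v] by simp
qed

text \<open>The coproducts of \<open>function_hopf\<close> and \<open>group_hopf\<close> are written
  over the underlying algebra record, while the Hopf axioms speak of the tensor square of the full
  Hopf record; this identifies the two spaces.\<close>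

lemma tensor_space_cong:
 assumes "carrier A = carrier A'" "add A = add A'" "smult A = smult A'"
  "carrier B = carrier B'" "add B = add B'" "smult B = smult B'"
 shows "tensor_space K A B = tensor_space K A' B'" "tensor K A B = tensor K A' B'"
proof -
 have "tensor_null K A B = tensor_null K A' B'"
  unfolding tensor_null_def tensor_relations_def assms Let_def ..
 then show "tensor_space K A B = tensor_space K A' B'" "tensor K A B = tensor K A' B'"
  unfolding tensor_space_def tensor_def[abs_def] assms by simp_all
qed

section \<open>Function algebras of finite groups\<close>

definition point_mass :: "('k, 'm) ring_scheme => ('g, 'n) monoid_scheme => 'g => 'g => 'k" where
 "point_mass K G x = restrict (basis_vector K x) (carrier G)"

lemma function_hopf_simps [simp]:
 "carrier (function_hopf K G) = carrier G \<rightarrow>\<^sub>E carrier K"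
 "monoid.mult (function_hopf K G) f g = (\<lambda>x\<in>carrier G. f x \<otimes>\<^bsub>K\<^esub> g x)"
 "one (function_hopf K G) = (\<lambda>x\<in>carrier G. \<one>\<^bsub>K\<^esub>)"
 "ring.zero (function_hopf K G) = (\<lambda>x\<in>carrier G. \<zero>\<^bsub>K\<^esub>)"
 "add (function_hopf K G) f g = (\<lambda>x\<in>carrier G. f x \<oplus>\<^bsub>K\<^esub> g x)"
 "smult (function_hopf K G) c f = (\<lambda>x\<in>carrier G. c \<otimes>\<^bsub>K\<^esub> f x)"
 "counit (function_hopf K G) f = f \<one>\<^bsub>G\<^esub>"
 "antipode (function_hopf K G) f = (\<lambda>x\<in>carrier G. f (inv\<^bsub>G\<^esub> x))"
 by (simp_all add: function_hopf_def Let_def function_algebra_def module.defs hopf_data.defs)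

lemma comult_function_hopf:
 "comult (function_hopf K G) f =
  (\<Oplus>\<^bsub>tensor_space K (function_hopf K G) (function_hopf K G)\<^esub> z \<in> carrier G \<times> carrier G.
   f (fst z \<otimes>\<^bsub>G\<^esub> snd z) \<odot>\<^bsub>tensor_space K (function_hopf K G) (function_hopf K G)\<^esub>
    tensor K (function_hopf K G) (function_hopf K G) (point_mass K G (fst z)) (point_mass K G (snd z)))"
proof -
 have eq: "carrier (function_algebra K G) = carrier (function_hopf K G)"
  "add (function_algebra K G) = add (function_hopf K G)"
  "smult (function_algebra K G) = smult (function_hopf K G)"
  by (simp_all add: fun_eq_iff) (simp_all add: function_algebra_def)
 show ?thesis
  unfolding tensor_space_cong[OF eq eq, symmetric]
  by (simp add: function_hopf_def Let_def module.defs hopf_data.defs point_mass_def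
    function_algebra_def)
qed

locale group_functions = K: field K + L: group L
 for K :: "('k, 'm) ring_scheme" and L :: "('g, 'n) monoid_scheme" +
 assumes finite_L: "finite (carrier L)"
begin

abbreviation "A \<equiv> function_hopf K L"
abbreviation "\<delta> \<equiv> point_mass K L"

lemma fn_ext: "f \<in> carrier A ==> g \<in> carrier A ==> (!!x. x \<in> carrier L ==> f x = g x) ==> f = g"
 by (auto intro: PiE_ext)

sublocale assoc_algebra K A
proof -
 have ag: "abelian_group A"
 proof (rule abelian_groupI)
  fix f assume f: "f \<in> carrier A"
  show "\<exists>g\<in>carrier A. g \<oplus>\<^bsub>A\<^esub> f = \<zero>\<^bsub>A\<^esub>"
  proof (intro bexI[of _ "\<lambda>x\<in>carrier L. \<ominus>\<^bsub>K\<^esub> f x"])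
   have "f x \<in> carrier K" if "x \<in> carrier L" for x using f that by auto
   then show "(\<lambda>x\<in>carrier L. \<ominus>\<^bsub>K\<^esub> f x) \<oplus>\<^bsub>A\<^esub> f = \<zero>\<^bsub>A\<^esub>"
    "(\<lambda>x\<in>carrier L. \<ominus>\<^bsub>K\<^esub> f x) \<in> carrier A"
    by (auto simp: K.l_neg intro!: restrict_ext)
  qed
 qed (auto simp: PiE_iff K.a_ac extensional_def fun_eq_iff)
 have mod: "module K A"
  by (rule moduleI) (use ag in \<open>auto simp: PiE_iff K.is_cring K.l_distr K.r_distr K.m_assoc extensional_def fun_eq_iff\<close>)
 have mon: "monoid A"
  by (rule monoidI) (auto simp: PiE_iff K.m_assoc extensional_def fun_eq_iff)
 have ring: "ring A"
  by (rule ringI[OF ag mon]) (auto simp: PiE_iff K.l_distr K.r_distr extensional_def fun_eq_iff)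
 show "assoc_algebra K A"
  by (intro assoc_algebra.intro mod ring K.field_axioms assoc_algebra_axioms.intro)
   (auto simp: PiE_iff K.m_ac extensional_def fun_eq_iff)
qed

lemma A_comm: "f \<in> carrier A ==> g \<in> carrier A ==> f \<otimes>\<^bsub>A\<^esub> g = g \<otimes>\<^bsub>A\<^esub> f"
 by (auto simp: PiE_iff K.m_comm intro!: restrict_ext)

sublocale AA: tensor_product K A A
 by unfold_locales

lemma mod_A: "module K A" by unfold_locales
lemma mod_K: "module K (scalar_module K)" by (rule module_scalar_module) unfold_locales

lemma eval_form: "x \<in> carrier L ==> linear_form K A (%f. f x)"
 by (rule linear_mapI) auto

lemma finsum_eval:
 assumes "finite S" "!!i. i \<in> S ==> f i \<in> carrier A" "x \<in> carrier L"
 shows "(\<Oplus>\<^bsub>A\<^esub>i\<in>S. f i) x = (\<Oplus>\<^bsub>K\<^esub>i\<in>S. f i x)"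
 using linear_map_finsum[OF mod_A mod_K eval_form[OF assms(3)] assms(1), of f] assms(2) by auto

lemma \<delta>_closed [simp]: "\<delta> x \<in> carrier A"
 by (auto simp: point_mass_def basis_vector_def)

lemma \<delta>_apply: "y \<in> carrier L ==> \<delta> x y = (if y = x then \<one>\<^bsub>K\<^esub> else \<zero>\<^bsub>K\<^esub>)"
 by (simp add: point_mass_def basis_vector_def)

lemma dual_system_eval: "dual_system K A (carrier L) (%x f. f x) \<delta>"
 unfolding dual_system_def
proof (intro conjI ballI)
 fix f assume f: "f \<in> carrier A"
 have fc: "f x \<in> carrier K" if "x \<in> carrier L" for x using f that by auto
 have cl: "f x \<odot>\<^bsub>A\<^esub> \<delta> x \<in> carrier A" if "x \<in> carrier L" for x
  by (rule smult_closed[OF fc[OF that] \<delta>_closed])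
 show "f = (\<Oplus>\<^bsub>A\<^esub>x\<in>carrier L. f x \<odot>\<^bsub>A\<^esub> \<delta> x)"
 proof (rule fn_ext[OF f])
  show "(\<Oplus>\<^bsub>A\<^esub>x\<in>carrier L. f x \<odot>\<^bsub>A\<^esub> \<delta> x) \<in> carrier A"
   using cl by (intro M.finsum_closed) (simp del: function_hopf_simps)
  fix y assume y: "y \<in> carrier L"
  have "(\<Oplus>\<^bsub>A\<^esub>x\<in>carrier L. f x \<odot>\<^bsub>A\<^esub> \<delta> x) y = (\<Oplus>\<^bsub>K\<^esub>x\<in>carrier L. (f x \<odot>\<^bsub>A\<^esub> \<delta> x) y)"
   by (rule finsum_eval[OF finite_L cl y])
  also have "... = (\<Oplus>\<^bsub>K\<^esub>x\<in>carrier L. if y = x then f x else \<zero>\<^bsub>K\<^esub>)"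
   using f y by (intro K.finsum_cong') (auto simp: \<delta>_apply fc)
  also have "... = f y" using f y finite_L by (subst K.finsum_singleton) auto
  finally show "f y = (\<Oplus>\<^bsub>A\<^esub>x\<in>carrier L. f x \<odot>\<^bsub>A\<^esub> \<delta> x) y" ..
 qed
qed (simp_all add: finite_L eval_form del: function_hopf_simps)

lemma eval_eval_bilinear:
 assumes "x \<in> carrier L" "y \<in> carrier L"
 shows "bilinear_map K A A (scalar_module K) (%f g. f x \<otimes>\<^bsub>K\<^esub> g y)"
 using assms by (intro bilinear_mapI linear_mapI) (auto simp: PiE_iff K.l_distr K.r_distr K.m_ac)

text \<open>The tensor square of the function algebra embeds into functions on pairs of
  points.\<close>

lemma tensor_A_eqI:
 assumes "u \<in> carrier AA.T" "v \<in> carrier AA.T"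
  and "!!x y. x \<in> carrier L ==> y \<in> carrier L ==>
   tensor_lift K (scalar_module K) (%f g. f x \<otimes>\<^bsub>K\<^esub> g y) u =
   tensor_lift K (scalar_module K) (%f g. f x \<otimes>\<^bsub>K\<^esub> g y) v"
 shows "u = v"
 by (rule tensor_eqI[OF mod_A mod_A dual_system_eval eval_form _ assms]) (auto intro: fn_ext)

lemma comult_A_closed: "f \<in> carrier A ==> comult A f \<in> carrier AA.T"
proof -
 assume "f \<in> carrier A"
 then have "!!x. x \<in> carrier L ==> f x \<in> carrier K" by auto
 then show ?thesis
  unfolding comult_function_hopf
  by (intro AA.T.finsum_closed) (auto intro!: AA.T.smult_closed AA.tensor_closed simp del: function_hopf_simps)
qed

text \<open>Of the defining expansion only the summand with index \<open>(x, y)\<close> survives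
  evaluation at that pair.\<close>

lemma eval_comult:
 assumes "f \<in> carrier A" "x \<in> carrier L" "y \<in> carrier L"
 shows "tensor_lift K (scalar_module K) (%f g. f x \<otimes>\<^bsub>K\<^esub> g y) (comult A f) = f (x \<otimes>\<^bsub>L\<^esub> y)"
proof -
 let ?S = "carrier L \<times> carrier L"
 note b = eval_eval_bilinear[OF assms(2,3)]
 note l = AA.lift_linear[OF mod_K b]
 have fc: "f z \<in> carrier K" if "z \<in> carrier L" for z using assms(1) that by auto
 have tc: "tensor K A A (\<delta> (fst z)) (\<delta> (snd z)) \<in> carrier AA.T" for z
  by (rule AA.tensor_closed) (simp_all del: function_hopf_simps)
 have cl: "f (fst z \<otimes>\<^bsub>L\<^esub> snd z) \<in> carrier K" if "z \<in> ?S" for z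
  using that fc by auto
 have "tensor_lift K (scalar_module K) (%f g. f x \<otimes>\<^bsub>K\<^esub> g y) (comult A f) =
  (\<Oplus>\<^bsub>scalar_module K\<^esub>z\<in>?S. tensor_lift K (scalar_module K) (%f g. f x \<otimes>\<^bsub>K\<^esub> g y)
   (f (fst z \<otimes>\<^bsub>L\<^esub> snd z) \<odot>\<^bsub>AA.T\<^esub> tensor K A A (\<delta> (fst z)) (\<delta> (snd z))))"
  unfolding comult_function_hopf
  by (rule linear_map_finsum[OF AA.T.module_axioms mod_K l]) (use finite_L cl tc in \<open>auto intro!: AA.T.smult_closed\<close>)
 also have "... = (\<Oplus>\<^bsub>K\<^esub>z\<in>?S. if (x, y) = z then f (fst z \<otimes>\<^bsub>L\<^esub> snd z) else \<zero>\<^bsub>K\<^esub>)"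
  unfolding finsum_scalar_module
 proof (rule K.finsum_cong'[OF refl])
  fix z assume z: "z \<in> ?S"
  show "tensor_lift K (scalar_module K) (%f g. f x \<otimes>\<^bsub>K\<^esub> g y)
    (f (fst z \<otimes>\<^bsub>L\<^esub> snd z) \<odot>\<^bsub>AA.T\<^esub> tensor K A A (\<delta> (fst z)) (\<delta> (snd z))) =
   (if (x, y) = z then f (fst z \<otimes>\<^bsub>L\<^esub> snd z) else \<zero>\<^bsub>K\<^esub>)"
   unfolding linear_map_smult[OF l cl[OF z] tc]
   by (subst AA.lift_tensor[OF mod_K b]) (use z cl[OF z] assms in \<open>auto simp: \<delta>_apply simp del: function_hopf_simps\<close>)
 qed (use cl in auto)
 also have "... = f (x \<otimes>\<^bsub>L\<^esub> y)"
  using assms cl finite_L by (subst K.finsum_singleton) auto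
 finally show ?thesis .
qed

lemma comult_A_linear: "linear_map K A AA.T (comult A)"
proof (rule linear_mapI)
 fix f assume f: "f \<in> carrier A"
 show "comult A f \<in> carrier AA.T" by (rule comult_A_closed[OF f])
 {
  fix g assume g: "g \<in> carrier A"
  show "comult A (f \<oplus>\<^bsub>A\<^esub> g) = comult A f \<oplus>\<^bsub>AA.T\<^esub> comult A g"
  proof (rule tensor_A_eqI)
   fix x y assume xy: "x \<in> carrier L" "y \<in> carrier L"
   note l = AA.lift_linear[OF mod_K eval_eval_bilinear[OF xy]]
   show "tensor_lift K (scalar_module K) (%f g. f x \<otimes>\<^bsub>K\<^esub> g y) (comult A (f \<oplus>\<^bsub>A\<^esub> g)) =
    tensor_lift K (scalar_module K) (%f g. f x \<otimes>\<^bsub>K\<^esub> g y) (comult A f \<oplus>\<^bsub>AA.T\<^esub> comult A g)"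
    unfolding linear_map_add[OF l comult_A_closed[OF f] comult_A_closed[OF g]]
     eval_comult[OF f xy] eval_comult[OF g xy] eval_comult[OF M.a_closed[OF f g] xy] using xy by simp
  qed (intro comult_A_closed M.a_closed f g AA.T.a_closed)+
 }
 fix c assume c: "c \<in> carrier K"
 show "comult A (c \<odot>\<^bsub>A\<^esub> f) = c \<odot>\<^bsub>AA.T\<^esub> comult A f"
 proof (rule tensor_A_eqI)
  fix x y assume xy: "x \<in> carrier L" "y \<in> carrier L"
  note l = AA.lift_linear[OF mod_K eval_eval_bilinear[OF xy]]
  show "tensor_lift K (scalar_module K) (%f g. f x \<otimes>\<^bsub>K\<^esub> g y) (comult A (c \<odot>\<^bsub>A\<^esub> f)) =
   tensor_lift K (scalar_module K) (%f g. f x \<otimes>\<^bsub>K\<^esub> g y) (c \<odot>\<^bsub>AA.T\<^esub> comult A f)"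
   unfolding linear_map_smult[OF l c comult_A_closed[OF f]]
    eval_comult[OF f xy] eval_comult[OF smult_closed[OF c f] xy] using xy by simp
 qed (intro comult_A_closed smult_closed c f AA.T.smult_closed)+
qed

text \<open>Converts a Sweedler sum at a point into a product in \<open>L\<close>; the counit and
  antipode axioms then become the unit and inverse laws.\<close>

lemma eval_lift_comult:
 assumes \<beta>: "bilinear_map K A A A \<beta>" and f: "f \<in> carrier A" and z: "z \<in> carrier L" "x \<in> carrier L" "y \<in> carrier L"
  and eq: "!!a b. a \<in> carrier A ==> b \<in> carrier A ==> \<beta> a b z = a x \<otimes>\<^bsub>K\<^esub> b y"
 shows "tensor_lift K A \<beta> (comult A f) z = f (x \<otimes>\<^bsub>L\<^esub> y)"
proof -
 note cf = comult_A_closed[OF f]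
 have "tensor_lift K A \<beta> (comult A f) z = tensor_lift K (scalar_module K) (%a b. \<beta> a b z) (comult A f)"
  by (rule AA.lift_comp[OF mod_A mod_K \<beta> eval_form[OF z(1)] cf])
 also have "... = tensor_lift K (scalar_module K) (%a b. a x \<otimes>\<^bsub>K\<^esub> b y) (comult A f)"
  by (rule AA.lift_cong[OF cf eq mod_K bilinear_map_post[OF \<beta> eval_form[OF z(1)]]])
 finally show ?thesis unfolding eval_comult[OF f z(2,3)] .
qed

lemma antipode_A_linear: "linear_map K A A (antipode A)"
 by (rule linear_mapI) (auto intro!: restrict_ext)

text \<open>Each axiom is tested at points, where \<open>eval_comult\<close> turns it into a group
  law of \<open>L\<close>.\<close>

theorem hopf_algebra_function_hopf: "hopf_algebra K A"
proof (intro hopf_algebra.intro hopf_algebra_axioms.intro assoc_algebra_axioms)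
 show "linear_map K A (tensor_space K A A) (comult A)" by (rule comult_A_linear)
 show "comult A \<in> ring_hom A (tensor_algebra K A A)"
 proof (rule ring_hom_memI)
  fix f assume f: "f \<in> carrier A"
  note cf = comult_A_closed[OF f]
  show "comult A f \<in> carrier (tensor_algebra K A A)" using cf by simp
  fix g assume g: "g \<in> carrier A"
  note cg = comult_A_closed[OF g]
  show "comult A (f \<oplus>\<^bsub>A\<^esub> g) = comult A f \<oplus>\<^bsub>tensor_algebra K A A\<^esub> comult A g"
   unfolding tensor_algebra_simps by (rule linear_map_add[OF comult_A_linear f g])
  show "comult A (f \<otimes>\<^bsub>A\<^esub> g) = comult A f \<otimes>\<^bsub>tensor_algebra K A A\<^esub> comult A g"
  proof (rule tensor_A_eqI[OF comult_A_closed[OF A.m_closed[OF f g]]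
     tensor_algebra_mult_closed[OF assoc_algebra_axioms assoc_algebra_axioms cf cg]])
   fix x y assume xy: "x \<in> carrier L" "y \<in> carrier L"
   note b = eval_eval_bilinear[OF xy]
   have fg: "f (x \<otimes>\<^bsub>L\<^esub> y) \<in> carrier K" "g (x \<otimes>\<^bsub>L\<^esub> y) \<in> carrier K"
    using f g xy by auto
   have b': "bilinear_map K A A (scalar_module K) (%a b. a x \<otimes>\<^bsub>K\<^esub> b y \<otimes>\<^bsub>K\<^esub> g (x \<otimes>\<^bsub>L\<^esub> y))"
    using bilinear_map_post[OF b linear_map_form_smult[OF mod_K linear_map_id, of "g (x \<otimes>\<^bsub>L\<^esub> y)"]] fg by simp
   have "tensor_lift K (scalar_module K) (%f g. f x \<otimes>\<^bsub>K\<^esub> g y) (comult A f \<otimes>\<^bsub>tensor_algebra K A A\<^esub> comult A g) =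
    tensor_lift K (scalar_module K) (%a b. tensor_lift K (scalar_module K)
     (%a' b'. (a \<otimes>\<^bsub>A\<^esub> a') x \<otimes>\<^bsub>K\<^esub> (b \<otimes>\<^bsub>A\<^esub> b') y) (comult A g)) (comult A f)"
    by (rule lift_tensor_algebra_mult[OF assoc_algebra_axioms assoc_algebra_axioms cf cg mod_K b])
   also have "... = tensor_lift K (scalar_module K) (%a b. a x \<otimes>\<^bsub>K\<^esub> b y \<otimes>\<^bsub>K\<^esub> g (x \<otimes>\<^bsub>L\<^esub> y)) (comult A f)"
   proof (rule AA.lift_cong[OF cf _ mod_K b', symmetric])
    fix a b assume ab: "a \<in> carrier A" "b \<in> carrier A"
    then have k: "a x \<in> carrier K" "b y \<in> carrier K" using xy by auto
    have ls: "linear_form K (scalar_module K) (%t. a x \<otimes>\<^bsub>K\<^esub> b y \<otimes>\<^bsub>K\<^esub> t)"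
     using linear_map_smult_fun[OF mod_K K.m_closed[OF k] linear_map_id] by simp
    have "a x \<otimes>\<^bsub>K\<^esub> b y \<otimes>\<^bsub>K\<^esub> g (x \<otimes>\<^bsub>L\<^esub> y) =
     a x \<otimes>\<^bsub>K\<^esub> b y \<otimes>\<^bsub>K\<^esub> tensor_lift K (scalar_module K) (%f g. f x \<otimes>\<^bsub>K\<^esub> g y) (comult A g)"
     unfolding eval_comult[OF g xy] ..
    also have "... = tensor_lift K (scalar_module K) (%f g. a x \<otimes>\<^bsub>K\<^esub> b y \<otimes>\<^bsub>K\<^esub> (f x \<otimes>\<^bsub>K\<^esub> g y)) (comult A g)"
     by (rule AA.lift_comp[OF mod_K mod_K b ls cg])
    also have "... = tensor_lift K (scalar_module K) (%a' b'. (a \<otimes>\<^bsub>A\<^esub> a') x \<otimes>\<^bsub>K\<^esub> (b \<otimes>\<^bsub>A\<^esub> b') y) (comult A g)"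
     by (rule AA.lift_cong[OF cg _ mod_K bilinear_map_post[OF b ls]])
      (use xy k in \<open>auto simp: K.m_ac PiE_iff\<close>)
    finally show "a x \<otimes>\<^bsub>K\<^esub> b y \<otimes>\<^bsub>K\<^esub> g (x \<otimes>\<^bsub>L\<^esub> y) =
     tensor_lift K (scalar_module K) (%a' b'. (a \<otimes>\<^bsub>A\<^esub> a') x \<otimes>\<^bsub>K\<^esub> (b \<otimes>\<^bsub>A\<^esub> b') y) (comult A g)" .
   qed
   also have "... = tensor_lift K (scalar_module K) (%f g. f x \<otimes>\<^bsub>K\<^esub> g y) (comult A f) \<otimes>\<^bsub>K\<^esub> g (x \<otimes>\<^bsub>L\<^esub> y)"
    using AA.lift_comp[OF mod_K mod_K b linear_map_form_smult[OF mod_K linear_map_id, of "g (x \<otimes>\<^bsub>L\<^esub> y)"] cf] fg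
    by simp
   finally show "tensor_lift K (scalar_module K) (%f g. f x \<otimes>\<^bsub>K\<^esub> g y) (comult A (f \<otimes>\<^bsub>A\<^esub> g)) =
    tensor_lift K (scalar_module K) (%f g. f x \<otimes>\<^bsub>K\<^esub> g y) (comult A f \<otimes>\<^bsub>tensor_algebra K A A\<^esub> comult A g)"
    unfolding eval_comult[OF A.m_closed[OF f g] xy] eval_comult[OF f xy] using xy by simp
  qed
 next
  show "comult A \<one>\<^bsub>A\<^esub> = \<one>\<^bsub>tensor_algebra K A A\<^esub>"
   unfolding tensor_algebra_simps
  proof (rule tensor_A_eqI[OF comult_A_closed[OF A.one_closed] AA.tensor_closed[OF A.one_closed A.one_closed]])
   fix x y assume xy: "x \<in> carrier L" "y \<in> carrier L"
   show "tensor_lift K (scalar_module K) (%f g. f x \<otimes>\<^bsub>K\<^esub> g y) (comult A \<one>\<^bsub>A\<^esub>) =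
    tensor_lift K (scalar_module K) (%f g. f x \<otimes>\<^bsub>K\<^esub> g y) (tensor K A A \<one>\<^bsub>A\<^esub> \<one>\<^bsub>A\<^esub>)"
    unfolding eval_comult[OF A.one_closed xy] AA.lift_tensor[OF mod_K eval_eval_bilinear[OF xy] A.one_closed A.one_closed]
    using xy by simp
  qed
 qed
 show "counit A \<in> ring_hom A K" by (rule ring_hom_memI) auto
 show "counit A (c \<odot>\<^bsub>A\<^esub> h) = c \<otimes>\<^bsub>K\<^esub> counit A h" if "c \<in> carrier K" "h \<in> carrier A" for c h by simp
 show "linear_map K A A (antipode A)" by (rule antipode_A_linear)
 fix h assume h: "h \<in> carrier A"
 note ch = comult_A_closed[OF h]
 have h_e: "tensor_lift K (scalar_module K) (%a b. a x \<otimes>\<^bsub>K\<^esub> b y) (comult A h) = h (x \<otimes>\<^bsub>L\<^esub> y)"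
  if "x \<in> carrier L" "y \<in> carrier L" for x y by (rule eval_comult[OF h that])
 have kk: "!!a x. a \<in> carrier A ==> x \<in> carrier L ==> a x \<in> carrier K" by auto
 show "tensor_lift K A (%a b. counit A a \<odot>\<^bsub>A\<^esub> b) (comult A h) = h"
 proof (rule fn_ext[OF _ h])
  have b: "bilinear_map K A A A (%a b. counit A a \<odot>\<^bsub>A\<^esub> b)"
   by (intro bilinear_mapI linear_mapI) (auto simp: PiE_iff K.l_distr K.r_distr K.m_ac intro!: restrict_ext)
  show "tensor_lift K A (%a b. counit A a \<odot>\<^bsub>A\<^esub> b) (comult A h) \<in> carrier A"
   by (rule linear_map_closed[OF AA.lift_linear[OF mod_A b] ch])
  fix x assume x: "x \<in> carrier L"
  show "tensor_lift K A (%a b. counit A a \<odot>\<^bsub>A\<^esub> b) (comult A h) x = h x"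
   using eval_lift_comult[OF b h x L.one_closed x] x by simp
 qed
 show "tensor_lift K A (%a b. counit A b \<odot>\<^bsub>A\<^esub> a) (comult A h) = h"
 proof (rule fn_ext[OF _ h])
  have b: "bilinear_map K A A A (%a b. counit A b \<odot>\<^bsub>A\<^esub> a)"
   by (intro bilinear_mapI linear_mapI) (auto simp: PiE_iff K.l_distr K.r_distr K.m_ac intro!: restrict_ext)
  show "tensor_lift K A (%a b. counit A b \<odot>\<^bsub>A\<^esub> a) (comult A h) \<in> carrier A"
   by (rule linear_map_closed[OF AA.lift_linear[OF mod_A b] ch])
  fix x assume x: "x \<in> carrier L"
  show "tensor_lift K A (%a b. counit A b \<odot>\<^bsub>A\<^esub> a) (comult A h) x = h x"
   using eval_lift_comult[OF b h x x L.one_closed] x by (simp add: K.m_comm PiE_iff)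
 qed
 have e: "counit A h \<odot>\<^bsub>A\<^esub> \<one>\<^bsub>A\<^esub> \<in> carrier A" using kk[OF h] by auto
 show "tensor_lift K A (%a b. antipode A a \<otimes>\<^bsub>A\<^esub> b) (comult A h) = counit A h \<odot>\<^bsub>A\<^esub> \<one>\<^bsub>A\<^esub>"
 proof (rule fn_ext[OF _ e])
  have b: "bilinear_map K A A A (%a b. antipode A a \<otimes>\<^bsub>A\<^esub> b)"
   by (intro bilinear_mapI linear_mapI) (auto simp: PiE_iff K.l_distr K.r_distr K.m_ac intro!: restrict_ext)
  show "tensor_lift K A (%a b. antipode A a \<otimes>\<^bsub>A\<^esub> b) (comult A h) \<in> carrier A"
   by (rule linear_map_closed[OF AA.lift_linear[OF mod_A b] ch])
  fix x assume x: "x \<in> carrier L"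
  show "tensor_lift K A (%a b. antipode A a \<otimes>\<^bsub>A\<^esub> b) (comult A h) x = (counit A h \<odot>\<^bsub>A\<^esub> \<one>\<^bsub>A\<^esub>) x"
   using eval_lift_comult[OF b h x L.inv_closed[OF x] x] x kk[OF h] by simp
 qed
 show "tensor_lift K A (%a b. a \<otimes>\<^bsub>A\<^esub> antipode A b) (comult A h) = counit A h \<odot>\<^bsub>A\<^esub> \<one>\<^bsub>A\<^esub>"
 proof (rule fn_ext[OF _ e])
  have b: "bilinear_map K A A A (%a b. a \<otimes>\<^bsub>A\<^esub> antipode A b)"
   by (intro bilinear_mapI linear_mapI) (auto simp: PiE_iff K.l_distr K.r_distr K.m_ac intro!: restrict_ext)
  show "tensor_lift K A (%a b. a \<otimes>\<^bsub>A\<^esub> antipode A b) (comult A h) \<in> carrier A"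
   by (rule linear_map_closed[OF AA.lift_linear[OF mod_A b] ch])
  fix x assume x: "x \<in> carrier L"
  show "tensor_lift K A (%a b. a \<otimes>\<^bsub>A\<^esub> antipode A b) (comult A h) x = (counit A h \<odot>\<^bsub>A\<^esub> \<one>\<^bsub>A\<^esub>) x"
   using eval_lift_comult[OF b h x x L.inv_closed[OF x]] x kk[OF h] by simp
 qed
 have id: "linear_map K A A id" using linear_map_id by (simp add: id_def)
 let ?T = "tensor_space K A A"
 note T = AA.T.module_axioms
 note l1 = tensor_map_linear[OF T mod_A mod_A mod_A comult_A_linear id]
 note l2 = tensor_map_linear[OF mod_A T mod_A mod_A id comult_A_linear]
 interpret L3: tensor_product K A ?T by (intro tensor_product.intro mod_A T)
 interpret R3: tensor_product K ?T A by (intro tensor_product.intro mod_A T)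
 let ?u = "tensor_map K ?T A (comult A) id (comult A h)"
 let ?v = "tensor_map K A ?T id (comult A) (comult A h)"
 have uc: "?u \<in> carrier R3.T" by (rule linear_map_closed[OF l1 ch])
 have vc: "?v \<in> carrier L3.T" by (rule linear_map_closed[OF l2 ch])
 have ac: "tensor_assoc K A A A ?u \<in> carrier L3.T"
  unfolding tensor_assoc_def Let_def
  by (rule linear_map_closed[OF R3.lift_linear[OF L3.T.module_axioms
    lift_bilinear_left[OF mod_A mod_A mod_A L3.T.module_axioms tensor_trilinear[OF mod_A mod_A mod_A]]] uc])
 let ?e = "%j. tensor_lift K (scalar_module K) (%a b. a (fst j) \<otimes>\<^bsub>K\<^esub> b (snd j))"
 \<comment> \<open>Both sides are tested at triples: \<open>x\<close> through
   \<open>dual_system_eval\<close>, and the pair \<open>j = (y, z)\<close> through evaluation on the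
   tensor square.\<close>
 show "tensor_assoc K A A A ?u = ?v"
 proof (rule tensor_eqI[OF mod_A T dual_system_eval, where J="carrier L \<times> carrier L" and \<psi>="?e"])
  show "linear_form K ?T (?e j)" if "j \<in> carrier L \<times> carrier L" for j
   using that by (intro AA.lift_linear mod_K eval_eval_bilinear) auto
  show "w = w'" if "w \<in> carrier ?T" "w' \<in> carrier ?T" "!!j. j \<in> carrier L \<times> carrier L ==> ?e j w = ?e j w'" for w w'
   using that by (intro tensor_A_eqI) (auto simp del: function_hopf_simps)
  fix x j assume x: "x \<in> carrier L" and j: "j \<in> carrier L \<times> carrier L"
  then obtain y z where yz: "j = (y, z)" "y \<in> carrier L" "z \<in> carrier L" by auto
  let ?g = "%a b c. a x \<otimes>\<^bsub>K\<^esub> (b y \<otimes>\<^bsub>K\<^esub> c z)"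
  have tri: "trilinear_map K A A A (scalar_module K) ?g"
   using x yz by (intro trilinear_mapI linear_mapI) (auto simp: PiE_iff K.l_distr K.r_distr K.m_ac)
  note bl = lift_bilinear_left[OF mod_A mod_A mod_A mod_K tri]
  note br = lift_bilinear_right[OF mod_A mod_A mod_A mod_K tri]
  have "?e j \<in> {?e (y, z)}" using yz by simp
  have e2: "tensor_lift K (scalar_module K) (?g a) w = a x \<otimes>\<^bsub>K\<^esub> ?e j w" if "a \<in> carrier A" "w \<in> carrier ?T" for a w
  proof -
   have ls: "linear_form K (scalar_module K) (%t. a x \<otimes>\<^bsub>K\<^esub> t)"
    using linear_map_smult_fun[OF mod_K kk[OF that(1) x] linear_map_id] by simp
   show ?thesis
    using AA.lift_comp[OF mod_K mod_K eval_eval_bilinear[OF yz(2,3)] ls that(2)] yz by simp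
  qed
  have "tensor_lift K (scalar_module K) (%a w. a x \<otimes>\<^bsub>K\<^esub> ?e j w) (tensor_assoc K A A A ?u) =
   tensor_lift K (scalar_module K) (%a w. tensor_lift K (scalar_module K) (?g a) w) (tensor_assoc K A A A ?u)"
   by (rule L3.lift_cong[OF ac _ mod_K br, symmetric]) (simp only: e2)
  also have "... = tensor_lift K (scalar_module K) (%w c. tensor_lift K (scalar_module K) (%a b. ?g a b c) w) ?u"
   by (rule lift_tensor_assoc[OF mod_A mod_A mod_A mod_K tri uc])
  also have "... = tensor_lift K (scalar_module K)
    (%a c. tensor_lift K (scalar_module K) (%p q. ?g p q (id c)) (comult A a)) (comult A h)"
   by (rule lift_tensor_map[OF T mod_A mod_A mod_A comult_A_linear id mod_K bl ch])
  also have "... = tensor_lift K (scalar_module K) (%a c. a (x \<otimes>\<^bsub>L\<^esub> y) \<otimes>\<^bsub>K\<^esub> c z) (comult A h)"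
  proof (rule AA.lift_cong[OF ch _ mod_K eval_eval_bilinear, symmetric])
   fix a c assume a: "a \<in> carrier A" "c \<in> carrier A"
   have ls: "linear_form K (scalar_module K) (%t. t \<otimes>\<^bsub>K\<^esub> c z)"
    using linear_map_form_smult[OF mod_K linear_map_id, of "c z"] kk[OF a(2) yz(3)] by simp
   have "a (x \<otimes>\<^bsub>L\<^esub> y) \<otimes>\<^bsub>K\<^esub> c z = tensor_lift K (scalar_module K) (%p q. p x \<otimes>\<^bsub>K\<^esub> q y) (comult A a) \<otimes>\<^bsub>K\<^esub> c z"
    unfolding eval_comult[OF a(1) x yz(2)] ..
   also have "... = tensor_lift K (scalar_module K) (%p q. p x \<otimes>\<^bsub>K\<^esub> q y \<otimes>\<^bsub>K\<^esub> c z) (comult A a)"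
    by (rule AA.lift_comp[OF mod_K mod_K eval_eval_bilinear[OF x yz(2)] ls comult_A_closed[OF a(1)]])
   also have "... = tensor_lift K (scalar_module K) (%p q. ?g p q (id c)) (comult A a)"
    by (rule AA.lift_cong[OF comult_A_closed[OF a(1)] _ mod_K bilinear_map_post[OF eval_eval_bilinear[OF x yz(2)] ls]])
     (simp add: K.m_assoc kk a x yz del: function_hopf_simps)
   finally show "a (x \<otimes>\<^bsub>L\<^esub> y) \<otimes>\<^bsub>K\<^esub> c z = tensor_lift K (scalar_module K) (%p q. ?g p q (id c)) (comult A a)" .
  qed (use x yz in auto)
  also have "... = h (x \<otimes>\<^bsub>L\<^esub> (y \<otimes>\<^bsub>L\<^esub> z))"
   using eval_comult[OF h L.m_closed[OF x yz(2)] yz(3)] x yz by (simp add: L.m_assoc)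
  also have "... = tensor_lift K (scalar_module K) (%a c. a x \<otimes>\<^bsub>K\<^esub> c (y \<otimes>\<^bsub>L\<^esub> z)) (comult A h)"
   using x yz by (intro eval_comult[OF h, symmetric]) auto
  also have "... = tensor_lift K (scalar_module K) (%a c. tensor_lift K (scalar_module K) (?g (id a)) (comult A c)) (comult A h)"
   by (rule AA.lift_cong[OF ch _ mod_K eval_eval_bilinear])
    (use x yz in \<open>auto simp: e2 comult_A_closed eval_comult simp del: function_hopf_simps\<close>)
  also have "... = tensor_lift K (scalar_module K) (%a w. tensor_lift K (scalar_module K) (?g a) w) ?v"
   by (rule lift_tensor_map[OF mod_A T mod_A mod_A id comult_A_linear mod_K br ch, symmetric])
  also have "... = tensor_lift K (scalar_module K) (%a w. a x \<otimes>\<^bsub>K\<^esub> ?e j w) ?v"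
   by (rule L3.lift_cong[OF vc _ mod_K br]) (simp only: e2)
  finally show "tensor_lift K (scalar_module K) (%a w. a x \<otimes>\<^bsub>K\<^esub> ?e j w) (tensor_assoc K A A A ?u) =
   tensor_lift K (scalar_module K) (%a w. a x \<otimes>\<^bsub>K\<^esub> ?e j w) ?v" .
 qed (rule ac vc)+
qed

end

section \<open>Homomorphisms of Hopf algebras and functoriality of function algebras\<close>

lemma hopf_algebra_module: "hopf_algebra K A ==> module K A"
proof -
 assume "hopf_algebra K A"
 then interpret hopf_algebra K A .
 show ?thesis by (rule mod_H)
qed

lemma hopf_homD:
 assumes "f \<in> hopf_hom K A B"
 shows "linear_map K A B f" "f \<in> ring_hom A B"
  "x \<in> carrier A ==> comult B (f x) = tensor_map K B B f f (comult A x)"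
  "x \<in> carrier A ==> counit B (f x) = counit A x"
  "x \<in> carrier A ==> antipode B (f x) = f (antipode A x)"
  "x \<in> carrier A ==> f x \<in> carrier B"
 using assms unfolding hopf_hom_def by (auto dest: linear_map_closed)

text \<open>Compatibility with coproducts in evaluated form: the legs of \<open>f x\<close> are the
  images of the legs of \<open>x\<close>.\<close>

lemma lift_hopf_hom:
 assumes "module K B" "hopf_algebra K A" "f \<in> hopf_hom K A B" "module K V" "bilinear_map K B B V \<beta>" "x \<in> carrier A"
 shows "tensor_lift K V \<beta> (comult B (f x)) = tensor_lift K V (%a b. \<beta> (f a) (f b)) (comult A x)"
proof -
 interpret A: hopf_algebra K A by fact
 note h = hopf_homD[OF assms(3)]
 show ?thesis
  unfolding h(3)[OF assms(6)]
  by (rule lift_tensor_map[OF assms(1,1) A.mod_H A.mod_H h(1) h(1) assms(4,5) A.comult_closed[OF assms(6)]])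
qed

lemma hopf_hom_comp:
 assumes A: "hopf_algebra K A" and B: "hopf_algebra K B" and C: "hopf_algebra K C"
  and f: "f \<in> hopf_hom K A B" and g: "g \<in> hopf_hom K B C"
 shows "(%x. g (f x)) \<in> hopf_hom K A C"
proof -
 interpret A: hopf_algebra K A by fact
 interpret B: hopf_algebra K B by fact
 interpret C: hopf_algebra K C by fact
 note f' = hopf_homD[OF f] and g' = hopf_homD[OF g]
 have "comult C (g (f x)) = tensor_map K C C (%x. g (f x)) (%x. g (f x)) (comult A x)" if x: "x \<in> carrier A" for x
 proof -
  have "comult C (g (f x)) = tensor_lift K (tensor_space K C C) (%c d. tensor K C C (g c) (g d)) (comult B (f x))"
   unfolding g'(3)[OF f'(6)[OF x]] tensor_map_def ..
  also have "... = tensor_lift K (tensor_space K C C) (%c d. tensor K C C (g (f c)) (g (f d))) (comult A x)"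
   by (rule lift_hopf_hom[OF B.mod_H A f C.HH.T.module_axioms
      bilinear_map_comp[OF C.HH.tensor_bilinear g'(1) g'(1)] x])
  finally show ?thesis unfolding tensor_map_def .
 qed
 moreover have "(%x. g (f x)) \<in> ring_hom A C"
  using ring_hom_trans[OF f'(2) g'(2)] by (simp add: comp_def)
 ultimately show ?thesis
  unfolding hopf_hom_def using linear_map_comp[OF g'(1) f'(1)] f'(4-6) g'(4-6) by simp
qed

lemma hopf_hom_inv:
 assumes A: "hopf_algebra K A" and B: "hopf_algebra K B"
  and f: "f \<in> hopf_hom K A B" and bij: "bij_betw f (carrier A) (carrier B)"
 shows "inv_into (carrier A) f \<in> hopf_hom K B A"
proof -
 interpret A: hopf_algebra K A by fact
 interpret B: hopf_algebra K B by fact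
 note f' = hopf_homD[OF f]
 let ?g = "inv_into (carrier A) f"
 have gf: "?g (f x) = x" if "x \<in> carrier A" for x
  using bij that by (simp add: bij_betw_def inv_into_f_f)
 have ex: "\<exists>x\<in>carrier A. y = f x" if "y \<in> carrier B" for y
  using bij that unfolding bij_betw_def by blast
 have lin: "linear_map K B A ?g"
 proof (rule linear_mapI)
  fix y assume "y \<in> carrier B"
  then obtain x where x: "x \<in> carrier A" "y = f x" using ex by blast
  show "?g y \<in> carrier A" using x gf by simp
  show "?g (c \<odot>\<^bsub>B\<^esub> y) = c \<odot>\<^bsub>A\<^esub> ?g y" if "c \<in> carrier K" for c
   using that x gf gf[of "c \<odot>\<^bsub>A\<^esub> x"] by (simp add: linear_map_smult[OF f'(1)])
  fix y' assume "y' \<in> carrier B"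
  then obtain x' where x': "x' \<in> carrier A" "y' = f x'" using ex by blast
  show "?g (y \<oplus>\<^bsub>B\<^esub> y') = ?g y \<oplus>\<^bsub>A\<^esub> ?g y'"
   using x x' gf gf[of "x \<oplus>\<^bsub>A\<^esub> x'"] by (simp add: linear_map_add[OF f'(1)])
 qed
 have ring: "?g \<in> ring_hom B A"
 proof (rule ring_hom_memI)
  fix y assume y: "y \<in> carrier B"
  then obtain x where x: "x \<in> carrier A" "y = f x" using ex by blast
  show "?g y \<in> carrier A" using x gf by simp
  fix y' assume y': "y' \<in> carrier B"
  then obtain x' where x': "x' \<in> carrier A" "y' = f x'" using ex by blast
  show "?g (y \<oplus>\<^bsub>B\<^esub> y') = ?g y \<oplus>\<^bsub>A\<^esub> ?g y'" by (rule linear_map_add[OF lin y y'])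
  show "?g (y \<otimes>\<^bsub>B\<^esub> y') = ?g y \<otimes>\<^bsub>A\<^esub> ?g y'"
   using x x' gf gf[of "x \<otimes>\<^bsub>A\<^esub> x'"] by (simp add: ring_hom_mult[OF f'(2)])
 qed (use gf[OF A.A.one_closed] ring_hom_one[OF f'(2)] in simp)
 have "comult A (?g y) = tensor_map K A A ?g ?g (comult B y)" if "y \<in> carrier B" for y
 proof -
  from ex[OF that] obtain x where x: "x \<in> carrier A" "y = f x" by (rule bexE)
  let ?T = "tensor_space K A A"
  have "tensor_map K A A ?g ?g (comult B (f x)) = tensor_lift K ?T (%a b. tensor K A A (?g (f a)) (?g (f b))) (comult A x)"
   unfolding tensor_map_def
   by (rule lift_hopf_hom[OF B.mod_H A f A.HH.T.module_axioms bilinear_map_comp[OF A.HH.tensor_bilinear lin lin] x(1)])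
  also have "... = tensor_lift K ?T (tensor K A A) (comult A x)"
   by (rule A.sw_cong[OF A.HH.T.module_axioms A.HH.tensor_bilinear x(1), symmetric]) (simp only: gf)
  also have "... = comult A x"
   by (rule A.HH.linear_maps_eq[OF A.HH.T.module_axioms A.HH.lift_linear[OF A.HH.T.module_axioms A.HH.tensor_bilinear]
      linear_map_id A.HH.lift_tensor[OF A.HH.T.module_axioms A.HH.tensor_bilinear] A.comult_closed[OF x(1)]])
  finally show ?thesis using x gf by simp
 qed
 moreover have "counit A (?g y) = counit B y \<and> antipode A (?g y) = ?g (antipode B y)" if "y \<in> carrier B" for y
 proof -
  from ex[OF that] obtain x where x: "x \<in> carrier A" "y = f x" by (rule bexE)
  then show ?thesis using gf f'(4)[OF x(1)] f'(5)[OF x(1)] gf[OF A.antipode_closed[OF x(1)]] by simp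
 qed
 ultimately show ?thesis unfolding hopf_hom_def using lin ring by simp
qed

lemma hopf_isomorphic_sym: "hopf_isomorphic K A B ==> hopf_isomorphic K B A"
 unfolding hopf_isomorphic_def using hopf_hom_inv bij_betw_inv_into by metis

lemma hopf_isomorphic_trans:
 assumes "hopf_isomorphic K A B" "hopf_isomorphic K B C"
 shows "hopf_isomorphic K A C"
proof -
 from assms obtain f g where *: "hopf_algebra K A" "hopf_algebra K B" "hopf_algebra K C"
  "f \<in> hopf_hom K A B" "g \<in> hopf_hom K B C"
  "bij_betw f (carrier A) (carrier B)" "bij_betw g (carrier B) (carrier C)"
  unfolding hopf_isomorphic_def by blast
 have "bij_betw (%x. g (f x)) (carrier A) (carrier C)"
  using bij_betw_trans[OF *(6,7)] by (simp add: comp_def)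
 then show ?thesis
  unfolding hopf_isomorphic_def using hopf_hom_comp[OF *(1-5)] *(1,3) by blast
qed

text \<open>Elements and tensors of the target are determined by their values, so every condition on
  \<Phi> can be stated pointwise.\<close>

lemma (in group_functions) hopf_hom_to_functionsI:
 assumes H: "hopf_algebra K H" and lin: "linear_map K H A \<Phi>"
  and mult: "!!a b x. a \<in> carrier H ==> b \<in> carrier H ==> x \<in> carrier L ==> \<Phi> (a \<otimes>\<^bsub>H\<^esub> b) x = \<Phi> a x \<otimes>\<^bsub>K\<^esub> \<Phi> b x"
  and one: "!!x. x \<in> carrier L ==> \<Phi> \<one>\<^bsub>H\<^esub> x = \<one>\<^bsub>K\<^esub>"
  and comult: "!!a x y. a \<in> carrier H ==> x \<in> carrier L ==> y \<in> carrier L ==>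
   tensor_lift K (scalar_module K) (%b c. \<Phi> b x \<otimes>\<^bsub>K\<^esub> \<Phi> c y) (comult H a) = \<Phi> a (x \<otimes>\<^bsub>L\<^esub> y)"
  and counit: "!!a. a \<in> carrier H ==> \<Phi> a \<one>\<^bsub>L\<^esub> = counit H a"
  and antipode: "!!a x. a \<in> carrier H ==> x \<in> carrier L ==> \<Phi> a (inv\<^bsub>L\<^esub> x) = \<Phi> (antipode H a) x"
 shows "\<Phi> \<in> hopf_hom K H A"
proof -
 interpret H: hopf_algebra K H by fact
 note cl = linear_map_closed[OF lin]
 have ring: "\<Phi> \<in> ring_hom H A"
 proof (rule ring_hom_memI)
  show "\<Phi> (a \<otimes>\<^bsub>H\<^esub> b) = \<Phi> a \<otimes>\<^bsub>A\<^esub> \<Phi> b" if "a \<in> carrier H" "b \<in> carrier H" for a b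
   using that by (intro fn_ext[OF cl A.m_closed]) (simp_all add: mult cl del: function_hopf_simps(1))
  show "\<Phi> \<one>\<^bsub>H\<^esub> = \<one>\<^bsub>A\<^esub>"
   by (intro fn_ext[OF cl A.one_closed]) (simp_all add: one)
 qed (simp_all add: cl linear_map_add[OF lin] del: function_hopf_simps)
 have "comult A (\<Phi> a) = tensor_map K A A \<Phi> \<Phi> (comult H a)" if a: "a \<in> carrier H" for a
 proof (rule tensor_A_eqI[OF comult_A_closed[OF cl[OF a]]])
  show "tensor_map K A A \<Phi> \<Phi> (comult H a) \<in> carrier AA.T"
   by (rule linear_map_closed[OF tensor_map_linear[OF mod_A mod_A H.mod_H H.mod_H lin lin] H.comult_closed[OF a]])
  fix x y assume xy: "x \<in> carrier L" "y \<in> carrier L"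
  show "tensor_lift K (scalar_module K) (%f g. f x \<otimes>\<^bsub>K\<^esub> g y) (comult A (\<Phi> a)) =
   tensor_lift K (scalar_module K) (%f g. f x \<otimes>\<^bsub>K\<^esub> g y) (tensor_map K A A \<Phi> \<Phi> (comult H a))"
   unfolding eval_comult[OF cl[OF a] xy] comult[OF a xy, symmetric]
   by (rule lift_tensor_map[OF mod_A mod_A H.mod_H H.mod_H lin lin mod_K eval_eval_bilinear[OF xy]
     H.comult_closed[OF a], symmetric])
 qed
 moreover have "antipode A (\<Phi> a) = \<Phi> (antipode H a)" if a: "a \<in> carrier H" for a
  by (rule fn_ext[OF linear_map_closed[OF antipode_A_linear cl[OF a]] cl[OF H.antipode_closed[OF a]]])
   (simp add: antipode a)
 ultimately show ?thesis unfolding hopf_hom_def using lin ring counit by simp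
qed

definition pullback :: "('l, 'n) monoid_scheme => ('l => 'g) => ('g => 'k) => 'l => 'k" where
 "pullback L \<phi> f = (\<lambda>x\<in>carrier L. f (\<phi> x))"

lemma pullback_hopf_hom:
 assumes G: "group_functions K G" and L: "group_functions K L" and \<phi>: "\<phi> \<in> hom L G"
 shows "pullback L \<phi> \<in> hopf_hom K (function_hopf K G) (function_hopf K L)"
proof -
 interpret G: group_functions K G by fact
 interpret L: group_functions K L by fact
 interpret \<phi>: group_hom L G \<phi> by unfold_locales (rule \<phi>)
 note [simp] = pullback_def
 show ?thesis
 proof (rule L.hopf_hom_to_functionsI[OF G.hopf_algebra_function_hopf])
  show "linear_map K G.A L.A (pullback L \<phi>)"
   by (rule linear_mapI) (auto intro!: restrict_ext)
  fix f x y assume f: "f \<in> carrier G.A" and x: "x \<in> carrier L" and y: "y \<in> carrier L"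
  show "tensor_lift K (scalar_module K) (%b c. pullback L \<phi> b x \<otimes>\<^bsub>K\<^esub> pullback L \<phi> c y) (comult G.A f) =
   pullback L \<phi> f (x \<otimes>\<^bsub>L\<^esub> y)"
   using G.eval_comult[OF f \<phi>.hom_closed[OF x] \<phi>.hom_closed[OF y]] x y by simp
 qed auto
qed

lemma function_hopf_iso:
 assumes G: "group_functions K G" and L: "group_functions K L" and "G \<cong> L"
 shows "hopf_isomorphic K (function_hopf K G) (function_hopf K L)"
proof -
 interpret G: group_functions K G by fact
 interpret L: group_functions K L by fact
 obtain \<phi> where "\<phi> \<in> iso L G"
  using assms(3) G.L.iso_sym unfolding is_iso_def by blast
 then have \<phi>: "\<phi> \<in> hom L G" "bij_betw \<phi> (carrier L) (carrier G)" by (auto simp: iso_def)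
 have "bij_betw (pullback L \<phi>) (carrier G.A) (carrier L.A)"
 proof (rule bij_betwI[where g="%f. \<lambda>y\<in>carrier G. f (inv_into (carrier L) \<phi> y)"])
  have i: "inv_into (carrier L) \<phi> y \<in> carrier L" "\<phi> (inv_into (carrier L) \<phi> y) = y" if "y \<in> carrier G" for y
   using \<phi>(2) that by (auto simp: bij_betw_def inv_into_into f_inv_into_f)
  have j: "inv_into (carrier L) \<phi> (\<phi> x) = x" "\<phi> x \<in> carrier G" if "x \<in> carrier L" for x
   using \<phi>(2) that by (auto simp: bij_betw_def inv_into_f_f)
  show "pullback L \<phi> \<in> carrier G.A \<rightarrow> carrier L.A"
   "(%f. \<lambda>y\<in>carrier G. f (inv_into (carrier L) \<phi> y)) \<in> carrier L.A \<rightarrow> carrier G.A"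
   using i j by (auto simp: pullback_def)
  show "(\<lambda>y\<in>carrier G. pullback L \<phi> f (inv_into (carrier L) \<phi> y)) = f" if "f \<in> carrier G.A" for f
   by (rule G.fn_ext[OF _ that]) (use that i in \<open>auto simp: pullback_def\<close>)
  show "pullback L \<phi> (\<lambda>y\<in>carrier G. f (inv_into (carrier L) \<phi> y)) = f" if "f \<in> carrier L.A" for f
   by (rule L.fn_ext[OF _ that]) (use that j in \<open>auto simp: pullback_def\<close>)
 qed
 then show ?thesis
  unfolding hopf_isomorphic_def
  using pullback_hopf_hom[OF G L \<phi>(1)] G.hopf_algebra_function_hopf L.hopf_algebra_function_hopf by blast
qed

section \<open>Split algebras, their characters and the recovery of the group\<close>

lemma smult_cancel:
 assumes "field K" "module K V" "v \<in> carrier V" "v ~= \<zero>\<^bsub>V\<^esub>" "a \<in> carrier K" "b \<in> carrier K"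
  "a \<odot>\<^bsub>V\<^esub> v = b \<odot>\<^bsub>V\<^esub> v"
 shows "a = b"
proof (rule ccontr)
 interpret K: field K by fact
 interpret V: module K V by fact
 assume "a ~= b"
 then have n: "a \<ominus>\<^bsub>K\<^esub> b \<in> Units K"
  using assms(5,6) by (simp add: K.field_Units)
 have "(a \<ominus>\<^bsub>K\<^esub> b) \<odot>\<^bsub>V\<^esub> v = \<zero>\<^bsub>V\<^esub>"
  using assms(3,5-7) by (simp add: K.minus_eq V.smult_l_distr V.smult_l_minus V.r_neg)
 then have "(inv\<^bsub>K\<^esub> (a \<ominus>\<^bsub>K\<^esub> b) \<otimes>\<^bsub>K\<^esub> (a \<ominus>\<^bsub>K\<^esub> b)) \<odot>\<^bsub>V\<^esub> v = \<zero>\<^bsub>V\<^esub>"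
  using n assms(3) K.Units_closed[OF n] K.Units_inv_closed[OF n] by (subst V.smult_assoc1) auto
 then show False using n assms(3,4) by simp
qed

text \<open>The eigenvalue of \<open>h\<close> on \<open>\<delta> i\<close> is multiplicative in
  \<open>h\<close>, which gives one character per index. Conversely a character \<chi> is non-zero
  on some \<open>\<delta> i\<close> because these sum to one, and
  \<open>\<chi>(h) \<chi>(\<delta> i) = \<chi>(h \<delta> i)\<close> forces \<open>\<chi>(h)\<close>
  to be that eigenvalue.\<close>

lemma split_characters:
 assumes alg: "assoc_algebra K A" and I: "finite I" and \<delta>: "!!i. i \<in> I ==> \<delta> i \<in> carrier A" "!!i. i \<in> I ==> \<delta> i ~= \<zero>\<^bsub>A\<^esub>"
  and orth: "!!i j. i \<in> I ==> j \<in> I ==> i ~= j ==> \<delta> i \<otimes>\<^bsub>A\<^esub> \<delta> j = \<zero>\<^bsub>A\<^esub>"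
  and sum: "(\<Oplus>\<^bsub>A\<^esub>i\<in>I. \<delta> i) = \<one>\<^bsub>A\<^esub>"
  and eig: "!!i h. i \<in> I ==> h \<in> carrier A ==> \<exists>c\<in>carrier K. h \<otimes>\<^bsub>A\<^esub> \<delta> i = c \<odot>\<^bsub>A\<^esub> \<delta> i"
 obtains \<theta> where "bij_betw \<theta> I (characters K A)"
  "!!i h. i \<in> I ==> h \<in> carrier A ==> h \<otimes>\<^bsub>A\<^esub> \<delta> i = \<theta> i h \<odot>\<^bsub>A\<^esub> \<delta> i"
  "!!h. h \<in> carrier A ==> h = (\<Oplus>\<^bsub>A\<^esub>i\<in>I. \<theta> i h \<odot>\<^bsub>A\<^esub> \<delta> i)"
proof -
 interpret K: field K by (rule assoc_algebra.axioms[OF alg])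
 interpret assoc_algebra K A by (rule alg)
 have mA: "module K A" by unfold_locales
 have mK: "module K (scalar_module K)" by (rule module_scalar_module) unfold_locales
 note can = smult_cancel[OF K.field_axioms mA]
 define t where "t i h = (SOME c. c \<in> carrier K \<and> h \<otimes>\<^bsub>A\<^esub> \<delta> i = c \<odot>\<^bsub>A\<^esub> \<delta> i)" for i h
 have t: "t i h \<in> carrier K" "h \<otimes>\<^bsub>A\<^esub> \<delta> i = t i h \<odot>\<^bsub>A\<^esub> \<delta> i" if "i \<in> I" "h \<in> carrier A" for i h
  using someI_ex[of "%c. c \<in> carrier K \<and> h \<otimes>\<^bsub>A\<^esub> \<delta> i = c \<odot>\<^bsub>A\<^esub> \<delta> i"] eig[OF that] unfolding t_def by blast+
 have tI: "t i h = c" if "i \<in> I" "h \<in> carrier A" "c \<in> carrier K" "h \<otimes>\<^bsub>A\<^esub> \<delta> i = c \<odot>\<^bsub>A\<^esub> \<delta> i" for i h c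
  using can[OF \<delta>(1)[OF that(1)] \<delta>(2)[OF that(1)] t(1)[OF that(1,2)] that(3)] t(2)[OF that(1,2)] that(4) by simp
 have lin: "linear_form K A (t i)" if i: "i \<in> I" for i
 proof (rule linear_mapI)
  fix h assume h: "h \<in> carrier A"
  show "t i h \<in> carrier (scalar_module K)" using t(1)[OF i h] by simp
  show "t i (c \<odot>\<^bsub>A\<^esub> h) = c \<odot>\<^bsub>scalar_module K\<^esub> t i h" if c: "c \<in> carrier K" for c
   using t[OF i h] \<delta>(1)[OF i] h c by (intro tI[OF i]) (auto simp: smult_mult_left smult_assoc1)
  fix g assume g: "g \<in> carrier A"
  show "t i (h \<oplus>\<^bsub>A\<^esub> g) = t i h \<oplus>\<^bsub>scalar_module K\<^esub> t i g"
   using t[OF i h] t[OF i g] \<delta>(1)[OF i] h g by (intro tI[OF i]) (auto simp: A.l_distr smult_l_distr)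
 qed
 have mult: "t i (g \<otimes>\<^bsub>A\<^esub> h) = t i g \<otimes>\<^bsub>K\<^esub> t i h" if i: "i \<in> I" and g: "g \<in> carrier A" and h: "h \<in> carrier A" for i g h
 proof (rule tI[OF i A.m_closed[OF g h] K.m_closed[OF t(1)[OF i g] t(1)[OF i h]]])
  have "g \<otimes>\<^bsub>A\<^esub> h \<otimes>\<^bsub>A\<^esub> \<delta> i = g \<otimes>\<^bsub>A\<^esub> (h \<otimes>\<^bsub>A\<^esub> \<delta> i)" by (rule A.m_assoc[OF g h \<delta>(1)[OF i]])
  also have "... = t i h \<odot>\<^bsub>A\<^esub> (g \<otimes>\<^bsub>A\<^esub> \<delta> i)"
   unfolding t(2)[OF i h] by (rule smult_mult_right[OF t(1)[OF i h] g \<delta>(1)[OF i]])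
  also have "... = (t i g \<otimes>\<^bsub>K\<^esub> t i h) \<odot>\<^bsub>A\<^esub> \<delta> i"
   unfolding t(2)[OF i g] using t(1)[OF i g] t(1)[OF i h] \<delta>(1)[OF i]
   by (simp add: smult_assoc1[symmetric] K.m_comm)
  finally show "g \<otimes>\<^bsub>A\<^esub> h \<otimes>\<^bsub>A\<^esub> \<delta> i = (t i g \<otimes>\<^bsub>K\<^esub> t i h) \<odot>\<^bsub>A\<^esub> \<delta> i" .
 qed
 have one: "t i \<one>\<^bsub>A\<^esub> = \<one>\<^bsub>K\<^esub>" if i: "i \<in> I" for i
  using \<delta>(1)[OF i] by (intro tI[OF i]) auto
 let ?\<theta> = "%i. restrict (t i) (carrier A)"
 have ch: "?\<theta> i \<in> characters K A" if i: "i \<in> I" for i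
  by (rule characterI[OF mA lin[OF i] one[OF i] A.ring_axioms mult[OF i]])
 have dd: "t i (\<delta> j) = (if i = j then \<one>\<^bsub>K\<^esub> else \<zero>\<^bsub>K\<^esub>)" if "i \<in> I" "j \<in> I" for i j
 proof (cases "i = j")
  case False
  then show ?thesis using that \<delta>(1) orth[OF that(2,1)] by (intro tI) auto
 next
  case True
  \<comment> \<open>The character has value one on the sum of the \<open>\<delta> k\<close> and
    kills all of them except \<open>\<delta> i\<close>.\<close>
  have "(\<Oplus>\<^bsub>K\<^esub>k\<in>I. t i (\<delta> k)) = t i (\<Oplus>\<^bsub>A\<^esub>k\<in>I. \<delta> k)"
   using linear_map_finsum[OF mA mK lin[OF that(1)] I, of \<delta>] \<delta>(1) by auto
  also have "(\<Oplus>\<^bsub>K\<^esub>k\<in>I. t i (\<delta> k)) = (\<Oplus>\<^bsub>K\<^esub>k\<in>I. if i = k then t i (\<delta> k) else \<zero>\<^bsub>K\<^esub>)"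
   using that \<delta>(1) orth t(1) by (intro K.finsum_cong') (auto intro!: tI)
  also have "... = t i (\<delta> i)"
   using that I t(1) \<delta>(1) by (subst K.finsum_singleton) auto
  finally show ?thesis using True one[OF that(1)] by (simp add: sum)
 qed
 have inj: "inj_on ?\<theta> I"
 proof (rule inj_onI, rule ccontr)
  fix i j assume ij: "i \<in> I" "j \<in> I" "?\<theta> i = ?\<theta> j" "i ~= j"
  have "t i (\<delta> j) = t j (\<delta> j)" using fun_cong[OF ij(3), of "\<delta> j"] \<delta>(1)[OF ij(2)] by simp
  then show False using dd[OF ij(1,2)] dd[OF ij(2,2)] ij(4) by simp
 qed
 have surj: "\<chi> \<in> ?\<theta> ` I" if \<chi>: "\<chi> \<in> characters K A" for \<chi>
 proof -
  note c = characterD[OF \<chi>]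
  have "(\<Oplus>\<^bsub>K\<^esub>i\<in>I. \<chi> (\<delta> i)) = \<one>\<^bsub>K\<^esub>"
   using linear_map_finsum[OF mA mK c(2) I, of \<delta>] \<delta>(1) c(6) by (auto simp: sum)
  then have "\<exists>i\<in>I. \<chi> (\<delta> i) ~= \<zero>\<^bsub>K\<^esub>"
   using K.add.finprod_one_eqI[of I "%i. \<chi> (\<delta> i)"] by fastforce
  then obtain i where i: "i \<in> I" "\<chi> (\<delta> i) ~= \<zero>\<^bsub>K\<^esub>" by blast
  have "\<chi> h = t i h" if h: "h \<in> carrier A" for h
  proof -
   have "\<chi> h \<otimes>\<^bsub>K\<^esub> \<chi> (\<delta> i) = \<chi> (h \<otimes>\<^bsub>A\<^esub> \<delta> i)"
    by (rule c(5)[OF h \<delta>(1)[OF i(1)], symmetric])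
   also have "... = t i h \<otimes>\<^bsub>K\<^esub> \<chi> (\<delta> i)"
    unfolding t(2)[OF i(1) h] using linear_map_smult[OF c(2) t(1)[OF i(1) h] \<delta>(1)[OF i(1)]] by simp
   finally show ?thesis
    using i(2) c(4)[OF h] c(4)[OF \<delta>(1)[OF i(1)]] t(1)[OF i(1) h] by (simp add: K.m_rcancel)
  qed
  then have "\<chi> = ?\<theta> i"
   by (intro extensionalityI[OF c(3) restrict_extensional]) simp
  then show ?thesis using i(1) by blast
 qed
 show thesis
 proof (rule that)
  show "bij_betw ?\<theta> I (characters K A)" unfolding bij_betw_def using inj surj ch by blast
  show e: "h \<otimes>\<^bsub>A\<^esub> \<delta> i = ?\<theta> i h \<odot>\<^bsub>A\<^esub> \<delta> i" if "i \<in> I" "h \<in> carrier A" for i h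
   using t(2)[OF that] that by simp
  show "h = (\<Oplus>\<^bsub>A\<^esub>i\<in>I. ?\<theta> i h \<odot>\<^bsub>A\<^esub> \<delta> i)" if h: "h \<in> carrier A" for h
  proof -
   have "h = h \<otimes>\<^bsub>A\<^esub> (\<Oplus>\<^bsub>A\<^esub>i\<in>I. \<delta> i)" using h by (simp add: sum)
   also have "... = (\<Oplus>\<^bsub>A\<^esub>i\<in>I. h \<otimes>\<^bsub>A\<^esub> \<delta> i)"
    using \<delta>(1) by (intro linear_map_finsum[OF mA mA mult_linear_right[OF h] I]) auto
   also have "... = (\<Oplus>\<^bsub>A\<^esub>i\<in>I. ?\<theta> i h \<odot>\<^bsub>A\<^esub> \<delta> i)"
    using \<delta>(1) h t by (intro M.finsum_cong') auto
   finally show ?thesis .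
  qed
 qed
qed

text \<open>The point masses are common eigenvectors, \<open>f\<close> having eigenvalue
  \<open>f x\<close> at \<open>x\<close>, so \<open>split_characters\<close> applies to
  them.\<close>

lemma (in group_functions) character_eval:
 assumes "\<chi> \<in> characters K A"
 obtains x where "x \<in> carrier L" "!!f. f \<in> carrier A ==> \<chi> f = f x"
proof -
 have dz: "\<delta> x ~= \<zero>\<^bsub>A\<^esub>" if x: "x \<in> carrier L" for x
 proof
  assume "\<delta> x = \<zero>\<^bsub>A\<^esub>"
  then have "\<delta> x x = \<zero>\<^bsub>A\<^esub> x" by simp
  then show False using x \<delta>_apply[OF x, of x] by simp
 qed
 have ev: "f \<otimes>\<^bsub>A\<^esub> \<delta> x = f x \<odot>\<^bsub>A\<^esub> \<delta> x" if f: "f \<in> carrier A" and x: "x \<in> carrier L" for f x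
 proof -
  have fc: "f y \<in> carrier K" if "y \<in> carrier L" for y using f that by auto
  show ?thesis
   by (rule fn_ext[OF A.m_closed[OF f \<delta>_closed] smult_closed[OF fc[OF x] \<delta>_closed]])
    (simp add: \<delta>_apply fc x)
 qed
 have sum: "(\<Oplus>\<^bsub>A\<^esub>x\<in>carrier L. \<delta> x) = \<one>\<^bsub>A\<^esub>"
 proof (rule fn_ext[OF M.finsum_closed A.one_closed])
  fix y assume y: "y \<in> carrier L"
  have "(\<Oplus>\<^bsub>A\<^esub>x\<in>carrier L. \<delta> x) y = (\<Oplus>\<^bsub>K\<^esub>x\<in>carrier L. \<delta> x y)"
   by (rule finsum_eval[OF finite_L \<delta>_closed y])
  also have "... = (\<Oplus>\<^bsub>K\<^esub>x\<in>carrier L. if y = x then \<one>\<^bsub>K\<^esub> else \<zero>\<^bsub>K\<^esub>)"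
   using y by (intro K.finsum_cong') (auto simp: \<delta>_apply)
  also have "... = \<one>\<^bsub>K\<^esub>" using K.finsum_singleton[OF y finite_L, of "%_. \<one>\<^bsub>K\<^esub>"] by simp
  finally show "(\<Oplus>\<^bsub>A\<^esub>x\<in>carrier L. \<delta> x) y = \<one>\<^bsub>A\<^esub> y" using y by simp
 qed (rule Pi_I, rule \<delta>_closed)
 have orth: "\<delta> x \<otimes>\<^bsub>A\<^esub> \<delta> y = \<zero>\<^bsub>A\<^esub>" if "x \<in> carrier L" "y \<in> carrier L" "x ~= y" for x y
  using that by (auto intro!: restrict_ext simp: \<delta>_apply)
 have eig: "\<exists>c\<in>carrier K. f \<otimes>\<^bsub>A\<^esub> \<delta> x = c \<odot>\<^bsub>A\<^esub> \<delta> x" if "x \<in> carrier L" "f \<in> carrier A" for x f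
 proof (intro bexI[of _ "f x"] ev[OF that(2,1)])
  show "f x \<in> carrier K" using that by auto
 qed
 obtain \<theta> where \<theta>: "bij_betw \<theta> (carrier L) (characters K A)"
  "!!i h. i \<in> carrier L ==> h \<in> carrier A ==> h \<otimes>\<^bsub>A\<^esub> \<delta> i = \<theta> i h \<odot>\<^bsub>A\<^esub> \<delta> i"
  by (rule split_characters[OF assoc_algebra_axioms finite_L \<delta>_closed dz orth sum eig]) blast+
 obtain x where x: "x \<in> carrier L" "\<chi> = \<theta> x"
  using assms \<theta>(1) unfolding bij_betw_def by blast
 show thesis
 proof (rule that[OF x(1)])
  fix f assume f: "f \<in> carrier A"
  show "\<chi> f = f x"
  proof (rule smult_cancel[OF K.field_axioms mod_A \<delta>_closed dz[OF x(1)]])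
   show "\<chi> f \<odot>\<^bsub>A\<^esub> \<delta> x = f x \<odot>\<^bsub>A\<^esub> \<delta> x"
    unfolding x(2) ev[OF f x(1), symmetric] by (rule \<theta>(2)[OF x(1) f, symmetric])
  qed (use f x(1) characterD(4)[OF assms f] in auto)
 qed
qed

text \<open>Composing the isomorphism \<open>F\<close> with evaluation at \<open>y\<close> gives a
  character, hence evaluation at a point \<open>m y\<close>. Coproducts make \<open>m\<close> a
  homomorphism; it is injective since every point mass is a value of \<open>F\<close>, and
  surjective since \<open>F\<close> kills no point mass.\<close>

lemma group_iso_of_hopf_iso:
 assumes G: "group_functions K G" and L: "group_functions K L"
  and iso: "hopf_isomorphic K (function_hopf K G) (function_hopf K L)"
 shows "G \<cong> L"
proof -
 interpret G: group_functions K G by fact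
 interpret L: group_functions K L by fact
 obtain F where F: "F \<in> hopf_hom K G.A L.A" "bij_betw F (carrier G.A) (carrier L.A)"
  using iso unfolding hopf_isomorphic_def by blast
 note h = hopf_homD[OF F(1)]
 have "\<exists>x. x \<in> carrier G \<and> (\<forall>f\<in>carrier G.A. F f y = f x)" if y: "y \<in> carrier L" for y
 proof -
  have "restrict (%f. F f y) (carrier G.A) \<in> characters K G.A"
  proof (rule characterI[OF G.mod_A linear_map_comp[OF L.eval_form[OF y] h(1)]])
   show "F \<one>\<^bsub>G.A\<^esub> y = \<one>\<^bsub>K\<^esub>" using ring_hom_one[OF h(2)] y by simp
   show "F (f \<otimes>\<^bsub>G.A\<^esub> g) y = F f y \<otimes>\<^bsub>K\<^esub> F g y" if "f \<in> carrier G.A" "g \<in> carrier G.A" for f g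
    using ring_hom_mult[OF h(2) that] y by simp
  qed (rule G.A.ring_axioms)
  then obtain x where "x \<in> carrier G" "!!f. f \<in> carrier G.A ==> restrict (%f. F f y) (carrier G.A) f = f x"
   using G.character_eval by blast
  then show ?thesis by (intro exI[of _ x]) simp
 qed
 then obtain m where m: "!!y. y \<in> carrier L ==> m y \<in> carrier G"
   "!!y f. y \<in> carrier L ==> f \<in> carrier G.A ==> F f y = f (m y)"
  by metis
 have sep: "x = x'" if "x \<in> carrier G" "x' \<in> carrier G" "!!f. f \<in> carrier G.A ==> f x = f x'" for x x'
  using that(3)[OF G.\<delta>_closed[of x]] G.\<delta>_apply[OF that(1), of x] G.\<delta>_apply[OF that(2), of x]
  by (auto split: if_splits)
 have hom: "m \<in> hom L G"
 proof (rule homI)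
  fix y y' assume y: "y \<in> carrier L" and y': "y' \<in> carrier L"
  show "m (y \<otimes>\<^bsub>L\<^esub> y') = m y \<otimes>\<^bsub>G\<^esub> m y'"
  proof (rule sep)
   fix f assume f: "f \<in> carrier G.A"
   have "f (m (y \<otimes>\<^bsub>L\<^esub> y')) = F f (y \<otimes>\<^bsub>L\<^esub> y')" using m(2) f y y' by simp
   also have "... = tensor_lift K (scalar_module K) (%f g. f y \<otimes>\<^bsub>K\<^esub> g y') (comult L.A (F f))"
    by (rule L.eval_comult[OF h(6)[OF f] y y', symmetric])
   also have "... = tensor_lift K (scalar_module K) (%a b. F a y \<otimes>\<^bsub>K\<^esub> F b y') (comult G.A f)"
    by (rule lift_hopf_hom[OF L.mod_A G.hopf_algebra_function_hopf F(1) L.mod_K L.eval_eval_bilinear[OF y y'] f])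
   also have "... = tensor_lift K (scalar_module K) (%a b. a (m y) \<otimes>\<^bsub>K\<^esub> b (m y')) (comult G.A f)"
    by (rule G.AA.lift_cong[OF G.comult_A_closed[OF f] _ G.mod_K G.eval_eval_bilinear, symmetric])
     (simp_all add: m y y' del: function_hopf_simps)
   also have "... = f (m y \<otimes>\<^bsub>G\<^esub> m y')" by (rule G.eval_comult[OF f m(1)[OF y] m(1)[OF y']])
   finally show "f (m (y \<otimes>\<^bsub>L\<^esub> y')) = f (m y \<otimes>\<^bsub>G\<^esub> m y')" .
  qed (use m(1) y y' in auto)
 qed (rule m(1))
 have inj: "inj_on m (carrier L)"
 proof (rule inj_onI)
  fix y y' assume y: "y \<in> carrier L" and y': "y' \<in> carrier L" and eq: "m y = m y'"
  obtain f where f: "f \<in> carrier G.A" "F f = L.\<delta> y"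
   using F(2) L.\<delta>_closed unfolding bij_betw_def by (metis imageE)
  have "L.\<delta> y y = L.\<delta> y y'"
   using m(2)[OF y f(1)] m(2)[OF y' f(1)] eq f(2) by simp
  then show "y = y'" using L.\<delta>_apply[OF y, of y] L.\<delta>_apply[OF y', of y] by (auto split: if_splits)
 qed
 have surj: "m ` carrier L = carrier G"
 proof (rule ccontr)
  assume "m ` carrier L ~= carrier G"
  then obtain x where x: "x \<in> carrier G" "x \<notin> m ` carrier L" using m(1) by blast
  have "F (G.\<delta> x) = F \<zero>\<^bsub>G.A\<^esub>"
  proof (rule L.fn_ext[OF h(6)[OF G.\<delta>_closed] h(6)[OF G.zero_closed]])
   fix y assume y: "y \<in> carrier L"
   then have "m y ~= x" using x by blast
   then show "F (G.\<delta> x) y = F \<zero>\<^bsub>G.A\<^esub> y"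
    using m(1)[OF y] m(2)[OF y G.\<delta>_closed] m(2)[OF y G.zero_closed] by (simp add: G.\<delta>_apply)
  qed
  then have "G.\<delta> x = \<zero>\<^bsub>G.A\<^esub>"
   using F(2) G.\<delta>_closed G.zero_closed unfolding bij_betw_def by (metis inj_onD)
  then have "G.\<delta> x x = \<zero>\<^bsub>G.A\<^esub> x" by simp
  then show False using x G.\<delta>_apply[OF x(1), of x] by simp
 qed
 have "m \<in> iso L G" using hom inj surj unfolding iso_def bij_betw_def by blast
 then show ?thesis using L.L.iso_sym unfolding is_iso_def by blast
qed

text \<open>The Gelfand transform sends \<open>h\<close> to the function taking \<chi> to
  \<open>\<chi> h\<close>. The splitting identifies the characters with the index set, so
  \<open>h\<close> is determined by its values and all values can be prescribed.\<close>

lemma (in comm_hopf_algebra) split_hopf_isomorphic: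
 assumes I: "finite I" and \<delta>: "!!i. i \<in> I ==> \<delta> i \<in> carrier H" "!!i. i \<in> I ==> \<delta> i ~= \<zero>\<^bsub>H\<^esub>"
  and orth: "!!i j. i \<in> I ==> j \<in> I ==> i ~= j ==> \<delta> i \<star> \<delta> j = \<zero>\<^bsub>H\<^esub>"
  and sum: "(\<Oplus>\<^bsub>H\<^esub>i\<in>I. \<delta> i) = \<one>\<^bsub>H\<^esub>"
  and eig: "!!i h. i \<in> I ==> h \<in> carrier H ==> \<exists>c\<in>carrier K. h \<star> \<delta> i = c \<bullet> \<delta> i"
 shows "group_functions K character_group"
  and "card (carrier character_group) = card I"
  and "hopf_isomorphic K H (function_hopf K character_group)"
proof -
 obtain \<theta> where \<theta>: "bij_betw \<theta> I (characters K H)"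
  "!!i h. i \<in> I ==> h \<in> carrier H ==> h \<star> \<delta> i = \<theta> i h \<bullet> \<delta> i"
  "!!h. h \<in> carrier H ==> h = (\<Oplus>\<^bsub>H\<^esub>i\<in>I. \<theta> i h \<bullet> \<delta> i)"
  by (rule split_characters[OF assoc_algebra_axioms I \<delta> orth sum eig]) blast+
 show gf: "group_functions K character_group"
  unfolding group_functions_def group_functions_axioms_def
  using group_character_group field_axioms bij_betw_finite[OF \<theta>(1)] I by simp
 show "card (carrier character_group) = card I"
  using bij_betw_same_card[OF \<theta>(1)] by simp
 interpret X: group_functions K character_group by (rule gf)
 define \<Phi> where "\<Phi> h = (\<lambda>\<chi>\<in>characters K H. \<chi> h)" for h
 have ch: "\<theta> i \<in> characters K H" if "i \<in> I" for i using \<theta>(1) that unfolding bij_betw_def by blast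
 note cl = characterD(4)
 have aK: "abelian_monoid K"
  using field_axioms by (simp add: field_def domain_def cring_def ring_def abelian_group_def)
 have \<Phi>A: "\<Phi> h \<in> carrier X.A" if "h \<in> carrier H" for h
  using that by (auto simp: \<Phi>_def intro: cl)
 have lin: "linear_map K H X.A \<Phi>"
 proof (rule linear_mapI)
  fix x y assume "x \<in> carrier H" "y \<in> carrier H"
  then show "\<Phi> (x \<oplus>\<^bsub>H\<^esub> y) = \<Phi> x \<oplus>\<^bsub>X.A\<^esub> \<Phi> y"
   by (auto simp: \<Phi>_def linear_map_add[OF characterD(2)] intro!: restrict_ext)
 next
  fix c x assume "c \<in> carrier K" "x \<in> carrier H"
  then show "\<Phi> (c \<bullet> x) = c \<odot>\<^bsub>X.A\<^esub> \<Phi> x"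
   by (auto simp: \<Phi>_def linear_map_smult[OF characterD(2)] intro!: restrict_ext)
 qed (rule \<Phi>A)
 have hom: "\<Phi> \<in> hopf_hom K H X.A"
 proof (rule X.hopf_hom_to_functionsI[OF hopf_algebra_axioms lin])
  fix a \<chi> \<psi> assume a: "a \<in> carrier H" and "\<chi> \<in> carrier character_group" "\<psi> \<in> carrier character_group"
  then have \<chi>: "\<chi> \<in> characters K H" "\<psi> \<in> characters K H" and m: "\<chi> \<otimes>\<^bsub>character_group\<^esub> \<psi> \<in> characters K H"
   using X.L.m_closed by auto
  show "sw (scalar_module K) (%b c. \<Phi> b \<chi> \<otimes>\<^bsub>K\<^esub> \<Phi> c \<psi>) a = \<Phi> a (\<chi> \<otimes>\<^bsub>character_group\<^esub> \<psi>)"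
   using \<chi> m by (simp add: \<Phi>_def character_mult_apply[OF \<chi> a])
 next
  fix a assume a: "a \<in> carrier H"
  show "\<Phi> a \<one>\<^bsub>character_group\<^esub> = counit H a"
   using X.L.one_closed a by (simp add: \<Phi>_def one_character_group)
 next
  fix a \<chi> assume a: "a \<in> carrier H" and c: "\<chi> \<in> carrier character_group"
  have i: "inv\<^bsub>character_group\<^esub> \<chi> = restrict (%h. \<chi> (antipode H h)) (carrier H)"
   by (rule inv_character_group) (use c in simp)
  show "\<Phi> a (inv\<^bsub>character_group\<^esub> \<chi>) = \<Phi> (antipode H a) \<chi>"
   using X.L.inv_closed[OF c] c a by (simp add: \<Phi>_def) (simp add: i)
 qed (simp_all add: \<Phi>_def characterD(5,6))
 have "bij_betw \<Phi> (carrier H) (carrier X.A)"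
  unfolding bij_betw_def
 proof
  show "inj_on \<Phi> (carrier H)"
  proof (rule inj_onI)
   fix g h assume g: "g \<in> carrier H" and h: "h \<in> carrier H" and eq: "\<Phi> g = \<Phi> h"
   have "\<theta> i g = \<theta> i h" if "i \<in> I" for i
    using fun_cong[OF eq, of "\<theta> i"] ch[OF that] by (simp add: \<Phi>_def)
   then have "(\<Oplus>\<^bsub>H\<^esub>i\<in>I. \<theta> i g \<bullet> \<delta> i) = (\<Oplus>\<^bsub>H\<^esub>i\<in>I. \<theta> i h \<bullet> \<delta> i)"
    using \<delta>(1) cl[OF ch h] by (intro M.finsum_cong') auto
   then show "g = h" using \<theta>(3)[OF g] \<theta>(3)[OF h] by simp
  qed
  show "\<Phi> ` carrier H = carrier X.A"
  proof
   show "\<Phi> ` carrier H \<subseteq> carrier X.A" using \<Phi>A by blast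
   show "carrier X.A \<subseteq> \<Phi> ` carrier H"
   proof
    fix F assume F: "F \<in> carrier X.A"
    have Fc: "F (\<theta> i) \<in> carrier K" if "i \<in> I" for i using F ch[OF that] by auto
    have td: "\<theta> j (\<delta> i) = (if i = j then \<one>\<^bsub>K\<^esub> else \<zero>\<^bsub>K\<^esub>)" if "i \<in> I" "j \<in> I" for i j
    proof (cases "i = j")
     case False
     then have "\<theta> j (\<delta> i) \<bullet> \<delta> j = \<zero>\<^bsub>K\<^esub> \<bullet> \<delta> j"
      using \<theta>(2)[OF that(2) \<delta>(1)[OF that(1)]] orth[OF that] \<delta>(1)[OF that(2)] by simp
     then show ?thesis
      using smult_cancel[OF field_axioms mod_H \<delta>(1)[OF that(2)] \<delta>(2)[OF that(2)]]
       cl[OF ch[OF that(2)] \<delta>(1)[OF that(1)]] zero_closed False by simp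
    next
     case True
     \<comment> \<open>Idempotence: multiply the sum of all \<open>\<delta> i\<close>, which is one,
       by \<open>\<delta> j\<close>.\<close>
     have "\<delta> j \<star> \<delta> j = (\<Oplus>\<^bsub>H\<^esub>i\<in>I. if j = i then \<delta> j \<star> \<delta> i else \<zero>\<^bsub>H\<^esub>)"
      using M.finsum_singleton[OF that(2) I, of "%i. \<delta> j \<star> \<delta> i"] \<delta>(1) that by auto
     also have "... = (\<Oplus>\<^bsub>H\<^esub>i\<in>I. \<delta> j \<star> \<delta> i)"
      using \<delta>(1) orth that by (intro M.finsum_cong') auto
     also have "... = \<delta> j \<star> (\<Oplus>\<^bsub>H\<^esub>i\<in>I. \<delta> i)"
      using \<delta>(1) that by (intro linear_map_finsum[OF mod_H mod_H mult_linear_right I, symmetric]) auto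
     finally have "\<delta> j \<star> \<delta> j = \<delta> j" using \<delta>(1) that by (simp add: sum)
     then have "\<theta> j (\<delta> j) \<bullet> \<delta> j = \<one>\<^bsub>K\<^esub> \<bullet> \<delta> j"
      using \<theta>(2)[OF that(2) \<delta>(1)[OF that(2)]] \<delta>(1)[OF that(2)] by simp
     then show ?thesis
      using smult_cancel[OF field_axioms mod_H \<delta>(1)[OF that(2)] \<delta>(2)[OF that(2)]]
       cl[OF ch[OF that(2)] \<delta>(1)[OF that(2)]] one_closed True by simp
    qed
    let ?h = "\<Oplus>\<^bsub>H\<^esub>i\<in>I. F (\<theta> i) \<bullet> \<delta> i"
    have hc: "?h \<in> carrier H" using Fc \<delta>(1) by (intro M.finsum_closed) auto
    have "\<Phi> ?h = F"
    proof (rule X.fn_ext[OF \<Phi>A[OF hc] F])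
     fix \<chi> assume "\<chi> \<in> carrier character_group"
     then obtain j where j: "j \<in> I" "\<chi> = \<theta> j" using \<theta>(1) unfolding bij_betw_def by auto
     note lj = characterD(2)[OF ch[OF j(1)]]
     have tdc: "\<theta> j (\<delta> i) \<in> carrier K" if "i \<in> I" for i by (rule cl[OF ch[OF j(1)] \<delta>(1)[OF that]])
     have "\<theta> j ?h = (\<Oplus>\<^bsub>K\<^esub>i\<in>I. \<theta> j (F (\<theta> i) \<bullet> \<delta> i))"
      using linear_map_finsum[OF mod_H mod_K lj I, of "%i. F (\<theta> i) \<bullet> \<delta> i"] Fc \<delta>(1) by auto
     also have "... = (\<Oplus>\<^bsub>K\<^esub>i\<in>I. if j = i then F (\<theta> i) else \<zero>\<^bsub>K\<^esub>)"
      using Fc \<delta>(1) tdc j(1) by (intro abelian_monoid.finsum_cong'[OF aK]) (auto simp: linear_map_smult[OF lj] td)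
     also have "... = F (\<theta> j)" using j(1) I Fc by (subst abelian_monoid.finsum_singleton[OF aK]) auto
     finally show "\<Phi> ?h \<chi> = F \<chi>" using ch[OF j(1)] by (simp add: \<Phi>_def j(2))
    qed
    then show "F \<in> \<Phi> ` carrier H" using hc by (rule image_eqI[OF sym])
   qed
  qed
 qed
 then show "hopf_isomorphic K H (function_hopf K character_group)"
  unfolding hopf_isomorphic_def using hom hopf_algebra_axioms X.hopf_algebra_function_hopf by blast
qed

section \<open>Eigenprojections and roots of unity\<close>

lemma (in algebraically_closed) ex_root:
 assumes "set P \<subseteq> carrier L" "P ~= []" "hd P ~= \<zero>" "length P > 1"
 shows "\<exists>x\<in>carrier L. eval P x = \<zero>"
proof -
 have P: "P \<in> carrier (poly_ring L)"
  using assms unfolding sym[OF univ_poly_carrier] polynomial_def by simp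
 have "size (roots P) = length P - 1"
  using roots_over_carrier[OF P] unfolding splitted_def .
 then have "roots P ~= {#}" using assms(4) by auto
 then obtain x where "x \<in># roots P" by blast
 then show ?thesis unfolding roots_mem_iff_is_root[OF P] is_root_def by blast
qed

lemma (in algebraically_closed) ex_nth_root:
 assumes "c \<in> carrier L" "(n::nat) > 0"
 shows "\<exists>x\<in>carrier L. x [^] n = c"
proof -
 \<comment> \<open>\<open>\<one> # ?Q\<close> is the coefficient list of \<open>X^n - c\<close>,
   leading coefficient first.\<close>
 let ?Q = "replicate (n - 1) \<zero> @ [\<ominus> c]"
 obtain x where x: "x \<in> carrier L" "eval (\<one> # ?Q) x = \<zero>"
 proof -
  have "set ?Q \<subseteq> carrier L" using assms(1) by auto
  then have "\<exists>x\<in>carrier L. eval (\<one> # ?Q) x = \<zero>" using assms(2) by (intro ex_root) auto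
  then show thesis using that by blast
 qed
 have "eval (\<one> # ?Q) x = x [^] n \<ominus> c"
  using assms x(1) eval_replicate[of "[\<ominus> c]" x "n - 1"] by (simp add: minus_eq)
 then have "x [^] n = c" using x assms by (simp add: r_right_minus_eq)
 then show ?thesis using x(1) by blast
qed

lemma (in cring) geometric_finsum:
 assumes "x \<in> carrier R"
 shows "(\<Oplus>i\<in>{..<n}. x [^] (i::nat)) \<otimes> (x \<ominus> \<one>) = x [^] n \<ominus> \<one>"
proof (induction n)
 case (Suc n)
 let ?s = "\<Oplus>i\<in>{..<n}. x [^] i"
 have s: "?s \<in> carrier R" using assms by (intro finsum_closed) auto
 have "(\<Oplus>i\<in>{..<Suc n}. x [^] i) \<otimes> (x \<ominus> \<one>) = x [^] n \<otimes> (x \<ominus> \<one>) \<oplus> ?s \<otimes> (x \<ominus> \<one>)"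
  using assms s by (simp add: lessThan_Suc l_distr)
 also have "... = x [^] n \<otimes> (x \<ominus> \<one>) \<oplus> (x [^] n \<ominus> \<one>)" by (simp only: Suc)
 also have "... = x [^] n \<otimes> x \<ominus> \<one>"
  using assms nat_pow_closed[OF assms, of n] by algebra
 finally show ?case by simp
qed (use assms in \<open>simp add: minus_eq r_neg\<close>)

lemma (in cring) eval_replicate_one:
 assumes "x \<in> carrier R"
 shows "eval (replicate n \<one>) x = (\<Oplus>i\<in>{..<n}. x [^] (i::nat))"
proof (induction n)
 case (Suc n)
 then show ?case using assms by (simp add: lessThan_Suc)
qed simp

lemma (in abelian_monoid) finsum_swap:
 assumes "finite A" "finite B" "!!i j. i \<in> A ==> j \<in> B ==> f i j \<in> carrier G"
 shows "(\<Oplus>i\<in>A. \<Oplus>j\<in>B. f i j) = (\<Oplus>j\<in>B. \<Oplus>i\<in>A. f i j)"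
 using assms(1,3)
proof (induction A)
 case (insert a A)
 then have c: "!!j. j \<in> B ==> f a j \<in> carrier G" "!!i j. i \<in> A ==> j \<in> B ==> f i j \<in> carrier G"
  by auto
 have "(\<Oplus>i\<in>insert a A. \<Oplus>j\<in>B. f i j) = (\<Oplus>j\<in>B. f a j) \<oplus> (\<Oplus>j\<in>B. \<Oplus>i\<in>A. f i j)"
  using insert c by (subst finsum_insert) (auto intro!: finsum_closed)
 also have "... = (\<Oplus>j\<in>B. f a j \<oplus> (\<Oplus>i\<in>A. f i j))"
  using c by (intro finsum_addf[symmetric]) (auto intro!: finsum_closed)
 also have "... = (\<Oplus>j\<in>B. \<Oplus>i\<in>insert a A. f i j)"
  using insert c by (intro finsum_cong') (auto intro!: finsum_closed)
 finally show ?case .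
qed simp

lemma (in abelian_group) finsum_cyclic_shift:
 assumes "!!i::nat. i \<le> p ==> g i \<in> carrier G" "g p = g 0"
 shows "(\<Oplus>i\<in>{..<p}. g (Suc i)) = (\<Oplus>i\<in>{..<p}. g i)"
proof (cases p)
 case (Suc m)
 have *: "(\<Oplus>i\<in>{..m}. g (Suc i)) \<oplus> g 0 = (\<Oplus>i\<in>{..m}. g i) \<oplus> g 0"
  using finsum_Suc2[of g m] finsum_Suc[of g m] assms Suc
  by (auto simp: a_comm Pi_iff intro!: finsum_closed)
 have "(\<Oplus>i\<in>{..m}. g (Suc i)) = (\<Oplus>i\<in>{..m}. g i)"
  by (rule add.right_cancel[THEN iffD1, OF _ _ _ *]) (use assms Suc in \<open>auto intro!: finsum_closed\<close>)
 then show ?thesis unfolding Suc lessThan_Suc_atMost .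
qed simp

text \<open>What the extension argument takes from algebraic closure and characteristic 0: a
  non-trivial \<open>p\<close>-th root of unity, invertibility of \<open>p\<close>, and
  \<open>p\<close>-th roots of scalars.\<close>

locale root_of_unity_field = field K for K :: "('k, 'm) ring_scheme" (structure) +
 fixes p :: nat and \<zeta> :: 'k
 assumes prime_p: "Factorial_Ring.prime p"
  and \<zeta>_closed [simp]: "\<zeta> \<in> carrier K" and \<zeta>_pow: "\<zeta> [^] p = \<one>" and \<zeta>_neq: "\<zeta> ~= \<one>"
  and p_neq: "[p] \<cdot> \<one> ~= \<zero>"
  and ex_pth_root: "c \<in> carrier K ==> \<exists>d\<in>carrier K. d [^] p = c"
begin

lemma p_pos: "p > 0" using prime_p by (simp add: prime_gt_0_nat)

abbreviation "pinv \<equiv> inv ([p] \<cdot> \<one>)"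

lemma pinv_closed [simp]: "pinv \<in> carrier K"
 and pinv_p: "pinv \<otimes> ([p] \<cdot> \<one>) = \<one>"
proof -
 have "[p] \<cdot> \<one> \<in> Units K" using p_neq by (simp add: field_Units)
 then show "pinv \<in> carrier K" "pinv \<otimes> ([p] \<cdot> \<one>) = \<one>" by auto
qed

lemma \<zeta>_pow_dvd: "p dvd i ==> \<zeta> [^] i = \<one>"
 by (auto simp: \<zeta>_pow simp flip: nat_pow_pow)

lemma \<zeta>_pow_mod: "\<zeta> [^] (i mod p) = \<zeta> [^] i"
proof -
 have "\<zeta> [^] i = \<zeta> [^] (p * (i div p)) \<otimes> \<zeta> [^] (i mod p)"
  by (simp only: nat_pow_mult \<zeta>_closed mult_div_mod_eq)
 then show ?thesis using \<zeta>_pow_dvd[of "p * (i div p)"] by simp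
qed

lemma \<zeta>_pow_cong: "i mod p = j mod p ==> \<zeta> [^] i = \<zeta> [^] j"
 by (metis \<zeta>_pow_mod)

text \<open>For \<open>i\<close> prime to \<open>p\<close> Bezout gives a multiple of
  \<open>i\<close> that is 1 modulo \<open>p\<close>, and then \<open>\<zeta>\<close> itself would
  be one.\<close>

lemma \<zeta>_pow_eq_one: "\<zeta> [^] i = \<one> \<longleftrightarrow> p dvd i"
proof
 assume 1: "\<zeta> [^] i = \<one>"
 show "p dvd i"
 proof (rule ccontr)
  assume "\<not> p dvd i"
  then have "coprime i p" using prime_p prime_imp_coprime coprime_commute by blast
  moreover have "i ~= 0" using \<open>\<not> p dvd i\<close> by (metis dvd_0_right)
  ultimately obtain x y where "i * x = p * y + 1" using bezout_nat[of i p] by (metis coprime_iff_gcd_eq_1)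
  then have "\<zeta> [^] (i * x) = \<zeta> [^] (p * y) \<otimes> \<zeta>"
   by (simp add: nat_pow_mult[symmetric])
  moreover have "\<zeta> [^] (i * x) = \<one>" by (simp add: 1 flip: nat_pow_pow)
  ultimately show False using \<zeta>_neq \<zeta>_pow_dvd[of "p * y"] by simp
 qed
qed (rule \<zeta>_pow_dvd)

text \<open>Orthogonality of the characters of \<open>Z/p\<close>: off the multiples of
  \<open>p\<close>, the geometric sum is annihilated by the non-zero factor
  \<open>\<zeta> [^] i \<ominus> \<one>\<close>.\<close>

lemma root_sum: "(\<Oplus>j\<in>{..<p}. \<zeta> [^] (i * j)) = (if p dvd i then [p] \<cdot> \<one> else \<zero>)"
proof (cases "p dvd i")
 case True
 then have "(\<Oplus>j\<in>{..<p}. \<zeta> [^] (i * j)) = (\<Oplus>j\<in>{..<p}. \<one>)"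
  by (intro finsum_cong') (auto simp: \<zeta>_pow_dvd)
 then show ?thesis using True add.finprod_const[of \<one> "{..<p}"] by simp
next
 case False
 let ?w = "\<zeta> [^] i"
 have w: "?w \<in> carrier K" by simp
 have s: "(\<Oplus>j\<in>{..<p}. ?w [^] j) \<in> carrier K" by (intro finsum_closed) auto
 have "(\<Oplus>j\<in>{..<p}. ?w [^] j) \<otimes> (?w \<ominus> \<one>) = ?w [^] p \<ominus> \<one>"
  by (rule geometric_finsum[OF w])
 also have "?w [^] p = \<one>" by (simp add: nat_pow_pow \<zeta>_pow_dvd)
 finally have "(\<Oplus>j\<in>{..<p}. ?w [^] j) \<otimes> (?w \<ominus> \<one>) = \<zero>" by (simp add: r_right_minus_eq)
 moreover have "?w \<ominus> \<one> ~= \<zero>" using False \<zeta>_pow_eq_one by (simp add: r_right_minus_eq)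
 ultimately have "(\<Oplus>j\<in>{..<p}. ?w [^] j) = \<zero>"
  using integral[OF _ s] by (metis minus_closed one_closed w)
 then show ?thesis using False by (simp add: nat_pow_pow)
qed

text \<open>The projection onto the eigenspace of \<open>T\<close> with eigenvalue \<open>\<zeta>\<^sup>j\<close>, when \<open>T\<^sup>p = id\<close>;
 the exponent \<open>(p - 1) i j\<close> stands for \<open>- i j\<close>.\<close>

definition eigenprojection :: "('k, 'v, 'x) module_scheme => ('v => 'v) => nat => 'v => 'v" where
 "eigenprojection V T j v = pinv \<odot>\<^bsub>V\<^esub> (\<Oplus>\<^bsub>V\<^esub>i\<in>{..<p}. \<zeta> [^] ((p - 1) * i * j) \<odot>\<^bsub>V\<^esub> (T ^^ i) v)"

context
 fixes V :: "('k, 'v, 'x) module_scheme" and T :: "'v => 'v"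
 assumes V: "module K V" and T: "linear_map K V V T"
begin

interpretation V: module K V by (rule V)

lemma pow_linear: "linear_map K V V (T ^^ i)"
proof (induction i)
 case (Suc i)
 then show ?case using linear_map_comp[OF T Suc] by (simp add: comp_def)
qed (simp add: linear_map_id id_def)

lemma pow_closed: "v \<in> carrier V ==> (T ^^ i) v \<in> carrier V"
 by (rule linear_map_closed[OF pow_linear])

lemma eigenprojection_linear: "linear_map K V V (eigenprojection V T j)"
 unfolding eigenprojection_def[abs_def]
 by (intro linear_map_smult_fun linear_map_finsum_fun V pow_linear) auto

lemma eigenprojection_closed: "v \<in> carrier V ==> eigenprojection V T j v \<in> carrier V"
 by (rule linear_map_closed[OF eigenprojection_linear])

text \<open>Applying \<open>T\<close> shifts the index of the averaging sum and extracts the factor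
  \<open>\<zeta> [^] j\<close>; the shift is cyclic because \<open>(T ^^ p) v = v\<close>.\<close>

lemma eigenprojection_eigen:
 assumes v: "v \<in> carrier V" and Tp: "(T ^^ p) v = v"
 shows "T (eigenprojection V T j v) = \<zeta> [^] j \<odot>\<^bsub>V\<^esub> eigenprojection V T j v"
proof -
 let ?g = "%i. \<zeta> [^] ((p - 1) * i * j) \<odot>\<^bsub>V\<^esub> (T ^^ i) v"
 have gc: "?g i \<in> carrier V" for i using v pow_closed by auto
 have sc: "(\<Oplus>\<^bsub>V\<^esub>i\<in>{..<p}. ?g i) \<in> carrier V" using gc by (intro V.finsum_closed) auto
 have e: "T (?g i) = \<zeta> [^] j \<odot>\<^bsub>V\<^esub> ?g (Suc i)" for i
 proof -
  \<comment> \<open>With \<open>p - 1\<close> read as -1, the exponents \<open>j - (i + 1) j\<close>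
    and \<open>- i j\<close> agree modulo \<open>p\<close>.\<close>
  have "j + (p - 1) * Suc i * j = (p - 1) * i * j + p * j"
   using p_pos by (cases p) (auto simp: algebra_simps)
  then have "\<zeta> [^] (j + (p - 1) * Suc i * j) = \<zeta> [^] ((p - 1) * i * j)"
   by (intro \<zeta>_pow_cong) simp
  then show ?thesis
   using pow_closed[OF v, of i] pow_closed[OF v, of "Suc i"]
   by (simp add: linear_map_smult[OF T] V.smult_assoc1[symmetric] nat_pow_mult)
 qed
 have "T (\<Oplus>\<^bsub>V\<^esub>i\<in>{..<p}. ?g i) = (\<Oplus>\<^bsub>V\<^esub>i\<in>{..<p}. T (?g i))"
  using gc by (intro linear_map_finsum[OF V V T]) auto
 also have "... = (\<Oplus>\<^bsub>V\<^esub>i\<in>{..<p}. \<zeta> [^] j \<odot>\<^bsub>V\<^esub> ?g (Suc i))" by (simp only: e)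
 also have "... = \<zeta> [^] j \<odot>\<^bsub>V\<^esub> (\<Oplus>\<^bsub>V\<^esub>i\<in>{..<p}. ?g (Suc i))"
  by (rule V.finsum_smult_rdistr[OF finite_lessThan nat_pow_closed[OF \<zeta>_closed] Pi_I[OF gc], symmetric])
 also have "(\<Oplus>\<^bsub>V\<^esub>i\<in>{..<p}. ?g (Suc i)) = (\<Oplus>\<^bsub>V\<^esub>i\<in>{..<p}. ?g i)"
 proof (rule V.finsum_cyclic_shift[OF gc])
  show "?g p = ?g 0" using Tp \<zeta>_pow_dvd[of "(p - 1) * p * j"] v by simp
 qed
 finally have "T (\<Oplus>\<^bsub>V\<^esub>i\<in>{..<p}. ?g i) = \<zeta> [^] j \<odot>\<^bsub>V\<^esub> (\<Oplus>\<^bsub>V\<^esub>i\<in>{..<p}. ?g i)" .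
 then show ?thesis
  unfolding eigenprojection_def using sc
  by (simp add: linear_map_smult[OF T] V.smult_assoc1[symmetric] m_comm)
qed

text \<open>After interchanging the sums, \<open>root_sum\<close> leaves only the term
  \<open>i = 0\<close>, with factor \<open>p\<close>.\<close>

lemma eigenprojection_sum:
 assumes v: "v \<in> carrier V"
 shows "(\<Oplus>\<^bsub>V\<^esub>j\<in>{..<p}. eigenprojection V T j v) = v"
proof -
 have gc: "\<zeta> [^] ((p - 1) * i * j) \<odot>\<^bsub>V\<^esub> (T ^^ i) v \<in> carrier V" for i j using v pow_closed by auto
 have pc: "(T ^^ i) v \<in> carrier V" for i by (rule pow_closed[OF v])
 have "(\<Oplus>\<^bsub>V\<^esub>j\<in>{..<p}. eigenprojection V T j v) =
  pinv \<odot>\<^bsub>V\<^esub> (\<Oplus>\<^bsub>V\<^esub>j\<in>{..<p}. \<Oplus>\<^bsub>V\<^esub>i\<in>{..<p}. \<zeta> [^] ((p - 1) * i * j) \<odot>\<^bsub>V\<^esub> (T ^^ i) v)"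
  unfolding eigenprojection_def
  using gc by (intro V.finsum_smult_rdistr[symmetric]) (auto intro!: V.finsum_closed)
 also have "(\<Oplus>\<^bsub>V\<^esub>j\<in>{..<p}. \<Oplus>\<^bsub>V\<^esub>i\<in>{..<p}. \<zeta> [^] ((p - 1) * i * j) \<odot>\<^bsub>V\<^esub> (T ^^ i) v) =
   (\<Oplus>\<^bsub>V\<^esub>i\<in>{..<p}. \<Oplus>\<^bsub>V\<^esub>j\<in>{..<p}. \<zeta> [^] ((p - 1) * i * j) \<odot>\<^bsub>V\<^esub> (T ^^ i) v)"
  using gc by (intro V.finsum_swap) auto
 also have "... = (\<Oplus>\<^bsub>V\<^esub>i\<in>{..<p}. if 0 = i then ([p] \<cdot> \<one>) \<odot>\<^bsub>V\<^esub> (T ^^ i) v else \<zero>\<^bsub>V\<^esub>)"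
 proof (rule V.finsum_cong'[OF refl])
  fix i assume i: "i \<in> {..<p}"
  have "(\<Oplus>\<^bsub>V\<^esub>j\<in>{..<p}. \<zeta> [^] ((p - 1) * i * j) \<odot>\<^bsub>V\<^esub> (T ^^ i) v) =
   (\<Oplus>j\<in>{..<p}. \<zeta> [^] ((p - 1) * i * j)) \<odot>\<^bsub>V\<^esub> (T ^^ i) v"
   using linear_map_finsum[OF module_scalar_module[OF is_cring] V linear_map_form_smult[OF V linear_map_id pc],
     of "{..<p}" "%j. \<zeta> [^] ((p - 1) * i * j)" i] by simp
  also have "... = (if 0 = i then ([p] \<cdot> \<one>) \<odot>\<^bsub>V\<^esub> (T ^^ i) v else \<zero>\<^bsub>V\<^esub>)"
  proof -
   have "p dvd (p - 1) * i \<longleftrightarrow> i = 0"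
   proof
    assume "p dvd (p - 1) * i"
    then have "p dvd p - 1 \<or> p dvd i" using prime_p prime_dvd_mult_iff by blast
    moreover have "\<not> p dvd p - 1" using prime_gt_1_nat[OF prime_p] by (auto dest: dvd_imp_le)
    ultimately show "i = 0" using i by (auto dest: dvd_imp_le)
   qed simp
   then show ?thesis using pc unfolding root_sum by auto
  qed
  finally show "(\<Oplus>\<^bsub>V\<^esub>j\<in>{..<p}. \<zeta> [^] ((p - 1) * i * j) \<odot>\<^bsub>V\<^esub> (T ^^ i) v) =
   (if 0 = i then ([p] \<cdot> \<one>) \<odot>\<^bsub>V\<^esub> (T ^^ i) v else \<zero>\<^bsub>V\<^esub>)" .
 qed (use pc v in auto)
 also have "... = ([p] \<cdot> \<one>) \<odot>\<^bsub>V\<^esub> v"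
  using p_pos pc v by (subst V.finsum_singleton) auto
 finally show ?thesis using v by (simp add: V.smult_assoc1[symmetric] pinv_p)
qed

lemma eigenprojection_of_eigenvector:
 assumes v: "v \<in> carrier V" and e: "T v = \<zeta> [^] k \<odot>\<^bsub>V\<^esub> v"
 shows "eigenprojection V T j v = (if j mod p = k mod p then v else \<zero>\<^bsub>V\<^esub>)"
proof -
 have Ti: "(T ^^ i) v = \<zeta> [^] (i * k) \<odot>\<^bsub>V\<^esub> v" for i
 proof (induction i)
  case (Suc i)
  then show ?case using v e
   by (simp add: linear_map_smult[OF T] V.smult_assoc1[symmetric] nat_pow_mult add.commute)
 qed (use v in simp)
 have ex: "\<zeta> [^] ((p - 1) * i * j) \<odot>\<^bsub>V\<^esub> (T ^^ i) v = \<zeta> [^] (((p - 1) * j + k) * i) \<odot>\<^bsub>V\<^esub> v" for i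
  using v by (simp add: Ti V.smult_assoc1[symmetric] nat_pow_mult algebra_simps)
 have "(\<Oplus>\<^bsub>V\<^esub>i\<in>{..<p}. \<zeta> [^] ((p - 1) * i * j) \<odot>\<^bsub>V\<^esub> (T ^^ i) v) =
  (\<Oplus>i\<in>{..<p}. \<zeta> [^] (((p - 1) * j + k) * i)) \<odot>\<^bsub>V\<^esub> v"
  unfolding ex
  using linear_map_finsum[OF module_scalar_module[OF is_cring] V linear_map_form_smult[OF V linear_map_id v],
    of "{..<p}" "%i. \<zeta> [^] (((p - 1) * j + k) * i)"] by simp
 moreover have "p dvd (p - 1) * j + k \<longleftrightarrow> j mod p = k mod p"
 proof -
  have "int ((p - 1) * j + k) = int p * int j - (int j - int k)"
  proof -
   have "int (p - 1) = int p - 1" using p_pos by simp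
   then show ?thesis unfolding of_nat_add of_nat_mult by (simp add: left_diff_distrib)
  qed
  then have "p dvd (p - 1) * j + k \<longleftrightarrow> int p dvd int p * int j - (int j - int k)"
   by (metis int_dvd_int_iff)
  also have "... \<longleftrightarrow> int p dvd int j - int k"
   by (metis dvd_diff_right_iff dvd_triv_left)
  also have "... \<longleftrightarrow> j mod p = k mod p"
   by (metis mod_eq_dvd_iff of_nat_eq_iff of_nat_mod)
  finally show ?thesis .
 qed
 ultimately show ?thesis
  unfolding eigenprojection_def root_sum using v by (simp add: V.smult_assoc1[symmetric] pinv_p)
qed

end

end

text \<open>A root of \<open>1 + X + ... + X^(p-1)\<close> is a \<open>p\<close>-th root of unity;
  it differs from 1 because the value at 1 is \<open>p\<close>, which is non-zero in characteristic
  0.\<close>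

lemma root_of_unity_field_exists:
 assumes "algebraically_closed K" "!!m :: nat. m > 0 ==> [m] \<cdot>\<^bsub>K\<^esub> \<one>\<^bsub>K\<^esub> ~= \<zero>\<^bsub>K\<^esub>" "Factorial_Ring.prime p"
 obtains \<zeta> where "root_of_unity_field K p \<zeta>"
proof -
 interpret K: algebraically_closed K by fact
 have p: "p > 1" using prime_gt_1_nat[OF assms(3)] .
 obtain z where z: "z \<in> carrier K" "K.eval (replicate p \<one>\<^bsub>K\<^esub>) z = \<zero>\<^bsub>K\<^esub>"
  using K.ex_root[of "replicate p \<one>\<^bsub>K\<^esub>"] p by auto
 have s: "(\<Oplus>\<^bsub>K\<^esub>i\<in>{..<p}. z [^]\<^bsub>K\<^esub> i) = \<zero>\<^bsub>K\<^esub>"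
  using z K.eval_replicate_one[OF z(1)] by simp
 have "z [^]\<^bsub>K\<^esub> p \<ominus>\<^bsub>K\<^esub> \<one>\<^bsub>K\<^esub> = \<zero>\<^bsub>K\<^esub>"
  using K.geometric_finsum[OF z(1), of p] z(1) by (simp add: s)
 then have zp: "z [^]\<^bsub>K\<^esub> p = \<one>\<^bsub>K\<^esub>" using z(1) by (simp add: K.r_right_minus_eq)
 have "z ~= \<one>\<^bsub>K\<^esub>"
 proof
  assume "z = \<one>\<^bsub>K\<^esub>"
  then have "[p] \<cdot>\<^bsub>K\<^esub> \<one>\<^bsub>K\<^esub> = \<zero>\<^bsub>K\<^esub>"
   using s K.add.finprod_const[of "\<one>\<^bsub>K\<^esub>" "{..<p}"] by simp
  then show False using assms(2) p by simp
 qed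
 then have "root_of_unity_field K p z"
  using z(1) zp assms p K.ex_nth_root by unfold_locales auto
 then show thesis by (rule that)
qed

section \<open>The group algebra of the cyclic group and its Fourier transform\<close>

lemma module_cong:
 assumes "module K V" "carrier W = carrier V" "add W = add V" "\<zero>\<^bsub>W\<^esub> = \<zero>\<^bsub>V\<^esub>" "smult W = smult V"
 shows "module K W"
proof -
 interpret V: module K V by fact
 have "abelian_group W"
  by (rule abelian_groupI; unfold assms(2-4)) (auto simp: V.a_ac intro: V.add.l_inv_ex)
 then show ?thesis
  by (intro moduleI) (simp_all add: assms(2-5) V.is_cring V.smult_l_distr V.smult_r_distr V.smult_assoc1)
qed

lemma finsum_structure_cong:
 assumes "carrier W = carrier V" "add W = add V" "\<zero>\<^bsub>W\<^esub> = \<zero>\<^bsub>V\<^esub>"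
 shows "finsum W f S = finsum V f S"
 using assms by (simp add: finsum_def finprod_def)

lemma free_space_linear_eq:
 assumes K: "cring K" and V: "module K V" and f: "linear_map K (free_space K I) V f"
  and g: "linear_map K (free_space K I) V g"
  and eq: "!!i. i \<in> I ==> f (basis_vector K i) = g (basis_vector K i)" and b: "b \<in> carrier (free_space K I)"
 shows "f b = g b"
proof -
 interpret K: cring K by fact
 interpret V: module K V by fact
 interpret F: module K "free_space K I" by (rule free_space_module[OF K])
 let ?S = "{i. b i ~= \<zero>\<^bsub>K\<^esub>}"
 have S: "finite ?S" "?S \<subseteq> I" and bK: "!!i. b i \<in> carrier K" using b by auto
 note e = free_space_expand[OF K b S(1) subset_refl S(2)]
 have bv: "basis_vector K i \<in> carrier (free_space K I)" if "i \<in> ?S" for i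
  using that S(2) by (intro basis_vector_closed[OF K]) auto
 have c: "(%i. b i \<odot>\<^bsub>free_space K I\<^esub> basis_vector K i) \<in> ?S \<rightarrow> carrier (free_space K I)"
  by (rule Pi_I, rule F.smult_closed[OF bK bv])
 have gc: "g (b i \<odot>\<^bsub>free_space K I\<^esub> basis_vector K i) \<in> carrier V" if "i \<in> ?S" for i
  by (rule linear_map_closed[OF g F.smult_closed[OF bK bv[OF that]]])
 have "f b = (\<Oplus>\<^bsub>V\<^esub>i\<in>?S. f (b i \<odot>\<^bsub>free_space K I\<^esub> basis_vector K i))"
  by (subst e) (rule linear_map_finsum[OF F.module_axioms V f S(1) c])
 also have "... = (\<Oplus>\<^bsub>V\<^esub>i\<in>?S. g (b i \<odot>\<^bsub>free_space K I\<^esub> basis_vector K i))"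
 proof (rule V.finsum_cong'[OF refl])
  fix i assume i: "i \<in> ?S"
  then have "i \<in> I" using S(2) by blast
  then show "f (b i \<odot>\<^bsub>free_space K I\<^esub> basis_vector K i) = g (b i \<odot>\<^bsub>free_space K I\<^esub> basis_vector K i)"
   by (simp only: linear_map_smult[OF f bK bv[OF i]] linear_map_smult[OF g bK bv[OF i]] eq)
 qed (use gc in auto)
 also have "... = g b"
  by (subst (3) e) (rule linear_map_finsum[OF F.module_axioms V g S(1) c, symmetric])
 finally show ?thesis .
qed

context root_of_unity_field
begin

abbreviation "C \<equiv> integer_mod_group p"
abbreviation "F \<equiv> free_space K (carrier C)"
abbreviation "B \<equiv> group_hopf K C"

lemma carrier_C: "carrier C = {0..<int p}"
 using p_pos by (simp add: carrier_integer_mod_group)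

lemma B_structure: "carrier B = carrier F" "add B = add F" "\<zero>\<^bsub>B\<^esub> = \<zero>\<^bsub>F\<^esub>" "smult B = smult F"
 by (simp_all add: group_hopf_def group_algebra_def Let_def module.defs hopf_data.defs)

lemma B_one: "\<one>\<^bsub>B\<^esub> = basis_vector K 0"
 by (simp add: group_hopf_def group_algebra_def Let_def module.defs hopf_data.defs)

lemma B_mult: "b \<otimes>\<^bsub>B\<^esub> b' = (\<Oplus>\<^bsub>F\<^esub> x \<in> {x. b x ~= \<zero>}. \<Oplus>\<^bsub>F\<^esub> y \<in> {y. b' y ~= \<zero>}.
  (b x \<otimes> b' y) \<odot>\<^bsub>F\<^esub> basis_vector K (x \<otimes>\<^bsub>C\<^esub> y))"
 by (simp add: group_hopf_def group_algebra_def Let_def module.defs hopf_data.defs del: mult_integer_mod_group)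

lemma B_counit: "counit B b = (\<Oplus>x\<in>{x. b x ~= \<zero>}. b x)"
 by (simp add: group_hopf_def Let_def module.defs hopf_data.defs)

lemma B_comult: "comult B b = (\<Oplus>\<^bsub>tensor_space K B B\<^esub> x \<in> {x. b x ~= \<zero>}.
  b x \<odot>\<^bsub>tensor_space K B B\<^esub> tensor K B B (basis_vector K x) (basis_vector K x))"
proof -
 have eq: "carrier (group_algebra K C) = carrier B" "add (group_algebra K C) = add B"
  "smult (group_algebra K C) = smult B"
  by (simp_all add: group_hopf_def group_algebra_def Let_def module.defs hopf_data.defs)
 show ?thesis
  unfolding tensor_space_cong[OF eq eq, symmetric]
  by (simp add: group_hopf_def Let_def module.defs hopf_data.defs)
qed

lemma B_antipode: "antipode B b = (\<Oplus>\<^bsub>F\<^esub> x \<in> {x. b x ~= \<zero>}. b x \<odot>\<^bsub>F\<^esub> basis_vector K (inv\<^bsub>C\<^esub> x))"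
proof -
 have "antipode B b = (\<Oplus>\<^bsub>group_algebra K C\<^esub> x \<in> {x. b x ~= \<zero>}. b x \<odot>\<^bsub>group_algebra K C\<^esub> basis_vector K (inv\<^bsub>C\<^esub> x))"
  by (simp add: group_hopf_def Let_def module.defs hopf_data.defs)
 then show ?thesis
  using finsum_structure_cong[of "group_algebra K C" F] by (simp add: group_algebra_def Let_def)
qed

lemma mod_K: "module K (scalar_module K)" by (rule module_scalar_module[OF is_cring])

lemma mod_F: "module K F" by (rule free_space_module[OF is_cring])

lemma mod_B: "module K B"
 by (rule module_cong[OF mod_F B_structure])

lemma linear_B_iff: "linear_map K B V f \<longleftrightarrow> linear_map K F V f"
 by (simp only: linear_map_def B_structure)

text \<open>The \<open>j\<close>-th character of the cyclic group, extended linearly. Together the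
  \<open>chi j\<close> are the discrete Fourier transform, and identities in
  \<open>group_hopf\<close> are checked on them through \<open>B_eqI\<close>.\<close>

definition chi :: "nat => (int => 'k) => 'k" where
 "chi j = lin_ext K (scalar_module K) (%x. \<zeta> [^] (j * nat x))"

lemma chi_form_F: "linear_form K F (chi j)"
 unfolding chi_def by (rule lin_ext_linear[OF mod_K]) simp

lemma chi_form: "linear_form K B (chi j)"
 unfolding linear_B_iff by (rule chi_form_F)

lemma chi_closed: "b \<in> carrier F ==> chi j b \<in> carrier K"
 using linear_map_closed[OF chi_form_F] by simp

lemma chi_basis: "chi j (basis_vector K x) = \<zeta> [^] (j * nat x)"
 unfolding chi_def by (rule lin_ext_basis[OF mod_K]) simp

lemma basis_F: "x \<in> carrier C ==> basis_vector K x \<in> carrier F"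
 by (rule basis_vector_closed[OF is_cring])

lemma chi_support: "chi j b = (\<Oplus>x\<in>{x. b x ~= \<zero>}. b x \<otimes> \<zeta> [^] (j * nat x))"
 by (simp add: chi_def lin_ext_def)

lemma support:
 assumes "b \<in> carrier F"
 shows "finite {x. b x ~= \<zero>}" "b x ~= \<zero> ==> x \<in> carrier C" "b x \<in> carrier K"
 using assms by auto

lemma chi_finsum:
 assumes "finite S" "!!i. i \<in> S ==> g i \<in> carrier F"
 shows "chi j (\<Oplus>\<^bsub>F\<^esub>i\<in>S. g i) = (\<Oplus>i\<in>S. chi j (g i))"
 using linear_map_finsum[OF mod_F mod_K chi_form_F assms(1), of g] assms(2) by auto

interpretation Fm: module K F by (rule mod_F)

lemma B_mult_closed:
 assumes b: "b \<in> carrier F" and b': "b' \<in> carrier F"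
 shows "b \<otimes>\<^bsub>B\<^esub> b' \<in> carrier F"
 unfolding B_mult using support[OF b] support[OF b']
 by (intro Fm.finsum_closed Pi_I Fm.smult_closed basis_F m_closed)
  (auto intro: group.is_monoid monoid.m_closed[OF group.is_monoid[OF group_integer_mod_group]] simp del: mult_integer_mod_group)

lemma \<zeta>_pow_C_mult:
 assumes "x \<in> carrier C" "y \<in> carrier C"
 shows "\<zeta> [^] (j * nat (x \<otimes>\<^bsub>C\<^esub> y)) = \<zeta> [^] (j * nat x) \<otimes> \<zeta> [^] (j * nat y)"
proof -
 have "nat (x \<otimes>\<^bsub>C\<^esub> y) = (nat x + nat y) mod p"
  using assms by (simp add: carrier_C nat_mod_distrib nat_add_distrib)
 then have "\<zeta> [^] (j * nat (x \<otimes>\<^bsub>C\<^esub> y)) = \<zeta> [^] (j * (nat x + nat y))"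
  by (intro \<zeta>_pow_cong) (metis mod_mult_right_eq)
 then show ?thesis by (simp add: nat_pow_mult distrib_left)
qed

lemma chi_mult:
 assumes b: "b \<in> carrier F" and b': "b' \<in> carrier F"
 shows "chi j (b \<otimes>\<^bsub>B\<^esub> b') = chi j b \<otimes> chi j b'"
proof -
 let ?S = "{x. b x ~= \<zero>}" and ?S' = "{x. b' x ~= \<zero>}"
 note s = support[OF b] and s' = support[OF b']
 have m: "x \<otimes>\<^bsub>C\<^esub> y \<in> carrier C" if "x \<in> ?S" "y \<in> ?S'" for x y
  using that s(2) s'(2) monoid.m_closed[OF group.is_monoid[OF group_integer_mod_group]] by blast
 have t: "(b x \<otimes> b' y) \<odot>\<^bsub>F\<^esub> basis_vector K (x \<otimes>\<^bsub>C\<^esub> y) \<in> carrier F" if "x \<in> ?S" "y \<in> ?S'" for x y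
  by (intro Fm.smult_closed basis_F m m_closed s(3) s'(3) that)
 have k: "\<zeta> [^] i \<in> carrier K" for i :: nat by simp
 have "chi j (b \<otimes>\<^bsub>B\<^esub> b') = (\<Oplus>x\<in>?S. \<Oplus>y\<in>?S'. chi j ((b x \<otimes> b' y) \<odot>\<^bsub>F\<^esub> basis_vector K (x \<otimes>\<^bsub>C\<^esub> y)))"
  unfolding B_mult
 proof (subst chi_finsum[OF s(1)])
  show "(\<Oplus>\<^bsub>F\<^esub>y\<in>?S'. (b x \<otimes> b' y) \<odot>\<^bsub>F\<^esub> basis_vector K (x \<otimes>\<^bsub>C\<^esub> y)) \<in> carrier F" if "x \<in> ?S" for x
   using t[OF that] by (intro Fm.finsum_closed) blast
  show "(\<Oplus>x\<in>?S. chi j (\<Oplus>\<^bsub>F\<^esub>y\<in>?S'. (b x \<otimes> b' y) \<odot>\<^bsub>F\<^esub> basis_vector K (x \<otimes>\<^bsub>C\<^esub> y))) =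
   (\<Oplus>x\<in>?S. \<Oplus>y\<in>?S'. chi j ((b x \<otimes> b' y) \<odot>\<^bsub>F\<^esub> basis_vector K (x \<otimes>\<^bsub>C\<^esub> y)))"
   using t chi_closed by (intro finsum_cong' refl chi_finsum s'(1) Pi_I finsum_closed) auto
 qed
 also have "... = (\<Oplus>x\<in>?S. (b x \<otimes> \<zeta> [^] (j * nat x)) \<otimes> (\<Oplus>y\<in>?S'. b' y \<otimes> \<zeta> [^] (j * nat y)))"
 proof (rule finsum_cong'[OF refl])
  fix x assume x: "x \<in> ?S"
  have "(\<Oplus>y\<in>?S'. chi j ((b x \<otimes> b' y) \<odot>\<^bsub>F\<^esub> basis_vector K (x \<otimes>\<^bsub>C\<^esub> y))) =
   (\<Oplus>y\<in>?S'. (b x \<otimes> \<zeta> [^] (j * nat x)) \<otimes> (b' y \<otimes> \<zeta> [^] (j * nat y)))"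
  proof (rule finsum_cong'[OF refl])
   fix y assume y: "y \<in> ?S'"
   have c: "x \<in> carrier C" "y \<in> carrier C" using x y s(2) s'(2) by auto
   have "chi j ((b x \<otimes> b' y) \<odot>\<^bsub>F\<^esub> basis_vector K (x \<otimes>\<^bsub>C\<^esub> y)) =
    (b x \<otimes> b' y) \<otimes> (\<zeta> [^] (j * nat x) \<otimes> \<zeta> [^] (j * nat y))"
    unfolding linear_map_smult[OF chi_form_F m_closed[OF s(3) s'(3)] basis_F[OF m[OF x y]]]
     chi_basis \<zeta>_pow_C_mult[OF c] by simp
   then show "chi j ((b x \<otimes> b' y) \<odot>\<^bsub>F\<^esub> basis_vector K (x \<otimes>\<^bsub>C\<^esub> y)) =
    (b x \<otimes> \<zeta> [^] (j * nat x)) \<otimes> (b' y \<otimes> \<zeta> [^] (j * nat y))"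
    using s(3)[of x] s'(3)[of y] k by (simp add: m_ac)
  qed (use s(3) s'(3) in auto)
  also have "... = (b x \<otimes> \<zeta> [^] (j * nat x)) \<otimes> (\<Oplus>y\<in>?S'. b' y \<otimes> \<zeta> [^] (j * nat y))"
   using s(3) s' by (intro finsum_rdistr[symmetric]) auto
  finally show "(\<Oplus>y\<in>?S'. chi j ((b x \<otimes> b' y) \<odot>\<^bsub>F\<^esub> basis_vector K (x \<otimes>\<^bsub>C\<^esub> y))) =
   (b x \<otimes> \<zeta> [^] (j * nat x)) \<otimes> (\<Oplus>y\<in>?S'. b' y \<otimes> \<zeta> [^] (j * nat y))" .
 qed (use s(3) s'(3) in \<open>auto intro!: finsum_closed\<close>)
 also have "... = chi j b \<otimes> chi j b'"
  unfolding chi_support using s s' by (intro finsum_ldistr[symmetric]) (auto intro!: finsum_closed)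
 finally show ?thesis .
qed

lemma chi_one: "chi j \<one>\<^bsub>B\<^esub> = \<one>"
 unfolding B_one chi_basis by simp

lemma B_one_closed: "\<one>\<^bsub>B\<^esub> \<in> carrier F"
 unfolding B_one by (rule basis_F) simp

lemma B_counit_chi:
 assumes b: "b \<in> carrier F"
 shows "counit B b = chi 0 b"
 unfolding B_counit chi_support
 by (rule finsum_cong'[OF refl]) (use support(3)[OF b] in \<open>simp_all add: Pi_iff\<close>)

lemma B_antipode_closed:
 assumes b: "b \<in> carrier F"
 shows "antipode B b \<in> carrier F"
proof -
 have "inv\<^bsub>C\<^esub> x \<in> carrier C" if "b x ~= \<zero>" for x
  using support(2)[OF b that] group.inv_closed[OF group_integer_mod_group] by blast
 then show ?thesis
  unfolding B_antipode
  by (intro Fm.finsum_closed Pi_I Fm.smult_closed[OF support(3)[OF b] basis_F]) blast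
qed

lemma chi_antipode:
 assumes b: "b \<in> carrier F"
 shows "chi j (antipode B b) = chi ((p - 1) * j) b"
proof -
 let ?S = "{x. b x ~= \<zero>}"
 note s = support[OF b]
 have i: "inv\<^bsub>C\<^esub> x \<in> carrier C" if "x \<in> ?S" for x
  using that s(2) group.inv_closed[OF group_integer_mod_group] by blast
 have "chi j (antipode B b) = (\<Oplus>x\<in>?S. chi j (b x \<odot>\<^bsub>F\<^esub> basis_vector K (inv\<^bsub>C\<^esub> x)))"
  unfolding B_antipode by (rule chi_finsum[OF s(1) Fm.smult_closed[OF s(3) basis_F[OF i]]])
 also have "... = (\<Oplus>x\<in>?S. b x \<otimes> \<zeta> [^] ((p - 1) * j * nat x))"
 proof (rule finsum_cong'[OF refl])
  fix x assume x: "x \<in> ?S"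
  then have xC: "x \<in> carrier C" using s(2) by blast
  have "int (j * nat (inv\<^bsub>C\<^esub> x)) mod int p = int ((p - 1) * j * nat x) mod int p"
  proof -
   have "int (p - 1) = int p - 1" "0 \<le> x" using p_pos xC by (auto simp: carrier_C)
   then have 1: "int ((p - 1) * j * nat x) = int j * (- x) + int p * (int j * x)"
    by (simp add: algebra_simps)
   have 2: "int (j * nat (inv\<^bsub>C\<^esub> x)) = int j * ((- x) mod int p)"
    using xC p_pos by (simp del: inv_integer_mod_group add: inv_integer_mod_group[OF xC])
   show ?thesis unfolding 1 2 by (simp only: mod_mult_right_eq mod_mult_self2)
  qed
  then have "\<zeta> [^] (j * nat (inv\<^bsub>C\<^esub> x)) = \<zeta> [^] ((p - 1) * j * nat x)"
   by (intro \<zeta>_pow_cong) (metis of_nat_eq_iff of_nat_mod)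
  then show "chi j (b x \<odot>\<^bsub>F\<^esub> basis_vector K (inv\<^bsub>C\<^esub> x)) = b x \<otimes> \<zeta> [^] ((p - 1) * j * nat x)"
   unfolding linear_map_smult[OF chi_form_F s(3) basis_F[OF i[OF x]]] chi_basis by simp
 qed (use s(3) in auto)
 finally show ?thesis unfolding chi_support[of "(p - 1) * j"] .
qed

sublocale BB: tensor_product K B B
 by (intro tensor_product.intro mod_B)

lemma chi_chi_bilinear: "bilinear_map K B B (scalar_module K) (%a b. chi i a \<otimes> chi j b)"
proof (intro bilinear_mapI)
 show "linear_form K B (%b. chi i a \<otimes> chi j b)" if "a \<in> carrier B" for a
  using linear_map_smult_fun[OF mod_K _ chi_form] chi_closed that B_structure(1) by simp
 show "linear_form K B (%a. chi i a \<otimes> chi j b)" if "b \<in> carrier B" for b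
  using linear_map_form_smult[OF mod_K chi_form] chi_closed that B_structure(1) by simp
qed

lemma B_comult_term:
 assumes "b \<in> carrier F" "x \<in> {x. b x ~= \<zero>}"
 shows "tensor K B B (basis_vector K x) (basis_vector K x) \<in> carrier BB.T"
  "b x \<odot>\<^bsub>BB.T\<^esub> tensor K B B (basis_vector K x) (basis_vector K x) \<in> carrier BB.T"
proof -
 have "basis_vector K x \<in> carrier B" using assms support(2) basis_F B_structure(1) by blast
 then show *: "tensor K B B (basis_vector K x) (basis_vector K x) \<in> carrier BB.T" by (intro BB.tensor_closed)
 show "b x \<odot>\<^bsub>BB.T\<^esub> tensor K B B (basis_vector K x) (basis_vector K x) \<in> carrier BB.T"
  by (rule BB.T.smult_closed[OF support(3)[OF assms(1)] *])
qed

lemma B_comult_closed: "b \<in> carrier F ==> comult B b \<in> carrier BB.T"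
 unfolding B_comult using B_comult_term(2) by (intro BB.T.finsum_closed) blast

text \<open>Group elements are grouplike, so the two characters are evaluated at the same element
  and their exponents add.\<close>

lemma chi_chi_comult:
 assumes b: "b \<in> carrier F"
 shows "tensor_lift K (scalar_module K) (%a b. chi i a \<otimes> chi j b) (comult B b) = chi (i + j) b"
proof -
 let ?S = "{x. b x ~= \<zero>}"
 note s = support[OF b]
 note l = BB.lift_linear[OF mod_K chi_chi_bilinear]
 have "tensor_lift K (scalar_module K) (%a b. chi i a \<otimes> chi j b) (comult B b) =
  (\<Oplus>\<^bsub>scalar_module K\<^esub>x\<in>?S. tensor_lift K (scalar_module K) (%a b. chi i a \<otimes> chi j b)
   (b x \<odot>\<^bsub>BB.T\<^esub> tensor K B B (basis_vector K x) (basis_vector K x)))"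
  unfolding B_comult using B_comult_term(2)[OF b]
  by (intro linear_map_finsum[OF BB.T.module_axioms mod_K l s(1)]) blast
 also have "... = (\<Oplus>x\<in>?S. b x \<otimes> \<zeta> [^] ((i + j) * nat x))"
  unfolding finsum_scalar_module
 proof (rule finsum_cong'[OF refl])
  fix x assume x: "x \<in> ?S"
  have bB: "basis_vector K x \<in> carrier B" using x s(2) basis_F B_structure(1) by blast
  show "tensor_lift K (scalar_module K) (%a b. chi i a \<otimes> chi j b)
    (b x \<odot>\<^bsub>BB.T\<^esub> tensor K B B (basis_vector K x) (basis_vector K x)) = b x \<otimes> \<zeta> [^] ((i + j) * nat x)"
   unfolding linear_map_smult[OF l s(3) B_comult_term(1)[OF b x]]
    BB.lift_tensor[OF mod_K chi_chi_bilinear bB bB] chi_basis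
   by (simp add: nat_pow_mult distrib_right)
 qed (use s(3) in auto)
 finally show ?thesis unfolding chi_support[of "i + j"] .
qed

text \<open>Fourier inversion: the basis dual to the \<open>chi j\<close>, consisting of the
  primitive idempotents of the group algebra.\<close>

definition chi_dual :: "nat => int => 'k" where
 "chi_dual j x = (if x \<in> carrier C then pinv \<otimes> \<zeta> [^] ((p - 1) * j * nat x) else \<zero>)"

lemma chi_dual_closed: "chi_dual j \<in> carrier F"
proof -
 have "{x. chi_dual j x ~= \<zero>} \<subseteq> {0..<int p}" by (auto simp: chi_dual_def carrier_C split: if_splits)
 then have "finite {x. chi_dual j x ~= \<zero>}" by (rule finite_subset) simp
 then show ?thesis by (auto simp: chi_dual_def)
qed

lemma dvd_shift_iff:
 assumes "i < p" "j < p"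
 shows "p dvd i + (p - 1) * j \<longleftrightarrow> i = j"
proof -
 have "int (p - 1) = int p - 1" using p_pos by simp
 then have e: "int (i + (p - 1) * j) = int p * int j + (int i - int j)"
  unfolding of_nat_add of_nat_mult by (simp add: left_diff_distrib)
 have "p dvd i + (p - 1) * j \<longleftrightarrow> int p dvd int p * int j + (int i - int j)"
  unfolding e[symmetric] by (rule int_dvd_int_iff[symmetric])
 also have "... \<longleftrightarrow> int p dvd int i - int j" by (simp add: dvd_add_right_iff)
 also have "... \<longleftrightarrow> i mod p = j mod p" by (metis mod_eq_dvd_iff of_nat_eq_iff of_nat_mod)
 finally show ?thesis using assms by simp
qed

lemma chi_chi_dual:
 assumes "i < p" "j < p"
 shows "chi i (chi_dual j) = (if i = j then \<one> else \<zero>)"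
proof -
 have "chi i (chi_dual j) = (\<Oplus>\<^bsub>scalar_module K\<^esub>x\<in>carrier C. chi_dual j x \<odot>\<^bsub>scalar_module K\<^esub> \<zeta> [^] (i * nat x))"
  unfolding chi_def
  by (rule lin_ext_superset[OF mod_K chi_dual_closed]) (auto simp: chi_dual_def carrier_C)
 also have "... = (\<Oplus>x\<in>int ` {..<p}. pinv \<otimes> \<zeta> [^] ((i + (p - 1) * j) * nat x))"
 proof -
  have "carrier C = int ` {..<p}" unfolding carrier_C by (simp add: image_int_atLeastLessThan lessThan_atLeast0)
  then show ?thesis
   by (simp, intro finsum_cong') (auto simp: chi_dual_def m_assoc nat_pow_mult algebra_simps)
 qed
 also have "... = (\<Oplus>x\<in>{..<p}. pinv \<otimes> \<zeta> [^] ((i + (p - 1) * j) * x))"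
  by (subst finsum_reindex) auto
 also have "... = pinv \<otimes> (\<Oplus>x\<in>{..<p}. \<zeta> [^] ((i + (p - 1) * j) * x))"
  by (intro finsum_rdistr[symmetric]) auto
 finally show ?thesis unfolding root_sum dvd_shift_iff[OF assms] by (auto simp: pinv_p)
qed

text \<open>On a group element, and at a coordinate \<open>y\<close>, the expansion is
  \<open>root_sum\<close> with the roles of characters and elements exchanged.\<close>

lemma dual_system_chi: "dual_system K B {..<p} chi chi_dual"
proof -
 have lin: "linear_map K F F (%b. \<Oplus>\<^bsub>F\<^esub>j\<in>{..<p}. chi j b \<odot>\<^bsub>F\<^esub> chi_dual j)"
  by (intro linear_map_finsum_fun mod_F linear_map_form_smult chi_form_F chi_dual_closed finite_lessThan)
 have "b = (\<Oplus>\<^bsub>F\<^esub>j\<in>{..<p}. chi j b \<odot>\<^bsub>F\<^esub> chi_dual j)" if "b \<in> carrier F" for b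
 proof (rule free_space_linear_eq[OF is_cring mod_F linear_map_id lin _ that])
  fix x assume x: "x \<in> carrier C"
  have ev: "(\<Oplus>\<^bsub>F\<^esub>j\<in>S. g j) y = (\<Oplus>j\<in>S. g j y)" if "finite S" "!!j. j \<in> S ==> g j \<in> carrier F" for S y and g :: "nat => int => 'k"
  proof -
   have l: "linear_form K F (%b. b y)" by (rule linear_mapI) auto
   have "(%i. g i) \<in> S \<rightarrow> carrier F" using that(2) by blast
   from linear_map_finsum[OF mod_F mod_K l that(1) this] show ?thesis by simp
  qed
  have xp: "nat x < p" "0 \<le> x" using x by (auto simp: carrier_C)
  show "basis_vector K x = (\<Oplus>\<^bsub>F\<^esub>j\<in>{..<p}. chi j (basis_vector K x) \<odot>\<^bsub>F\<^esub> chi_dual j)"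
  proof
   fix y
   have "(\<Oplus>\<^bsub>F\<^esub>j\<in>{..<p}. chi j (basis_vector K x) \<odot>\<^bsub>F\<^esub> chi_dual j) y =
    (\<Oplus>j\<in>{..<p}. (chi j (basis_vector K x) \<odot>\<^bsub>F\<^esub> chi_dual j) y)"
    by (rule ev[OF finite_lessThan Fm.smult_closed[OF chi_closed[OF basis_F[OF x]] chi_dual_closed]])
   also have "... = (\<Oplus>j\<in>{..<p}. \<zeta> [^] (j * nat x) \<otimes> chi_dual j y)"
    by (simp add: chi_basis)
   also have "... = (if y = x then \<one> else \<zero>)"
   proof (cases "y \<in> carrier C")
    case True
    then have yp: "nat y < p" "0 \<le> y" by (auto simp: carrier_C)
    have "(\<Oplus>j\<in>{..<p}. \<zeta> [^] (j * nat x) \<otimes> chi_dual j y) =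
     (\<Oplus>j\<in>{..<p}. pinv \<otimes> \<zeta> [^] ((nat x + (p - 1) * nat y) * j))"
     using True
     by (intro finsum_cong') (auto simp: chi_dual_def m_lcomm nat_pow_mult algebra_simps)
    also have "... = pinv \<otimes> (\<Oplus>j\<in>{..<p}. \<zeta> [^] ((nat x + (p - 1) * nat y) * j))"
     by (intro finsum_rdistr[symmetric]) auto
    finally show ?thesis
     unfolding root_sum dvd_shift_iff[OF xp(1) yp(1)] using xp yp by (auto simp: pinv_p)
   next
    case False
    then have "(\<Oplus>j\<in>{..<p}. \<zeta> [^] (j * nat x) \<otimes> chi_dual j y) = (\<Oplus>j\<in>{..<p}. \<zero>)"
     by (intro finsum_cong') (auto simp: chi_dual_def)
    then show ?thesis using False x by auto
   qed
   finally show "basis_vector K x y = (\<Oplus>\<^bsub>F\<^esub>j\<in>{..<p}. chi j (basis_vector K x) \<odot>\<^bsub>F\<^esub> chi_dual j) y"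
    by (simp add: basis_vector_def)
  qed
 qed
 moreover have "finsum B f S = finsum F f S" for f and S :: "nat set"
  by (rule finsum_structure_cong) (rule B_structure)+
 ultimately show ?thesis
  unfolding dual_system_def B_structure using chi_form chi_dual_closed by (simp add: B_structure)
qed

lemma B_eqI: "b \<in> carrier F ==> b' \<in> carrier F ==> (!!j. j < p ==> chi j b = chi j b') ==> b = b'"
 using dual_system_eqI[OF mod_B dual_system_chi] B_structure(1) by blast

lemma chi_mod: "chi (j mod p) b = chi j b"
 unfolding chi_def by (metis (no_types, opaque_lifting) \<zeta>_pow_cong mod_mult_left_eq)

end

text \<open>\<open>H\<close> may be infinite-dimensional, so Zorn is used: let \<open>M\<close> be
  maximal among the submodules avoiding \<open>v\<close>. Then every vector is an element of
  \<open>M\<close> plus a unique multiple of \<open>v\<close>, and this multiple is the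
  form.\<close>

lemma linear_form_exists:
 assumes "field K" "module K V" "v \<in> carrier V" "v ~= \<zero>\<^bsub>V\<^esub>"
 obtains f where "linear_form K V f" "f v = \<one>\<^bsub>K\<^esub>"
proof -
 interpret K: field K by fact
 interpret V: module K V by fact
 note can = smult_cancel[OF assms(1,2,3,4)]
 let ?S = "{N. submodule N K V \<and> v \<notin> N}"
 have "submodule {\<zero>\<^bsub>V\<^esub>} K V" by (rule V.submoduleI) auto
 then have ne: "?S ~= {}" using assms(4) by blast
 have "\<exists>M\<in>?S. \<forall>Y\<in>?S. M \<subseteq> Y --> Y = M"
 proof (rule subset_Zorn_nonempty[OF ne])
  fix \<C> assume C: "\<C> ~= {}" "subset.chain ?S \<C>"
  have S: "submodule N K V" "v \<notin> N" if "N \<in> \<C>" for N using C(2) that unfolding subset.chain_def by auto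
  note E = V.submoduleE[OF S(1)]
  have "submodule (\<Union>\<C>) K V"
  proof (rule V.submoduleI)
   show "\<Union>\<C> \<subseteq> carrier V" using E(1) by blast
   show "\<zero>\<^bsub>V\<^esub> \<in> \<Union>\<C>" using C(1) subgroup.one_closed[OF submodule.axioms(1)[OF S(1)]] by fastforce
   fix a b assume "a \<in> \<Union>\<C>" "b \<in> \<Union>\<C>"
   then obtain N N' where N: "N \<in> \<C>" "N' \<in> \<C>" "a \<in> N" "b \<in> N'" by blast
   moreover have "N \<subseteq> N' \<or> N' \<subseteq> N" using C(2) N(1,2) unfolding subset.chain_def by blast
   ultimately show "a \<oplus>\<^bsub>V\<^esub> b \<in> \<Union>\<C>" using E(5)[OF N(1)] E(5)[OF N(2)] by blast
  qed (use E(3,4) in blast)+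
  then show "\<Union>\<C> \<in> ?S" using S(2) by blast
 qed
 then obtain M where M: "submodule M K V" "v \<notin> M"
  and max: "!!Y. submodule Y K V ==> v \<notin> Y ==> M \<subseteq> Y ==> Y = M" by blast
 note E = V.submoduleE[OF M(1)]
 have M0: "\<zero>\<^bsub>V\<^esub> \<in> M" using subgroup.one_closed[OF submodule.axioms(1)[OF M(1)]] by simp
 have mV: "m \<in> carrier V" if "m \<in> M" for m using that E(1) by blast
 have ex: "\<exists>c\<in>carrier K. \<exists>m\<in>M. w = m \<oplus>\<^bsub>V\<^esub> c \<odot>\<^bsub>V\<^esub> v" if w: "w \<in> carrier V" for w
 proof (cases "w \<in> M")
  case True
  then show ?thesis using w assms(3) by (intro bexI[of _ "\<zero>\<^bsub>K\<^esub>"] bexI[of _ w]) auto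
 next
  case False
  \<comment> \<open>For \<open>w\<close> outside \<open>M\<close>, maximality puts \<open>v\<close>
    into \<open>M + K w\<close>; its coefficient at \<open>w\<close> is non-zero, so the relation
    can be solved for \<open>w\<close>.\<close>
  let ?X = "{m \<oplus>\<^bsub>V\<^esub> c \<odot>\<^bsub>V\<^esub> w | m c. m \<in> M \<and> c \<in> carrier K}"
  have subm: "submodule ?X K V"
  proof (rule V.submoduleI)
   show "?X \<subseteq> carrier V" using mV w by auto
   have "\<zero>\<^bsub>V\<^esub> = \<zero>\<^bsub>V\<^esub> \<oplus>\<^bsub>V\<^esub> \<zero>\<^bsub>K\<^esub> \<odot>\<^bsub>V\<^esub> w" using w by simp
   then show "\<zero>\<^bsub>V\<^esub> \<in> ?X" using M0 by blast
  next
   fix a assume "a \<in> ?X"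
   then obtain m c where m: "m \<in> M" "c \<in> carrier K" "a = m \<oplus>\<^bsub>V\<^esub> c \<odot>\<^bsub>V\<^esub> w" by blast
   have "\<ominus>\<^bsub>V\<^esub> a = \<ominus>\<^bsub>V\<^esub> m \<oplus>\<^bsub>V\<^esub> (\<ominus>\<^bsub>K\<^esub> c) \<odot>\<^bsub>V\<^esub> w"
    unfolding m(3) using m(1,2) mV w by (simp add: V.minus_add V.smult_l_minus)
   then show "\<ominus>\<^bsub>V\<^esub> a \<in> ?X" using E(3)[OF m(1)] m(2) by blast
   {
    fix b assume "b \<in> ?X"
    then obtain m' c' where m': "m' \<in> M" "c' \<in> carrier K" "b = m' \<oplus>\<^bsub>V\<^esub> c' \<odot>\<^bsub>V\<^esub> w" by blast
    have "a \<oplus>\<^bsub>V\<^esub> b = (m \<oplus>\<^bsub>V\<^esub> m') \<oplus>\<^bsub>V\<^esub> (c \<oplus>\<^bsub>K\<^esub> c') \<odot>\<^bsub>V\<^esub> w"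
     unfolding m(3) m'(3) using m(1,2) m'(1,2) mV w by (simp add: V.smult_l_distr V.a_ac)
    then show "a \<oplus>\<^bsub>V\<^esub> b \<in> ?X" using E(5)[OF m(1) m'(1)] m(2) m'(2) by blast
   }
   fix k assume k: "k \<in> carrier K"
   have "k \<odot>\<^bsub>V\<^esub> a = k \<odot>\<^bsub>V\<^esub> m \<oplus>\<^bsub>V\<^esub> (k \<otimes>\<^bsub>K\<^esub> c) \<odot>\<^bsub>V\<^esub> w"
    unfolding m(3) using m(1,2) mV w k by (simp add: V.smult_r_distr V.smult_assoc1)
   then show "k \<odot>\<^bsub>V\<^esub> a \<in> ?X" using E(4)[OF k m(1)] m(2) k by blast
  qed
  have "M \<subseteq> ?X"
  proof
   fix m assume m: "m \<in> M"
   then have "m = m \<oplus>\<^bsub>V\<^esub> \<zero>\<^bsub>K\<^esub> \<odot>\<^bsub>V\<^esub> w" using mV w by simp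
   then show "m \<in> ?X" using m by blast
  qed
  moreover have "w \<in> ?X"
  proof -
   have "w = \<zero>\<^bsub>V\<^esub> \<oplus>\<^bsub>V\<^esub> \<one>\<^bsub>K\<^esub> \<odot>\<^bsub>V\<^esub> w" using w by simp
   then show ?thesis using M0 by blast
  qed
  ultimately have "v \<in> ?X" using max[OF subm] False by blast
  then obtain m c where m: "m \<in> M" "c \<in> carrier K" "v = m \<oplus>\<^bsub>V\<^esub> c \<odot>\<^bsub>V\<^esub> w" by blast
  have c: "c ~= \<zero>\<^bsub>K\<^esub>"
  proof
   assume "c = \<zero>\<^bsub>K\<^esub>"
   then have "v = m" using m mV w by simp
   then show False using m(1) M(2) by simp
  qed
  then have u: "c \<in> Units K" using m(2) by (simp add: K.field_Units)
  let ?d = "inv\<^bsub>K\<^esub> c"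
  have d: "?d \<in> carrier K" using u by simp
  have "?d \<odot>\<^bsub>V\<^esub> v = ?d \<odot>\<^bsub>V\<^esub> m \<oplus>\<^bsub>V\<^esub> w"
   unfolding m(3) using m(1,2) mV w d u by (simp add: V.smult_r_distr V.smult_assoc1[symmetric])
  then have "w = (\<ominus>\<^bsub>V\<^esub> (?d \<odot>\<^bsub>V\<^esub> m)) \<oplus>\<^bsub>V\<^esub> ?d \<odot>\<^bsub>V\<^esub> v"
   using w d m mV by (simp add: V.r_neg1)
  moreover have "\<ominus>\<^bsub>V\<^esub> (?d \<odot>\<^bsub>V\<^esub> m) \<in> M" using E(3)[OF E(4)[OF d m(1)]] .
  ultimately show ?thesis using d by blast
 qed
 have uniq: "c = c'" if "c \<in> carrier K" "c' \<in> carrier K" "m \<in> M" "m' \<in> M"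
  "m \<oplus>\<^bsub>V\<^esub> c \<odot>\<^bsub>V\<^esub> v = m' \<oplus>\<^bsub>V\<^esub> c' \<odot>\<^bsub>V\<^esub> v" for c c' m m'
 proof (rule ccontr)
  assume "c ~= c'"
  then have u: "c \<ominus>\<^bsub>K\<^esub> c' \<in> Units K" using that by (simp add: K.field_Units)
  let ?d = "inv\<^bsub>K\<^esub> (c \<ominus>\<^bsub>K\<^esub> c')"
  have "(c \<ominus>\<^bsub>K\<^esub> c') \<odot>\<^bsub>V\<^esub> v = c \<odot>\<^bsub>V\<^esub> v \<oplus>\<^bsub>V\<^esub> (\<ominus>\<^bsub>V\<^esub> (c' \<odot>\<^bsub>V\<^esub> v))"
   using that assms(3) by (simp add: K.minus_eq V.smult_l_distr V.smult_l_minus)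
  also have "... = (\<ominus>\<^bsub>V\<^esub> m) \<oplus>\<^bsub>V\<^esub> (m \<oplus>\<^bsub>V\<^esub> c \<odot>\<^bsub>V\<^esub> v) \<oplus>\<^bsub>V\<^esub> (\<ominus>\<^bsub>V\<^esub> (c' \<odot>\<^bsub>V\<^esub> v))"
   using that(1,2) mV[OF that(3)] mV[OF that(4)] assms(3) by (simp add: V.r_neg1)
  also have "... = (\<ominus>\<^bsub>V\<^esub> m) \<oplus>\<^bsub>V\<^esub> m'"
   unfolding that(5) using that mV assms(3) by (simp add: V.a_assoc V.r_neg)
  also have "... \<in> M" using E(5)[OF E(3)[OF that(3)] that(4)] .
  finally have "?d \<odot>\<^bsub>V\<^esub> ((c \<ominus>\<^bsub>K\<^esub> c') \<odot>\<^bsub>V\<^esub> v) \<in> M" using E(4) u by blast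
  then show False using M(2) u assms(3) that K.Units_inv_closed[OF u] by (simp add: V.smult_assoc1[symmetric])
 qed
 define f where "f w = (SOME c. c \<in> carrier K \<and> (\<exists>m\<in>M. w = m \<oplus>\<^bsub>V\<^esub> c \<odot>\<^bsub>V\<^esub> v))" for w
 have f: "f w \<in> carrier K \<and> (\<exists>m\<in>M. w = m \<oplus>\<^bsub>V\<^esub> f w \<odot>\<^bsub>V\<^esub> v)" if "w \<in> carrier V" for w
  unfolding f_def by (rule someI_ex) (use ex[OF that] in blast)
 have fI: "f w = c" if "c \<in> carrier K" "m \<in> M" "w = m \<oplus>\<^bsub>V\<^esub> c \<odot>\<^bsub>V\<^esub> v" for w c m
 proof -
  have "w \<in> carrier V" using that mV assms(3) by simp
  then show ?thesis using f uniq that by metis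
 qed
 show thesis
 proof (rule that)
  show "linear_form K V f"
  proof (rule linear_mapI)
   fix x assume x: "x \<in> carrier V"
   show "f x \<in> carrier (scalar_module K)" using f[OF x] by simp
   obtain m where m: "m \<in> M" "x = m \<oplus>\<^bsub>V\<^esub> f x \<odot>\<^bsub>V\<^esub> v" "f x \<in> carrier K" using f[OF x] by blast
   {
    fix y assume y: "y \<in> carrier V"
    obtain m' where m': "m' \<in> M" "y = m' \<oplus>\<^bsub>V\<^esub> f y \<odot>\<^bsub>V\<^esub> v" "f y \<in> carrier K" using f[OF y] by blast
    have "x \<oplus>\<^bsub>V\<^esub> y = (m \<oplus>\<^bsub>V\<^esub> f x \<odot>\<^bsub>V\<^esub> v) \<oplus>\<^bsub>V\<^esub> (m' \<oplus>\<^bsub>V\<^esub> f y \<odot>\<^bsub>V\<^esub> v)"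
     using m(2) m'(2) by simp
    also have "... = (m \<oplus>\<^bsub>V\<^esub> m') \<oplus>\<^bsub>V\<^esub> (f x \<oplus>\<^bsub>K\<^esub> f y) \<odot>\<^bsub>V\<^esub> v"
     using m(1,3) m'(1,3) mV assms(3) by (simp add: V.smult_l_distr V.a_ac)
    finally show "f (x \<oplus>\<^bsub>V\<^esub> y) = f x \<oplus>\<^bsub>scalar_module K\<^esub> f y"
     using fI[OF _ E(5)[OF m(1) m'(1)], of "f x \<oplus>\<^bsub>K\<^esub> f y" "x \<oplus>\<^bsub>V\<^esub> y"] m(3) m'(3) by simp
   }
   fix k assume k: "k \<in> carrier K"
   have "k \<odot>\<^bsub>V\<^esub> x = k \<odot>\<^bsub>V\<^esub> (m \<oplus>\<^bsub>V\<^esub> f x \<odot>\<^bsub>V\<^esub> v)" using m(2) by simp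
   also have "... = k \<odot>\<^bsub>V\<^esub> m \<oplus>\<^bsub>V\<^esub> (k \<otimes>\<^bsub>K\<^esub> f x) \<odot>\<^bsub>V\<^esub> v"
    using m(1,3) mV assms(3) k by (simp add: V.smult_r_distr V.smult_assoc1)
   finally show "f (k \<odot>\<^bsub>V\<^esub> x) = k \<odot>\<^bsub>scalar_module K\<^esub> f x"
    using fI[OF _ E(4)[OF k m(1)], of "k \<otimes>\<^bsub>K\<^esub> f x" "k \<odot>\<^bsub>V\<^esub> x"] m(3) k by simp
  qed
  show "f v = \<one>\<^bsub>K\<^esub>" using fI[OF _ M0, of "\<one>\<^bsub>K\<^esub>" v] assms(3) by simp
 qed
qed

lemma (in abelian_monoid) finsum_product:
 assumes "finite A" "finite B" "!!i j. i \<in> A ==> j \<in> B ==> f (i, j) \<in> carrier G"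
 shows "(\<Oplus>z\<in>A \<times> B. f z) = (\<Oplus>i\<in>A. \<Oplus>j\<in>B. f (i, j))"
 using assms(1,3)
proof (induction A)
 case (insert a A)
 then have c: "!!j. j \<in> B ==> f (a, j) \<in> carrier G" "!!i j. i \<in> A ==> j \<in> B ==> f (i, j) \<in> carrier G"
  by auto
 have e: "insert a A \<times> B = Pair a ` B \<union> A \<times> B" by auto
 have "(\<Oplus>z\<in>insert a A \<times> B. f z) = (\<Oplus>z\<in>Pair a ` B. f z) \<oplus> (\<Oplus>z\<in>A \<times> B. f z)"
  unfolding e using insert(1,2) assms(2) c by (intro finsum_Un_disjoint) auto
 also have "(\<Oplus>z\<in>Pair a ` B. f z) = (\<Oplus>j\<in>B. f (a, j))"
  using c by (intro finsum_reindex) (auto simp: inj_on_def)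
 finally show ?case
  using insert c by (subst finsum_insert) (auto intro!: finsum_closed)
qed simp

lemma (in tensor_product) lift_finsum:
 assumes V: "module K V" and S: "finite S" and \<beta>: "!!i. i \<in> S ==> bilinear_map K A B V (\<beta> i)"
  and u: "u \<in> carrier T"
 shows "tensor_lift K V (%a b. \<Oplus>\<^bsub>V\<^esub>i\<in>S. \<beta> i a b) u = (\<Oplus>\<^bsub>V\<^esub>i\<in>S. tensor_lift K V (\<beta> i) u)"
proof -
 interpret V: module K V by fact
 have b: "bilinear_map K A B V (%a b. \<Oplus>\<^bsub>V\<^esub>i\<in>S. \<beta> i a b)"
  by (intro bilinear_mapI linear_map_finsum_fun V S bilinear_map_left[OF \<beta>] bilinear_map_right[OF \<beta>])
 show ?thesis
 proof (rule linear_maps_eq[OF V lift_linear[OF V b] linear_map_finsum_fun[OF V S lift_linear[OF V \<beta>]] _ u])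
  fix a b' assume ab: "a \<in> carrier A" "b' \<in> carrier B"
  show "tensor_lift K V (%a b. \<Oplus>\<^bsub>V\<^esub>i\<in>S. \<beta> i a b) (tensor K A B a b') = (\<Oplus>\<^bsub>V\<^esub>i\<in>S. tensor_lift K V (\<beta> i) (tensor K A B a b'))"
   unfolding lift_tensor[OF V b ab]
   by (rule V.finsum_cong'[OF refl]) (use bilinear_map_closed[OF \<beta> ab] in \<open>auto simp: lift_tensor[OF V \<beta> ab]\<close>)
 qed
qed

text \<open>The pairs of points with product one are those of the form
  \<open>(inv y, y)\<close>.\<close>

lemma (in group_functions) comult_point_mass_one:
 "comult A (\<delta> \<one>\<^bsub>L\<^esub>) = (\<Oplus>\<^bsub>AA.T\<^esub>y\<in>carrier L. tensor K A A (\<delta> (inv\<^bsub>L\<^esub> y)) (\<delta> y))"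
proof (rule tensor_A_eqI[OF comult_A_closed[OF \<delta>_closed]])
 have tc: "tensor K A A (\<delta> (inv\<^bsub>L\<^esub> y)) (\<delta> y) \<in> carrier AA.T" for y
  by (rule AA.tensor_closed[OF \<delta>_closed \<delta>_closed])
 then show "(\<Oplus>\<^bsub>AA.T\<^esub>y\<in>carrier L. tensor K A A (\<delta> (inv\<^bsub>L\<^esub> y)) (\<delta> y)) \<in> carrier AA.T"
  by (intro AA.T.finsum_closed) blast
 fix a b assume ab: "a \<in> carrier L" "b \<in> carrier L"
 note bl = eval_eval_bilinear[OF ab]
 have "tensor_lift K (scalar_module K) (%f g. f a \<otimes>\<^bsub>K\<^esub> g b)
   (\<Oplus>\<^bsub>AA.T\<^esub>y\<in>carrier L. tensor K A A (\<delta> (inv\<^bsub>L\<^esub> y)) (\<delta> y)) =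
  (\<Oplus>\<^bsub>scalar_module K\<^esub>y\<in>carrier L. tensor_lift K (scalar_module K) (%f g. f a \<otimes>\<^bsub>K\<^esub> g b) (tensor K A A (\<delta> (inv\<^bsub>L\<^esub> y)) (\<delta> y)))"
  using tc by (intro linear_map_finsum[OF AA.T.module_axioms mod_K AA.lift_linear[OF mod_K bl] finite_L]) blast
 also have "... = (\<Oplus>\<^bsub>K\<^esub>y\<in>carrier L. if b = y then \<delta> (inv\<^bsub>L\<^esub> y) a else \<zero>\<^bsub>K\<^esub>)"
  unfolding finsum_scalar_module AA.lift_tensor[OF mod_K bl \<delta>_closed \<delta>_closed]
  using ab by (intro K.finsum_cong') (auto simp: \<delta>_apply)
 also have "... = \<delta> (inv\<^bsub>L\<^esub> b) a"
  using ab finite_L by (subst K.finsum_singleton) (auto simp: \<delta>_apply)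
 also have "... = \<delta> \<one>\<^bsub>L\<^esub> (a \<otimes>\<^bsub>L\<^esub> b)"
 proof -
  have "a = inv\<^bsub>L\<^esub> b \<longleftrightarrow> a \<otimes>\<^bsub>L\<^esub> b = \<one>\<^bsub>L\<^esub>" using ab by (metis L.inv_equality L.l_inv)
  then show ?thesis using ab by (simp add: \<delta>_apply)
 qed
 finally show "tensor_lift K (scalar_module K) (%f g. f a \<otimes>\<^bsub>K\<^esub> g b) (comult A (\<delta> \<one>\<^bsub>L\<^esub>)) =
  tensor_lift K (scalar_module K) (%f g. f a \<otimes>\<^bsub>K\<^esub> g b)
   (\<Oplus>\<^bsub>AA.T\<^esub>y\<in>carrier L. tensor K A A (\<delta> (inv\<^bsub>L\<^esub> y)) (\<delta> y))"
  unfolding eval_comult[OF \<delta>_closed ab] by simp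
qed

text \<open>Translation affects the last leg of a coproduct alone: by coassociativity both sides are
  \<open>\<beta>(h1, h2) \<psi>(h3)\<close>.\<close>

lemma (in hopf_algebra) sw_right_translate:
 assumes V: "module K V" and \<beta>: "bilinear_map K H H V \<beta>" and \<psi>: "linear_form K H \<psi>" and h: "h \<in> carrier H"
 shows "sw V (%a b. \<beta> a (right_translate \<psi> b)) h = sw V \<beta> (right_translate \<psi> h)"
proof -
 note c = linear_map_closed[OF \<psi>, simplified]
 note tb = translate_bilinear[OF \<psi>]
 note l = sw_linear[OF V \<beta>]
 interpret V: module K V by (rule V)
 have tri: "trilinear_map K H H H V (%x y z. \<psi> z \<odot>\<^bsub>V\<^esub> \<beta> x y)"
  by (intro trilinear_mapI linear_map_smult_fun[OF V] linear_map_form_smult[OF V] c \<psi>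
    bilinear_map_left[OF \<beta>] bilinear_map_right[OF \<beta>] bilinear_map_closed[OF \<beta>])
 have "sw V \<beta> (right_translate \<psi> h) = sw V (%a z. sw V \<beta> (\<psi> z \<bullet> a)) h"
  unfolding right_translate_def[of \<psi> h] by (rule sw_post[OF mod_H V tb l h])
 also have "... = sw V (%a z. sw V (%x y. \<psi> z \<odot>\<^bsub>V\<^esub> \<beta> x y) a) h"
 proof (rule sw_cong[OF V bilinear_map_post[OF tb l] h])
  fix a z assume az: "a \<in> carrier H" "z \<in> carrier H"
  show "sw V \<beta> (\<psi> z \<bullet> a) = sw V (%x y. \<psi> z \<odot>\<^bsub>V\<^esub> \<beta> x y) a"
   unfolding linear_map_smult[OF l c[OF az(2)] az(1)]
   by (rule sw_post[OF V V \<beta> linear_map_smult_fun[OF V c[OF az(2)] linear_map_id] az(1)])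
 qed
 also have "... = sw V (%a z. sw V (%y w. \<psi> w \<odot>\<^bsub>V\<^esub> \<beta> a y) z) h"
  by (rule sw_coassoc[OF V tri h])
 also have "... = sw V (%a b. \<beta> a (right_translate \<psi> b)) h"
 proof (rule sw_cong[OF V _ h, symmetric])
  show "bilinear_map K H H V (%a b. \<beta> a (right_translate \<psi> b))"
   by (rule bilinear_map_comp[OF \<beta> linear_map_id right_translate_linear[OF \<psi>]])
  fix a b assume ab: "a \<in> carrier H" "b \<in> carrier H"
  note la = bilinear_map_right[OF \<beta> ab(1)]
  have "\<beta> a (right_translate \<psi> b) = sw V (%y w. \<beta> a (\<psi> w \<bullet> y)) b"
   unfolding right_translate_def by (rule sw_post[OF mod_H V tb la ab(2)])
  also have "... = sw V (%y w. \<psi> w \<odot>\<^bsub>V\<^esub> \<beta> a y) b"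
   by (rule sw_cong[OF V bilinear_map_post[OF tb la] ab(2)]) (simp add: linear_map_smult[OF la c])
  finally show "\<beta> a (right_translate \<psi> b) = sw V (%y w. \<psi> w \<odot>\<^bsub>V\<^esub> \<beta> a y) b" .
 qed
 finally show ?thesis ..
qed

section \<open>Commutative extensions split\<close>

lemma module_add_left_eq_self:
 assumes "module K V" "a \<in> carrier V" "b \<in> carrier V" "b = a \<oplus>\<^bsub>V\<^esub> b"
 shows "a = \<zero>\<^bsub>V\<^esub>"
proof -
 interpret V: module K V by fact
 show ?thesis using V.add.right_cancel[OF assms(3,2) V.zero_closed] V.l_zero[OF assms(3)] assms(4) by argo
qed

declare function_hopf_simps [simp del]

locale commutative_extension = U: root_of_unity_field K p \<zeta> + comm_hopf_algebra K H + G: group_functions K G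
 for K :: "('k, 'm) ring_scheme" and p :: nat and \<zeta> :: 'k and H :: "('k, 'h) hopf_data"
  and G :: "('g, 'n) monoid_scheme" +
 fixes \<iota> :: "('g => 'k) => 'h" and \<pi> :: "'h => int => 'k"
 assumes \<iota>: "\<iota> \<in> hopf_hom K (function_hopf K G) H"
  and \<pi>: "\<pi> \<in> hopf_hom K H (group_hopf K (integer_mod_group p))"
  and \<iota>_inj: "inj_on \<iota> (carrier (function_hopf K G))"
  and \<pi>_surj: "\<pi> ` carrier H = carrier (group_hopf K (integer_mod_group p))"
  and \<pi>_kernel: "a_kernel H (group_hopf K (integer_mod_group p)) \<pi> =
   augmentation_ideal_span K H (\<iota> ` carrier (function_hopf K G))"
begin

lemmas \<iota>D = hopf_homD[OF \<iota>] and \<pi>D = hopf_homD[OF \<pi>]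

text \<open>The orthogonal idempotents that cut \<open>H\<close> into blocks indexed by
  \<open>G\<close>.\<close>

definition e :: "'g => 'h" where "e x = \<iota> (G.\<delta> x)"

lemma e_closed [simp]: "e x \<in> carrier H"
 unfolding e_def by (rule \<iota>D(6)[OF G.\<delta>_closed])

lemma \<iota>_e:
 assumes f: "f \<in> carrier G.A" and x: "x \<in> carrier G"
 shows "\<iota> f \<star> e x = f x \<bullet> e x"
proof -
 have fc: "f y \<in> carrier K" if "y \<in> carrier G" for y using f that by (auto simp: function_hopf_simps)
 have "f \<otimes>\<^bsub>G.A\<^esub> G.\<delta> x = f x \<odot>\<^bsub>G.A\<^esub> G.\<delta> x"
  by (rule G.fn_ext[OF G.A.m_closed[OF f G.\<delta>_closed] G.smult_closed[OF fc[OF x] G.\<delta>_closed]])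
   (simp add: G.\<delta>_apply fc x function_hopf_simps)
 then show ?thesis
  unfolding e_def using ring_hom_mult[OF \<iota>D(2) f G.\<delta>_closed[of x]] linear_map_smult[OF \<iota>D(1) fc[OF x] G.\<delta>_closed[of x]]
  by metis
qed

lemma e_orth:
 assumes "x \<in> carrier G" "y \<in> carrier G"
 shows "e x \<star> e y = (if x = y then e y else \<zero>\<^bsub>H\<^esub>)"
 using \<iota>_e[OF G.\<delta>_closed assms(2), of x] assms by (simp add: e_def[of x, symmetric] G.\<delta>_apply)

lemma e_sum: "(\<Oplus>\<^bsub>H\<^esub>x\<in>carrier G. e x) = \<one>\<^bsub>H\<^esub>"
proof -
 have o: "\<one>\<^bsub>G.A\<^esub> \<in> carrier G.A" by (rule G.A.one_closed)
 have c: "\<one>\<^bsub>G.A\<^esub> x \<odot>\<^bsub>G.A\<^esub> G.\<delta> x = G.\<delta> x" if "x \<in> carrier G" for x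
  using that G.smult_one[OF G.\<delta>_closed] by (simp add: function_hopf_simps(3))
 have "\<one>\<^bsub>G.A\<^esub> = (\<Oplus>\<^bsub>G.A\<^esub>x\<in>carrier G. \<one>\<^bsub>G.A\<^esub> x \<odot>\<^bsub>G.A\<^esub> G.\<delta> x)"
  using G.dual_system_eval o unfolding dual_system_def by blast
 also have "... = (\<Oplus>\<^bsub>G.A\<^esub>x\<in>carrier G. G.\<delta> x)"
  using c G.\<delta>_closed by (intro G.M.finsum_cong') (simp_all del: function_hopf_simps)
 finally have "\<iota> \<one>\<^bsub>G.A\<^esub> = \<iota> (\<Oplus>\<^bsub>G.A\<^esub>x\<in>carrier G. G.\<delta> x)" by (rule arg_cong)
 also have "... = (\<Oplus>\<^bsub>H\<^esub>x\<in>carrier G. e x)"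
  unfolding e_def by (rule linear_map_finsum[OF G.mod_A mod_H \<iota>D(1) G.finite_L Pi_I[OF G.\<delta>_closed]])
 finally show ?thesis using ring_hom_one[OF \<iota>D(2)] by simp
qed

lemma e_nonzero:
 assumes x: "x \<in> carrier G"
 shows "e x ~= \<zero>\<^bsub>H\<^esub>"
proof
 assume "e x = \<zero>\<^bsub>H\<^esub>"
 then have "\<iota> (G.\<delta> x) = \<iota> \<zero>\<^bsub>G.A\<^esub>" unfolding e_def using linear_map_zero[OF G.mod_A mod_H \<iota>D(1)] by simp
 then have "G.\<delta> x = \<zero>\<^bsub>G.A\<^esub>" by (rule inj_onD[OF \<iota>_inj _ G.\<delta>_closed G.M.zero_closed])
 then have "G.\<delta> x x = \<zero>\<^bsub>G.A\<^esub> x" by simp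
 then show False using x G.\<delta>_apply[OF x, of x] by (simp add: function_hopf_simps(4))
qed

abbreviation "e1 \<equiv> e \<one>\<^bsub>G\<^esub>"

lemma kernel_mult:
 assumes f: "f \<in> carrier G.A" and "f \<one>\<^bsub>G\<^esub> = \<zero>\<^bsub>K\<^esub>" and h: "h \<in> carrier H"
 shows "\<pi> (\<iota> f \<star> h) = \<zero>\<^bsub>U.B\<^esub>"
proof -
 have "counit H (\<iota> f) = \<zero>\<^bsub>K\<^esub>" using \<iota>D(4)[OF f] assms(2) by (simp add: function_hopf_simps(7))
 then have "\<iota> f \<star> h \<in> augmentation_ideal_span K H (\<iota> ` carrier G.A)"
  unfolding augmentation_ideal_span_def using f h by (intro subsetD[OF span_in_superset]) blast
 then show ?thesis unfolding \<pi>_kernel[symmetric] a_kernel_def' by blast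
qed

text \<open>The kernel is spanned by products \<open>\<iota>(f) h\<close> with \<open>f\<close>
  vanishing at the identity, and \<open>e1\<close> annihilates each such \<open>\<iota>(f)\<close>.
  So multiplication by \<open>e1\<close> factors through \<pi>, and the block at the identity has
  dimension at most \<open>p\<close>.\<close>

lemma \<pi>_kernelD:
 assumes "h \<in> carrier H" "\<pi> h = \<zero>\<^bsub>U.B\<^esub>"
 shows "e1 \<star> h = \<zero>\<^bsub>H\<^esub>"
proof -
 have sub: "submodule {h \<in> carrier H. e1 \<star> h = \<zero>\<^bsub>H\<^esub>} K H"
  by (rule linear_map_kernel_submodule[OF mod_H mod_H mult_linear_right[OF e_closed]])
 have "{a \<star> h | a h. a \<in> \<iota> ` carrier G.A \<and> counit H a = \<zero>\<^bsub>K\<^esub> \<and> h \<in> carrier H} \<subseteq>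
   {h \<in> carrier H. e1 \<star> h = \<zero>\<^bsub>H\<^esub>}"
 proof clarify
  fix f h assume f: "f \<in> carrier G.A" and z: "counit H (\<iota> f) = \<zero>\<^bsub>K\<^esub>" and h: "h \<in> carrier H"
  have "f \<one>\<^bsub>G\<^esub> = \<zero>\<^bsub>K\<^esub>" using z \<iota>D(4)[OF f] by (simp add: function_hopf_simps(7))
  then have "\<iota> f \<star> e1 = \<zero>\<^bsub>H\<^esub>" using \<iota>_e[OF f G.L.one_closed] by simp
  then show "\<iota> f \<star> h \<in> carrier H \<and> e1 \<star> (\<iota> f \<star> h) = \<zero>\<^bsub>H\<^esub>"
   using \<iota>D(6)[OF f] h by (simp add: A.m_assoc[symmetric] H_comm[OF e_closed \<iota>D(6)[OF f]])
 qed
 from span_in_minimal[OF this sub]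
 have "a_kernel H U.B \<pi> \<subseteq> {h \<in> carrier H. e1 \<star> h = \<zero>\<^bsub>H\<^esub>}"
  unfolding \<pi>_kernel augmentation_ideal_span_def .
 then show ?thesis using assms unfolding a_kernel_def' by blast
qed

text \<open>Characters of the cyclic group pulled back to \<open>H\<close>. Exponents add under
  convolution (\<open>\<psi>_conv\<close>), and \<open>\<psi> 0\<close> is the counit.\<close>

definition \<psi> :: "nat => 'h => 'k" where "\<psi> j h = U.chi j (\<pi> h)"

lemma \<pi>_F: "h \<in> carrier H ==> \<pi> h \<in> carrier U.F"
 using \<pi>D(6) U.B_structure(1) by blast

lemma \<psi>_form: "linear_form K H (\<psi> j)"
 unfolding \<psi>_def[abs_def] by (rule linear_map_comp[OF U.chi_form \<pi>D(1)])

lemma \<psi>_closed [simp]: "h \<in> carrier H ==> \<psi> j h \<in> carrier K"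
 using linear_map_closed[OF \<psi>_form] by simp

lemma \<psi>_mult: "g \<in> carrier H ==> h \<in> carrier H ==> \<psi> j (g \<star> h) = \<psi> j g \<otimes>\<^bsub>K\<^esub> \<psi> j h"
 unfolding \<psi>_def ring_hom_mult[OF \<pi>D(2)] by (rule U.chi_mult[OF \<pi>_F \<pi>_F])

lemma \<psi>_one: "\<psi> j \<one>\<^bsub>H\<^esub> = \<one>\<^bsub>K\<^esub>"
 unfolding \<psi>_def ring_hom_one[OF \<pi>D(2)] by (rule U.chi_one)

lemma \<psi>_hom: "\<psi> j \<in> ring_hom H K"
 by (rule ring_hom_memI) (use linear_map_add[OF \<psi>_form] in \<open>simp_all add: \<psi>_mult \<psi>_one\<close>)

lemma \<psi>_0: "h \<in> carrier H ==> \<psi> 0 h = counit H h"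
 unfolding \<psi>_def U.B_counit_chi[OF \<pi>_F, symmetric] by (rule \<pi>D(4))

lemma \<psi>_mod: "\<psi> (j mod p) h = \<psi> j h"
 unfolding \<psi>_def by (rule U.chi_mod)

text \<open>Subtracting the constant \<open>f \<one>\<close> gives a function vanishing at the
  identity, whose image \<pi> kills. So every \<open>\<psi> j\<close> restricts to the counit on
  functions.\<close>

lemma \<psi>_\<iota>:
 assumes f: "f \<in> carrier G.A"
 shows "\<psi> j (\<iota> f) = f \<one>\<^bsub>G\<^esub>"
proof -
 have c: "f \<one>\<^bsub>G\<^esub> \<in> carrier K" using f by (auto simp: function_hopf_simps)
 note oc = G.smult_closed[OF c G.A.one_closed]
 let ?f = "f \<ominus>\<^bsub>G.A\<^esub> (f \<one>\<^bsub>G\<^esub> \<odot>\<^bsub>G.A\<^esub> \<one>\<^bsub>G.A\<^esub>)"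
 have fc: "?f \<in> carrier G.A" using f oc by (rule G.M.minus_closed)
 have fe: "f = ?f \<oplus>\<^bsub>G.A\<^esub> (f \<one>\<^bsub>G\<^esub> \<odot>\<^bsub>G.A\<^esub> \<one>\<^bsub>G.A\<^esub>)"
  using f oc by (simp add: G.M.minus_eq G.M.a_assoc G.M.l_neg)
 have "f \<one>\<^bsub>G\<^esub> = ?f \<one>\<^bsub>G\<^esub> \<oplus>\<^bsub>K\<^esub> f \<one>\<^bsub>G\<^esub>"
  using fun_cong[OF fe, of "\<one>\<^bsub>G\<^esub>"] c by (simp add: function_hopf_simps(3,5,6))
 moreover have "?f \<one>\<^bsub>G\<^esub> \<in> carrier K" using fc by (auto simp: function_hopf_simps(1))
 ultimately have z: "?f \<one>\<^bsub>G\<^esub> = \<zero>\<^bsub>K\<^esub>"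
  using c U.add.right_cancel[OF c _ U.zero_closed, of "?f \<one>\<^bsub>G\<^esub>"] by simp
 have i: "\<iota> ?f \<in> carrier H" by (rule \<iota>D(6)[OF fc])
 have "\<psi> j (\<iota> ?f) = U.chi j \<zero>\<^bsub>U.B\<^esub>"
  using kernel_mult[OF fc z A.one_closed] i by (simp add: \<psi>_def)
 also have "... = \<zero>\<^bsub>K\<^esub>" using linear_map_zero[OF U.mod_B U.mod_K U.chi_form] by simp
 finally have 0: "\<psi> j (\<iota> ?f) = \<zero>\<^bsub>K\<^esub>" .
 have "\<iota> f = \<iota> ?f \<oplus>\<^bsub>H\<^esub> f \<one>\<^bsub>G\<^esub> \<bullet> \<one>\<^bsub>H\<^esub>"
  by (subst fe, subst linear_map_add[OF \<iota>D(1) fc oc], subst linear_map_smult[OF \<iota>D(1) c G.A.one_closed])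
   (simp only: ring_hom_one[OF \<iota>D(2)])
 then have "\<psi> j (\<iota> f) = \<psi> j (\<iota> ?f \<oplus>\<^bsub>H\<^esub> f \<one>\<^bsub>G\<^esub> \<bullet> \<one>\<^bsub>H\<^esub>)" by (rule arg_cong)
 also have "... = \<psi> j (\<iota> ?f) \<oplus>\<^bsub>K\<^esub> \<psi> j (f \<one>\<^bsub>G\<^esub> \<bullet> \<one>\<^bsub>H\<^esub>)"
  using linear_map_add[OF \<psi>_form i smult_closed[OF c A.one_closed]] by simp
 also have "\<psi> j (f \<one>\<^bsub>G\<^esub> \<bullet> \<one>\<^bsub>H\<^esub>) = f \<one>\<^bsub>G\<^esub>"
  using linear_map_smult[OF \<psi>_form c A.one_closed] c by (simp add: \<psi>_one)
 finally show ?thesis using c by (simp add: 0)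
qed

lemma \<psi>_conv:
 assumes h: "h \<in> carrier H"
 shows "\<psi> i (right_translate (\<psi> j) h) = \<psi> (i + j) h"
proof -
 have "\<psi> i (right_translate (\<psi> j) h) = sw (scalar_module K) (%a b. \<psi> i a \<otimes>\<^bsub>K\<^esub> \<psi> j b) h"
  by (rule form_right_translate[OF \<psi>_form \<psi>_form h])
 also have "... = tensor_lift K (scalar_module K) (%a b. U.chi i a \<otimes>\<^bsub>K\<^esub> U.chi j b) (comult U.B (\<pi> h))"
  unfolding \<psi>_def by (rule lift_hopf_hom[OF U.mod_B hopf_algebra_axioms \<pi> mod_K U.chi_chi_bilinear h, symmetric])
 also have "... = \<psi> (i + j) h" unfolding \<psi>_def by (rule U.chi_chi_comult[OF \<pi>_F[OF h]])
 finally show ?thesis .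
qed

text \<open>Encodes the grading: \<rho> generates the action of \<open>Z/p\<close> dual to the
  coaction induced by \<pi>, and the eigenspace for \<open>\<zeta> [^] j\<close> is the component of
  degree \<open>j\<close>.\<close>

definition \<rho> :: "'h => 'h" where "\<rho> = right_translate (\<psi> 1)"

lemma \<rho>_linear: "linear_map K H H \<rho>"
 unfolding \<rho>_def by (rule right_translate_linear[OF \<psi>_form])

lemma \<rho>_closed [simp]: "h \<in> carrier H ==> \<rho> h \<in> carrier H"
 by (rule linear_map_closed[OF \<rho>_linear])

lemma \<rho>_mult: "g \<in> carrier H ==> h \<in> carrier H ==> \<rho> (g \<star> h) = \<rho> g \<star> \<rho> h"
 unfolding \<rho>_def by (rule right_translate_mult[OF \<psi>_hom \<psi>_form])

lemma \<rho>_pow: "h \<in> carrier H ==> (\<rho> ^^ j) h = right_translate (\<psi> j) h"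
proof (induction j)
 case 0
 then show ?case
  using right_translate_cong[OF \<psi>_form \<psi>_0 0] right_translate_counit[OF 0] by simp
next
 case (Suc j)
 have "\<rho> (right_translate (\<psi> j) h) = right_translate (%x. \<psi> 1 (right_translate (\<psi> j) x)) h"
  unfolding \<rho>_def by (rule right_translate_comp[OF \<psi>_form \<psi>_form Suc(2)])
 also have "... = right_translate (\<psi> (Suc j)) h"
  by (rule right_translate_cong[OF _ _ Suc(2)])
   (auto intro: linear_map_comp[OF \<psi>_form right_translate_linear[OF \<psi>_form]] simp: \<psi>_conv)
 finally show ?case using Suc by simp
qed

lemma \<rho>_pow_p: "h \<in> carrier H ==> (\<rho> ^^ p) h = h"
proof -
 assume h: "h \<in> carrier H"
 have "right_translate (\<psi> p) h = right_translate (\<psi> 0) h"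
  by (rule right_translate_cong[OF \<psi>_form _ h]) (use \<psi>_mod[of p] in simp)
 then show ?thesis using \<rho>_pow[OF h, of p] \<rho>_pow[OF h, of 0] by simp
qed

text \<open>On functions \<open>\<psi> 1\<close> is the counit, so translation by it does nothing
  there: functions have degree zero.\<close>

lemma \<rho>_\<iota>:
 assumes f: "f \<in> carrier G.A"
 shows "\<rho> (\<iota> f) = \<iota> f"
proof -
 interpret GA: hopf_algebra K G.A by (rule G.hopf_algebra_function_hopf)
 note tb = translate_bilinear[OF \<psi>_form, of 1] and tb' = GA.translate_bilinear[OF GA.counit_form]
 have b: "bilinear_map K G.A G.A H (%a b. \<psi> 1 (\<iota> b) \<bullet> \<iota> a)"
  by (rule bilinear_map_comp[OF tb \<iota>D(1) \<iota>D(1)])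
 have "\<rho> (\<iota> f) = tensor_lift K H (%a b. \<psi> 1 (\<iota> b) \<bullet> \<iota> a) (comult G.A f)"
  unfolding \<rho>_def right_translate_def
  by (rule lift_hopf_hom[OF mod_H G.hopf_algebra_function_hopf \<iota> mod_H tb f])
 also have "... = tensor_lift K H (%a b. \<iota> (counit G.A b \<odot>\<^bsub>G.A\<^esub> a)) (comult G.A f)"
  by (rule GA.sw_cong[OF mod_H b f])
   (simp add: \<psi>_\<iota> linear_map_smult[OF \<iota>D(1) GA.counit_closed], simp add: function_hopf_simps(7))
 also have "... = \<iota> (tensor_lift K G.A (%a b. counit G.A b \<odot>\<^bsub>G.A\<^esub> a) (comult G.A f))"
  by (rule GA.sw_post[OF G.mod_A mod_H tb' \<iota>D(1) f, symmetric])
 finally show ?thesis unfolding GA.counit_right[OF f] .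
qed

lemma \<rho>_e: "\<rho> (e x) = e x"
 unfolding e_def by (rule \<rho>_\<iota>[OF G.\<delta>_closed])

lemma antipode_e: "x \<in> carrier G ==> antipode H (e x) = e (inv\<^bsub>G\<^esub> x)"
proof -
 assume x: "x \<in> carrier G"
 have "antipode G.A (G.\<delta> x) = G.\<delta> (inv\<^bsub>G\<^esub> x)"
  by (rule G.fn_ext[OF linear_map_closed[OF G.antipode_A_linear G.\<delta>_closed] G.\<delta>_closed])
   (use x in \<open>auto simp: G.\<delta>_apply function_hopf_simps(8)\<close>)
 then show ?thesis unfolding e_def using \<iota>D(5)[OF G.\<delta>_closed, of x] by simp
qed

text \<open>The coproduct of \<open>e1\<close> is the sum of all
  \<open>e (inv y) \<otimes> e y\<close>; the last hypothesis isolates the summand at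
  \<open>x\<close>.\<close>

lemma sw_e1:
 assumes V: "module K V" and \<beta>: "bilinear_map K H H V \<beta>" and x: "x \<in> carrier G"
  and z: "!!y. y \<in> carrier G ==> y ~= x ==> \<beta> (e (inv\<^bsub>G\<^esub> y)) (e y) = \<zero>\<^bsub>V\<^esub>"
 shows "sw V \<beta> e1 = \<beta> (e (inv\<^bsub>G\<^esub> x)) (e x)"
proof -
 interpret V: module K V by fact
 have bl: "bilinear_map K G.A G.A V (%a b. \<beta> (\<iota> a) (\<iota> b))" by (rule bilinear_map_comp[OF \<beta> \<iota>D(1) \<iota>D(1)])
 have bc: "\<beta> (e y) (e y') \<in> carrier V" for y y' by (rule bilinear_map_closed[OF \<beta> e_closed e_closed])
 have "sw V \<beta> e1 = tensor_lift K V (%a b. \<beta> (\<iota> a) (\<iota> b)) (comult G.A (G.\<delta> \<one>\<^bsub>G\<^esub>))"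
  unfolding e_def by (rule lift_hopf_hom[OF mod_H G.hopf_algebra_function_hopf \<iota> V \<beta> G.\<delta>_closed])
 also have "... = (\<Oplus>\<^bsub>V\<^esub>y\<in>carrier G. tensor_lift K V (%a b. \<beta> (\<iota> a) (\<iota> b)) (tensor K G.A G.A (G.\<delta> (inv\<^bsub>G\<^esub> y)) (G.\<delta> y)))"
  unfolding G.comult_point_mass_one
  by (rule linear_map_finsum[OF G.AA.T.module_axioms V G.AA.lift_linear[OF V bl] G.finite_L])
   (rule Pi_I, rule G.AA.tensor_closed[OF G.\<delta>_closed G.\<delta>_closed])
 also have "... = (\<Oplus>\<^bsub>V\<^esub>y\<in>carrier G. if x = y then \<beta> (e (inv\<^bsub>G\<^esub> y)) (e y) else \<zero>\<^bsub>V\<^esub>)"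
  unfolding G.AA.lift_tensor[OF V bl G.\<delta>_closed G.\<delta>_closed] e_def[symmetric]
  using bc z by (intro V.finsum_cong') auto
 also have "... = \<beta> (e (inv\<^bsub>G\<^esub> x)) (e x)"
  using bc x G.finite_L by (subst V.finsum_singleton) auto
 finally show ?thesis .
qed

text \<open>Choose preimages \<open>g j\<close> of the dual basis \<open>chi_dual j\<close>. Then
  \<open>h\<close> and the combination of the \<open>g j\<close> with coefficients
  \<open>\<psi> j h\<close> have the same image under \<pi>, so \<open>e1\<close> does not
  distinguish them; \<open>v j\<close> is \<open>e1 \<star> g j\<close>.\<close>

lemma e1_expand:
 obtains v where "!!j. v j \<in> carrier H"
  "!!h. h \<in> carrier H ==> e1 \<star> h = (\<Oplus>\<^bsub>H\<^esub>j\<in>{..<p}. \<psi> j h \<bullet> v j)"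
proof -
 have "\<exists>h\<in>carrier H. \<pi> h = U.chi_dual j" for j
  using \<pi>_surj U.chi_dual_closed[of j] unfolding U.B_structure(1) by (metis imageE)
 then obtain g where g: "!!j. g j \<in> carrier H" "!!j. \<pi> (g j) = U.chi_dual j" by metis
 show thesis
 proof (rule that[of "%j. e1 \<star> g j"])
  fix h assume h: "h \<in> carrier H"
  let ?w = "\<Oplus>\<^bsub>H\<^esub>j\<in>{..<p}. \<psi> j h \<bullet> g j"
  have t: "(%j. \<psi> j h \<bullet> g j) \<in> {..<p} \<rightarrow> carrier H" using g h by auto
  have w: "?w \<in> carrier H" using t by (rule M.finsum_closed)
  have "\<pi> ?w = (\<Oplus>\<^bsub>U.B\<^esub>j\<in>{..<p}. \<pi> (\<psi> j h \<bullet> g j))"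
   by (rule linear_map_finsum[OF mod_H U.mod_B \<pi>D(1) finite_lessThan t])
  also have "... = (\<Oplus>\<^bsub>U.B\<^esub>j\<in>{..<p}. U.chi j (\<pi> h) \<odot>\<^bsub>U.B\<^esub> U.chi_dual j)"
   unfolding linear_map_smult[OF \<pi>D(1) \<psi>_closed[OF h] g(1)] g(2) unfolding \<psi>_def ..
  also have "... = \<pi> h"
   using U.dual_system_chi \<pi>D(6)[OF h] unfolding dual_system_def by (elim conjE) (drule (1) bspec, erule sym)
  finally have eq: "\<pi> ?w = \<pi> h" .

  have d: "h \<ominus>\<^bsub>H\<^esub> ?w \<in> carrier H" using h w by (rule M.minus_closed)
  have "h = (h \<ominus>\<^bsub>H\<^esub> ?w) \<oplus>\<^bsub>H\<^esub> ?w" using h w by (simp add: M.minus_eq M.a_assoc M.l_neg)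
  then have "\<pi> h = \<pi> (h \<ominus>\<^bsub>H\<^esub> ?w) \<oplus>\<^bsub>U.B\<^esub> \<pi> h" using linear_map_add[OF \<pi>D(1) d w] eq by argo
  then have "\<pi> (h \<ominus>\<^bsub>H\<^esub> ?w) = \<zero>\<^bsub>U.B\<^esub>"
   by (rule module_add_left_eq_self[OF U.mod_B \<pi>D(6)[OF d] \<pi>D(6)[OF h]])
  then have "e1 \<star> (h \<ominus>\<^bsub>H\<^esub> ?w) = \<zero>\<^bsub>H\<^esub>" by (rule \<pi>_kernelD[OF d])
  then have "e1 \<star> ((h \<ominus>\<^bsub>H\<^esub> ?w) \<oplus>\<^bsub>H\<^esub> ?w) = e1 \<star> ?w"
   unfolding A.r_distr[OF d w e_closed] using w by simp
  then have "e1 \<star> h = e1 \<star> ?w"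
   using \<open>h = (h \<ominus>\<^bsub>H\<^esub> ?w) \<oplus>\<^bsub>H\<^esub> ?w\<close> by argo
  also have "... = (\<Oplus>\<^bsub>H\<^esub>j\<in>{..<p}. e1 \<star> (\<psi> j h \<bullet> g j))"
   by (rule linear_map_finsum[OF mod_H mod_H mult_linear_right[OF e_closed] finite_lessThan t])
  also have "... = (\<Oplus>\<^bsub>H\<^esub>j\<in>{..<p}. \<psi> j h \<bullet> (e1 \<star> g j))"
   by (simp only: smult_mult_right[OF \<psi>_closed[OF h] e_closed g(1)])
  finally show "e1 \<star> h = (\<Oplus>\<^bsub>H\<^esub>j\<in>{..<p}. \<psi> j h \<bullet> (e1 \<star> g j))" .
 qed (use g in simp)
qed

text \<open>The coinvariants are spanned by the idempotents \<open>e x\<close>: for \<open>b\<close> in the block of \<open>e x\<close>,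
 evaluating \<open>\<Sum> f (b\<^sub>1 S(b\<^sub>2)) e x b\<^sub>3\<close> with an extra factor \<open>e1\<close> on
 the last two tensor legs in two ways gives \<open>b = f b e x\<close>.\<close>

lemma coinvariant:
 assumes x: "x \<in> carrier G" and b: "b \<in> carrier H" and eb: "e x \<star> b = b" and rb: "\<rho> b = b"
 shows "\<exists>c\<in>carrier K. b = c \<bullet> e x"
proof -
 obtain f where f: "linear_form K H f" "f (e x) = \<one>\<^bsub>K\<^esub>"
  by (rule linear_form_exists[OF U.field_axioms mod_H e_closed e_nonzero[OF x]])
 note fc = linear_map_closed[OF f(1), simplified]
 let ?S = "antipode H"
 have rb': "right_translate (\<psi> j) b = b" for j
 proof -
  have "(\<rho> ^^ j) b = b" by (induction j) (simp_all add: rb)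
  then show ?thesis using \<rho>_pow[OF b] by simp
 qed
 \<comment> \<open>\<open>\<Gamma> a c\<close> is the sum of \<open>f(a S(c1)) e x c2\<close>. Taken
   over the coproduct of \<open>b\<close> with \<open>e1\<close> put in front of \<open>c\<close>,
   it is the quantity that is evaluated twice.\<close>
 define \<Gamma> where "\<Gamma> a c = sw H (%s t. f (a \<star> ?S s) \<bullet> (e x \<star> t)) c" for a c
 have g1: "bilinear_map K H H H (%s t. f (a \<star> ?S s) \<bullet> (e x \<star> t))" if "a \<in> carrier H" for a
  by (intro bilinear_mapI linear_intros mod_H linear_map_comp[OF f(1)] fc A.m_closed e_closed antipode_closed that)
 have G_bil: "bilinear_map K H H H \<Gamma>"
  unfolding \<Gamma>_def[abs_def]
  by (intro bilinear_mapI sw_linear sw_param[OF mod_H g1 _ mod_H] mod_H g1)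
   (auto intro!: linear_intros mod_H linear_map_comp[OF f(1)])
 obtain v where v: "!!j. v j \<in> carrier H"
  "!!h. h \<in> carrier H ==> e1 \<star> h = (\<Oplus>\<^bsub>H\<^esub>j\<in>{..<p}. \<psi> j h \<bullet> v j)"
  by (rule e1_expand) blast
 have bil: "bilinear_map K H H H (%a c. \<Gamma> a (e1 \<star> c))"
  by (rule bilinear_map_comp[OF G_bil linear_map_id mult_linear_right[OF e_closed]])
 have bj: "bilinear_map K H H H (%a c. \<psi> j c \<bullet> \<Gamma> a (v j))" for j
  by (intro bilinear_mapI linear_map_form_smult mod_H \<psi>_form linear_map_smult_fun \<psi>_closed
    bilinear_map_left[OF G_bil v(1)] bilinear_map_closed[OF G_bil _ v(1)])
 \<comment> \<open>First evaluation: \<open>e1_expand\<close> replaces the last leg by scalars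
   \<open>\<psi> j c\<close>. These turn the coproduct of \<open>b\<close> into translates of
   \<open>b\<close>, and \<open>b\<close> is fixed by translations.\<close>
 have one: "sw H (%a c. \<Gamma> a (e1 \<star> c)) b = f b \<bullet> e x"
 proof -
  have "sw H (%a c. \<Gamma> a (e1 \<star> c)) b = sw H (%a c. \<Oplus>\<^bsub>H\<^esub>j\<in>{..<p}. \<psi> j c \<bullet> \<Gamma> a (v j)) b"
  proof (rule sw_cong[OF mod_H bil b])
   fix a c assume a: "a \<in> carrier H" and c: "c \<in> carrier H"
   note la = bilinear_map_right[OF G_bil a]
   have t: "(%j. \<psi> j c \<bullet> v j) \<in> {..<p} \<rightarrow> carrier H" using v(1) c by auto
   show "\<Gamma> a (e1 \<star> c) = (\<Oplus>\<^bsub>H\<^esub>j\<in>{..<p}. \<psi> j c \<bullet> \<Gamma> a (v j))"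
    unfolding v(2)[OF c] linear_map_finsum[OF mod_H mod_H la finite_lessThan t]
    by (simp only: linear_map_smult[OF la \<psi>_closed[OF c] v(1)])
  qed
  also have "... = (\<Oplus>\<^bsub>H\<^esub>j\<in>{..<p}. sw H (%a c. \<psi> j c \<bullet> \<Gamma> a (v j)) b)"
   by (rule HH.lift_finsum[OF mod_H finite_lessThan bj comult_closed[OF b]])
  also have "... = (\<Oplus>\<^bsub>H\<^esub>j\<in>{..<p}. \<Gamma> b (v j))"
  proof -
   have "sw H (%a c. \<psi> j c \<bullet> \<Gamma> a (v j)) b = \<Gamma> b (v j)" for j
   proof -
    note lv = bilinear_map_left[OF G_bil v(1)]
    have "sw H (%a c. \<psi> j c \<bullet> \<Gamma> a (v j)) b = sw H (%a c. \<Gamma> (\<psi> j c \<bullet> a) (v j)) b"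
     by (rule sw_cong[OF mod_H bj b]) (simp only: linear_map_smult[OF lv \<psi>_closed])
    also have "... = \<Gamma> (right_translate (\<psi> j) b) (v j)"
     unfolding right_translate_def by (rule sw_post[OF mod_H mod_H translate_bilinear[OF \<psi>_form] lv b, symmetric])
    finally show ?thesis unfolding rb' .
   qed
   then show ?thesis by simp
  qed
  also have "... = \<Gamma> b (\<Oplus>\<^bsub>H\<^esub>j\<in>{..<p}. v j)"
   by (rule linear_map_finsum[OF mod_H mod_H bilinear_map_right[OF G_bil b] finite_lessThan Pi_I[OF v(1)], symmetric])
  \<comment> \<open>The expansion of \<open>e1\<close> at the unit, where every
    \<open>\<psi> j\<close> is one.\<close>
  also have "(\<Oplus>\<^bsub>H\<^esub>j\<in>{..<p}. v j) = e1"
   using v(2)[OF A.one_closed] v(1) by (simp add: \<psi>_one)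
  also have "\<Gamma> b e1 = f (b \<star> ?S (e (inv\<^bsub>G\<^esub> x))) \<bullet> (e x \<star> e x)"
   unfolding \<Gamma>_def
   by (rule sw_e1[OF mod_H g1[OF b] x]) (use x b fc in \<open>simp add: e_orth\<close>)
  also have "... = f b \<bullet> e x"
   using x b eb by (simp add: antipode_e e_orth H_comm[OF b e_closed])
  finally show ?thesis .
 qed
 \<comment> \<open>Second evaluation: the coproduct of \<open>e1 \<star> c\<close> is a product, and
   the factor \<open>e x\<close> selects one summand of that of \<open>e1\<close>. The antipode of
   its first leg is \<open>e x\<close>, which ends up inside \<open>f\<close>; then
   \<open>a S(s)\<close> collapses to the counit, and \<open>f(e x)\<close> is one.\<close>
 have "sw H (%a c. \<Gamma> a (e1 \<star> c)) b = b"
 proof -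
  let ?h = "%a s t. f (a \<star> ?S s \<star> e x) \<bullet> (e x \<star> t)"
  have tri: "trilinear_map K H H H H ?h"
   by (intro trilinear_mapI linear_intros mod_H linear_map_comp[OF f(1)] fc A.m_closed e_closed antipode_closed)
  have "sw H (%a c. \<Gamma> a (e1 \<star> c)) b = sw H (%a c. sw H (?h a) c) b"
  proof (rule sw_cong[OF mod_H bil b])
   fix a c assume a: "a \<in> carrier H" and c: "c \<in> carrier H"
   let ?k = "%s t. sw H (%s' t'. f (a \<star> ?S (s \<star> s')) \<bullet> (e x \<star> (t \<star> t'))) c"
   have bi: "bilinear_map K H H H (%s' t'. f (a \<star> ?S (s \<star> s')) \<bullet> (e x \<star> (t \<star> t')))"
    if "s \<in> carrier H" "t \<in> carrier H" for s t
    by (intro bilinear_mapI linear_intros mod_H linear_map_comp[OF f(1)] fc A.m_closed e_closed antipode_closed a that)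
   have bk: "bilinear_map K H H H ?k"
    by (intro bilinear_mapI sw_param[OF mod_H bi _ mod_H c])
     (auto intro!: linear_intros mod_H linear_map_comp[OF f(1)] fc simp: a)
   have "\<Gamma> a (e1 \<star> c) = sw H ?k e1"
    unfolding \<Gamma>_def by (rule sw_mult[OF mod_H g1[OF a] e_closed c])
   also have "... = ?k (e (inv\<^bsub>G\<^esub> x)) (e x)"
   proof (rule sw_e1[OF mod_H bk x])
    fix y assume y: "y \<in> carrier G" "y ~= x"
    have "?k (e (inv\<^bsub>G\<^esub> y)) (e y) = sw H (%s' t'. \<zero>\<^bsub>K\<^esub> \<bullet> t') c"
     by (rule sw_cong[OF mod_H bi[OF e_closed e_closed] c])
      (use x y a fc in \<open>simp add: A.m_assoc[symmetric] e_orth\<close>)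
    also have "... = \<zero>\<^bsub>K\<^esub> \<bullet> sw H (%s' t'. \<zero>\<^bsub>K\<^esub> \<bullet> t') c"
    proof -
     have zb: "bilinear_map K H H H (%s' t'. \<zero>\<^bsub>K\<^esub> \<bullet> t')"
      by (rule bilinear_mapI; rule linear_mapI) auto
     show ?thesis
      by (subst sw_post[OF mod_H mod_H zb linear_map_smult_fun[OF mod_H U.zero_closed linear_map_id] c])
       (rule sw_cong[OF mod_H zb c], simp)
    qed
    also have "... = \<zero>\<^bsub>H\<^esub>"
    proof -
     have zb: "bilinear_map K H H H (%s' t'. \<zero>\<^bsub>K\<^esub> \<bullet> t')"
      by (rule bilinear_mapI; rule linear_mapI) auto
     show ?thesis using sw_closed[OF mod_H zb c] by simp
    qed
    finally show "?k (e (inv\<^bsub>G\<^esub> y)) (e y) = \<zero>\<^bsub>H\<^esub>" .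
   qed
   also have "... = sw H (?h a) c"
   proof (rule sw_cong[OF mod_H bi[OF e_closed e_closed] c])
    fix s t assume s: "s \<in> carrier H" and t: "t \<in> carrier H"
    have "a \<star> ?S (e (inv\<^bsub>G\<^esub> x) \<star> s) = a \<star> ?S s \<star> e x"
     using x a s by (simp add: antipode_mult antipode_e HC.m_ac)
    moreover have "e x \<star> (e x \<star> t) = e x \<star> t"
     using x t by (simp add: A.m_assoc[symmetric] e_orth)
    ultimately show "f (a \<star> ?S (e (inv\<^bsub>G\<^esub> x) \<star> s)) \<bullet> (e x \<star> (e x \<star> t)) = ?h a s t"
     by simp
   qed
   finally show "\<Gamma> a (e1 \<star> c) = sw H (?h a) c" .
  qed
  also have "... = sw H (%q t. sw H (%a s. ?h a s t) q) b"
   by (rule sw_coassoc[OF mod_H tri b, symmetric])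
  also have "... = sw H (%q t. e x \<star> (counit H q \<bullet> t)) b"
  proof (rule sw_cong[OF mod_H _ b, symmetric])
   have cb: "bilinear_map K H H H (%q t. counit H q \<bullet> t)"
    by (intro bilinear_mapI linear_intros mod_H counit_closed)
   show "bilinear_map K H H H (%q t. e x \<star> (counit H q \<bullet> t))"
    by (rule bilinear_map_post[OF cb mult_linear_right[OF e_closed]])
   fix q t assume q: "q \<in> carrier H" and t: "t \<in> carrier H"
   have ab: "bilinear_map K H H H (%a s. a \<star> ?S s)" by (intro bilinear_mapI linear_intros antipode_closed)
   have l: "linear_map K H H (%y. f (y \<star> e x) \<bullet> (e x \<star> t))"
    by (intro linear_intros mod_H linear_map_comp[OF f(1)] e_closed A.m_closed t)
   have "sw H (%a s. ?h a s t) q = f (sw H (%a s. a \<star> ?S s) q \<star> e x) \<bullet> (e x \<star> t)"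
    by (rule sw_post[OF mod_H mod_H ab l q, symmetric])
   then show "e x \<star> (counit H q \<bullet> t) = sw H (%a s. ?h a s t) q"
    using q t by (simp add: antipode_right smult_mult_left smult_mult_right linear_map_smult[OF f(1)] f(2))
  qed
  also have "... = e x \<star> sw H (%q t. counit H q \<bullet> t) b"
  proof -
   have cb: "bilinear_map K H H H (%q t. counit H q \<bullet> t)"
    by (intro bilinear_mapI linear_intros mod_H counit_closed)
   show ?thesis by (rule sw_post[OF mod_H mod_H cb mult_linear_right[OF e_closed] b, symmetric])
  qed
  finally show ?thesis by (simp add: counit_left[OF b] eb)
 qed
 then have "b = f b \<bullet> e x" using one by argo
 then show ?thesis using fc[OF b] by blast
qed

end

section \<open>Homogeneous elements and the splitting of each block\<close>

lemma (in root_of_unity_field) eigenprojection_post: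
 assumes V: "module K V" and T: "linear_map K V V T" and W: "module K W" and g: "linear_map K V W g"
  and v: "v \<in> carrier V"
 shows "g (eigenprojection V T j v) =
  pinv \<odot>\<^bsub>W\<^esub> (\<Oplus>\<^bsub>W\<^esub>i\<in>{..<p}. \<zeta> [^] ((p - 1) * i * j) \<odot>\<^bsub>W\<^esub> g ((T ^^ i) v))"
proof -
 interpret V: module K V by fact
 have k: "\<zeta> [^] i \<in> carrier K" for i :: nat by simp
 have t: "(%i. \<zeta> [^] ((p - 1) * i * j) \<odot>\<^bsub>V\<^esub> (T ^^ i) v) \<in> {..<p} \<rightarrow> carrier V"
  by (rule Pi_I, rule V.smult_closed[OF k pow_closed[OF V T v]])
 have s: "(\<Oplus>\<^bsub>V\<^esub>i\<in>{..<p}. \<zeta> [^] ((p - 1) * i * j) \<odot>\<^bsub>V\<^esub> (T ^^ i) v) \<in> carrier V"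
  using t by (rule V.finsum_closed)
 show ?thesis
  unfolding eigenprojection_def linear_map_smult[OF g pinv_closed s] linear_map_finsum[OF V W g finite_lessThan t]
  by (simp only: linear_map_smult[OF g k pow_closed[OF V T v]])
qed

lemma (in hopf_algebra) sw_zero: "module K V ==> h \<in> carrier H ==> sw V (%a b. \<zero>\<^bsub>V\<^esub>) h = \<zero>\<^bsub>V\<^esub>"
proof -
 assume V: "module K V" and h: "h \<in> carrier H"
 have b: "bilinear_map K H H V (%a b. \<zero>\<^bsub>V\<^esub>)" by (intro bilinear_mapI linear_map_zero_fun V)
 show ?thesis
  by (rule HH.linear_maps_eq[OF V HH.lift_linear[OF V b] linear_map_zero_fun[OF V] _ comult_closed[OF h]])
   (rule HH.lift_tensor[OF V b])
qed

lemma (in assoc_algebra) smult_pow: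
 assumes "a \<in> carrier K" "h \<in> carrier A"
 shows "(a \<odot>\<^bsub>A\<^esub> h) [^]\<^bsub>A\<^esub> (n::nat) = (a [^]\<^bsub>K\<^esub> n) \<odot>\<^bsub>A\<^esub> (h [^]\<^bsub>A\<^esub> n)"
proof (induction n)
 case (Suc n)
 have c: "a [^]\<^bsub>K\<^esub> n \<in> carrier K" "h [^]\<^bsub>A\<^esub> n \<in> carrier A" using assms by auto
 show ?case using Suc assms c
  by (simp add: smult_mult_left smult_mult_right smult_assoc1[symmetric] m_comm)
qed (use assms in simp)

context commutative_extension
begin

abbreviation "P \<equiv> U.eigenprojection H \<rho>"

lemmas P_closed = U.eigenprojection_closed[OF mod_H \<rho>_linear]
 and P_linear = U.eigenprojection_linear[OF mod_H \<rho>_linear]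
 and P_post = U.eigenprojection_post[OF mod_H \<rho>_linear]

definition homog :: "nat => 'h => bool" where
 "homog j a \<longleftrightarrow> a \<in> carrier H \<and> \<rho> a = (\<zeta> [^]\<^bsub>K\<^esub> j) \<bullet> a"

lemma homogD: "homog j a ==> a \<in> carrier H" "homog j a ==> \<rho> a = (\<zeta> [^]\<^bsub>K\<^esub> j) \<bullet> a"
 unfolding homog_def by auto

lemma homog_P: "a \<in> carrier H ==> homog j (P j a)"
 unfolding homog_def using P_closed U.eigenprojection_eigen[OF mod_H \<rho>_linear _ \<rho>_pow_p] by blast

lemma homog_mult:
 assumes "homog i a" "homog j b"
 shows "homog (i + j) (a \<star> b)"
proof -
 note a = homogD[OF assms(1)] and b = homogD[OF assms(2)]
 have k: "\<zeta> [^]\<^bsub>K\<^esub> i \<in> carrier K" "\<zeta> [^]\<^bsub>K\<^esub> j \<in> carrier K" by simp_all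
 have "\<rho> (a \<star> b) = (\<zeta> [^]\<^bsub>K\<^esub> i \<otimes>\<^bsub>K\<^esub> \<zeta> [^]\<^bsub>K\<^esub> j) \<bullet> (a \<star> b)"
  unfolding \<rho>_mult[OF a(1) b(1)] a(2) b(2)
  using a(1) b(1) k by (simp add: smult_mult_left smult_mult_right smult_assoc1[symmetric] U.m_comm)
 then show ?thesis unfolding homog_def using a(1) b(1) by (simp add: U.nat_pow_mult)
qed

lemma homog_e: "homog 0 (e x)"
 unfolding homog_def by (simp add: \<rho>_e)

lemma homog_one: "homog 0 \<one>\<^bsub>H\<^esub>"
proof -
 have "\<rho> \<one>\<^bsub>H\<^esub> = \<one>\<^bsub>H\<^esub>" unfolding \<rho>_def by (rule right_translate_one[OF \<psi>_hom \<psi>_form])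
 then show ?thesis unfolding homog_def by simp
qed

lemma homog_pow: "homog i a ==> homog (i * n) (a [^]\<^bsub>H\<^esub> n)"
proof (induction n)
 case (Suc n)
 then show ?case using homog_mult[OF Suc(1)[OF Suc(2)] Suc(2)] by (simp add: add.commute)
qed (simp add: homog_one)

lemma homog_mod: "homog i a ==> i mod p = j mod p ==> homog j a"
 unfolding homog_def using U.\<zeta>_pow_cong[of i j] by simp

lemma P_homog: "homog k a ==> P j a = (if j mod p = k mod p then a else \<zero>\<^bsub>H\<^esub>)"
 unfolding homog_def using U.eigenprojection_of_eigenvector[OF mod_H \<rho>_linear] by blast

text \<open>Degree zero means coinvariant, and by \<open>coinvariant\<close> each block is
  one-dimensional in that degree.\<close>

lemma homog_zero_scalar:
 assumes "homog i a" "p dvd i" "x \<in> carrier G" "e x \<star> a = a"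
 shows "\<exists>c\<in>carrier K. a = c \<bullet> e x"
proof -
 have "\<rho> a = a" using homogD[OF assms(1)] U.\<zeta>_pow_dvd[OF assms(2)] by simp
 then show ?thesis by (rule coinvariant[OF assms(3) homogD(1)[OF assms(1)] assms(4)])
qed

text \<open>\<open>P j\<close> is a combination of translations, each of which acts on the last leg
  alone by \<open>sw_right_translate\<close>.\<close>

lemma sw_P:
 assumes V: "module K V" and \<beta>: "bilinear_map K H H V \<beta>" and h: "h \<in> carrier H"
 shows "sw V (%a b. \<beta> a (P j b)) h = sw V \<beta> (P j h)"
proof -
 interpret V: module K V by fact
 let ?z = "%i. \<zeta> [^]\<^bsub>K\<^esub> ((p - 1) * i * j)"
 have k: "?z i \<in> carrier K" for i by simp
 have b: "bilinear_map K H H V (%a b. \<beta> a (right_translate (\<psi> i) b))" for i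
  by (rule bilinear_map_comp[OF \<beta> linear_map_id right_translate_linear[OF \<psi>_form]])
 have zl: "linear_map K V V (%y. ?z i \<odot>\<^bsub>V\<^esub> y)" for i by (rule linear_map_smult_fun[OF V k linear_map_id])
 have pl: "linear_map K V V (%y. U.pinv \<odot>\<^bsub>V\<^esub> y)" by (rule linear_map_smult_fun[OF V U.pinv_closed linear_map_id])
 note bz = bilinear_map_post[OF b zl]
 have bs: "bilinear_map K H H V (%a b. \<Oplus>\<^bsub>V\<^esub>i\<in>{..<p}. ?z i \<odot>\<^bsub>V\<^esub> \<beta> a (right_translate (\<psi> i) b))"
  by (intro bilinear_mapI linear_map_finsum_fun V finite_lessThan bilinear_map_left[OF bz] bilinear_map_right[OF bz])
 have "sw V (%a b. \<beta> a (P j b)) h =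
  sw V (%a b. U.pinv \<odot>\<^bsub>V\<^esub> (\<Oplus>\<^bsub>V\<^esub>i\<in>{..<p}. ?z i \<odot>\<^bsub>V\<^esub> \<beta> a (right_translate (\<psi> i) b))) h"
  by (rule sw_cong[OF V bilinear_map_comp[OF \<beta> linear_map_id P_linear] h])
   (simp only: P_post[OF V bilinear_map_right[OF \<beta>]] \<rho>_pow)
 also have "... = U.pinv \<odot>\<^bsub>V\<^esub> sw V (%a b. \<Oplus>\<^bsub>V\<^esub>i\<in>{..<p}. ?z i \<odot>\<^bsub>V\<^esub> \<beta> a (right_translate (\<psi> i) b)) h"
  by (rule sw_post[OF V V bs pl h, symmetric])
 also have "sw V (%a b. \<Oplus>\<^bsub>V\<^esub>i\<in>{..<p}. ?z i \<odot>\<^bsub>V\<^esub> \<beta> a (right_translate (\<psi> i) b)) h =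
   (\<Oplus>\<^bsub>V\<^esub>i\<in>{..<p}. sw V (%a b. ?z i \<odot>\<^bsub>V\<^esub> \<beta> a (right_translate (\<psi> i) b)) h)"
  by (rule HH.lift_finsum[OF V finite_lessThan bz comult_closed[OF h]])
 also have "... = (\<Oplus>\<^bsub>V\<^esub>i\<in>{..<p}. ?z i \<odot>\<^bsub>V\<^esub> sw V \<beta> ((\<rho> ^^ i) h))"
  by (simp only: sw_post[OF V V b zl h, symmetric] sw_right_translate[OF V \<beta> \<psi>_form h] \<rho>_pow[OF h])
 also have "U.pinv \<odot>\<^bsub>V\<^esub> ... = sw V \<beta> (P j h)"
  by (rule P_post[OF V sw_linear[OF V \<beta>] h, symmetric])
 finally show ?thesis .
qed

text \<open>A preimage of the generator of the cyclic group is projected to degree one. Its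
  \<open>i\<close>-th translate has counit \<open>\<zeta> [^] i\<close>, which cancels the
  coefficient in the average, so all \<open>p\<close> terms are one.\<close>

lemma degree_one_element:
 obtains c where "homog 1 c" "counit H c = \<one>\<^bsub>K\<^esub>"
proof -
 have "1 \<in> carrier U.C" using prime_gt_1_nat[OF U.prime_p] by (simp add: U.carrier_C)
 then have "basis_vector K 1 \<in> \<pi> ` carrier H"
  unfolding \<pi>_surj U.B_structure(1) by (rule U.basis_F)
 then obtain c where c: "c \<in> carrier H" "\<pi> c = basis_vector K 1" by auto
 have z: "\<zeta> [^]\<^bsub>K\<^esub> ((p - 1) * i * 1) \<otimes>\<^bsub>K\<^esub> counit H ((\<rho> ^^ i) c) = \<one>\<^bsub>K\<^esub>" for i
 proof -
  have "counit H ((\<rho> ^^ i) c) = \<zeta> [^]\<^bsub>K\<^esub> i"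
   unfolding \<rho>_pow[OF c(1)] counit_right_translate[OF \<psi>_form c(1)] \<psi>_def c(2) U.chi_basis by simp
  moreover have "(p - 1) * i + i = p * i" using U.p_pos by (cases p) auto
  ultimately show ?thesis by (simp add: U.nat_pow_mult U.\<zeta>_pow_dvd)
 qed
 have "counit H (P 1 c) = U.pinv \<otimes>\<^bsub>K\<^esub> (\<Oplus>\<^bsub>K\<^esub>i\<in>{..<p}. \<one>\<^bsub>K\<^esub>)"
  using P_post[OF mod_K counit_form c(1), of 1] by (simp only: scalar_module_simps finsum_scalar_module z)
 also have "... = \<one>\<^bsub>K\<^esub>"
  using U.add.finprod_const[of "\<one>\<^bsub>K\<^esub>" "{..<p}"] by (simp add: U.pinv_p)
 finally show thesis using that[OF homog_P[OF c(1)]] by blast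
qed

text \<open>Take \<open>c\<close> of degree one with counit one. In \<open>1 = S(c1) c2\<close> the
  leg \<open>c2\<close> may be projected to degree one, by \<open>sw_P\<close>. Multiplied by
  \<open>e x\<close> and projected to degree zero, the sum is \<open>e x\<close>, so some term is
  non-zero; a homogeneous part of its first factor gives \<open>a\<close>.\<close>

lemma block_nonzero_product:
 assumes x: "x \<in> carrier G"
 obtains k a b where "k < p" "p dvd k + 1" "homog k a" "homog 1 b" "e x \<star> (a \<star> b) ~= \<zero>\<^bsub>H\<^esub>"
proof -
 obtain c where c: "homog 1 c" "counit H c = \<one>\<^bsub>K\<^esub>" by (rule degree_one_element)
 note cH = homogD(1)[OF c(1)]
 let ?S = "antipode H"
 have bS: "bilinear_map K H H H (%a b. ?S a \<star> b)" by (intro bilinear_mapI linear_intros antipode_closed)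
 have lP: "linear_map K H H (%y. P 0 (e x \<star> y))"
  by (rule linear_map_comp[OF P_linear mult_linear_right[OF e_closed]])
 note bSP = bilinear_map_comp[OF bS linear_map_id P_linear]
 have "\<one>\<^bsub>H\<^esub> = sw H (%a b. ?S a \<star> b) c" using antipode_left[OF cH] c(2) by simp
 also have "... = sw H (%a b. ?S a \<star> b) (P 1 c)" using P_homog[OF c(1), of 1] by simp
 also have "... = sw H (%a b. ?S a \<star> P 1 b) c" by (rule sw_P[OF mod_H bS cH, symmetric])
 finally have 1: "\<one>\<^bsub>H\<^esub> = sw H (%a b. ?S a \<star> P 1 b) c" .
 have "e x = P 0 (e x \<star> \<one>\<^bsub>H\<^esub>)" using P_homog[OF homog_e, of 0 x] by simp
 also have "... = P 0 (e x \<star> sw H (%a b. ?S a \<star> P 1 b) c)" by (simp only: 1[symmetric])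
 also have "... = sw H (%a b. P 0 (e x \<star> (?S a \<star> P 1 b))) c"
  by (rule sw_post[OF mod_H mod_H bSP lP cH])
 finally have ex: "e x = sw H (%a b. P 0 (e x \<star> (?S a \<star> P 1 b))) c" .
 have "\<exists>a\<in>carrier H. \<exists>b\<in>carrier H. P 0 (e x \<star> (?S a \<star> P 1 b)) ~= \<zero>\<^bsub>H\<^esub>"
 proof (rule ccontr)
  assume n: "\<not> ?thesis"
  have "sw H (%a b. P 0 (e x \<star> (?S a \<star> P 1 b))) c = sw H (%a b. \<zero>\<^bsub>H\<^esub>) c"
   by (rule sw_cong[OF mod_H bilinear_map_post[OF bSP lP] cH]) (use n in blast)
  also have "... = \<zero>\<^bsub>H\<^esub>" by (rule sw_zero[OF mod_H cH])
  finally show False using ex e_nonzero[OF x] by argo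
 qed
 then obtain a' b' where ab: "a' \<in> carrier H" "b' \<in> carrier H" "P 0 (e x \<star> (?S a' \<star> P 1 b')) ~= \<zero>\<^bsub>H\<^esub>"
  by blast
 define a b where "a = ?S a'" and "b = P 1 b'"
 have a: "a \<in> carrier H" and b: "homog 1 b" using ab homog_P unfolding a_def b_def by auto
 note bH = homogD(1)[OF b]
 have lg: "linear_map K H H (%y. P 0 (e x \<star> (y \<star> b)))"
  by (rule linear_map_comp[OF lP mult_linear_left[OF bH]])
 have "\<exists>k<p. P 0 (e x \<star> (P k a \<star> b)) ~= \<zero>\<^bsub>H\<^esub>"
 proof (rule ccontr)
  assume n: "\<not> ?thesis"
  have "P 0 (e x \<star> (a \<star> b)) = P 0 (e x \<star> ((\<Oplus>\<^bsub>H\<^esub>k\<in>{..<p}. P k a) \<star> b))"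
   by (simp only: U.eigenprojection_sum[OF mod_H \<rho>_linear a])
  also have "... = (\<Oplus>\<^bsub>H\<^esub>k\<in>{..<p}. P 0 (e x \<star> (P k a \<star> b)))"
   by (rule linear_map_finsum[OF mod_H mod_H lg finite_lessThan Pi_I[OF P_closed[OF a]]])
  also have "... = \<zero>\<^bsub>H\<^esub>" using n by (intro M.add.finprod_one_eqI) blast
  finally show False using ab(3) unfolding a_def b_def by blast
 qed
 then obtain k where k: "k < p" "P 0 (e x \<star> (P k a \<star> b)) ~= \<zero>\<^bsub>H\<^esub>" by blast
 have h: "homog (0 + (k + 1)) (e x \<star> (P k a \<star> b))"
  by (intro homog_mult homog_e homog_P a b)
 have d: "0 mod p = (0 + (k + 1)) mod p" and nz: "e x \<star> (P k a \<star> b) ~= \<zero>\<^bsub>H\<^esub>"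
  using k(2) unfolding P_homog[OF h] by (auto split: if_splits)
 have "p dvd k + 1" using d by (simp add: mod_eq_0_iff_dvd)
 then show thesis using that[OF k(1) _ homog_P[OF a] b nz] by blast
qed

lemma e_idem: "x \<in> carrier G ==> e x \<star> e x = e x"
 by (simp add: e_orth)

lemma e_pow: "x \<in> carrier G ==> n > 0 ==> e x [^]\<^bsub>H\<^esub> (n::nat) = e x"
proof (induction n)
 case (Suc n)
 then show ?case by (cases "n = 0") (simp_all add: e_idem)
qed simp

text \<open>Put \<open>v = e x \<star> b\<close>. Degree-zero elements of the block are multiples of
  \<open>e x\<close>. The product \<open>a \<star> v\<close> is a non-zero one, so \<open>v\<close>
  is not nilpotent, and its \<open>p\<close>-th power is a non-zero multiple too. Dividing
  \<open>v\<close> by a \<open>p\<close>-th root of that scalar gives \<open>u\<close>.\<close>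

lemma block_unit:
 assumes x: "x \<in> carrier G"
 obtains u where "homog 1 u" "e x \<star> u = u" "u [^]\<^bsub>H\<^esub> p = e x"
proof -
 obtain k a b where k: "k < p" "p dvd k + 1" and a: "homog k a" and b: "homog 1 b"
  and nz: "e x \<star> (a \<star> b) ~= \<zero>\<^bsub>H\<^esub>"
  by (rule block_nonzero_product[OF x])
 note aH = homogD(1)[OF a] and bH = homogD(1)[OF b] and ee = e_closed[of x]
 define v where "v = e x \<star> b"
 have vH: "v \<in> carrier H" unfolding v_def using bH by simp
 have hv: "homog 1 v" unfolding v_def using homog_mult[OF homog_e b] by simp
 have ev: "e x \<star> v = v" unfolding v_def using bH by (simp add: A.m_assoc[symmetric] e_idem[OF x])
 have av: "a \<star> v = e x \<star> (a \<star> b)"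
  unfolding v_def using aH bH by (simp add: HC.m_lcomm)
 have eav: "e x \<star> (a \<star> v) = a \<star> v"
  using HC.m_lcomm[OF ee aH vH] ev by simp
 obtain l where l: "l \<in> carrier K" "a \<star> v = l \<bullet> e x"
  using homog_zero_scalar[OF homog_mult[OF a hv] k(2) x eav] by blast
 have l0: "l ~= \<zero>\<^bsub>K\<^esub>" using l(2) nz av by auto
 have p0: "p > 0" by (rule U.p_pos)
 have evp: "e x \<star> v [^]\<^bsub>H\<^esub> p = v [^]\<^bsub>H\<^esub> p"
 proof -
  have "v [^]\<^bsub>H\<^esub> p = v [^]\<^bsub>H\<^esub> (1 + (p - 1))" using p0 by simp
  also have "... = v \<star> v [^]\<^bsub>H\<^esub> (p - 1)" using vH by (subst A.nat_pow_mult[symmetric]) simp_all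
  finally show ?thesis using vH ev by (simp add: A.m_assoc[symmetric])
 qed
 obtain c where c: "c \<in> carrier K" "v [^]\<^bsub>H\<^esub> p = c \<bullet> e x"
  using homog_zero_scalar[OF homog_pow[OF hv] _ x evp] by auto
 have c0: "c ~= \<zero>\<^bsub>K\<^esub>"
 proof
  assume "c = \<zero>\<^bsub>K\<^esub>"
  then have "(a \<star> v) [^]\<^bsub>H\<^esub> p = \<zero>\<^bsub>H\<^esub>"
   using c(2) aH vH by (simp add: HC.nat_pow_distrib)
  then have z: "(l [^]\<^bsub>K\<^esub> p) \<bullet> e x = \<zero>\<^bsub>K\<^esub> \<bullet> e x"
   unfolding l(2) smult_pow[OF l(1) ee] e_pow[OF x p0] by simp
  have "l [^]\<^bsub>K\<^esub> p = \<zero>\<^bsub>K\<^esub>"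
   by (rule smult_cancel[OF U.field_axioms mod_H ee e_nonzero[OF x] _ _ z]) (use l(1) in simp_all)
  moreover have "l [^]\<^bsub>K\<^esub> n ~= \<zero>\<^bsub>K\<^esub>" for n :: nat
   using l(1) l0 by (induction n) (auto simp: U.integral_iff)
  ultimately show False by blast
 qed
 obtain d where d: "d \<in> carrier K" "d [^]\<^bsub>K\<^esub> p = c" using U.ex_pth_root[OF c(1)] by blast
 have d0: "d ~= \<zero>\<^bsub>K\<^esub>" using d c0 p0 U.nat_pow_zero[of p] by auto
 let ?d = "inv\<^bsub>K\<^esub> d"
 have du: "?d \<in> carrier K" "?d \<otimes>\<^bsub>K\<^esub> d = \<one>\<^bsub>K\<^esub>" using d(1) d0 by (auto simp: U.field_Units)
 have dp: "?d [^]\<^bsub>K\<^esub> p \<otimes>\<^bsub>K\<^esub> c = \<one>\<^bsub>K\<^esub>"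
  using U.nat_pow_distrib[OF du(1) d(1), of p] du d by simp
 let ?u = "?d \<bullet> v"
 show thesis
 proof (rule that)
  show "homog 1 ?u"
   unfolding homog_def linear_map_smult[OF \<rho>_linear du(1) vH] homogD(2)[OF hv]
   using du(1) vH by (simp add: smult_assoc1[symmetric] U.m_comm)
  show "e x \<star> ?u = ?u" using du(1) vH ev by (simp add: smult_mult_right)
  show "?u [^]\<^bsub>H\<^esub> p = e x"
   unfolding smult_pow[OF du(1) vH] c(2) using du(1) c(1) by (simp add: smult_assoc1[symmetric] dp)
 qed
qed

text \<open>The \<open>E j\<close> are the eigencomponents of \<open>e x\<close> under
  multiplication by \<open>u\<close>. A degree-\<open>i\<close> element of the block is a multiple
  of the \<open>i\<close>-th power of \<open>u\<close>, so everything in the block acts on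
  \<open>E j\<close> through powers of \<open>u\<close>, that is by scalars.\<close>

lemma block_idempotents:
 assumes x: "x \<in> carrier G"
 obtains E where "!!j. E j \<in> carrier H" "!!j. E j ~= \<zero>\<^bsub>H\<^esub>" "!!j. e x \<star> E j = E j"
  "!!i j. i < p ==> j < p ==> i ~= j ==> E i \<star> E j = \<zero>\<^bsub>H\<^esub>"
  "(\<Oplus>\<^bsub>H\<^esub>j\<in>{..<p}. E j) = e x" "!!h j. h \<in> carrier H ==> \<exists>c\<in>carrier K. h \<star> E j = c \<bullet> E j"
proof -
 obtain u where u: "homog 1 u" "e x \<star> u = u" "u [^]\<^bsub>H\<^esub> p = e x" by (rule block_unit[OF x])
 note uH = homogD(1)[OF u(1)] and ee = e_closed[of x]
 have up: "u [^]\<^bsub>H\<^esub> i \<in> carrier H" for i :: nat using uH by simp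
 have hup: "homog i (u [^]\<^bsub>H\<^esub> i)" for i using homog_pow[OF u(1), of i] by simp
 define T where "T y = u \<star> y" for y
 have Tl: "linear_map K H H T" unfolding T_def[abs_def] by (rule mult_linear_right[OF uH])
 have Ti: "(T ^^ i) y = u [^]\<^bsub>H\<^esub> i \<star> y" if y: "y \<in> carrier H" for i y
 proof (induction i)
  case (Suc i)
  have "u \<star> (u [^]\<^bsub>H\<^esub> i \<star> y) = u [^]\<^bsub>H\<^esub> i \<star> u \<star> y"
   using uH up y by (simp add: HC.m_ac)
  then show ?case using Suc by (simp add: T_def)
 qed (use y in simp)
 have Tp: "(T ^^ p) (e x) = e x" unfolding Ti[OF ee] u(3) by (rule e_idem[OF x])
 define E where "E j = U.eigenprojection H T j (e x)" for j
 have EH: "E j \<in> carrier H" for j unfolding E_def by (rule U.eigenprojection_closed[OF mod_H Tl ee])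
 have uE: "u \<star> E j = (\<zeta> [^]\<^bsub>K\<^esub> j) \<bullet> E j" for j
  using U.eigenprojection_eigen[OF mod_H Tl ee Tp, of j] unfolding E_def T_def .
 have Esum: "(\<Oplus>\<^bsub>H\<^esub>j\<in>{..<p}. E j) = e x" unfolding E_def by (rule U.eigenprojection_sum[OF mod_H Tl ee])
 note post = U.eigenprojection_post[OF mod_H Tl mod_H _ ee, folded E_def]
 have eE: "e x \<star> E j = E j" for j
 proof -
  have "e x \<star> (T ^^ i) (e x) = (T ^^ i) (e x)" for i
   unfolding Ti[OF ee] using HC.m_lcomm[OF ee up ee] by (simp add: e_idem[OF x])
  note Te = this
  have "e x \<star> E j =
    U.pinv \<bullet> (\<Oplus>\<^bsub>H\<^esub>i\<in>{..<p}. \<zeta> [^]\<^bsub>K\<^esub> ((p - 1) * i * j) \<bullet> (e x \<star> (T ^^ i) (e x)))"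
   by (rule post[OF mult_linear_right[OF ee]])
  also have "... = U.pinv \<bullet> (\<Oplus>\<^bsub>H\<^esub>i\<in>{..<p}. \<zeta> [^]\<^bsub>K\<^esub> ((p - 1) * i * j) \<bullet> (T ^^ i) (e x))"
   by (simp only: Te)
  also have "... = E j" by (rule post[OF linear_map_id, symmetric])
  finally show ?thesis .
 qed
 \<comment> \<open>Among the powers of \<open>u\<close> below \<open>p\<close> only the zeroth has
   degree zero, so the degree-zero part of \<open>E j\<close> is \<open>e x\<close> divided by
   \<open>p\<close>.\<close>
 have Enz: "E j ~= \<zero>\<^bsub>H\<^esub>" for j
 proof
  assume 0: "E j = \<zero>\<^bsub>H\<^esub>"
  have t: "P 0 ((T ^^ i) (e x)) = (if 0 = i then e x else \<zero>\<^bsub>H\<^esub>)" if "i < p" for i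
  proof -
   have "homog (i + 0) ((T ^^ i) (e x))" unfolding Ti[OF ee] by (rule homog_mult[OF hup homog_e])
   then show ?thesis using P_homog[of "i + 0" "(T ^^ i) (e x)" 0] that by auto
  qed
  have "P 0 (E j) = U.pinv \<bullet> (\<Oplus>\<^bsub>H\<^esub>i\<in>{..<p}. if 0 = i then (\<zeta> [^]\<^bsub>K\<^esub> ((p - 1) * i * j)) \<bullet> e x else \<zero>\<^bsub>H\<^esub>)"
   unfolding post[OF P_linear]
   by (rule arg_cong[where f="%y. U.pinv \<bullet> y"], rule M.finsum_cong'[OF refl]) (auto simp: t)
  also have "(\<Oplus>\<^bsub>H\<^esub>i\<in>{..<p}. if 0 = i then (\<zeta> [^]\<^bsub>K\<^esub> ((p - 1) * i * j)) \<bullet> e x else \<zero>\<^bsub>H\<^esub>) = e x"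
   using U.p_pos by (subst M.finsum_singleton) auto
  finally have "U.pinv \<bullet> e x = \<zero>\<^bsub>K\<^esub> \<bullet> e x"
   using linear_map_zero[OF mod_H mod_H P_linear, of 0] unfolding 0 by simp
  then have "U.pinv = \<zero>\<^bsub>K\<^esub>"
   by (rule smult_cancel[OF U.field_axioms mod_H ee e_nonzero[OF x] U.pinv_closed U.zero_closed])
  then show False using U.pinv_p by simp
 qed
 \<comment> \<open>A non-zero product would be an eigenvector of \<open>u\<close> for two different
   eigenvalues.\<close>
 have Eorth: "E i \<star> E j = \<zero>\<^bsub>H\<^esub>" if "i < p" "j < p" "i ~= j" for i j
 proof (rule ccontr)
  assume nz: "E i \<star> E j ~= \<zero>\<^bsub>H\<^esub>"
  have "(\<zeta> [^]\<^bsub>K\<^esub> i) \<bullet> (E i \<star> E j) = u \<star> (E i \<star> E j)"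
   using EH uH by (simp add: A.m_assoc[symmetric] uE smult_mult_left)
  also have "... = E i \<star> (u \<star> E j)" using EH uH by (simp add: HC.m_lcomm)
  also have "... = (\<zeta> [^]\<^bsub>K\<^esub> j) \<bullet> (E i \<star> E j)" using EH by (simp add: uE smult_mult_right)
  finally have eq: "\<zeta> [^]\<^bsub>K\<^esub> i = \<zeta> [^]\<^bsub>K\<^esub> j"
   by (rule smult_cancel[OF U.field_axioms mod_H A.m_closed[OF EH EH] nz, rotated 2]) simp_all
  have "\<zeta> [^]\<^bsub>K\<^esub> (i + (p - 1) * j) = \<zeta> [^]\<^bsub>K\<^esub> (j + (p - 1) * j)"
   using eq by (simp add: U.nat_pow_mult[symmetric])
  also have "... = \<one>\<^bsub>K\<^esub>"
  proof (rule U.\<zeta>_pow_dvd)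
   have "j + (p - 1) * j = p * j" using U.p_pos by (cases p) auto
   then show "p dvd j + (p - 1) * j" by simp
  qed
  finally show False unfolding U.\<zeta>_pow_eq_one U.dvd_shift_iff[OF that(1,2)] using that(3) by simp
 qed
 have Eeig: "\<exists>c\<in>carrier K. h \<star> E j = c \<bullet> E j" if h: "h \<in> carrier H" for h j
 proof -
  \<comment> \<open>Multiplication by the power \<open>p - i\<close> of \<open>u\<close>, which is
    invertible in the block, brings the degree-\<open>i\<close> part into degree zero.\<close>
  have "\<exists>c\<in>carrier K. (e x \<star> P i h) \<star> u [^]\<^bsub>H\<^esub> (p - i) = c \<bullet> e x" if "i < p" for i
  proof (rule homog_zero_scalar[OF homog_mult[OF homog_mult[OF homog_e homog_P[OF h]] hup] _ x])
   show "p dvd 0 + i + (p - i)" using that by simp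
   show "e x \<star> (e x \<star> P i h \<star> u [^]\<^bsub>H\<^esub> (p - i)) = e x \<star> P i h \<star> u [^]\<^bsub>H\<^esub> (p - i)"
    using P_closed[OF h, of i] up[of "p - i"] by (simp add: A.m_assoc[symmetric] e_idem[OF x])
  qed
  then obtain c where c: "!!i. i < p ==> c i \<in> carrier K"
   "!!i. i < p ==> (e x \<star> P i h) \<star> u [^]\<^bsub>H\<^esub> (p - i) = c i \<bullet> e x" by metis
  have uiE: "u [^]\<^bsub>H\<^esub> i \<star> E j = (\<zeta> [^]\<^bsub>K\<^esub> (i * j)) \<bullet> E j" for i :: nat
  proof (induction i)
   case (Suc i)
   have "u [^]\<^bsub>H\<^esub> Suc i \<star> E j = u [^]\<^bsub>H\<^esub> i \<star> (u \<star> E j)" using uH up EH by (simp add: A.m_assoc)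
   then show ?case unfolding uE using Suc up EH
    by (simp add: smult_mult_right smult_assoc1[symmetric] U.nat_pow_mult)
  qed (use EH in simp)
  have Pih: "(P i h) \<star> E j = (c i \<otimes>\<^bsub>K\<^esub> \<zeta> [^]\<^bsub>K\<^esub> (i * j)) \<bullet> E j" if i: "i < p" for i
  proof -
   note Pc = P_closed[OF h, of i]
   have "u [^]\<^bsub>H\<^esub> (p - i) \<star> u [^]\<^bsub>H\<^esub> i = e x"
    using A.nat_pow_mult[OF uH, of "p - i" i] i u(3) by simp
   then have "P i h \<star> E j = P i h \<star> ((u [^]\<^bsub>H\<^esub> (p - i) \<star> u [^]\<^bsub>H\<^esub> i) \<star> (e x \<star> E j))"
    by (simp only: eE)
   also have "... = ((e x \<star> P i h) \<star> u [^]\<^bsub>H\<^esub> (p - i)) \<star> (u [^]\<^bsub>H\<^esub> i \<star> E j)"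
    using Pc up EH ee by (simp add: HC.m_ac)
   also have "... = (c i \<bullet> e x) \<star> ((\<zeta> [^]\<^bsub>K\<^esub> (i * j)) \<bullet> E j)"
    by (simp only: c(2)[OF i] uiE)
   also have "... = (c i \<otimes>\<^bsub>K\<^esub> \<zeta> [^]\<^bsub>K\<^esub> (i * j)) \<bullet> E j"
    using c(1)[OF i] EH by (simp add: smult_mult_left smult_mult_right smult_assoc1[symmetric] U.m_comm eE)
   finally show ?thesis .
  qed
  have "h \<star> E j = (\<Oplus>\<^bsub>H\<^esub>i\<in>{..<p}. P i h) \<star> E j"
   by (simp only: U.eigenprojection_sum[OF mod_H \<rho>_linear h])
  also have "... = (\<Oplus>\<^bsub>H\<^esub>i\<in>{..<p}. P i h \<star> E j)"
   by (rule linear_map_finsum[OF mod_H mod_H mult_linear_left[OF EH] finite_lessThan Pi_I[OF P_closed[OF h]]])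
  also have "... = (\<Oplus>\<^bsub>H\<^esub>i\<in>{..<p}. (c i \<otimes>\<^bsub>K\<^esub> \<zeta> [^]\<^bsub>K\<^esub> (i * j)) \<bullet> E j)"
   using c(1) EH Pih by (intro M.finsum_cong') auto
  also have "... = (\<Oplus>\<^bsub>K\<^esub>i\<in>{..<p}. c i \<otimes>\<^bsub>K\<^esub> \<zeta> [^]\<^bsub>K\<^esub> (i * j)) \<bullet> E j"
   using linear_map_finsum[OF mod_K mod_H linear_map_form_smult[OF mod_H linear_map_id EH] finite_lessThan,
     of "%i. c i \<otimes>\<^bsub>K\<^esub> \<zeta> [^]\<^bsub>K\<^esub> (i * j)" p j] c(1) by (simp add: Pi_iff)
  finally show ?thesis using c(1) by (intro bexI[where x="\<Oplus>\<^bsub>K\<^esub>i\<in>{..<p}. c i \<otimes>\<^bsub>K\<^esub> \<zeta> [^]\<^bsub>K\<^esub> (i * j)"] U.finsum_closed) auto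
 qed
 show thesis by (rule that[OF EH Enz eE Eorth Esum Eeig])
qed

text \<open>The composite with \<iota> is a character of a function algebra, hence evaluation at a
  point. This point becomes the image of \<chi> in \<open>G\<close>.\<close>

lemma character_restrict:
 assumes "\<chi> \<in> characters K H"
 shows "\<exists>x\<in>carrier G. \<forall>f\<in>carrier G.A. \<chi> (\<iota> f) = f x"
proof -
 note c = characterD[OF assms]
 have "restrict (%f. \<chi> (\<iota> f)) (carrier G.A) \<in> characters K G.A"
  by (rule characterI[OF G.mod_A linear_map_comp[OF c(2) \<iota>D(1)] _ G.A.ring_axioms])
   (simp_all add: ring_hom_one[OF \<iota>D(2)] ring_hom_mult[OF \<iota>D(2)] c(5,6) \<iota>D(6))
 then obtain x where x: "x \<in> carrier G" "!!f. f \<in> carrier G.A ==> restrict (%f. \<chi> (\<iota> f)) (carrier G.A) f = f x"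
  using G.character_eval by blast
 then show ?thesis by (intro bexI[of _ x]) (simp_all add: x)
qed

text \<open>The idempotents of all blocks together satisfy the hypotheses of
  \<open>split_hopf_isomorphic\<close>, and \<open>q\<close> records the point over which a
  character lies.\<close>

theorem extension_structure:
 shows "group_functions K character_group" "card (carrier character_group) = card (carrier G) * p"
  "hopf_isomorphic K H (function_hopf K character_group)"
  "\<exists>q \<in> hom character_group G. q ` carrier character_group = carrier G"
proof -
 have "\<forall>x. \<exists>E. x \<in> carrier G --> (\<forall>j. E j \<in> carrier H \<and> E j ~= \<zero>\<^bsub>H\<^esub> \<and> e x \<star> E j = E j) \<and>
  (\<forall>i j. i < p --> j < p --> i ~= j --> E i \<star> E j = \<zero>\<^bsub>H\<^esub>) \<and> (\<Oplus>\<^bsub>H\<^esub>j\<in>{..<p}. E j) = e x \<and>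
  (\<forall>h\<in>carrier H. \<forall>j. \<exists>c\<in>carrier K. h \<star> E j = c \<bullet> E j)"
 proof
  fix x
  show "\<exists>E. x \<in> carrier G --> (\<forall>j. E j \<in> carrier H \<and> E j ~= \<zero>\<^bsub>H\<^esub> \<and> e x \<star> E j = E j) \<and>
   (\<forall>i j. i < p --> j < p --> i ~= j --> E i \<star> E j = \<zero>\<^bsub>H\<^esub>) \<and> (\<Oplus>\<^bsub>H\<^esub>j\<in>{..<p}. E j) = e x \<and>
   (\<forall>h\<in>carrier H. \<forall>j. \<exists>c\<in>carrier K. h \<star> E j = c \<bullet> E j)"
  proof (cases "x \<in> carrier G")
   case True
   show ?thesis by (rule block_idempotents[OF True]) blast
  qed blast
 qed
 from choice[OF this] obtain E where E: "!!x j. x \<in> carrier G ==> E x j \<in> carrier H"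
  "!!x j. x \<in> carrier G ==> E x j ~= \<zero>\<^bsub>H\<^esub>" "!!x j. x \<in> carrier G ==> e x \<star> E x j = E x j"
  "!!x i j. x \<in> carrier G ==> i < p ==> j < p ==> i ~= j ==> E x i \<star> E x j = \<zero>\<^bsub>H\<^esub>"
  "!!x. x \<in> carrier G ==> (\<Oplus>\<^bsub>H\<^esub>j\<in>{..<p}. E x j) = e x"
  "!!x h j. x \<in> carrier G ==> h \<in> carrier H ==> \<exists>c\<in>carrier K. h \<star> E x j = c \<bullet> E x j"
  by blast
 let ?I = "carrier G \<times> {..<p}" and ?d = "%i. E (fst i) (snd i)"
 have fin: "finite ?I" using G.finite_L by simp
 have d: "?d i \<in> carrier H" "?d i ~= \<zero>\<^bsub>H\<^esub>" if "i \<in> ?I" for i using that E(1,2) by auto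
 have orth: "?d i \<star> ?d j = \<zero>\<^bsub>H\<^esub>" if ij: "i \<in> ?I" "j \<in> ?I" "i ~= j" for i j
 proof -
  obtain x k y l where s: "i = (x, k)" "j = (y, l)" "x \<in> carrier G" "y \<in> carrier G" "k < p" "l < p"
   using ij by auto
  show ?thesis
  proof (cases "x = y")
   case True
   then show ?thesis using E(4) s ij(3) by auto
  next
   case False
   have "E x k \<star> E y l = (e x \<star> E x k) \<star> (e y \<star> E y l)" using E(3) s by simp
   also have "... = (e x \<star> e y) \<star> (E x k \<star> E y l)"
    using E(1) s e_closed by (simp only: HC.m_ac A.m_closed)
   also have "... = \<zero>\<^bsub>H\<^esub>" using e_orth[OF s(3,4)] False E(1) s by simp
   finally show ?thesis using s by simp
  qed
 qed
 have sum: "(\<Oplus>\<^bsub>H\<^esub>i\<in>?I. ?d i) = \<one>\<^bsub>H\<^esub>"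
 proof -
  have "(\<Oplus>\<^bsub>H\<^esub>i\<in>?I. ?d i) = (\<Oplus>\<^bsub>H\<^esub>x\<in>carrier G. \<Oplus>\<^bsub>H\<^esub>j\<in>{..<p}. E x j)"
   using M.finsum_product[OF G.finite_L finite_lessThan, of p ?d] E(1) by simp
  also have "... = (\<Oplus>\<^bsub>H\<^esub>x\<in>carrier G. e x)" by (rule M.finsum_cong'[OF refl]) (simp_all add: E(5))
  finally show ?thesis by (simp add: e_sum)
 qed
 have eig: "\<exists>c\<in>carrier K. h \<star> ?d i = c \<bullet> ?d i" if "i \<in> ?I" "h \<in> carrier H" for i h
  using E(6) that by auto
 show gf: "group_functions K character_group" by (rule split_hopf_isomorphic(1)[OF fin d orth sum eig])
 show "card (carrier character_group) = card (carrier G) * p"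
  using split_hopf_isomorphic(2)[OF fin d orth sum eig] by (simp add: card_cartesian_product)
 show "hopf_isomorphic K H (function_hopf K character_group)"
  by (rule split_hopf_isomorphic(3)[OF fin d orth sum eig])
 interpret CG: group_functions K character_group by (rule gf)
 obtain q where q: "!!\<chi>. \<chi> \<in> characters K H ==> q \<chi> \<in> carrier G"
  "!!\<chi> f. \<chi> \<in> characters K H ==> f \<in> carrier G.A ==> \<chi> (\<iota> f) = f (q \<chi>)"
  using character_restrict by metis
 have \<delta>1: "G.\<delta> x y = \<one>\<^bsub>K\<^esub> ==> y \<in> carrier G ==> y = x" for x y
  using G.\<delta>_apply[of y x] by (auto split: if_splits)
 have hom: "q \<in> hom character_group G"
 proof (rule homI)
  fix \<chi> \<phi> assume a: "\<chi> \<in> carrier character_group" "\<phi> \<in> carrier character_group"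
  then have \<chi>: "\<chi> \<in> characters K H" and \<phi>: "\<phi> \<in> characters K H" by simp_all
  have m: "\<chi> \<otimes>\<^bsub>character_group\<^esub> \<phi> \<in> characters K H" using CG.L.m_closed[OF a] by simp
  have qc: "q \<chi> \<in> carrier G" "q \<phi> \<in> carrier G" using q(1) \<chi> \<phi> by auto
  let ?f = "G.\<delta> (q \<chi> \<otimes>\<^bsub>G\<^esub> q \<phi>)"
  have bl: "bilinear_map K H H (scalar_module K) (%a b. \<chi> a \<otimes>\<^bsub>K\<^esub> \<phi> b)"
   by (intro bilinear_mapI linear_intros characterD(2)[OF \<chi>] characterD(2)[OF \<phi>] characterD(4)[OF \<chi>] characterD(4)[OF \<phi>])
  have "?f (q (\<chi> \<otimes>\<^bsub>character_group\<^esub> \<phi>)) = (\<chi> \<otimes>\<^bsub>character_group\<^esub> \<phi>) (\<iota> ?f)"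
   by (rule q(2)[OF m G.\<delta>_closed, symmetric])
  also have "... = sw (scalar_module K) (%a b. \<chi> a \<otimes>\<^bsub>K\<^esub> \<phi> b) (\<iota> ?f)"
   by (rule character_mult_apply[OF \<chi> \<phi> \<iota>D(6)[OF G.\<delta>_closed]])
  also have "... = tensor_lift K (scalar_module K) (%a b. \<chi> (\<iota> a) \<otimes>\<^bsub>K\<^esub> \<phi> (\<iota> b)) (comult G.A ?f)"
   by (rule lift_hopf_hom[OF mod_H G.hopf_algebra_function_hopf \<iota> mod_K bl G.\<delta>_closed])
  also have "... = tensor_lift K (scalar_module K) (%a b. a (q \<chi>) \<otimes>\<^bsub>K\<^esub> b (q \<phi>)) (comult G.A ?f)"
   by (rule G.AA.lift_cong[OF G.comult_A_closed[OF G.\<delta>_closed] _ G.mod_K G.eval_eval_bilinear[OF qc], symmetric])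
    (simp only: q(2)[OF \<chi>] q(2)[OF \<phi>])
  also have "... = ?f (q \<chi> \<otimes>\<^bsub>G\<^esub> q \<phi>)" by (rule G.eval_comult[OF G.\<delta>_closed qc])
  also have "... = \<one>\<^bsub>K\<^esub>" using qc by (simp add: G.\<delta>_apply)
  finally show "q (\<chi> \<otimes>\<^bsub>character_group\<^esub> \<phi>) = q \<chi> \<otimes>\<^bsub>G\<^esub> q \<phi>" by (rule \<delta>1[OF _ q(1)[OF m]])
 qed (use q(1) in simp)
 have "carrier G \<subseteq> q ` carrier character_group"
 proof
  fix x assume x: "x \<in> carrier G"
  obtain \<theta> where \<theta>: "bij_betw \<theta> ?I (characters K H)"
   "!!i h. i \<in> ?I ==> h \<in> carrier H ==> h \<star> ?d i = \<theta> i h \<bullet> ?d i"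
   by (rule split_characters[OF assoc_algebra_axioms fin d orth sum eig]) blast+
  have i: "(x, 0) \<in> ?I" using x U.p_pos by simp
  then have \<chi>: "\<theta> (x, 0) \<in> characters K H" using \<theta>(1) unfolding bij_betw_def by blast
  \<comment> \<open>\<open>e x\<close> acts as one on \<open>E x 0\<close>, so the character
    belonging to this idempotent lies over \<open>x\<close>.\<close>
  have "\<theta> (x, 0) (e x) \<bullet> E x 0 = \<one>\<^bsub>K\<^esub> \<bullet> E x 0"
   using \<theta>(2)[OF i e_closed, of x] E(1,3)[OF x, of 0] by simp
  then have "\<theta> (x, 0) (e x) = \<one>\<^bsub>K\<^esub>"
   by (rule smult_cancel[OF U.field_axioms mod_H E(1)[OF x] E(2)[OF x] characterD(4)[OF \<chi> e_closed] U.one_closed])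
  then have "q (\<theta> (x, 0)) = x"
   using q(2)[OF \<chi> G.\<delta>_closed, of x] \<delta>1[OF _ q(1)[OF \<chi>]] unfolding e_def by simp
  then show "x \<in> q ` carrier character_group" using \<chi> by (intro image_eqI[of _ _ "\<theta> (x, 0)"]) simp_all
 qed
 then have "q ` carrier character_group = carrier G" using q(1) by auto
 with hom show "\<exists>q \<in> hom character_group G. q ` carrier character_group = carrier G" by blast
qed

end

section \<open>Function algebras as extensions\<close>

text \<open>By commutativity and the antipode axioms, both adjoint actions of \<open>h\<close>
  reduce to multiplication by the scalar \<open>counit H h\<close>.\<close>

lemma (in comm_hopf_algebra) normal_hopf_subsetI:
 assumes A: "A \<subseteq> carrier H" and smult: "!!c a. c \<in> carrier K ==> a \<in> A ==> c \<bullet> a \<in> A"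
 shows "normal_hopf_subset K H A"
 unfolding normal_hopf_subset_def
proof (intro ballI)
 fix h a assume h: "h \<in> carrier H" and a: "a \<in> A"
 then have aH: "a \<in> carrier H" using A by blast
 let ?S = "antipode H"
 have b1: "bilinear_map K H H H (%x y. x \<star> ?S y)" and b2: "bilinear_map K H H H (%x y. ?S x \<star> y)"
  by (intro bilinear_mapI linear_intros antipode_closed; assumption)+
 note la = lin_mult_left[OF aH linear_map_id]
 have "sw H (%x y. a \<star> (x \<star> ?S y)) h = counit H h \<bullet> a"
  unfolding sw_post[OF mod_H mod_H b1 la h, symmetric] antipode_right[OF h] using h aH by (simp add: smult_mult_right)
 moreover have "sw H (%x y. a \<star> (x \<star> ?S y)) h = sw H (%x y. x \<star> a \<star> ?S y) h"
  by (rule sw_cong[OF mod_H bilinear_map_post[OF b1 la] h]) (simp add: aH HC.m_ac)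
 moreover have "sw H (%x y. a \<star> (?S x \<star> y)) h = counit H h \<bullet> a"
  unfolding sw_post[OF mod_H mod_H b2 la h, symmetric] antipode_left[OF h] using h aH by (simp add: smult_mult_right)
 moreover have "sw H (%x y. a \<star> (?S x \<star> y)) h = sw H (%x y. ?S x \<star> a \<star> y) h"
  by (rule sw_cong[OF mod_H bilinear_map_post[OF b2 la] h]) (simp add: aH HC.m_ac)
 ultimately show "sw H (%x y. x \<star> a \<star> ?S y) h \<in> A \<and> sw H (%x y. ?S x \<star> a \<star> y) h \<in> A"
  using smult[OF counit_closed[OF h] a] by argo
qed

lemma (in group_functions) comm_hopf_algebra_function_hopf: "comm_hopf_algebra K A"
 by (intro comm_hopf_algebra.intro hopf_algebra_function_hopf comm_hopf_algebra_axioms.intro A_comm)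

locale cyclic_kernel = U: root_of_unity_field K p \<zeta> + L: group_functions K L + G: group_functions K G
 for K :: "('k, 'm) ring_scheme" and p :: nat and \<zeta> :: 'k and L :: "('l, 'r) monoid_scheme"
  and G :: "('g, 'n) monoid_scheme" +
 fixes q :: "'l => 'g" and z :: 'l
 assumes q_hom: "q \<in> hom L G" and q_surj: "q ` carrier L = carrier G"
  and z_closed: "z \<in> carrier L" and z_pow_p: "z [^]\<^bsub>L\<^esub> p = \<one>\<^bsub>L\<^esub>"
  and q_kernel: "!!x. x \<in> carrier L ==> q x = \<one>\<^bsub>G\<^esub> \<longleftrightarrow> (\<exists>j<p. x = z [^]\<^bsub>L\<^esub> j)"
  and z_inj: "inj_on (%j. z [^]\<^bsub>L\<^esub> j) {..<p}"
begin

abbreviation zp :: "nat => 'l" where "zp j \<equiv> z [^]\<^bsub>L\<^esub> j"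

lemma zp_closed: "zp j \<in> carrier L" using z_closed by simp

lemma zp_mod: "zp (j mod p) = zp j"
proof -
 have "zp j = zp (p * (j div p) + j mod p)" by simp
 also have "... = zp (p * (j div p)) \<otimes>\<^bsub>L\<^esub> zp (j mod p)" using L.L.nat_pow_mult[OF z_closed] by metis
 also have "zp (p * (j div p)) = \<one>\<^bsub>L\<^esub>" using L.L.nat_pow_pow[OF z_closed, of p "j div p"] z_pow_p by simp
 finally show ?thesis using zp_closed by simp
qed

lemma inv_zp: "inv\<^bsub>L\<^esub> (zp j) = zp ((p - 1) * j)"
proof (rule L.L.inv_equality[OF _ zp_closed zp_closed])
 have "(p - 1) * j + j = p * j" using U.p_pos by (cases p) auto
 then have "zp ((p - 1) * j) \<otimes>\<^bsub>L\<^esub> zp j = zp (p * j)" using L.L.nat_pow_mult[OF z_closed] by metis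
 then show "zp ((p - 1) * j) \<otimes>\<^bsub>L\<^esub> zp j = \<one>\<^bsub>L\<^esub>" using zp_mod[of "p * j"] by simp
qed

text \<open>Restriction of functions to the powers of \<open>z\<close>, followed by the Fourier
  identification of functions on \<open>Z/p\<close> with the group algebra of the cyclic
  group.\<close>

definition proj :: "('l => 'k) => int => 'k" where
 "proj f = (\<Oplus>\<^bsub>U.B\<^esub>j\<in>{..<p}. f (zp j) \<odot>\<^bsub>U.B\<^esub> U.chi_dual j)"

lemma proj_linear: "linear_map K L.A U.B proj"
 unfolding proj_def[abs_def]
 by (intro linear_map_finsum_fun U.mod_B linear_map_form_smult L.eval_form zp_closed finite_lessThan)
  (simp add: U.B_structure(1) U.chi_dual_closed del: free_space_simps)

lemmas proj_closed = linear_map_closed[OF proj_linear]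

lemma fn_closed: "f \<in> carrier L.A ==> x \<in> carrier L ==> f x \<in> carrier K"
 by (auto simp: function_hopf_simps)

lemma dual_B: "U.chi_dual j \<in> carrier U.B"
 unfolding U.B_structure(1) by (rule U.chi_dual_closed)

lemma chi_proj:
 assumes f: "f \<in> carrier L.A"
 shows "U.chi i (proj f) = f (zp i)"
proof -
 have *: "U.chi i (proj f) = f (zp i)" if i: "i < p" for i
 proof -
  have k: "f (zp j) \<in> carrier K" for j by (rule fn_closed[OF f zp_closed])
  have "U.chi i (proj f) = (\<Oplus>\<^bsub>scalar_module K\<^esub>j\<in>{..<p}. U.chi i (f (zp j) \<odot>\<^bsub>U.B\<^esub> U.chi_dual j))"
   unfolding proj_def
   by (rule linear_map_finsum[OF U.mod_B U.mod_K U.chi_form finite_lessThan Pi_I[OF module.smult_closed[OF U.mod_B k dual_B]]])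
  also have "... = (\<Oplus>\<^bsub>K\<^esub>j\<in>{..<p}. U.chi i (f (zp j) \<odot>\<^bsub>U.B\<^esub> U.chi_dual j))" by (rule finsum_scalar_module)
  also have "... = (\<Oplus>\<^bsub>K\<^esub>j\<in>{..<p}. if i = j then f (zp j) else \<zero>\<^bsub>K\<^esub>)"
   using i k by (intro U.finsum_cong'[OF refl])
    (auto simp: linear_map_smult[OF U.chi_form k dual_B] U.chi_chi_dual)
  also have "... = f (zp i)" using i k by (intro U.finsum_singleton) auto
  finally show ?thesis .
 qed
 \<comment> \<open>Both sides have period \<open>p\<close> in \<open>i\<close>.\<close>
 show ?thesis using *[of "i mod p"] U.p_pos by (simp add: U.chi_mod zp_mod)
qed

text \<open>The forms \<open>chi j\<close> separate elements and tensors of the group algebra; after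
  applying them, \<open>chi_proj\<close> leaves identities between values at powers of
  \<open>z\<close>.\<close>

lemma proj_hom: "proj \<in> hopf_hom K L.A U.B"
proof -
 interpret H: hopf_algebra K L.A by (rule L.hopf_algebra_function_hopf)
 have cl: "proj f \<in> carrier U.F" if "f \<in> carrier L.A" for f using proj_closed[OF that] by (simp only: U.B_structure)
 have ring: "proj \<in> ring_hom L.A U.B"
 proof (rule ring_hom_memI)
  fix f g assume f: "f \<in> carrier L.A" and g: "g \<in> carrier L.A"
  show "proj (f \<otimes>\<^bsub>L.A\<^esub> g) = proj f \<otimes>\<^bsub>U.B\<^esub> proj g"
   by (rule U.B_eqI[OF cl[OF L.A.m_closed[OF f g]] U.B_mult_closed[OF cl[OF f] cl[OF g]]])
    (unfold U.chi_mult[OF cl[OF f] cl[OF g]] chi_proj[OF f] chi_proj[OF g] chi_proj[OF L.A.m_closed[OF f g]],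
     simp add: function_hopf_simps(2) zp_closed)
  show "proj (f \<oplus>\<^bsub>L.A\<^esub> g) = proj f \<oplus>\<^bsub>U.B\<^esub> proj g" by (rule linear_map_add[OF proj_linear f g])
 next
  show "proj \<one>\<^bsub>L.A\<^esub> = \<one>\<^bsub>U.B\<^esub>"
   by (rule U.B_eqI[OF cl[OF L.A.one_closed] U.B_one_closed])
    (unfold U.chi_one chi_proj[OF L.A.one_closed], simp add: function_hopf_simps(3) zp_closed)
 qed (rule proj_closed)
 have comult: "comult U.B (proj f) = tensor_map K U.B U.B proj proj (comult L.A f)" if f: "f \<in> carrier L.A" for f
 proof (rule tensor_eqI[OF U.mod_B U.mod_B U.dual_system_chi, of "{..<p}" U.chi])
  show "linear_form K U.B (U.chi j)" for j by (rule U.chi_form)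
  show "w = w'" if "w \<in> carrier U.B" "w' \<in> carrier U.B" "!!j. j \<in> {..<p} ==> U.chi j w = U.chi j w'" for w w'
   by (rule dual_system_eqI[OF U.mod_B U.dual_system_chi that(1,2)], rule that(3))
  show "comult U.B (proj f) \<in> carrier (tensor_space K U.B U.B)" by (rule U.B_comult_closed[OF cl[OF f]])
  show "tensor_map K U.B U.B proj proj (comult L.A f) \<in> carrier (tensor_space K U.B U.B)"
   by (rule linear_map_closed[OF tensor_map_linear[OF U.mod_B U.mod_B L.mod_A L.mod_A proj_linear proj_linear]
     H.comult_closed[OF f]])
  fix i j
  have "tensor_lift K (scalar_module K) (%a b. U.chi i a \<otimes>\<^bsub>K\<^esub> U.chi j b) (tensor_map K U.B U.B proj proj (comult L.A f)) =
   tensor_lift K (scalar_module K) (%a b. U.chi i (proj a) \<otimes>\<^bsub>K\<^esub> U.chi j (proj b)) (comult L.A f)"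
   by (rule lift_tensor_map[OF U.mod_B U.mod_B L.mod_A L.mod_A proj_linear proj_linear U.mod_K U.chi_chi_bilinear
     H.comult_closed[OF f]])
  also have "... = tensor_lift K (scalar_module K) (%a b. a (zp i) \<otimes>\<^bsub>K\<^esub> b (zp j)) (comult L.A f)"
   by (rule L.AA.lift_cong[OF L.comult_A_closed[OF f] _ L.mod_K L.eval_eval_bilinear[OF zp_closed zp_closed], symmetric])
    (simp only: chi_proj)
  also have "... = f (zp i \<otimes>\<^bsub>L\<^esub> zp j)" by (rule L.eval_comult[OF f zp_closed zp_closed])
  also have "... = U.chi (i + j) (proj f)" unfolding chi_proj[OF f] using L.L.nat_pow_mult[OF z_closed] by simp
  finally show "tensor_lift K (scalar_module K) (%a b. U.chi i a \<otimes>\<^bsub>K\<^esub> U.chi j b) (comult U.B (proj f)) =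
   tensor_lift K (scalar_module K) (%a b. U.chi i a \<otimes>\<^bsub>K\<^esub> U.chi j b) (tensor_map K U.B U.B proj proj (comult L.A f))"
   unfolding U.chi_chi_comult[OF cl[OF f]] by (rule sym)
 qed
 have counit: "counit U.B (proj f) = counit L.A f" if f: "f \<in> carrier L.A" for f
  unfolding U.B_counit_chi[OF cl[OF f]] chi_proj[OF f] by (simp add: function_hopf_simps)
 have antipode: "antipode U.B (proj f) = proj (antipode L.A f)" if f: "f \<in> carrier L.A" for f
  by (rule U.B_eqI[OF U.B_antipode_closed[OF cl[OF f]] cl[OF H.antipode_closed[OF f]]])
   (unfold U.chi_antipode[OF cl[OF f]] chi_proj[OF f] chi_proj[OF H.antipode_closed[OF f]],
    simp add: function_hopf_simps(8) zp_closed inv_zp)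
 show ?thesis unfolding hopf_hom_def using proj_linear ring comult counit antipode by blast
qed

abbreviation "\<iota> \<equiv> pullback L q"

lemma \<iota>_hom: "\<iota> \<in> hopf_hom K G.A L.A"
 by (rule pullback_hopf_hom[OF G.group_functions_axioms L.group_functions_axioms q_hom])

lemmas \<iota>D = hopf_homD[OF \<iota>_hom]

lemma q_closed: "x \<in> carrier L ==> q x \<in> carrier G" using q_surj by blast

lemma \<iota>_inj: "inj_on \<iota> (carrier G.A)"
proof (rule inj_onI)
 fix f g assume f: "f \<in> carrier G.A" and g: "g \<in> carrier G.A" and eq: "\<iota> f = \<iota> g"
 have e: "f (q x) = g (q x)" if "x \<in> carrier L" for x using fun_cong[OF eq, of x] that by (simp add: pullback_def)
 show "f = g"
 proof (rule G.fn_ext[OF f g])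
  fix y assume "y \<in> carrier G"
  then obtain x where "x \<in> carrier L" "y = q x" using q_surj by auto
  then show "f y = g y" using e by simp
 qed
qed

lemma proj_surj: "proj ` carrier L.A = carrier U.B"
proof
 show "carrier U.B \<subseteq> proj ` carrier L.A"
 proof
  fix b assume b: "b \<in> carrier U.B"
  then have bF: "b \<in> carrier U.F" by (simp only: U.B_structure)
  define f where "f = (\<lambda>x\<in>carrier L. if \<exists>j<p. x = zp j then U.chi (the_inv_into {..<p} zp x) b else \<zero>\<^bsub>K\<^esub>)"
  have f: "f \<in> carrier L.A" unfolding f_def by (auto simp: function_hopf_simps U.chi_closed[OF bF])
  have "f (zp j) = U.chi j b" if "j < p" for j
   using that zp_closed[of j] the_inv_into_f_f[OF z_inj, of j] by (auto simp: f_def)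
  then have "b = proj f"
   by (intro U.B_eqI bF proj_closed[OF f, unfolded U.B_structure(1)]) (simp only: chi_proj[OF f])
  then show "b \<in> proj ` carrier L.A" using f by blast
 qed
qed (use proj_closed in blast)

text \<open>A function vanishing on the kernel of \<open>q\<close> is unchanged by multiplication
  with the pullback of the indicator function of the non-identity elements of \<open>G\<close>, and
  this pullback has counit zero. The other inclusion is checked on generators.\<close>

lemma proj_kernel: "a_kernel L.A U.B proj = augmentation_ideal_span K L.A (\<iota> ` carrier G.A)"
proof
 note B_zero = abelian_monoid.zero_closed[OF abelian_group.axioms(1)[OF module.axioms(2)[OF U.mod_B]]]
 let ?S = "{a \<otimes>\<^bsub>L.A\<^esub> h |a h. a \<in> \<iota> ` carrier G.A \<and> counit L.A a = \<zero>\<^bsub>K\<^esub> \<and> h \<in> carrier L.A}"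
 interpret q: group_hom L G q by unfold_locales (rule q_hom)
 have zc: "U.chi j \<zero>\<^bsub>U.B\<^esub> = \<zero>\<^bsub>K\<^esub>" for j
  using linear_map_zero[OF U.mod_B U.mod_K U.chi_form] by simp
 have k: "a_kernel L.A U.B proj = {f \<in> carrier L.A. proj f = \<zero>\<^bsub>U.B\<^esub>}" unfolding a_kernel_def' ..
 have S: "?S \<subseteq> {f \<in> carrier L.A. proj f = \<zero>\<^bsub>U.B\<^esub>}"
 proof
  fix f assume "f \<in> ?S"
  then obtain g h where gh: "f = \<iota> g \<otimes>\<^bsub>L.A\<^esub> h" "g \<in> carrier G.A" "counit L.A (\<iota> g) = \<zero>\<^bsub>K\<^esub>" "h \<in> carrier L.A" by auto
  have f: "f \<in> carrier L.A" unfolding gh(1) by (rule L.A.m_closed[OF \<iota>D(6)[OF gh(2)] gh(4)])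
  have g0: "g \<one>\<^bsub>G\<^esub> = \<zero>\<^bsub>K\<^esub>" using gh(3) by (simp add: function_hopf_simps pullback_def)
  have "f (zp j) = \<zero>\<^bsub>K\<^esub>" if "j < p" for j
  proof -
   have "q (zp j) = \<one>\<^bsub>G\<^esub>" using q_kernel[OF zp_closed] that by blast
   then show ?thesis
    unfolding gh(1) by (simp add: function_hopf_simps(2) pullback_def zp_closed g0 fn_closed[OF gh(4) zp_closed])
  qed
  then have "proj f = \<zero>\<^bsub>U.B\<^esub>"
   by (intro U.B_eqI proj_closed[OF f, unfolded U.B_structure(1)] B_zero[unfolded U.B_structure(1)])
    (simp only: chi_proj[OF f] zc)
  then show "f \<in> {f \<in> carrier L.A. proj f = \<zero>\<^bsub>U.B\<^esub>}" using f by blast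
 qed
 show "augmentation_ideal_span K L.A (\<iota> ` carrier G.A) \<subseteq> a_kernel L.A U.B proj"
  unfolding k augmentation_ideal_span_def
  by (rule span_in_minimal[OF S linear_map_kernel_submodule[OF L.mod_A U.mod_B proj_linear]])
 show "a_kernel L.A U.B proj \<subseteq> augmentation_ideal_span K L.A (\<iota> ` carrier G.A)"
 proof
  fix f assume "f \<in> a_kernel L.A U.B proj"
  then have f: "f \<in> carrier L.A" and f0: "proj f = \<zero>\<^bsub>U.B\<^esub>" unfolding k by auto
  have fz: "f (zp j) = \<zero>\<^bsub>K\<^esub>" for j using chi_proj[OF f, of j] unfolding f0 zc by simp
  define g where "g = (\<lambda>y\<in>carrier G. if y = \<one>\<^bsub>G\<^esub> then \<zero>\<^bsub>K\<^esub> else \<one>\<^bsub>K\<^esub>)"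
  have g: "g \<in> carrier G.A" unfolding g_def by (auto simp: function_hopf_simps)
  have c: "counit L.A (\<iota> g) = \<zero>\<^bsub>K\<^esub>" by (simp add: function_hopf_simps pullback_def g_def)
  have "f = \<iota> g \<otimes>\<^bsub>L.A\<^esub> f"
  proof (rule L.fn_ext[OF f L.A.m_closed[OF \<iota>D(6)[OF g] f]])
   fix x assume x: "x \<in> carrier L"
   show "f x = (\<iota> g \<otimes>\<^bsub>L.A\<^esub> f) x"
    using q_kernel[OF x] fz x q_closed[OF x] fn_closed[OF f x]
    by (auto simp: function_hopf_simps(2) pullback_def g_def)
  qed
  then have "f \<in> ?S" using c g f by blast
  then show "f \<in> augmentation_ideal_span K L.A (\<iota> ` carrier G.A)"
   unfolding augmentation_ideal_span_def by (rule subsetD[OF span_in_superset])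
 qed
qed

theorem function_hopf_extension: "L.A \<in> commutative_extensions K G p"
proof -
 interpret H: comm_hopf_algebra K L.A by (rule L.comm_hopf_algebra_function_hopf)
 have "normal_hopf_subset K L.A (\<iota> ` carrier G.A)"
 proof (rule H.normal_hopf_subsetI)
  show "\<iota> ` carrier G.A \<subseteq> carrier L.A" using \<iota>D(6) by blast
  fix c a assume c: "c \<in> carrier K" and "a \<in> \<iota> ` carrier G.A"
  then obtain g where g: "g \<in> carrier G.A" "a = \<iota> g" by blast
  have "c \<odot>\<^bsub>L.A\<^esub> a = \<iota> (c \<odot>\<^bsub>G.A\<^esub> g)" unfolding g(2) by (rule linear_map_smult[OF \<iota>D(1) c g(1), symmetric])
  then show "c \<odot>\<^bsub>L.A\<^esub> a \<in> \<iota> ` carrier G.A" using G.smult_closed[OF c g(1)] by blast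
 qed
 then have "hopf_extension K G.A L.A U.B"
  unfolding hopf_extension_def
  by (intro conjI bexI[OF _ \<iota>_hom] bexI[OF _ proj_hom] L.hopf_algebra_function_hopf \<iota>_inj proj_surj proj_kernel)
 then show ?thesis unfolding commutative_extensions_def by (intro CollectI conjI H.HC.is_cring)
qed

end

theorem commutative_extension_structure:
 assumes "algebraically_closed K" "!!m :: nat. m > 0 ==> [m] \<cdot>\<^bsub>K\<^esub> \<one>\<^bsub>K\<^esub> ~= \<zero>\<^bsub>K\<^esub>" "Factorial_Ring.prime p"
  and G: "group G" "finite (carrier G)" and H: "H \<in> commutative_extensions K G p"
 obtains L :: "('h => 'k) monoid" and q where "group L" "card (carrier L) = card (carrier G) * p"
  "hopf_isomorphic K (H :: ('k, 'h) hopf_data) (function_hopf K L)" "q \<in> hom L G" "q ` carrier L = carrier G"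
proof -
 obtain \<zeta> where z: "root_of_unity_field K p \<zeta>" by (rule root_of_unity_field_exists[OF assms(1-3)])
 interpret U: root_of_unity_field K p \<zeta> by (rule z)
 interpret G: group_functions K G
  by (intro group_functions.intro U.field_axioms G group_functions_axioms.intro)
 from H obtain \<iota> \<pi> where *: "hopf_algebra K H" "cring H" "\<iota> \<in> hopf_hom K (function_hopf K G) H"
   "\<pi> \<in> hopf_hom K H (group_hopf K (integer_mod_group p))" "inj_on \<iota> (carrier (function_hopf K G))"
   "\<pi> ` carrier H = carrier (group_hopf K (integer_mod_group p))"
   "a_kernel H (group_hopf K (integer_mod_group p)) \<pi> =
    augmentation_ideal_span K H (\<iota> ` carrier (function_hopf K G))"
  unfolding commutative_extensions_def hopf_extension_def by blast
 interpret HC: cring H by (rule *(2))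
 interpret H: comm_hopf_algebra K H
  by (intro comm_hopf_algebra.intro *(1) comm_hopf_algebra_axioms.intro HC.m_comm)
 interpret E: commutative_extension K p \<zeta> H G \<iota> \<pi>
  by (intro commutative_extension.intro z H.comm_hopf_algebra_axioms G.group_functions_axioms
    commutative_extension_axioms.intro *)
 interpret CG: group_functions K H.character_group by (rule E.extension_structure(1))
 show thesis using that[OF CG.L.is_group E.extension_structure(2,3)] E.extension_structure(4) by blast
qed

section \<open>Model groups\<close>

text \<open>A bilinear cocycle whose antisymmetrisation is the standard alternating form of rank
  \<open>2 * r\<close> on the first \<open>2 * r\<close> coordinates.\<close>

definition twist :: "nat => (nat => nat) => (nat => nat) => nat" where
 "twist r u v = (\<Sum>j<r. u (2 * j + 1) * v (2 * j))"

text \<open>The power of the \<open>k\<close>-th generator that equals the central element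
  \<open>z\<close>. For \<open>k = n\<close> the generator is \<open>z\<close> itself; otherwise it
  has order \<open>p^2\<close> and its \<open>p\<close>-th power is \<open>z\<close>.\<close>

definition central_step :: "nat => nat => nat => nat" where
 "central_step p n k = (if k = n then 1 else p)"

text \<open>For \<open>k\<close> below \<open>n\<close>, coordinate \<open>k\<close> takes over the
  role of coordinate \<open>n\<close>, which shrinks to a single value. Thus \<open>n + 1\<close>
  coordinates serve in all cases and the order is always \<open>p^(n+1)\<close>.\<close>

definition modulus :: "nat => nat => nat => nat => nat" where
 "modulus p n k i = (if i = k then p * central_step p n k else if i = n then 1 else p)"

definition model_group :: "nat => nat => nat => nat => (nat => nat) monoid" where
 "model_group p n r k = \<lparr>carrier = (\<Pi>\<^sub>E i\<in>{..n}. {..<modulus p n k i}),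
   monoid.mult = (%u v. \<lambda>i\<in>{..n}. (u i + v i + (if i = k then central_step p n k * twist r u v else 0)) mod modulus p n k i),
   one = (\<lambda>i\<in>{..n}. 0)\<rparr>"

text \<open>The \<open>p\<close>-th power map is trivial for \<open>k = n\<close>. For
  \<open>k = n - 1\<close> the condition \<open>2 * r < n\<close> keeps coordinate \<open>k\<close>
  outside the form, so the map is non-trivial on the centre; for \<open>k = 0\<close> the condition
  \<open>0 < r\<close> puts it inside, and the map is trivial on the centre.\<close>

definition model_params :: "nat => (nat \<times> nat) set" where
 "model_params n = {(r, k). 2 * r \<le> n \<and> (k = n \<or> k + 1 = n \<and> 2 * r < n \<or> k = 0 \<and> 0 < r)}"

lemma mod_add_dvd: "(b :: nat) dvd x ==> (a + x) mod b = a mod b"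
 by (auto elim!: dvdE)

lemma mod_add3:
 "(a mod b + c + d mod b) mod b = (a + c + d) mod b" "(c + a mod b + d mod b) mod b = (c + a + d) mod (b :: nat)"
 "(a mod b + c + d) mod b = (a + c + d) mod b"
 by (metis mod_add_left_eq mod_add_right_eq add.assoc add.commute)+

lemma mod_add_left_cancel: "(a + x) mod b = (a + y) mod b ==> x mod b = y mod (b :: nat)"
 by (simp add: nat_mod_eq_iff add.assoc)

lemma twist_cong:
 assumes "!!i. i < 2 * r ==> u i mod p = u' i mod p" "!!i. i < 2 * r ==> v i mod p = v' i mod p"
 shows "twist r u v mod p = twist r u' v' mod p"
proof -
 have "(u (2 * j + 1) * v (2 * j)) mod p = (u' (2 * j + 1) * v' (2 * j)) mod p" if "j < r" for j
  using that by (intro mod_mult_cong assms) auto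
 then have "(\<Sum>j<r. (u (2 * j + 1) * v (2 * j)) mod p) mod p = (\<Sum>j<r. (u' (2 * j + 1) * v' (2 * j)) mod p) mod p"
  by simp
 then show ?thesis unfolding twist_def mod_sum_eq .
qed

lemma twist_simps:
 "twist r (%i. u i + u' i) v = twist r u v + twist r u' v"
 "twist r u (%i. v i + v' i) = twist r u v + twist r u v'"
 "twist r (%i. a * u i) v = a * twist r u v"
 by (simp_all add: twist_def algebra_simps sum.distrib sum_distrib_left)

locale model =
 fixes p n r k :: nat
 assumes prime_p: "Factorial_Ring.prime p" and odd_p: "odd p" and params: "(r, k) \<in> model_params n"
begin

abbreviation "E \<equiv> model_group p n r k"
abbreviation "s \<equiv> central_step p n k"
abbreviation "m \<equiv> modulus p n k"

lemma p_gt_1: "1 < p" using prime_p by (rule prime_gt_1_nat)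

lemma r_le: "2 * r \<le> n" and k_le: "k \<le> n" using params unfolding model_params_def by auto

lemma s_pos: "0 < s" using p_gt_1 by (simp add: central_step_def)

lemma m_pos: "0 < m i" using p_gt_1 by (simp add: modulus_def central_step_def)

lemma m_k: "m k = s * p" by (simp add: modulus_def)

lemma p_dvd_m: "i < n ==> p dvd m i" by (simp add: modulus_def)

lemma p_dvd_s: "k < 2 * r ==> p dvd s" using r_le by (simp add: central_step_def)

lemma m_dvd_p2: "m i dvd p * p" by (simp add: modulus_def central_step_def)

lemma carrier_E: "u \<in> carrier E \<longleftrightarrow> u \<in> extensional {..n} \<and> (\<forall>i\<le>n. u i < m i)"
 by (auto simp: model_group_def PiE_iff)

lemma mult_E: "i \<le> n ==> (u \<otimes>\<^bsub>E\<^esub> v) i = (u i + v i + (if i = k then s * twist r u v else 0)) mod m i"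
 by (simp add: model_group_def)

lemma one_E: "i \<le> n ==> \<one>\<^bsub>E\<^esub> i = 0"
 by (simp add: model_group_def)

lemma one_closed: "\<one>\<^bsub>E\<^esub> \<in> carrier E"
 using m_pos by (auto simp: model_group_def)

lemma mult_closed: "u \<otimes>\<^bsub>E\<^esub> v \<in> carrier E"
 using m_pos by (auto simp: model_group_def)

lemma eqI: "u \<in> carrier E ==> v \<in> carrier E ==> (!!i. i \<le> n ==> u i = v i) ==> u = v"
 unfolding carrier_E by (auto intro: extensionalityI)

lemma s_mult_cong: "a mod p = b mod p ==> (s * a) mod m k = (s * b) mod m k"
 unfolding m_k by simp

text \<open>If the twisted coordinate \<open>k\<close> itself enters the form, its modulus is
  \<open>p^2\<close> and the cocycle is added in multiples of \<open>p\<close>. Modulo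
  \<open>p\<close> the coordinates seen by the form therefore simply add, which makes the twisted
  product associative.\<close>

lemma mult_mod_p: "i < 2 * r ==> (u \<otimes>\<^bsub>E\<^esub> v) i mod p = (u i + v i) mod p"
proof -
 assume i: "i < 2 * r"
 then have "i < n" using r_le by simp
 then have "(u \<otimes>\<^bsub>E\<^esub> v) i mod p = (u i + v i + (if i = k then s * twist r u v else 0)) mod p"
  by (simp add: mult_E mod_mod_cancel[OF p_dvd_m])
 then show ?thesis using p_dvd_s i by (auto simp: mod_add_dvd)
qed

lemma twist_mult:
 "(s * twist r (u \<otimes>\<^bsub>E\<^esub> v) w) mod m k = (s * (twist r u w + twist r v w)) mod m k"
 "(s * twist r w (u \<otimes>\<^bsub>E\<^esub> v)) mod m k = (s * (twist r w u + twist r w v)) mod m k"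
 unfolding twist_simps(1,2)[symmetric] by (intro s_mult_cong twist_cong mult_mod_p refl; assumption)+

lemma monoid_E: "monoid E"
proof (rule monoidI)
 fix u v w assume "u \<in> carrier E" "v \<in> carrier E" "w \<in> carrier E"
 show "u \<otimes>\<^bsub>E\<^esub> v \<otimes>\<^bsub>E\<^esub> w = u \<otimes>\<^bsub>E\<^esub> (v \<otimes>\<^bsub>E\<^esub> w)"
 proof (rule eqI[OF mult_closed mult_closed])
  fix i assume i: "i \<le> n"
  show "(u \<otimes>\<^bsub>E\<^esub> v \<otimes>\<^bsub>E\<^esub> w) i = (u \<otimes>\<^bsub>E\<^esub> (v \<otimes>\<^bsub>E\<^esub> w)) i"
  proof (cases "i = k")
   case True
   have "(u \<otimes>\<^bsub>E\<^esub> v \<otimes>\<^bsub>E\<^esub> w) k = ((u k + v k + s * twist r u v) mod m k + w k + (s * twist r (u \<otimes>\<^bsub>E\<^esub> v) w) mod m k) mod m k"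
    using k_le by (simp add: mult_E mod_simps)
   also have "... = (u k + (v k + w k + s * twist r v w) mod m k + (s * (twist r u v + twist r u w)) mod m k) mod m k"
    unfolding twist_mult mod_add3(1,2) by (simp add: algebra_simps)
   also have "... = (u \<otimes>\<^bsub>E\<^esub> (v \<otimes>\<^bsub>E\<^esub> w)) k"
    unfolding twist_mult[symmetric] using k_le by (simp add: mult_E mod_simps)
   finally show ?thesis using True by simp
  qed (simp add: mult_E i mod_simps add.assoc)
 qed
next
 fix u assume u: "u \<in> carrier E"
 have 0: "twist r \<one>\<^bsub>E\<^esub> v = 0" "twist r v \<one>\<^bsub>E\<^esub> = 0" for v
  using r_le by (auto simp: twist_def one_E)
 show "\<one>\<^bsub>E\<^esub> \<otimes>\<^bsub>E\<^esub> u = u" "u \<otimes>\<^bsub>E\<^esub> \<one>\<^bsub>E\<^esub> = u"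
  using u by (intro eqI[OF mult_closed u]; simp add: mult_E 0 one_E carrier_E)+
qed (rule mult_closed one_closed)+

text \<open>Each further factor \<open>u\<close> adds \<open>N\<close> times
  \<open>twist r u u\<close> to the twisted coordinate, and \<open>0 + 1 + ... + (N - 1)\<close> is
  the binomial coefficient.\<close>

lemma pow_E:
 assumes u: "u \<in> carrier E" and i: "i \<le> n"
 shows "(u [^]\<^bsub>E\<^esub> N) i = (N * u i + (if i = k then s * (twist r u u * (N choose 2)) else 0)) mod m i"
 using i
proof (induction N arbitrary: i)
 case 0
 interpret monoid E by (rule monoid_E)
 show ?case using 0 by (simp add: one_E numeral_2_eq_2)
next
 case (Suc N)
 interpret monoid E by (rule monoid_E)
 have mp: "(u [^]\<^bsub>E\<^esub> N) j mod p = (N * u j) mod p" if j: "j < 2 * r" for j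
 proof -
  have j': "j \<le> n" "j < n" using j r_le by auto
  have "(u [^]\<^bsub>E\<^esub> N) j mod p = (N * u j + (if j = k then s * (twist r u u * (N choose 2)) else 0)) mod p"
   unfolding Suc.IH[OF j'(1)] by (rule mod_mod_cancel[OF p_dvd_m[OF j'(2)]])
  then show ?thesis using p_dvd_s j by (auto simp: mod_add_dvd)
 qed
 show ?case
 proof (cases "i = k")
  case True
  have "(s * twist r (u [^]\<^bsub>E\<^esub> N) u) mod m k = (s * (N * twist r u u)) mod m k"
   unfolding twist_simps(3)[symmetric] by (intro s_mult_cong twist_cong mp refl; assumption)
  then have t: "(a + s * twist r (u [^]\<^bsub>E\<^esub> N) u) mod m k = (a + s * (N * twist r u u)) mod m k" for a
   by (metis mod_add_right_eq)
  have c: "Suc N choose 2 = N + (N choose 2)" by (simp add: numeral_2_eq_2)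
  have "(u [^]\<^bsub>E\<^esub> Suc N) k = ((N * u k + s * (twist r u u * (N choose 2))) mod m k + u k + s * twist r (u [^]\<^bsub>E\<^esub> N) u) mod m k"
   using k_le Suc.IH[OF k_le] by (simp add: mult_E)
  also have "... = ((N * u k + s * (twist r u u * (N choose 2))) mod m k + u k + s * (N * twist r u u)) mod m k"
   by (rule t)
  also have "... = (Suc N * u k + s * (twist r u u * (Suc N choose 2))) mod m k"
   unfolding c mod_add3(3) by (simp add: algebra_simps)
  finally show ?thesis using True by simp
 next
  case False
  then show ?thesis using Suc by (simp add: mult_E mod_simps algebra_simps)
 qed
qed

text \<open>Here oddness of \<open>p\<close> enters: the quadratic correction in
  \<open>pow_E\<close> disappears for the exponents \<open>p\<close> and
  \<open>p * p\<close>.\<close>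

lemma p_dvd_choose: "p dvd p choose 2" "p dvd p * p choose 2"
proof -
 obtain q where q: "p = 2 * q + 1" using odd_p by (elim oddE)
 have "p * (p - 1) div 2 = p * q" "p * p * (p * p - 1) div 2 = p * (p * (2 * q * q + 2 * q))"
  unfolding q by (simp_all add: algebra_simps)
 then show "p dvd p choose 2" "p dvd p * p choose 2" by (auto simp: choose_two)
qed

lemma pow_p_E:
 assumes u: "u \<in> carrier E" and i: "i \<le> n"
 shows "(u [^]\<^bsub>E\<^esub> p) i = (if i = k then (p * u k) mod m k else 0)"
proof -
 have "m k dvd s * (twist r u u * (p choose 2))" unfolding m_k using p_dvd_choose(1) by (intro mult_dvd_mono) auto
 moreover have "m i dvd p" if "i ~= k" using that by (simp add: modulus_def)
 ultimately show ?thesis unfolding pow_E[OF u i] by (auto simp: mod_add_dvd)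
qed

lemma pow_p2_E:
 assumes u: "u \<in> carrier E"
 shows "u [^]\<^bsub>E\<^esub> (p * p) = \<one>\<^bsub>E\<^esub>"
proof -
 interpret monoid E by (rule monoid_E)
 show ?thesis
 proof (rule eqI[OF nat_pow_closed[OF u] one_closed])
  fix i assume i: "i \<le> n"
  have "m k dvd s * (twist r u u * (p * p choose 2))" unfolding m_k using p_dvd_choose(2) by (intro mult_dvd_mono) auto
  then show "(u [^]\<^bsub>E\<^esub> (p * p)) i = \<one>\<^bsub>E\<^esub> i"
   unfolding pow_E[OF u i] one_E[OF i] using m_dvd_p2[of i] by (auto intro!: dvd_imp_mod_0 dvd_add dvd_mult2)
 qed
qed

text \<open>Inverses are powers with exponent \<open>p * p - 1\<close>, which spares an explicit
  formula involving the cocycle.\<close>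

lemma group_E: "group E"
proof -
 interpret monoid E by (rule monoid_E)
 show ?thesis
 proof (rule group_l_invI)
  fix u assume u: "u \<in> carrier E"
  have "u [^]\<^bsub>E\<^esub> (p * p - 1) \<otimes>\<^bsub>E\<^esub> u = u [^]\<^bsub>E\<^esub> Suc (p * p - 1)" by simp
  also have "Suc (p * p - 1) = p * p" using p_gt_1 by simp
  finally show "\<exists>v\<in>carrier E. v \<otimes>\<^bsub>E\<^esub> u = \<one>\<^bsub>E\<^esub>" using pow_p2_E[OF u] nat_pow_closed[OF u] by metis
 qed
qed

sublocale E: group E by (rule group_E)

text \<open>Used with \<open>j = 0\<close> for the order of the group and with
  \<open>j = 2 * r\<close> for the order of the centre. The formula counts coordinate
  \<open>k\<close>, so the second alternative covers a range that misses it.\<close>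

lemma prod_modulus:
 assumes "j \<le> n"
 shows "(\<Prod>i\<in>{j..n}. modulus p n k i) = p ^ (n + 1 - j) \<or> k < j"
proof (cases "k < j")
 case False
 then have k: "k \<in> {j..n}" using k_le by simp
 have "(\<Prod>i\<in>{j..n}. m i) = m k * (\<Prod>i\<in>{j..n} - {k}. m i)" by (rule prod.remove[OF _ k]) simp
 also have "... = p ^ (n + 1 - j)"
 proof (cases "k = n")
  case True
  have "(\<Prod>i\<in>{j..n} - {k}. m i) = (\<Prod>i\<in>{j..n} - {k}. p)" by (rule prod.cong) (auto simp: modulus_def True)
  also have "... = p ^ (n - j)" using True assms by simp
  finally show ?thesis using True assms by (simp add: modulus_def central_step_def Suc_diff_le)
 next
  case False
  have n: "n \<in> {j..n} - {k}" using False assms by simp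
  have "(\<Prod>i\<in>{j..n} - {k}. m i) = m n * (\<Prod>i\<in>{j..n} - {k} - {n}. m i)" by (rule prod.remove[OF _ n]) simp
  also have "... = (\<Prod>i\<in>{j..n} - {k} - {n}. p)" using False by (auto simp: modulus_def intro!: prod.cong)
  also have "... = p ^ (n - j - 1)" using n k by (simp add: card_Diff_subset)
  finally have "(\<Prod>i\<in>{j..n} - {k}. m i) = p ^ (n - j - 1)" .
  moreover have "n + 1 - j = 2 + (n - j - 1)" using k False k_le by auto
  ultimately show ?thesis using False by (simp add: modulus_def central_step_def power_add power2_eq_square)
 qed
 finally show ?thesis by simp
qed simp

lemma finite_E: "finite (carrier E)"
 by (simp add: model_group_def finite_PiE)

lemma card_E: "card (carrier E) = p ^ (n + 1)"
proof -
 have "card (carrier E) = (\<Prod>i\<in>{..n}. m i)" by (simp add: model_group_def card_PiE)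
 also have "{..n} = {0..n}" by (simp add: atMost_atLeast0)
 finally show ?thesis using prod_modulus[of 0] by simp
qed

text \<open>The entry is \<open>1 mod m j\<close> because coordinate \<open>n\<close> may have
  modulus 1.\<close>

definition unit_vec :: "nat => nat => nat" where
 "unit_vec j = (\<lambda>i\<in>{..n}. if i = j then 1 mod m j else 0)"

lemma unit_vec_closed: "unit_vec j \<in> carrier E"
 using m_pos by (auto simp: carrier_E unit_vec_def intro!: Suc_lessI)

lemma twist_unit_vec:
 assumes "j < r"
 shows "twist r (unit_vec (2 * j + 1)) v = v (2 * j)" "twist r v (unit_vec (2 * j)) = v (2 * j + 1)"
  "twist r (unit_vec (2 * j)) v = 0" "twist r v (unit_vec (2 * j + 1)) = 0"
proof -
 have m1: "1 mod m i = 1" if "i < n" for i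
  using that p_gt_1 by (auto simp: modulus_def central_step_def intro!: mod_less)
 have o: "unit_vec (2 * j + 1) (2 * i + 1) = (if i = j then 1 else 0)" "unit_vec (2 * j + 1) (2 * i) = 0"
  "unit_vec (2 * j) (2 * i) = (if i = j then 1 else 0)" "unit_vec (2 * j) (2 * i + 1) = 0" if "i < r" for i
  using that assms r_le m1[of "2 * j + 1"] m1[of "2 * j"] by (auto simp: unit_vec_def) presburger+
 have *: "(\<Sum>i<r. (if i = j then 1 else 0) * f i) = f j" "(\<Sum>i<r. f i * (if i = j then 1 else 0)) = f j" for f :: "nat => nat"
  using assms by (simp_all add: if_distrib[of "%x. x * _"] if_distrib[of "%x. _ * x"] cong: if_cong)
 show "twist r (unit_vec (2 * j + 1)) v = v (2 * j)" "twist r v (unit_vec (2 * j)) = v (2 * j + 1)"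
  "twist r (unit_vec (2 * j)) v = 0" "twist r v (unit_vec (2 * j + 1)) = 0"
 proof -
  have "twist r (unit_vec (2 * j + 1)) v = (\<Sum>i<r. (if i = j then 1 else 0) * v (2 * i))"
   unfolding twist_def using o by (intro sum.cong) simp_all
  then show "twist r (unit_vec (2 * j + 1)) v = v (2 * j)" unfolding * .
  have "twist r v (unit_vec (2 * j)) = (\<Sum>i<r. v (2 * i + 1) * (if i = j then 1 else 0))"
   unfolding twist_def using o by (intro sum.cong) simp_all
  then show "twist r v (unit_vec (2 * j)) = v (2 * j + 1)" unfolding * .
  show "twist r (unit_vec (2 * j)) v = 0" "twist r v (unit_vec (2 * j + 1)) = 0"
   unfolding twist_def using o by (auto intro!: sum.neutral)
 qed
qed

definition "center = {u \<in> carrier E. \<forall>v\<in>carrier E. u \<otimes>\<^bsub>E\<^esub> v = v \<otimes>\<^bsub>E\<^esub> u}"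

lemma commute_iff:
 assumes "u \<in> carrier E" "v \<in> carrier E"
 shows "u \<otimes>\<^bsub>E\<^esub> v = v \<otimes>\<^bsub>E\<^esub> u \<longleftrightarrow> twist r u v mod p = twist r v u mod p"
proof
 assume "twist r u v mod p = twist r v u mod p"
 from s_mult_cong[OF this] have t: "(a + s * twist r u v) mod m k = (a + s * twist r v u) mod m k" for a
  by (metis mod_add_right_eq)
 show "u \<otimes>\<^bsub>E\<^esub> v = v \<otimes>\<^bsub>E\<^esub> u"
  by (rule eqI[OF mult_closed mult_closed]) (auto simp: mult_E add.commute t)
next
 assume "u \<otimes>\<^bsub>E\<^esub> v = v \<otimes>\<^bsub>E\<^esub> u"
 then have "(u k + v k + s * twist r u v) mod m k = (u k + v k + s * twist r v u) mod m k"
  using mult_E[OF k_le, of u v] mult_E[OF k_le, of v u] by (simp add: add.commute)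
 from mod_add_left_cancel[OF this] have "s * (twist r u v mod p) = s * (twist r v u mod p)"
  unfolding m_k by (simp only: mult_mod_right)
 then show "twist r u v mod p = twist r v u mod p" using s_pos by simp
qed

text \<open>Commuting with the unit vectors at \<open>2 * j\<close> and \<open>2 * j + 1\<close>
  forces the partner coordinate to vanish modulo \<open>p\<close>; the centre is the radical of the
  form.\<close>

lemma center_iff: "u \<in> center \<longleftrightarrow> u \<in> carrier E \<and> (\<forall>i<2 * r. p dvd u i)"
proof
 assume "u \<in> center"
 then have u: "u \<in> carrier E" "!!v. v \<in> carrier E ==> twist r u v mod p = twist r v u mod p"
  using commute_iff unfolding center_def by auto
 have "p dvd u i" if i: "i < 2 * r" for i
 proof -
  define j where "j = i div 2"
  have j: "j < r" and "i = 2 * j \<or> i = 2 * j + 1" using i unfolding j_def by auto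
  then show ?thesis
   using u(2)[OF unit_vec_closed, of "2 * j"] u(2)[OF unit_vec_closed, of "2 * j + 1"] twist_unit_vec[OF j, of u]
   by (auto simp: mod_eq_0_iff_dvd)
 qed
 with u show "u \<in> carrier E \<and> (\<forall>i<2 * r. p dvd u i)" by blast
next
 assume u: "u \<in> carrier E \<and> (\<forall>i<2 * r. p dvd u i)"
 have "twist r u v mod p = twist r v u mod p" for v
 proof -
  have "twist r u v mod p = twist r (%_. 0) v mod p" "twist r v u mod p = twist r v (%_. 0) mod p"
   using u by (auto intro!: twist_cong)
  then show ?thesis by (simp add: twist_def)
 qed
 then show "u \<in> center" using u commute_iff unfolding center_def by auto
qed

text \<open>If \<open>k\<close> is among the first \<open>2 * r\<close> coordinates, the
  \<open>p\<close> admissible values there make up for the trivial coordinate \<open>n\<close>.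
  Either way the order depends on \<open>k\<close> no longer.\<close>

lemma card_center: "card center = p ^ (n + 1 - 2 * r)"
proof -
 let ?S = "%i. if i < 2 * r then {x. x < m i \<and> p dvd x} else {..<m i}"
 have c: "center = (\<Pi>\<^sub>E i\<in>{..n}. ?S i)"
 proof (rule Set.set_eqI)
  fix u
  show "u \<in> center \<longleftrightarrow> u \<in> (\<Pi>\<^sub>E i\<in>{..n}. ?S i)"
   unfolding center_iff carrier_E PiE_iff using r_le by auto
 qed
 have S: "card {x. x < m i \<and> p dvd x} = (if i = k then p else 1)" if i: "i < 2 * r" for i
 proof -
  have "{x. x < m i \<and> p dvd x} = (%x. p * x) ` {..<(if i = k then p else 1)}"
  proof -
   have "m i = p * (if i = k then p else 1)" using i r_le by (simp add: modulus_def central_step_def)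
   then show ?thesis using p_gt_1 by (auto simp: dvd_def)
  qed
  moreover have "inj_on (%x. p * x) A" for A using p_gt_1 by (simp add: inj_on_def)
  ultimately show ?thesis by (simp add: card_image)
 qed
 have split: "{..n} = {..<2 * r} \<union> {2 * r..n}" using r_le by auto
 have "card center = (\<Prod>i\<in>{..n}. card (?S i))" unfolding c by (simp add: card_PiE)
 also have "... = (\<Prod>i\<in>{..<2 * r}. card (?S i)) * (\<Prod>i\<in>{2 * r..n}. card (?S i))"
  unfolding split by (rule prod.union_disjoint) auto
 also have "(\<Prod>i\<in>{..<2 * r}. card (?S i)) = (\<Prod>i\<in>{..<2 * r}. if i = k then p else 1)"
  by (rule prod.cong) (simp_all add: S)
 also have "... = (if k < 2 * r then p else 1)" by simp
 also have "(\<Prod>i\<in>{2 * r..n}. card (?S i)) = (\<Prod>i\<in>{2 * r..n}. m i)" by (rule prod.cong) auto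
 also have "(if k < 2 * r then p else 1) * ... = p ^ (n + 1 - 2 * r)"
 proof (cases "k < 2 * r")
  case True
  then have n: "n \<in> {2 * r..n}" "n ~= k" using r_le by auto
  have "(\<Prod>i\<in>{2 * r..n}. m i) = m n * (\<Prod>i\<in>{2 * r..n} - {n}. m i)" by (rule prod.remove[OF _ n(1)]) simp
  also have "... = (\<Prod>i\<in>{2 * r..n} - {n}. p)" using n True by (auto simp: modulus_def intro!: prod.cong)
  also have "... = p ^ (n - 2 * r)" using n by simp
  finally show ?thesis using True r_le by (simp add: Suc_diff_le)
 qed (use prod_modulus[OF r_le] in auto)
 finally show ?thesis .
qed

text \<open>By \<open>pow_p_E\<close> the \<open>p\<close>-th power map sees only coordinate
  \<open>k\<close>; the \<open>k\<close>-th unit vector is the test element, central exactly when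
  \<open>k\<close> is at least \<open>2 * r\<close>.\<close>

lemma exists_pow_p_neq: "(\<exists>u\<in>carrier E. u [^]\<^bsub>E\<^esub> p ~= \<one>\<^bsub>E\<^esub>) \<longleftrightarrow> k ~= n"
 "(\<exists>u\<in>center. u [^]\<^bsub>E\<^esub> p ~= \<one>\<^bsub>E\<^esub>) \<longleftrightarrow> k ~= n \<and> 2 * r \<le> k"
proof -
 have c: "center \<subseteq> carrier E" unfolding center_def by blast
 have uk: "unit_vec k [^]\<^bsub>E\<^esub> p ~= \<one>\<^bsub>E\<^esub>" if "k ~= n"
 proof
  assume "unit_vec k [^]\<^bsub>E\<^esub> p = \<one>\<^bsub>E\<^esub>"
  then have "(unit_vec k [^]\<^bsub>E\<^esub> p) k = 0" using one_E[OF k_le] by simp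
  then have "(p * (1 mod m k)) mod m k = 0" unfolding pow_p_E[OF unit_vec_closed k_le] using k_le by (simp add: unit_vec_def)
  moreover have "m k = p * p" using that by (simp add: modulus_def central_step_def)
  moreover have "1 < p * p" "p < p * p" using p_gt_1 less_1_mult[OF p_gt_1 p_gt_1] by simp_all
  ultimately show False using p_gt_1 by simp
 qed
 have triv: "u [^]\<^bsub>E\<^esub> p = \<one>\<^bsub>E\<^esub>" if u: "u \<in> carrier E" and d: "m k dvd p * u k" for u
  by (rule eqI[OF E.nat_pow_closed[OF u] one_closed]) (use d in \<open>simp add: pow_p_E[OF u] one_E\<close>)
 have 1: "u [^]\<^bsub>E\<^esub> p = \<one>\<^bsub>E\<^esub>" if "u \<in> carrier E" "k = n" for u
  using that by (intro triv) (auto simp: modulus_def central_step_def)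
 have 2: "u [^]\<^bsub>E\<^esub> p = \<one>\<^bsub>E\<^esub>" if "u \<in> center" "k < 2 * r" for u
  using that r_le center_iff by (intro triv) (auto simp: modulus_def central_step_def)
 have 3: "unit_vec k \<in> center" if "2 * r \<le> k"
  using that unit_vec_closed r_le by (auto simp: center_iff unit_vec_def)
 show "(\<exists>u\<in>carrier E. u [^]\<^bsub>E\<^esub> p ~= \<one>\<^bsub>E\<^esub>) \<longleftrightarrow> k ~= n" using uk unit_vec_closed 1 by blast
 show "(\<exists>u\<in>center. u [^]\<^bsub>E\<^esub> p ~= \<one>\<^bsub>E\<^esub>) \<longleftrightarrow> k ~= n \<and> 2 * r \<le> k" using uk 1 2 3 c by (meson not_le subsetD)
qed

end

text \<open>The order of the centre gives \<open>r\<close>; whether \<open>p\<close>-th powers are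
  trivial on the group, and on the centre, tells the admissible values of \<open>k\<close>
  apart.\<close>

lemma model_groups_not_iso:
 assumes "model p n r k" "model p n r' k'" "model_group p n r k \<cong> model_group p n r' k'"
 shows "r = r' \<and> k = k'"
proof -
 interpret A: model p n r k by fact
 interpret B: model p n r' k' by fact
 obtain h where h: "h \<in> iso A.E B.E" using assms(3) unfolding is_iso_def by blast
 then have hom: "h \<in> hom A.E B.E" and bij: "bij_betw h (carrier A.E) (carrier B.E)" unfolding iso_def by auto
 interpret h: group_hom A.E B.E h by unfold_locales (rule hom)
 have im: "h ` carrier A.E = carrier B.E" and inj: "inj_on h (carrier A.E)" using bij unfolding bij_betw_def by auto
 have cen: "h ` A.center = B.center"
 proof (intro equalityI subsetI)
  fix y assume "y \<in> h ` A.center"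
  then obtain u where u: "u \<in> carrier A.E" "!!v. v \<in> carrier A.E ==> u \<otimes>\<^bsub>A.E\<^esub> v = v \<otimes>\<^bsub>A.E\<^esub> u" "y = h u"
   unfolding A.center_def by auto
  have "h u \<otimes>\<^bsub>B.E\<^esub> w = w \<otimes>\<^bsub>B.E\<^esub> h u" if "w \<in> carrier B.E" for w
  proof -
   have "w \<in> h ` carrier A.E" unfolding im by (rule that)
   then obtain v where v: "v \<in> carrier A.E" "w = h v" by blast
   show ?thesis unfolding v(2) using u(2)[OF v(1)] h.hom_mult[OF u(1) v(1)] h.hom_mult[OF v(1) u(1)] by simp
  qed
  then show "y \<in> B.center" unfolding B.center_def using u(1,3) by simp
 next
  fix y assume y: "y \<in> B.center"
  then obtain u where u: "u \<in> carrier A.E" "y = h u" using im unfolding B.center_def by auto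
  have "u \<otimes>\<^bsub>A.E\<^esub> v = v \<otimes>\<^bsub>A.E\<^esub> u" if v: "v \<in> carrier A.E" for v
  proof (rule inj_onD[OF inj])
   show "h (u \<otimes>\<^bsub>A.E\<^esub> v) = h (v \<otimes>\<^bsub>A.E\<^esub> u)"
    unfolding h.hom_mult[OF u(1) v(1)] h.hom_mult[OF v u(1)] using y u v unfolding B.center_def by simp
  qed (use u v in auto)
  then show "y \<in> h ` A.center" unfolding A.center_def using u by blast
 qed
 have "inj_on h A.center" using inj by (rule inj_on_subset) (auto simp: A.center_def)
 then have "card A.center = card B.center" using cen card_image by metis
 then have "n + 1 - 2 * r = n + 1 - 2 * r'"
  unfolding A.card_center B.card_center using A.p_gt_1 power_inject_exp by blast
 then have r: "r = r'" using A.r_le B.r_le by simp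
 have pow: "h u [^]\<^bsub>B.E\<^esub> p ~= \<one>\<^bsub>B.E\<^esub> \<longleftrightarrow> u [^]\<^bsub>A.E\<^esub> p ~= \<one>\<^bsub>A.E\<^esub>" if u: "u \<in> carrier A.E" for u
  using inj_onD[OF inj, of "u [^]\<^bsub>A.E\<^esub> p" "\<one>\<^bsub>A.E\<^esub>"] u h.hom_nat_pow[OF u, of p] h.hom_one by auto
 have 1: "k ~= n \<longleftrightarrow> k' ~= n"
  unfolding A.exists_pow_p_neq(1)[symmetric] B.exists_pow_p_neq(1)[symmetric] im[symmetric] using pow by blast
 have "A.center \<subseteq> carrier A.E" unfolding A.center_def by blast
 then have 2: "k ~= n \<and> 2 * r \<le> k \<longleftrightarrow> k' ~= n \<and> 2 * r' \<le> k'"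
  unfolding A.exists_pow_p_neq(2)[symmetric] B.exists_pow_p_neq(2)[symmetric] cen[symmetric] using pow by blast
 show ?thesis using r 1 2 A.params B.params unfolding model_params_def by auto
qed

section \<open>Commutators in a central cyclic subgroup, and maps out of the model groups\<close>

lemma (in group) pow_mod: "g \<in> carrier G ==> g [^] d = \<one> ==> g [^] (a mod d) = g [^] (a :: nat)"
proof -
 assume g: "g \<in> carrier G" "g [^] d = \<one>"
 have "g [^] a = g [^] (d * (a div d) + a mod d)" by simp
 also have "... = (g [^] d) [^] (a div d) \<otimes> g [^] (a mod d)"
  using g(1) by (simp only: nat_pow_mult[symmetric] nat_pow_pow)
 finally show ?thesis using g by simp
qed

locale central_element = group L for L :: "('a, 'b) monoid_scheme" (structure) +
 fixes z :: 'a
 assumes z_closed [simp]: "z \<in> carrier L" and z_central: "x \<in> carrier L ==> x \<otimes> z = z \<otimes> x"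
begin

abbreviation zp :: "nat => 'a" where "zp i \<equiv> z [^] i"

text \<open>The commutator of \<open>x\<close> and \<open>y\<close> is the \<open>i\<close>-th power
  of \<open>z\<close>. It is a relation because the exponent is determined only modulo the order of
  \<open>z\<close>; exponents add in each argument.\<close>

definition rel :: "'a => 'a => nat => bool" where
 "rel x y i \<longleftrightarrow> x \<otimes> y = zp i \<otimes> (y \<otimes> x)"

lemma zp_commute: "x \<in> carrier L ==> x \<otimes> zp i = zp i \<otimes> x"
 using group_commutes_pow[of z x i] z_central by simp

lemma zp_left: "x \<in> carrier L ==> y \<in> carrier L ==> x \<otimes> (zp i \<otimes> y) = zp i \<otimes> (x \<otimes> y)"
 by (simp add: m_assoc[symmetric] zp_commute)

lemma zp_add: "y \<in> carrier L ==> zp i \<otimes> (zp j \<otimes> y) = zp (i + j) \<otimes> y"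
 by (simp add: m_assoc[symmetric] nat_pow_mult)

lemma relD: "rel x y i ==> x \<otimes> y = zp i \<otimes> (y \<otimes> x)"
 by (simp add: rel_def)

lemma relD2:
 assumes "rel x y i" "x \<in> carrier L" "y \<in> carrier L" "w \<in> carrier L"
 shows "x \<otimes> (y \<otimes> w) = zp i \<otimes> (y \<otimes> (x \<otimes> w))"
proof -
 have "x \<otimes> (y \<otimes> w) = (x \<otimes> y) \<otimes> w" using assms by (simp add: m_assoc)
 then show ?thesis unfolding relD[OF assms(1)] using assms by (simp add: m_assoc)
qed

lemma rel_0_iff: "x \<in> carrier L ==> y \<in> carrier L ==> rel x y 0 \<longleftrightarrow> x \<otimes> y = y \<otimes> x"
 by (simp add: rel_def)

lemma rel_0_sym: "x \<in> carrier L ==> y \<in> carrier L ==> rel x y 0 ==> rel y x 0"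
 by (simp add: rel_def)

lemma rel_refl: "x \<in> carrier L ==> rel x x 0"
 by (simp add: rel_def)

lemma rel_one: "x \<in> carrier L ==> rel x \<one> 0" "x \<in> carrier L ==> rel \<one> x 0"
 by (simp_all add: rel_def)

lemma rel_z: "x \<in> carrier L ==> rel x z 0" "x \<in> carrier L ==> rel z x 0"
 by (simp_all add: rel_def z_central)

lemma rel_mult_left:
 assumes "rel x y i" "rel x' y j" and c: "x \<in> carrier L" "x' \<in> carrier L" "y \<in> carrier L"
 shows "rel (x \<otimes> x') y (i + j)"
 unfolding rel_def using c
 by (simp add: m_assoc relD[OF assms(2)] zp_left[OF c(1)] relD2[OF assms(1)] zp_add add.commute)

lemma rel_mult_right:
 assumes "rel x y i" "rel x y' j" and c: "x \<in> carrier L" "y \<in> carrier L" "y' \<in> carrier L"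
 shows "rel x (y \<otimes> y') (i + j)"
 unfolding rel_def using c
 by (simp add: m_assoc relD[OF assms(2)] zp_left[OF c(2)] relD2[OF assms(1)] zp_add)

lemma rel_pow_left:
 assumes "rel x y i" and c: "x \<in> carrier L" "y \<in> carrier L"
 shows "rel (x [^] (a :: nat)) y (a * i)"
proof (induction a)
 case (Suc a)
 show ?case using rel_mult_left[OF Suc assms(1)] c by (simp add: add.commute)
qed (use c in \<open>simp add: rel_one\<close>)

lemma rel_pow_right:
 assumes "rel x y i" and c: "x \<in> carrier L" "y \<in> carrier L"
 shows "rel x (y [^] (b :: nat)) (b * i)"
proof (induction b)
 case (Suc b)
 show ?case using rel_mult_right[OF Suc assms(1)] c by (simp add: add.commute)
qed (use c in \<open>simp add: rel_one\<close>)

text \<open>Moving the \<open>m\<close>-th power of \<open>y\<close> past the next \<open>x\<close>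
  costs \<open>m * i\<close> factors \<open>z\<close>; these add up to
  \<open>i * (m choose 2)\<close>.\<close>

lemma mult_pow:
 assumes "rel y x i" and c: "x \<in> carrier L" "y \<in> carrier L"
 shows "(x \<otimes> y) [^] (m :: nat) = zp (i * (m choose 2)) \<otimes> (x [^] m \<otimes> y [^] m)"
proof (induction m)
 case (Suc m)
 note r = rel_pow_left[OF assms(1) c(2,1), of m]
 have xm: "x [^] m \<in> carrier L" and ym: "y [^] m \<in> carrier L" using c by auto
 have ch: "i * (Suc m choose 2) = i * (m choose 2) + m * i" by (simp add: numeral_2_eq_2 algebra_simps)
 have "(x \<otimes> y) [^] Suc m = zp (i * (m choose 2)) \<otimes> (x [^] m \<otimes> (y [^] m \<otimes> (x \<otimes> y)))"
  using Suc c by (simp add: m_assoc)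
 also have "y [^] m \<otimes> (x \<otimes> y) = zp (m * i) \<otimes> (x \<otimes> (y [^] m \<otimes> y))"
  by (rule relD2[OF r ym c])
 also have "zp (i * (m choose 2)) \<otimes> (x [^] m \<otimes> (zp (m * i) \<otimes> (x \<otimes> (y [^] m \<otimes> y)))) =
   zp (i * (m choose 2) + m * i) \<otimes> (x [^] m \<otimes> (x \<otimes> (y [^] m \<otimes> y)))"
  using c by (simp add: zp_left[OF xm] zp_add)
 also have "... = zp (i * (Suc m choose 2)) \<otimes> (x [^] Suc m \<otimes> y [^] Suc m)"
  unfolding ch using c by (simp add: m_assoc)
 finally show ?case .
qed (simp add: numeral_2_eq_2)

text \<open>Normal form of a word: generators in increasing order, with exponent vector
  \<open>u\<close>.\<close>

fun oprod :: "(nat => 'a) => (nat => nat) => nat => 'a" where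
 "oprod x u 0 = \<one>"
| "oprod x u (Suc N) = oprod x u N \<otimes> x N [^] u N"

lemma oprod_cong: "(!!i. i < N ==> x i [^] u i = x i [^] v i) ==> oprod x u N = oprod x v N"
 by (induction N) auto

end

lemma sum_odd: "(\<Sum>i<2 * q. if odd i then f i else 0) = (\<Sum>j<q. f (2 * j + 1 :: nat) :: nat)"
 by (induction q) auto

text \<open>Elements satisfying the defining relations of the model group, so that exponent vectors
  can be sent to ordered products. The element \<open>z\<close> may be trivial, and
  \<open>model_to_G\<close> takes it to be the identity of \<open>G\<close>.\<close>

locale model_target = model p n r k + central_element L z
 for p n r k and L :: "('a, 'b) monoid_scheme" (structure) and z +
 fixes x :: "nat => 'a"
 assumes x_closed: "i \<le> n ==> x i \<in> carrier L"
  and x_rel: "i < j ==> j \<le> n ==> rel (x j) (x i) (if odd j \<and> j < 2 * r \<and> Suc i = j then 1 else 0)"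
  and x_pow: "i \<le> n ==> x i [^] modulus p n k i = \<one>"
  and x_z: "x k [^] central_step p n k = z"
begin

lemma oprod_closed: "N \<le> Suc n ==> oprod x u N \<in> carrier L"
 by (induction N) (auto simp: x_closed)

text \<open>Only one earlier generator may fail to commute with \<open>x N\<close>, namely its
  partner \<open>x (N - 1)\<close> for odd \<open>N\<close> below \<open>2 * r\<close>, and it
  contributes its exponent.\<close>

lemma x_oprod_rel:
 assumes "N \<le> n" "N' \<le> N"
 shows "rel (x N) (oprod x v N') (if odd N \<and> N < 2 * r \<and> N' = N then v (N - 1) else 0)"
 using assms(2)
proof (induction N')
 case 0
 then show ?case using assms(1) rel_one(1)[OF x_closed] by (auto split: nat.splits)
next
 case (Suc N')
 have c: "x N \<in> carrier L" "x N' \<in> carrier L" "oprod x v N' \<in> carrier L"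
  using assms(1) Suc.prems by (auto intro: x_closed oprod_closed)
 have "rel (x N) (oprod x v N' \<otimes> x N' [^] v N')
  ((if odd N \<and> N < 2 * r \<and> N' = N then v (N - 1) else 0) + v N' * (if odd N \<and> N < 2 * r \<and> Suc N' = N then 1 else 0))"
  using c Suc assms(1)
  by (intro rel_mult_right rel_pow_right x_rel) auto
 then show ?case using Suc.prems by (auto split: if_splits)
qed

text \<open>Sorting moves each \<open>x N [^] u N\<close> to the right past the earlier part of the
  second word; the exponents of \<open>z\<close> collected on the way form the cocycle.\<close>

lemma oprod_mult:
 "N \<le> Suc n ==> oprod x u N \<otimes> oprod x v N =
  zp (\<Sum>i<N. if odd i \<and> i < 2 * r then u i * v (i - 1) else 0) \<otimes> oprod x (%i. u i + v i) N"
proof (induction N)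
 case (Suc N)
 let ?c = "u N * (if odd N \<and> N < 2 * r \<and> N = N then v (N - 1) else 0)"
 let ?S = "\<Sum>i<N. if odd i \<and> i < 2 * r then u i * v (i - 1) else 0"
 have N: "N \<le> n" "N \<le> Suc n" using Suc.prems by auto
 have c: "x N \<in> carrier L" "oprod x u N \<in> carrier L" "oprod x v N \<in> carrier L" "oprod x (%i. u i + v i) N \<in> carrier L"
  using N by (auto intro: x_closed oprod_closed)
 have cp: "x N [^] a \<in> carrier L" for a :: nat using c by simp
 note rl = rel_pow_left[OF x_oprod_rel[OF N(1) order_refl, of v] c(1,3), of "u N"]
 have "oprod x u (Suc N) \<otimes> oprod x v (Suc N) =
  oprod x u N \<otimes> (x N [^] u N \<otimes> (oprod x v N \<otimes> x N [^] v N))"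
  using c cp by (simp add: m_assoc)
 also have "... = zp ?c \<otimes> (oprod x u N \<otimes> (oprod x v N \<otimes> (x N [^] u N \<otimes> x N [^] v N)))"
  unfolding relD2[OF rl cp c(3) cp] by (rule zp_left) (use c cp in auto)
 also have "... = zp ?c \<otimes> ((oprod x u N \<otimes> oprod x v N) \<otimes> x N [^] (u N + v N))"
  using c cp by (simp add: m_assoc nat_pow_mult)
 also have "... = zp (?c + ?S) \<otimes> (oprod x (%i. u i + v i) N \<otimes> x N [^] (u N + v N))"
  unfolding Suc.IH[OF N(2)] using c cp by (simp add: m_assoc zp_add)
 also have "?c + ?S = (\<Sum>i<Suc N. if odd i \<and> i < 2 * r then u i * v (i - 1) else 0)" by simp
 finally show ?case by simp
qed simp

text \<open>The power \<open>central_step\<close> of \<open>x k\<close> is \<open>z\<close>, so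
  excess exponent at \<open>k\<close> comes out as a power of \<open>z\<close>. This matches the
  twisted coordinate of \<open>model_group\<close>.\<close>

lemma oprod_central:
 "N \<le> Suc n ==> oprod x (%i. u i + (if i = k then central_step p n k * c else 0)) N =
  (if k < N then zp c else \<one>) \<otimes> oprod x u N"
proof (induction N)
 case (Suc N)
 have c: "x N \<in> carrier L" "oprod x u N \<in> carrier L" using Suc.prems by (auto intro: x_closed oprod_closed)
 have k: "x k \<in> carrier L" by (rule x_closed[OF k_le])
 show ?case
 proof (cases "N = k")
  case True
  have "x k [^] (u k + central_step p n k * c) = x k [^] u k \<otimes> zp c"
   using k by (simp add: nat_pow_mult[symmetric] nat_pow_pow[symmetric] x_z)
  also have "... = zp c \<otimes> x k [^] u k" using k by (simp add: zp_commute)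
  finally show ?thesis using Suc True c k by (simp add: zp_left)
 next
  case False
  then show ?thesis using Suc c by (auto simp: m_assoc)
 qed
qed simp

definition \<Phi> :: "(nat => nat) => 'a" where "\<Phi> u = oprod x u (Suc n)"

lemma \<Phi>_hom: "\<Phi> \<in> hom E L"
proof (rule homI)
 fix u v assume "u \<in> carrier E" "v \<in> carrier E"
 have tw: "(\<Sum>i<Suc n. if odd i \<and> i < 2 * r then u i * v (i - 1) else 0) = twist r u v"
 proof -
  have "(\<Sum>i<Suc n. if odd i \<and> i < 2 * r then u i * v (i - 1) else 0) = (\<Sum>i<2 * r. if odd i then u i * v (i - 1) else 0)"
   using r_le by (intro sum.mono_neutral_cong_right) auto
  then show ?thesis by (simp add: sum_odd twist_def)
 qed
 have "\<Phi> (u \<otimes>\<^bsub>E\<^esub> v) = oprod x (%i. u i + v i + (if i = k then s * twist r u v else 0)) (Suc n)"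
  unfolding \<Phi>_def by (rule oprod_cong) (simp add: mult_E pow_mod[OF x_closed x_pow] del: nat_pow_Suc)
 also have "... = zp (twist r u v) \<otimes> oprod x (%i. u i + v i) (Suc n)"
  using oprod_central[OF order_refl, of "%i. u i + v i" "twist r u v"] k_le by (simp add: less_Suc_eq_le)
 also have "... = \<Phi> u \<otimes> \<Phi> v" unfolding \<Phi>_def oprod_mult[OF order_refl] tw ..
 finally show "\<Phi> (u \<otimes>\<^bsub>E\<^esub> v) = \<Phi> u \<otimes> \<Phi> v" .
qed (simp add: \<Phi>_def oprod_closed del: oprod.simps)

lemma \<Phi>_unit_vec: "j \<le> n ==> \<Phi> (unit_vec j) = x j"
proof -
 assume j: "j \<le> n"
 have "N \<le> Suc n ==> oprod x (unit_vec j) N = (if j < N then x j else \<one>)" for N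
 proof (induction N)
  case (Suc N)
  have "x j [^] (1 mod m j) = x j" using pow_mod[OF x_closed[OF j] x_pow[OF j], of 1] x_closed[OF j] by simp
  then show ?case using Suc x_closed[OF j] x_closed[of N] by (auto simp: unit_vec_def less_Suc_eq)
 qed simp
 then show ?thesis unfolding \<Phi>_def using j by (simp del: oprod.simps)
qed

lemma \<Phi>_surj:
 assumes "!!T. subgroup T L ==> (!!i. i \<le> n ==> x i \<in> T) ==> carrier L \<subseteq> T"
 shows "\<Phi> ` carrier E = carrier L"
proof -
 interpret \<Phi>: group_hom E L \<Phi> by unfold_locales (rule \<Phi>_hom)
 have "x i \<in> \<Phi> ` carrier E" if "i \<le> n" for i
  using \<Phi>_unit_vec[OF that] unit_vec_closed by (metis imageI)
 then have "carrier L \<subseteq> \<Phi> ` carrier E" by (intro assms \<Phi>.img_is_subgroup)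
 then show ?thesis using \<Phi>.hom_closed by auto
qed

lemma \<Phi>_iso:
 assumes "!!T. subgroup T L ==> (!!i. i \<le> n ==> x i \<in> T) ==> carrier L \<subseteq> T" "card (carrier L) = p ^ (n + 1)"
 shows "E \<cong> L"
proof -
 note s = \<Phi>_surj[OF assms(1)]
 have "inj_on \<Phi> (carrier E)" by (rule eq_card_imp_inj_on[OF finite_E]) (simp add: s assms(2) card_E)
 then have "\<Phi> \<in> iso E L" unfolding iso_def bij_betw_def using \<Phi>_hom s by blast
 then show ?thesis unfolding is_iso_def by blast
qed

end

section \<open>Central extensions of elementary abelian groups\<close>

lemma nat_inverse_mod_prime:
 assumes "Factorial_Ring.prime p" "\<not> p dvd (i :: nat)"
 obtains c v where "i * c = p * v + 1"
proof -
 have "coprime i p" using prime_imp_coprime[OF assms] by (rule coprime_commute[THEN iffD1])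
 moreover have "i ~= 0" using assms(2) by (intro notI) simp
 then obtain c v where "i * c = p * v + gcd i p" using bezout_nat by blast
 ultimately show thesis using that by simp
qed

lemma odd_prime_dvd_choose: "odd p ==> (p :: nat) dvd p choose 2"
proof (elim oddE)
 fix q assume q: "p = 2 * q + 1"
 have "p * (p - 1) div 2 = p * q" unfolding q by (simp add: algebra_simps)
 then show "p dvd p choose 2" by (simp add: choose_two)
qed

locale central_extension = central_element L z for L :: "('a, 'b) monoid_scheme" (structure) and z +
 fixes p :: nat
 assumes prime_p: "Factorial_Ring.prime p" and odd_p: "odd p" and finite_L: "finite (carrier L)"
  and z_pow: "z [^] p = \<one>" and z_neq: "z ~= \<one>"
  and commutator: "x \<in> carrier L ==> y \<in> carrier L ==> \<exists>i. rel x y i"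
  and pth_power: "x \<in> carrier L ==> \<exists>i::nat. x [^] p = z [^] i"
begin

lemma p_gt_1: "1 < p" using prime_p by (rule prime_gt_1_nat)

lemma ord_z: "ord z = p"
proof -
 have "ord z dvd p" using pow_eq_id[OF z_closed, of p] z_pow by simp
 moreover have "ord z ~= 1" using pow_eq_id[OF z_closed, of 1] z_neq by auto
 ultimately show ?thesis using prime_p[unfolded prime_nat_iff] by blast
qed

lemma zp_inj: "inj_on zp {..<p}"
proof -
 have "{..<p} = {0..ord z - 1}" unfolding ord_z using p_gt_1 by auto
 then show ?thesis using ord_inj[OF z_closed] by simp
qed

lemma zp_eq_iff: "zp i = zp j \<longleftrightarrow> i mod p = j mod p"
proof
 assume "zp i = zp j"
 then have "zp (i mod p) = zp (j mod p)" by (simp add: pow_mod[OF z_closed z_pow])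
 then show "i mod p = j mod p" using inj_onD[OF zp_inj] p_gt_1 by simp
qed (use pow_mod[OF z_closed z_pow, of i] pow_mod[OF z_closed z_pow, of j] in simp)

lemma zp_eq_one_iff: "zp i = \<one> \<longleftrightarrow> p dvd i"
 using zp_eq_iff[of i 0] by (simp add: mod_eq_0_iff_dvd)

lemma rel_unique: "rel x y i ==> rel x y j ==> x \<in> carrier L ==> y \<in> carrier L ==> i mod p = j mod p"
 unfolding rel_def zp_eq_iff[symmetric] using right_cancel[of "y \<otimes> x"] by auto

lemma rel_mod: "rel x y i ==> i mod p = j mod p ==> rel x y j"
 unfolding rel_def zp_eq_iff[symmetric] by simp

lemma rel_sym:
 assumes "rel x y i" "x \<in> carrier L" "y \<in> carrier L"
 shows "rel y x ((p - 1) * i)"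
proof -
 have "(p - 1) * i + i = p * i" using p_gt_1 by (cases p) auto
 then have "zp ((p - 1) * i + i) = \<one>" by (simp add: zp_eq_one_iff)
 then show ?thesis unfolding rel_def relD[OF assms(1)] using assms by (simp add: zp_add)
qed

text \<open>The commutator correction is a power of \<open>z\<close> whose exponent is a multiple of
  \<open>p choose 2\<close>, hence of \<open>p\<close> for odd \<open>p\<close>.\<close>

lemma pth_power_mult:
 assumes "x \<in> carrier L" "y \<in> carrier L"
 shows "(x \<otimes> y) [^] p = x [^] p \<otimes> y [^] p"
proof -
 obtain i where "rel y x i" using commutator assms by blast
 from mult_pow[OF this assms, of p] show ?thesis
  using zp_eq_one_iff[of "i * (p choose 2)"] odd_prime_dvd_choose[OF odd_p] assms by simp
qed

lemma pow_p2: "x \<in> carrier L ==> x [^] (p * p) = \<one>"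
proof -
 assume x: "x \<in> carrier L"
 obtain i :: nat where "x [^] p = z [^] i" using pth_power[OF x] by blast
 then have "x [^] (p * p) = zp (i * p)" using x nat_pow_pow[OF x, of p p] nat_pow_pow[OF z_closed, of i p] by simp
 then show ?thesis by (simp add: zp_eq_one_iff)
qed

text \<open>Subgroups containing \<open>z\<close> stand for the subspaces of the quotient of
  \<open>L\<close> by the powers of \<open>z\<close>, and their orders stand for dimensions.\<close>

definition sub :: "'a set => bool" where "sub M \<longleftrightarrow> subgroup M L \<and> z \<in> M"

text \<open>Closure under products gives inverses, as \<open>a [^] (p * p)\<close> is the identity
  by \<open>pow_p2\<close>.\<close>

lemma subI:
 assumes "M \<subseteq> carrier L" "z \<in> M" "!!a b. a \<in> M ==> b \<in> M ==> a \<otimes> b \<in> M"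
 shows "sub M"
proof -
 have "inv a \<in> M" if a: "a \<in> M" for a
 proof -
  have c: "a \<in> carrier L" using a assms(1) by blast
  have p2: "a [^] Suc j \<in> M" for j :: nat using a c assms(3) by (induction j) auto
  have "1 < p * p" using less_1_mult[OF p_gt_1 p_gt_1] .
  then have e: "Suc (Suc (p * p - 2)) = p * p" by simp
  have "a [^] Suc (Suc (p * p - 2)) = \<one>" unfolding e by (rule pow_p2[OF c])
  then have "a [^] Suc (p * p - 2) \<otimes> a = \<one>" by simp
  then have "inv a = a [^] Suc (p * p - 2)" using c by (intro inv_equality) auto
  then show ?thesis using p2 by simp
 qed
 then show ?thesis unfolding sub_def using assms by (auto intro: subgroupI)
qed

lemma subD:
 assumes "sub M"
 shows "M \<subseteq> carrier L" "z \<in> M" "a \<in> M ==> b \<in> M ==> a \<otimes> b \<in> M" "a \<in> M ==> inv a \<in> M" "\<one> \<in> M"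
  "a \<in> M ==> a [^] (j :: nat) \<in> M" "finite M" "zp j \<in> M"
proof -
 have s: "subgroup M L" "z \<in> M" using assms unfolding sub_def by auto
 show "M \<subseteq> carrier L" "z \<in> M" "a \<in> M ==> b \<in> M ==> a \<otimes> b \<in> M" "a \<in> M ==> inv a \<in> M" "\<one> \<in> M"
  using s subgroup.subset subgroup.m_closed subgroup.m_inv_closed subgroup.one_closed by auto
 have pw: "a [^] (j :: nat) \<in> M" if "a \<in> M" for a j
  using that s(1) by (induction j) (auto intro: subgroup.one_closed subgroup.m_closed)
 then show "a \<in> M ==> a [^] (j :: nat) \<in> M" "zp j \<in> M" using s(2) by blast+
 show "finite M" using subgroup.subset[OF s(1)] finite_L finite_subset by blast
qed

lemma sub_carrier: "sub (carrier L)" by (rule subI) auto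

text \<open>The orthogonal complement of \<open>A\<close> under the commutator form.\<close>

definition cent :: "'a set => 'a set" where "cent A = {h \<in> carrier L. \<forall>a\<in>A. rel a h 0}"

lemma sub_cent: "A \<subseteq> carrier L ==> sub (cent A)"
proof (rule subI)
 assume A: "A \<subseteq> carrier L"
 show "z \<in> cent A" using A rel_z unfolding cent_def by auto
 fix a b assume "a \<in> cent A" "b \<in> cent A"
 then show "a \<otimes> b \<in> cent A" using A rel_mult_right[of _ a 0 b 0] unfolding cent_def by auto
qed (auto simp: cent_def)

lemma cent_rel:
 assumes "h \<in> cent A" "a \<in> A" "a \<in> carrier L"
 shows "rel h a 0"
 by (rule rel_0_sym[OF assms(3)]) (use assms in \<open>simp_all add: cent_def\<close>)

lemma cent_pairI:
 assumes h: "h \<in> carrier L" "x \<in> carrier L" "x' \<in> carrier L" "rel h x 0" "rel h x' 0"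
 shows "h \<in> cent {x, x'}"
 using rel_0_sym[OF h(1,2,4)] rel_0_sym[OF h(1,3,5)] h(1) by (simp add: cent_def)

lemma sub_Int: "sub M ==> sub N ==> sub (M \<inter> N)"
 unfolding sub_def by (auto intro: subgroups_Inter_pair)

text \<open>The span of a subspace and one further vector \<open>y\<close>; exponents below
  \<open>p\<close> suffice because the \<open>p\<close>-th power of \<open>y\<close> is a power of
  \<open>z\<close>, which lies in \<open>S\<close> when \<open>sub S\<close> holds.\<close>

definition ext :: "'a set => 'a => 'a set" where "ext S y = {y [^] (a :: nat) \<otimes> s | a s. a < p \<and> s \<in> S}"

lemma ext_memI:
 assumes S: "sub S" and y: "y \<in> carrier L" and s: "s \<in> S"
 shows "y [^] (a :: nat) \<otimes> s \<in> ext S y"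
proof -
 note SD = subD[OF S]
 obtain i :: nat where i: "y [^] p = z [^] i" using pth_power[OF y] by blast
 have sc: "s \<in> carrier L" using s SD(1) by blast
 have "y [^] a = y [^] (a mod p + p * (a div p))" by simp
 also have "... = y [^] (a mod p) \<otimes> (y [^] p) [^] (a div p)" using y by (simp only: nat_pow_mult[symmetric] nat_pow_pow)
 also have "... = y [^] (a mod p) \<otimes> zp (i * (a div p))" unfolding i by (simp add: nat_pow_pow)
 finally have "y [^] a \<otimes> s = y [^] (a mod p) \<otimes> (zp (i * (a div p)) \<otimes> s)" using y sc by (simp add: m_assoc)
 moreover have "zp (i * (a div p)) \<otimes> s \<in> S" using SD s by blast
 moreover have "a mod p < p" using p_gt_1 by simp
 ultimately show ?thesis unfolding ext_def by blast
qed

lemma sub_ext: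
 assumes S: "sub S" and y: "y \<in> carrier L"
 shows "sub (ext S y)" "S \<subseteq> ext S y" "y \<in> ext S y"
proof -
 note SD = subD[OF S]
 show SE: "S \<subseteq> ext S y"
 proof
  fix s assume s: "s \<in> S"
  then show "s \<in> ext S y" using ext_memI[OF S y s, of 0] SD(1) by auto
 qed
 show "y \<in> ext S y" using ext_memI[OF S y SD(5), of 1] y by simp
 show "sub (ext S y)"
 proof (rule subI)
  show "ext S y \<subseteq> carrier L" using SD(1) y unfolding ext_def by auto
  show "z \<in> ext S y" using SE SD(2) by blast
  fix g h assume "g \<in> ext S y" "h \<in> ext S y"
  then obtain a s b t where gh: "g = y [^] (a::nat) \<otimes> s" "s \<in> S" "h = y [^] (b::nat) \<otimes> t" "t \<in> S"
   unfolding ext_def by blast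
  have c: "s \<in> carrier L" "t \<in> carrier L" using gh SD(1) by auto
  have yp: "y [^] j \<in> carrier L" for j :: nat using y by simp
  obtain i where i: "rel s (y [^] b) i" using commutator[OF c(1) yp] by blast
  have "g \<otimes> h = y [^] a \<otimes> (s \<otimes> (y [^] b \<otimes> t))" unfolding gh using c yp by (simp add: m_assoc)
  also have "... = y [^] a \<otimes> (y [^] b \<otimes> (zp i \<otimes> (s \<otimes> t)))"
   unfolding relD2[OF i c(1) yp c(2)] using c yp by (simp add: zp_left)
  also have "... = y [^] (a + b) \<otimes> (zp i \<otimes> (s \<otimes> t))"
   using c y by (simp add: nat_pow_mult[symmetric] m_assoc)
  also have "... \<in> ext S y" by (rule ext_memI[OF S y SD(3)[OF SD(8) SD(3)[OF gh(2,4)]]])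
  finally show "g \<otimes> h \<in> ext S y" .
 qed
qed

lemma ext_least: "sub T ==> S \<subseteq> T ==> y \<in> T ==> ext S y \<subseteq> T"
 unfolding ext_def using subD(3,6) by auto

text \<open>If \<open>y [^] d\<close> with \<open>0 < d < p\<close> lay in \<open>S\<close>,
  inverting \<open>d\<close> modulo \<open>p\<close> would put \<open>y\<close> itself into
  \<open>S\<close>. Hence the products \<open>y [^] a \<otimes> s\<close> are distinct.\<close>

lemma card_ext:
 assumes S: "sub S" and y: "y \<in> carrier L" "y \<notin> S"
 shows "card (ext S y) = p * card S"
proof -
 note SD = subD[OF S]
 have mem: "y \<in> S" if d: "0 < d" "d < p" "y [^] d \<in> S" for d :: nat
 proof -
  have "\<not> p dvd d" using d by (simp add: nat_dvd_not_less)
  from nat_inverse_mod_prime[OF prime_p this] obtain c v where cv: "d * c = p * v + 1" .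
  obtain i :: nat where i: "y [^] p = z [^] i" using pth_power[OF y(1)] by blast
  have e: "y [^] (p * v) \<in> S" using nat_pow_pow[OF y(1), of p v] i SD(6)[OF SD(8), of i v] by simp
  have "(y [^] d) [^] c = y [^] (p * v) \<otimes> y" using nat_pow_pow[OF y(1), of d c] cv y(1) by simp
  then have "y [^] (p * v) \<otimes> y \<in> S" using SD(6)[OF d(3), of c] by simp
  then have "inv (y [^] (p * v)) \<otimes> (y [^] (p * v) \<otimes> y) \<in> S" using SD(3,4) e by blast
  then show ?thesis using y(1) by (simp add: m_assoc[symmetric])
 qed
 have le: "a = b \<and> s = t" if h: "a \<le> b" "b < p" "s \<in> S" "t \<in> S" "y [^] a \<otimes> s = y [^] b \<otimes> t" for a b :: nat and s t
 proof -
  have c: "s \<in> carrier L" "t \<in> carrier L" using h SD(1) by auto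
  have "y [^] a \<otimes> s = y [^] a \<otimes> (y [^] (b - a) \<otimes> t)"
   using h(1,5) c y(1) by (simp add: m_assoc[symmetric] nat_pow_mult)
  then have s: "s = y [^] (b - a) \<otimes> t" using c y(1) by simp
  then have "y [^] (b - a) = s \<otimes> inv t" using c y(1) by (simp add: m_assoc)
  then have "y [^] (b - a) \<in> S" using h SD(3,4) by simp
  moreover have "b - a < p" using h(2) by simp
  ultimately have "b - a = 0" using mem[of "b - a"] y(2) by blast
  then show ?thesis using h(1) s c by simp
 qed
 have "inj_on (%(a, s). y [^] a \<otimes> s) ({..<p} \<times> S)"
 proof (rule inj_onI)
  fix u v assume u: "u \<in> {..<p} \<times> S" and v: "v \<in> {..<p} \<times> S"
   and e: "(%(a, s). y [^] a \<otimes> s) u = (%(a, s). y [^] a \<otimes> s) v"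
  obtain a s b t where uv: "u = (a, s)" "v = (b, t)" by (cases u, cases v)
  then have *: "a < p" "b < p" "s \<in> S" "t \<in> S" and eq: "y [^] a \<otimes> s = y [^] b \<otimes> t" using u v e by simp_all
  show "u = v"
  proof (cases "a \<le> b")
   case True
   show ?thesis using le[OF True *(2,3,4) eq] uv by simp
  next
   case False
   then have "b \<le> a" by simp
   from le[OF this *(1,4,3) eq[symmetric]] show ?thesis using uv by simp
  qed
 qed
 moreover have "ext S y = (%(a, s). y [^] a \<otimes> s) ` ({..<p} \<times> S)" unfolding ext_def by auto
 ultimately show ?thesis by (simp add: card_image card_cartesian_product)
qed

text \<open>Basis extension, one vector at a time; the order of \<open>M\<close> measures the length
  of the list.\<close>

lemma list_extension:
 assumes "sub S" "sub M" "S \<subseteq> M"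
 shows "\<exists>ys. set ys \<subseteq> M \<and> (\<forall>T. sub T --> S \<subseteq> T --> set ys \<subseteq> T --> M \<subseteq> T) \<and> card M = card S * p ^ length ys"
 using assms
proof (induction "card M - card S" arbitrary: S rule: less_induct)
 case less
 note MD = subD[OF less.prems(2)] and SD = subD[OF less.prems(1)]
 show ?case
 proof (cases "S = M")
  case True
  then show ?thesis by (intro exI[of _ "[]"]) auto
 next
  case False
  then obtain y where y: "y \<in> M" "y \<notin> S" using less.prems(3) by blast
  have yc: "y \<in> carrier L" using y MD(1) by blast
  note E = sub_ext[OF less.prems(1) yc]
  have EM: "ext S y \<subseteq> M" by (rule ext_least[OF less.prems(2,3) y(1)])
  have "card S < card (ext S y)" using E y(2) subD(7)[OF E(1)] by (intro psubset_card_mono) auto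
  moreover have "card (ext S y) \<le> card M" by (rule card_mono[OF MD(7) EM])
  ultimately have "card M - card (ext S y) < card M - card S" by simp
  from less.hyps[OF this E(1) less.prems(2) EM] obtain ys where ys: "set ys \<subseteq> M"
   "\<forall>T. sub T --> ext S y \<subseteq> T --> set ys \<subseteq> T --> M \<subseteq> T" "card M = card (ext S y) * p ^ length ys" by blast
  show ?thesis
  proof (intro exI[of _ "y # ys"] conjI allI impI)
   show "set (y # ys) \<subseteq> M" using ys y by simp
   show "card M = card S * p ^ length (y # ys)" using ys(3) card_ext[OF less.prems(1) yc y(2)] by simp
   fix T assume T: "sub T" "S \<subseteq> T" "set (y # ys) \<subseteq> T"
   then show "M \<subseteq> T" using ys(2) ext_least[OF T(1,2), of y] by simp
  qed
 qed
qed

lemma zset: "sub (zp ` {..<p})" "card (zp ` {..<p}) = p" "sub T ==> zp ` {..<p} \<subseteq> T"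
proof -
 show "sub (zp ` {..<p})"
 proof (rule subI)
  show "z \<in> zp ` {..<p}" using p_gt_1 by (intro image_eqI[of _ _ 1]) auto
  fix a b assume "a \<in> zp ` {..<p}" "b \<in> zp ` {..<p}"
  then obtain i j where "a = zp i" "b = zp j" by blast
  then have "a \<otimes> b = zp ((i + j) mod p)" by (simp add: pow_mod[OF z_closed z_pow] nat_pow_mult)
  then show "a \<otimes> b \<in> zp ` {..<p}" using p_gt_1 by simp
 qed auto
 show "card (zp ` {..<p}) = p" using card_image[OF zp_inj] by simp
 show "sub T ==> zp ` {..<p} \<subseteq> T" using subD(8) by blast
qed

text \<open>Hyperbolic pairs at positions \<open>2 * j\<close> and \<open>2 * j + 1\<close> for
  \<open>j < r\<close>, with all other entries commuting: the pattern required by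
  \<open>model_target\<close>.\<close>

definition std :: "nat => 'a list => bool" where
 "std r xs \<longleftrightarrow> set xs \<subseteq> carrier L \<and> 2 * r \<le> length xs \<and>
  (\<forall>i j. i < j --> j < length xs --> rel (xs ! j) (xs ! i) (if odd j \<and> j < 2 * r \<and> Suc i = j then 1 else 0))"

lemma std_Cons:
 assumes "std r xs" and c: "x \<in> carrier L" "x' \<in> carrier L" and r: "rel x' x 1" and xs: "set xs \<subseteq> cent {x, x'}"
 shows "std (Suc r) (x # x' # xs)"
 unfolding std_def
proof (intro conjI allI impI)
 have s: "set xs \<subseteq> carrier L" "2 * r \<le> length xs" using assms(1) unfolding std_def by auto
 then show "set (x # x' # xs) \<subseteq> carrier L" "2 * Suc r \<le> length (x # x' # xs)" using c by auto
 fix i j assume ij: "i < j" "j < length (x # x' # xs)"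
 show "rel ((x # x' # xs) ! j) ((x # x' # xs) ! i) (if odd j \<and> j < 2 * Suc r \<and> Suc i = j then 1 else 0)"
 proof (cases "j = 1")
  case True
  then show ?thesis using ij r by simp
 next
  case False
  then have "j = Suc (Suc (j - 2))" using ij by simp
  then obtain j' where j: "j = Suc (Suc j')" by blast
  have j': "xs ! j' \<in> set xs" "j' < length xs" using ij j by auto
  have cm: "rel (xs ! j') x 0" "rel (xs ! j') x' 0"
   by (rule cent_rel[OF subsetD[OF xs j'(1)]]; simp add: c)+
  show ?thesis
  proof (cases "i = 0 \<or> i = 1")
   case True
   then show ?thesis using cm j by auto
  next
   case False
   then have "i = Suc (Suc (i - 2))" by linarith
   then obtain i' where i: "i = Suc (Suc i')" by blast
   show ?thesis using assms(1) ij j' unfolding std_def i j by auto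
  qed
 qed
qed

lemma std_append:
 assumes "std r xs" "set ws \<subseteq> cent (carrier L)"
 shows "std r (xs @ ws)"
 unfolding std_def
proof (intro conjI allI impI)
 have s: "set xs \<subseteq> carrier L" "2 * r \<le> length xs" using assms(1) unfolding std_def by auto
 have w: "set ws \<subseteq> carrier L" using assms(2) unfolding cent_def by auto
 show "set (xs @ ws) \<subseteq> carrier L" "2 * r \<le> length (xs @ ws)" using s w by auto
 fix i j assume ij: "i < j" "j < length (xs @ ws)"
 show "rel ((xs @ ws) ! j) ((xs @ ws) ! i) (if odd j \<and> j < 2 * r \<and> Suc i = j then 1 else 0)"
 proof (cases "j < length xs")
  case True
  then show ?thesis using assms(1) ij unfolding std_def by (simp add: nth_append)
 next
  case False
  then have m: "(xs @ ws) ! j \<in> set ws" using ij by (auto simp: nth_append)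
  have "i < length (xs @ ws)" using ij by simp
  from nth_mem[OF this] have i: "(xs @ ws) ! i \<in> carrier L" using s w by auto
  have "rel ((xs @ ws) ! i) ((xs @ ws) ! j) 0" using m i assms(2) unfolding cent_def by blast
  then have "rel ((xs @ ws) ! j) ((xs @ ws) ! i) 0" by (rule rel_0_sym[OF i subsetD[OF w m]])
  then show ?thesis using False s(2) by simp
 qed
qed

text \<open>Projection to the orthogonal complement of a hyperbolic pair. If \<open>g\<close> has
  commutator exponents \<open>i\<close> with \<open>x\<close> and \<open>j\<close> with
  \<open>x'\<close>, the factors \<open>x'\<close> to the power \<open>- i\<close> and
  \<open>x\<close> to the power \<open>j\<close> cancel them; \<open>p - 1\<close> stands for
  -1.\<close>

lemma adjust:
 assumes c: "x \<in> carrier L" "x' \<in> carrier L" "g \<in> carrier L" and r: "rel x' x 1"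
 shows "\<exists>a b. g \<otimes> (x' [^] (a::nat) \<otimes> x [^] (b::nat)) \<in> cent {x, x'}"
proof -
 obtain i j where ij: "rel g x i" "rel g x' j" using commutator[OF c(3,1)] commutator[OF c(3,2)] by blast
 let ?a = "(p - 1) * i" and ?w = "x' [^] ((p - 1) * i) \<otimes> x [^] j"
 have pc: "x' [^] ?a \<in> carrier L" "x [^] j \<in> carrier L" "?w \<in> carrier L" using c by auto
 have "rel ?w x (?a * 1 + j * 0)"
  using rel_mult_left[OF rel_pow_left[OF r c(2,1)] rel_pow_left[OF rel_refl[OF c(1)] c(1,1)] pc(1,2) c(1)] .
 from rel_mult_left[OF ij(1) this c(3) pc(3) c(1)] have 1: "rel (g \<otimes> ?w) x (i + ?a)" by simp
 have "rel ?w x' (?a * 0 + j * ((p - 1) * 1))"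
  using rel_mult_left[OF rel_pow_left[OF rel_refl[OF c(2)] c(2,2)] rel_pow_left[OF rel_sym[OF r c(2,1)] c(1,2)] pc(1,2) c(2)] .
 from rel_mult_left[OF ij(2) this c(3) pc(3) c(2)] have 2: "rel (g \<otimes> ?w) x' (j + j * (p - 1))" by simp
 have "i + ?a = p * i" "j + j * (p - 1) = p * j" using p_gt_1 by (cases p; simp)+
 then have "rel (g \<otimes> ?w) x 0" "rel (g \<otimes> ?w) x' 0" using rel_mod[OF 1, of 0] rel_mod[OF 2, of 0] by simp_all
 then have "g \<otimes> ?w \<in> cent {x, x'}" by (intro cent_pairI m_closed c pc)
 then show ?thesis by blast
qed

text \<open>\<open>M\<close> is the orthogonal sum of the pair and its complement \<open>M'\<close>.
  Generation comes from \<open>adjust\<close>, and each of \<open>x\<close>, \<open>x'\<close> adds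
  a dimension because the two do not commute.\<close>

lemma hyperbolic_pair:
 assumes M: "sub M" and c: "x \<in> M" "x' \<in> M" and r: "rel x' x 1"
 defines "M' \<equiv> M \<inter> cent {x, x'}"
 shows "sub M'" "M' \<subset> M" "card M = p * p * card M'" "sub T ==> M' \<subseteq> T ==> x \<in> T ==> x' \<in> T ==> M \<subseteq> T"
proof -
 note MD = subD[OF M]
 have cc: "x \<in> carrier L" "x' \<in> carrier L" using c MD(1) by auto
 show M': "sub M'" unfolding M'_def by (intro sub_Int M sub_cent) (use cc in auto)
 have n0: "\<not> rel x' x 0" using rel_unique[OF r _ cc(2,1), of 0] p_gt_1 by auto
 have xM: "x \<notin> M'" using n0 unfolding M'_def cent_def by auto
 then show "M' \<subset> M" using c unfolding M'_def by auto
 note E1 = sub_ext[OF M' cc(1)]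
 note E2 = sub_ext[OF E1(1) cc(2)]
 have sc: "sub (cent {x})" by (rule sub_cent) (use cc in auto)
 \<comment> \<open>Everything in this span commutes with \<open>x\<close>, whereas \<open>x'\<close>
   does not.\<close>
 have "ext M' x \<subseteq> cent {x}"
  by (rule ext_least[OF sc]) (use cc in \<open>auto simp: M'_def cent_def rel_refl\<close>)
 then have x'M: "x' \<notin> ext M' x" using n0 rel_0_sym[OF cc] unfolding cent_def by auto
 have least: "M \<subseteq> T" if T: "sub T" "M' \<subseteq> T" "x \<in> T" "x' \<in> T" for T
 proof
  note TD = subD[OF T(1)]
  fix g assume g: "g \<in> M"
  then have gc: "g \<in> carrier L" using MD(1) by blast
  obtain a b :: nat where ab: "g \<otimes> (x' [^] a \<otimes> x [^] b) \<in> cent {x, x'}" using adjust[OF cc gc r] by blast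
  let ?w = "x' [^] a \<otimes> x [^] b"
  have "?w \<in> M" and wT: "?w \<in> T" using MD(3,6) TD(3,6) c T by blast+
  then have "g \<otimes> ?w \<in> T" using ab g MD(3) T(2) unfolding M'_def by blast
  then have "(g \<otimes> ?w) \<otimes> inv ?w \<in> T" using wT TD(3,4) by blast
  then show "g \<in> T" using gc cc by (simp add: m_assoc)
 qed
 then show "sub T ==> M' \<subseteq> T ==> x \<in> T ==> x' \<in> T ==> M \<subseteq> T" by blast
 have "ext (ext M' x) x' = M"
 proof
  show "ext (ext M' x) x' \<subseteq> M" by (intro ext_least M c) (simp add: M'_def)
  show "M \<subseteq> ext (ext M' x) x'" using E1 E2 by (intro least) auto
 qed
 then show "card M = p * p * card M'" using card_ext[OF E1(1) cc(2) x'M] card_ext[OF M' cc(1) xM] by simp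
qed

text \<open>A symplectic basis of \<open>M\<close>: \<open>r\<close> hyperbolic pairs, then
  generators of the radical modulo \<open>z\<close>. The last clause is non-degeneracy modulo the
  radical: if the commutator functional of \<open>g\<close> vanishes on the radical of
  \<open>M\<close>, then on \<open>M\<close> it is inverse to that of some \<open>m\<close> in
  \<open>M\<close>.\<close>

definition decomp :: "'a set => nat => 'a list => bool" where
 "decomp M r xs \<longleftrightarrow> std r xs \<and> set xs \<subseteq> M \<and> (\<forall>T. sub T --> set xs \<subseteq> T --> M \<subseteq> T) \<and> card M = p ^ Suc (length xs) \<and>
  (\<forall>y\<in>set (drop (2 * r) xs). \<forall>h\<in>M. rel y h 0) \<and>
  (\<forall>g\<in>carrier L. (\<forall>y\<in>set (drop (2 * r) xs). rel g y 0) --> (\<exists>m\<in>M. \<forall>h\<in>M. rel (g \<otimes> m) h 0))"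

lemma decompD:
 assumes "decomp M r xs"
 shows "std r xs" "set xs \<subseteq> M" "sub T ==> set xs \<subseteq> T ==> M \<subseteq> T" "card M = p ^ Suc (length xs)"
  "y \<in> set (drop (2 * r) xs) ==> h \<in> M ==> rel y h 0"
  "g \<in> carrier L ==> \<forall>y\<in>set (drop (2 * r) xs). rel g y 0 ==> \<exists>m\<in>M. \<forall>h\<in>M. rel (g \<otimes> m) h 0"
 using assms unfolding decomp_def by simp_all

text \<open>Induction on the order. An abelian \<open>M\<close> is its own radical; otherwise a
  non-commuting pair is scaled to have commutator \<open>z\<close> and split off.\<close>

lemma symplectic_decomposition:
 assumes "sub M"
 shows "\<exists>r xs. decomp M r xs"
 using assms
proof (induction "card M" arbitrary: M rule: less_induct)
 case less
 note M = less.prems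
 note MD = subD[OF M]
 show ?case
 proof (cases "\<forall>x\<in>M. \<forall>y\<in>M. rel x y 0")
  case True
  obtain ys where ys: "set ys \<subseteq> M" "!!T. sub T ==> zp ` {..<p} \<subseteq> T ==> set ys \<subseteq> T ==> M \<subseteq> T"
   "card M = card (zp ` {..<p}) * p ^ length ys"
   using list_extension[OF zset(1) M zset(3)[OF M]] by blast
  have gen: "M \<subseteq> T" if "sub T" "set ys \<subseteq> T" for T using ys(2) zset(3) that by blast
  show ?thesis
  proof (intro exI[of _ 0] exI[of _ ys], unfold decomp_def, intro conjI allI impI ballI)
   show "std 0 ys" unfolding std_def using True ys(1) MD(1) by (auto simp: nth_mem subset_iff)
   show "card M = p ^ Suc (length ys)" using ys(3) zset(2) by simp
   show "rel y h 0" if "y \<in> set (drop (2 * 0) ys)" "h \<in> M" for y h using that True ys(1) by auto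
   fix g assume g: "g \<in> carrier L" "\<forall>y\<in>set (drop (2 * 0) ys). rel g y 0"
   have "M \<subseteq> cent {g}"
    by (rule gen[OF sub_cent]) (use g ys(1) MD(1) in \<open>auto simp: cent_def\<close>)
   then show "\<exists>m\<in>M. \<forall>h\<in>M. rel (g \<otimes> m) h 0" using MD(5) g(1) by (intro bexI[of _ \<one>]) (auto simp: cent_def)
  qed (use ys(1) gen in auto)
 next
  case False
  then obtain x y where xy: "x \<in> M" "y \<in> M" "\<not> rel y x 0" by blast
  have xc: "x \<in> carrier L" "y \<in> carrier L" using xy MD(1) by auto
  obtain i where i: "rel y x i" using commutator xc by blast
  have "\<not> p dvd i" using rel_mod[OF i, of 0] xy(3) by (auto simp: mod_eq_0_iff_dvd)
  from nat_inverse_mod_prime[OF prime_p this] obtain c v where cv: "i * c = p * v + 1" .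
  \<comment> \<open>The exponent \<open>c\<close> inverts \<open>i\<close> modulo \<open>p\<close>,
    so that the commutator of \<open>x'\<close> and \<open>x\<close> becomes
    \<open>z\<close>.\<close>
  define x' where "x' = y [^] c"
  have x': "x' \<in> M" "x' \<in> carrier L" unfolding x'_def using MD(6)[OF xy(2)] xc by auto
  have r: "rel x' x 1" unfolding x'_def
   by (rule rel_mod[OF rel_pow_left[OF i xc(2,1), of c]]) (simp only: mult.commute[of c i] cv mod_mult_self4)
  define M' where "M' = M \<inter> cent {x, x'}"
  note H = hyperbolic_pair[OF M xy(1) x'(1) r, folded M'_def]
  have lt: "card M' < card M" by (rule psubset_card_mono[OF MD(7) H(2)])
  obtain r' xs where "decomp M' r' xs"
   using less.hyps[OF lt H(1)] by blast
  note IH = decompD[OF this]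
  have gen: "M \<subseteq> cent {h}" if h: "h \<in> carrier L" "M' \<subseteq> cent {h}" "rel h x 0" "rel h x' 0" for h
   by (rule H(4)[OF sub_cent]) (use h xc x' in \<open>auto simp: cent_def\<close>)
  have M'c: "M' \<subseteq> carrier L" "M' \<subseteq> cent {x, x'}" using MD(1) unfolding M'_def by auto
  have dr: "drop (2 * Suc r') (x # x' # xs) = drop (2 * r') xs" by simp
  show ?thesis
  proof (intro exI[of _ "Suc r'"] exI[of _ "x # x' # xs"], unfold decomp_def dr, intro conjI allI impI ballI)
   show "std (Suc r') (x # x' # xs)" by (rule std_Cons[OF IH(1) xc(1) x'(2) r]) (use IH(2) M'c in auto)
   show "set (x # x' # xs) \<subseteq> M" using xy x' IH(2) unfolding M'_def by auto
   show "card M = p ^ Suc (length (x # x' # xs))" using H(3) IH(4) by simp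
   show "M \<subseteq> T" if "sub T" "set (x # x' # xs) \<subseteq> T" for T using H(4)[OF that(1)] IH(3)[OF that(1)] that(2) by simp
   show "rel y h 0" if y: "y \<in> set (drop (2 * r') xs)" and h: "h \<in> M" for y h
   proof -
    have yM: "y \<in> M'" using y IH(2) set_drop_subset by fast
    then have yc: "y \<in> carrier L" "rel y x 0" "rel y x' 0"
     using M'c(1) cent_rel[OF subsetD[OF M'c(2) yM]] xc x' by auto
    have "M \<subseteq> cent {y}" by (rule gen[OF yc(1) _ yc(2,3)]) (use IH(5)[OF y] M'c in \<open>auto simp: cent_def\<close>)
    then show ?thesis using h by (auto simp: cent_def)
   qed
   fix g assume g: "g \<in> carrier L" "\<forall>y\<in>set (drop (2 * r') xs). rel g y 0"
   obtain m' where m': "m' \<in> M'" "!!h. h \<in> M' ==> rel (g \<otimes> m') h 0" using IH(6)[OF g] by blast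
   have mc: "m' \<in> carrier L" "m' \<in> M" using m' M'c unfolding M'_def by auto
   have gm: "g \<otimes> m' \<in> carrier L" using g mc by simp
   \<comment> \<open>After the correction \<open>m'\<close> for \<open>M'\<close>, a word in
     \<open>x\<close> and \<open>x'\<close> repairs the commutators with the pair; it commutes with
     \<open>M'\<close>, so the first correction stays intact.\<close>
   obtain a b :: nat where ab: "(g \<otimes> m') \<otimes> (x' [^] a \<otimes> x [^] b) \<in> cent {x, x'}"
    using adjust[OF xc(1) x'(2) gm r] by blast
   let ?w = "x' [^] a \<otimes> x [^] b"
   have w: "?w \<in> M" "?w \<in> carrier L" using MD(3,6) xy x' xc by auto
   have hc: "(g \<otimes> m') \<otimes> ?w \<in> carrier L" using gm w by simp
   have "M \<subseteq> cent {(g \<otimes> m') \<otimes> ?w}"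
   proof (rule gen[OF hc])
    show "rel (g \<otimes> m' \<otimes> ?w) x 0" "rel (g \<otimes> m' \<otimes> ?w) x' 0"
     using cent_rel[OF ab] xc x' by auto
    have "rel ((g \<otimes> m') \<otimes> ?w) h 0" if h: "h \<in> M'" for h
    proof -
     have hh: "h \<in> carrier L" "rel x h 0" "rel x' h 0" using h M'c by (auto simp: cent_def)
     have "rel ?w h (a * 0 + b * 0)"
      by (intro rel_mult_left rel_pow_left hh xc x' nat_pow_closed)
     from rel_mult_left[OF m'(2)[OF h] this gm w(2) hh(1)] show ?thesis by simp
    qed
    then show "M' \<subseteq> cent {(g \<otimes> m') \<otimes> ?w}" using M'c by (auto simp: cent_def)
   qed
   then have "\<forall>h\<in>M. rel (g \<otimes> (m' \<otimes> ?w)) h 0" using g mc w by (auto simp: cent_def m_assoc)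
   then show "\<exists>m\<in>M. \<forall>h\<in>M. rel (g \<otimes> m) h 0" using MD(3)[OF mc(2) w(1)] by blast
  qed
 qed
qed

end

section \<open>The \<open>p\<close>-th power map and the normal form\<close>

context central_extension
begin

lemma pth_power_z:
 assumes w: "w \<in> carrier L" "w [^] p ~= \<one>"
 obtains c :: nat where "(w [^] c) [^] p = z"
proof -
 obtain i :: nat where i: "w [^] p = z [^] i" using pth_power[OF w(1)] by blast
 then have "\<not> p dvd i" using w(2) zp_eq_one_iff by simp
 from nat_inverse_mod_prime[OF prime_p this] obtain c v where cv: "i * c = p * v + 1" .
 have "(w [^] c) [^] p = (w [^] p) [^] c" using w(1) by (simp add: nat_pow_pow mult.commute)
 also have "... = zp (i * c)" unfolding i by (simp add: nat_pow_pow)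
 also have "... = zp 1" unfolding cv zp_eq_iff by (rule mod_mult_self4)
 finally show thesis using that by simp
qed

text \<open>The kernel of the linear form given by the \<open>p\<close>-th power map: a hyperplane
  unless the form is zero.\<close>

definition torsion :: "'a set" where "torsion = {g \<in> carrier L. g [^] p = \<one>}"

lemma sub_torsion: "sub torsion"
 by (rule subI) (auto simp: torsion_def z_pow pth_power_mult)

text \<open>For any \<open>g\<close> the right power of \<open>y\<close> cancels the
  \<open>p\<close>-th power of \<open>g\<close>, so \<open>y\<close> spans a complement of the
  hyperplane.\<close>

lemma torsion_complement:
 assumes y: "y \<in> carrier L" "y [^] p = z"
 shows "g \<in> carrier L ==> \<exists>j::nat. g \<otimes> y [^] j \<in> torsion" "card (carrier L) = p * card torsion"
  "sub T ==> torsion \<subseteq> T ==> y \<in> T ==> carrier L \<subseteq> T"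
proof -
 have yj: "(y [^] (j::nat)) [^] p = zp j" for j
 proof -
  have "(y [^] j) [^] p = (y [^] p) [^] j" using y(1) by (simp add: nat_pow_pow mult.commute)
  then show ?thesis unfolding y(2) .
 qed
 show c: "\<exists>j::nat. g \<otimes> y [^] j \<in> torsion" if g: "g \<in> carrier L" for g
 proof -
  obtain i :: nat where i: "g [^] p = z [^] i" using pth_power[OF g] by blast
  have "i + (p - 1) * i = p * i" using p_gt_1 by (cases p) auto
  then have "zp (i + (p - 1) * i) = \<one>" by (simp add: zp_eq_one_iff)
  then have "(g \<otimes> y [^] ((p - 1) * i)) [^] p = \<one>"
   using pth_power_mult[OF g nat_pow_closed[OF y(1)]] by (simp only: yj i nat_pow_mult[OF z_closed])
  then show ?thesis using g y(1) unfolding torsion_def by (intro exI[of _ "(p - 1) * i"]) simp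
 qed
 show gen: "carrier L \<subseteq> T" if T: "sub T" "torsion \<subseteq> T" "y \<in> T" for T
 proof
  fix g assume g: "g \<in> carrier L"
  obtain j :: nat where "g \<otimes> y [^] j \<in> torsion" using c[OF g] by blast
  then have "(g \<otimes> y [^] j) \<otimes> inv (y [^] j) \<in> T" using T subD(3,4,6)[OF T(1)] by blast
  then show "g \<in> T" using g y(1) by (simp add: m_assoc)
 qed
 note E = sub_ext[OF sub_torsion y(1)]
 have "ext torsion y = carrier L" using gen[OF E] subD(1)[OF E(1)] by blast
 moreover have "y \<notin> torsion" using y(2) z_neq unfolding torsion_def by simp
 ultimately show "card (carrier L) = p * card torsion" using card_ext[OF sub_torsion y(1)] by simp
qed

lemma one_cent: "\<one> \<in> cent (carrier L)" and z_cent: "z \<in> cent (carrier L)"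
 unfolding cent_def using rel_one rel_z by auto

lemma exponent_length: "p ^ a = p ^ b ==> a = b"
 using p_gt_1 power_inject_exp by blast

text \<open>If the \<open>p\<close>-th power map is non-trivial but trivial on the centre, some element \<open>x'\<close>
 represents it: \<open>x'\<close> centralises the \<open>p\<close>-torsion, and an element commuting with \<open>x'\<close> is torsion.\<close>

lemma torsion_dual_element:
 assumes y: "y \<in> carrier L" "y [^] p = z"
  and cen: "!!w. w \<in> carrier L ==> \<forall>g\<in>carrier L. rel g w 0 ==> w [^] p = \<one>"
 obtains x where "x \<in> carrier L" "rel x y 1" "!!g. g \<in> carrier L ==> rel x g 0 ==> g \<in> torsion"
proof -
 note TC = torsion_complement[OF y]
 have tc: "torsion \<subseteq> carrier L" unfolding torsion_def by blast
 \<comment> \<open>Otherwise the radical of \<open>torsion\<close> commutes with \<open>y\<close>,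
   and the last clause of \<open>decomp\<close> gives \<open>m\<close> in \<open>torsion\<close>
   with \<open>y \<otimes> m\<close> centralising \<open>torsion\<close>. Then
   \<open>y \<otimes> m\<close> commutes with \<open>y\<close> as well and is central, although its
   \<open>p\<close>-th power is \<open>z\<close>.\<close>
 have "\<exists>x\<in>carrier L. (\<forall>h\<in>torsion. rel x h 0) \<and> \<not> rel x y 0"
 proof (rule ccontr)
  assume n: "\<not> ?thesis"
  have yc: "rel x y 0" if "x \<in> carrier L" "!!h. h \<in> torsion ==> rel x h 0" for x using n that by blast
  obtain r xs where "decomp torsion r xs" using symplectic_decomposition[OF sub_torsion] by blast
  note D = decompD[OF this]
  have "rel y v 0" if v: "v \<in> set (drop (2 * r) xs)" for v
  proof -
   have vc: "v \<in> carrier L" using v D(2) tc set_drop_subset by fast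
   show ?thesis by (rule rel_0_sym[OF vc y(1) yc[OF vc D(5)[OF v]]])
  qed
  then obtain m where m: "m \<in> torsion" "!!h. h \<in> torsion ==> rel (y \<otimes> m) h 0" using D(6)[OF y(1)] by blast
  have mc: "m \<in> carrier L" "y \<otimes> m \<in> carrier L" using m(1) tc y(1) by auto
  have "carrier L \<subseteq> cent {y \<otimes> m}"
   by (rule TC(3)[OF sub_cent]) (use mc m(2) tc y(1) yc[OF mc(2) m(2)] in \<open>auto simp: cent_def\<close>)
  then have "\<forall>g\<in>carrier L. rel g (y \<otimes> m) 0" using cent_rel[of _ "{y \<otimes> m}"] mc(2) by auto
  from cen[OF mc(2) this] have "z \<otimes> m [^] p = \<one>" using pth_power_mult[OF y(1) mc(1)] y(2) by simp
  then show False using m(1) z_neq unfolding torsion_def by simp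
 qed
 then obtain x where x: "x \<in> carrier L" "!!h. h \<in> torsion ==> rel x h 0" "\<not> rel x y 0" by blast
 obtain i where i: "rel x y i" using commutator[OF x(1) y(1)] by blast
 have "\<not> p dvd i" using rel_mod[OF i, of 0] x(3) by (auto simp: mod_eq_0_iff_dvd)
 from nat_inverse_mod_prime[OF prime_p this] obtain c v where cv: "i * c = p * v + 1" .
 have xc: "x [^] c \<in> carrier L" using x(1) by simp
 have r1: "rel (x [^] c) y 1"
  by (rule rel_mod[OF rel_pow_left[OF i x(1) y(1), of c]]) (simp only: mult.commute[of c i] cv mod_mult_self4)
 \<comment> \<open>Some \<open>g \<otimes> y [^] j\<close> is torsion and hence commutes with
   \<open>x\<close>; comparing commutators with \<open>x [^] c\<close> shows that \<open>p\<close>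
   divides \<open>j\<close>.\<close>
 have "g \<in> torsion" if g: "g \<in> carrier L" "rel (x [^] c) g 0" for g
 proof -
  obtain j :: nat where j: "g \<otimes> y [^] j \<in> torsion" using TC(1)[OF g(1)] by blast
  have yj: "y [^] j \<in> carrier L" using y(1) by simp
  have "rel (x [^] c) (g \<otimes> y [^] j) (c * 0)" by (rule rel_pow_left[OF x(2)[OF j] x(1)]) (use g y in simp)
  moreover have "rel (x [^] c) (g \<otimes> y [^] j) (0 + j * 1)"
   by (rule rel_mult_right[OF g(2) rel_pow_right[OF r1 xc y(1)] xc g(1) yj])
  ultimately have "p dvd j" using rel_unique[of "x [^] c" "g \<otimes> y [^] j" 0 j] xc g(1) yj by (simp add: mod_eq_0_iff_dvd)
  then have "zp j = \<one>" by (simp only: zp_eq_one_iff)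
  moreover have "(y [^] j) [^] p = (y [^] p) [^] j" using y(1) by (simp add: nat_pow_pow mult.commute)
  ultimately have "(y [^] j) [^] p = \<one>" unfolding y(2) by simp
  then have "g [^] p = (g \<otimes> y [^] j) [^] p" using pth_power_mult[OF g(1) yj] g(1) by simp
  then show ?thesis using j g(1) unfolding torsion_def by simp
 qed
 then show thesis by (rule that[OF xc r1])
qed

text \<open>The three cases use a symplectic decomposition of the whole group, of the torsion
  subgroup, or of the complement of a hyperbolic pair; the remaining generators are added by
  hand.\<close>

lemma normal_form:
 assumes card: "card (carrier L) = p ^ (n + 1)"
 obtains r k xs where "(r, k) \<in> model_params n" "std r xs" "length xs = Suc n"
  "!!i. i \<le> n ==> (xs ! i) [^] modulus p n k i = \<one>" "(xs ! k) [^] central_step p n k = z"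
  "!!T. sub T ==> set xs \<subseteq> T ==> carrier L \<subseteq> T"
proof (cases "\<forall>g\<in>carrier L. g [^] p = \<one>")
 case True
 obtain r xs where "decomp (carrier L) r xs" using symplectic_decomposition[OF sub_carrier] by blast
 note D = decompD[OF this]
 have len: "length xs = n" using exponent_length[OF trans[OF card[symmetric] D(4)]] by simp
 have i: "(if i < n then xs ! i else z) [^] modulus p n n i = \<one>" if "i \<le> n" for i
 proof (cases "i < n")
  case i: True
  then have "xs ! i \<in> carrier L" using D(2) len nth_mem[of i xs] by blast
  then show ?thesis using i True by (simp add: modulus_def)
 qed (use that z_pow in \<open>simp add: modulus_def central_step_def\<close>)
 show thesis
 \<comment> \<open>\<open>z\<close> itself is the last generator, hence
   \<open>k = n\<close>.\<close>
 proof (rule that[of r n "xs @ [z]"])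
  show "(r, n) \<in> model_params n" using D(1) len unfolding std_def model_params_def by simp
  show "std r (xs @ [z])" by (rule std_append[OF D(1)]) (simp add: z_cent)
  show "((xs @ [z]) ! i) [^] modulus p n n i = \<one>" if "i \<le> n" for i
   using i[OF that] len that by (cases "i < n") (auto simp: nth_append)
  show "carrier L \<subseteq> T" if "sub T" "set (xs @ [z]) \<subseteq> T" for T using D(3) that by simp
 qed (simp_all add: len nth_append central_step_def)
next
 case False
 show thesis
 proof (cases "\<exists>w\<in>carrier L. (\<forall>g\<in>carrier L. rel g w 0) \<and> w [^] p ~= \<one>")
  case True
  then obtain w where w: "w \<in> carrier L" "!!g. g \<in> carrier L ==> rel g w 0" "w [^] p ~= \<one>" by blast
  obtain c :: nat where c: "(w [^] c) [^] p = z" by (rule pth_power_z[OF w(1,3)])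
  define W where "W = w [^] c"
  have W: "W \<in> carrier L" "W [^] p = z" unfolding W_def using w(1) c by auto
  have Wc: "W \<in> cent (carrier L)"
   unfolding cent_def using W(1) rel_pow_right[OF w(2) _ w(1), of _ c] unfolding W_def by auto
  note TC = torsion_complement[OF W]
  obtain r xs where "decomp torsion r xs" using symplectic_decomposition[OF sub_torsion] by blast
  note D = decompD[OF this]
  have "p ^ (n + 1) = p ^ Suc (Suc (length xs))"
   unfolding card[symmetric] TC(2) D(4) by (rule power_Suc[symmetric])
  then have len: "n = Suc (length xs)" using exponent_length by fastforce
  have i: "(if i < length xs then xs ! i else if i = length xs then W else \<one>) [^] modulus p n (length xs) i = \<one>"
   if il: "i \<le> n" for i
  proof -
   consider "i < length xs" | "i = length xs" | "i = n" using il len by linarith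
   then show ?thesis
   proof cases
    case 1
    then have "xs ! i \<in> torsion" using D(2) nth_mem by blast
    then show ?thesis using 1 len by (simp add: modulus_def torsion_def)
   next
    case 2
    then show ?thesis using len pow_p2[OF W(1)] by (simp add: modulus_def central_step_def)
   next
    case 3
    then show ?thesis using len by (simp add: modulus_def)
   qed
  qed
  show thesis
  \<comment> \<open>The central \<open>W\<close> with \<open>p\<close>-th power \<open>z\<close>
    takes position \<open>n - 1\<close>; the identity fills the trivial coordinate
    \<open>n\<close>.\<close>
  proof (rule that[of r "length xs" "xs @ [W, \<one>]"])
   show "(r, length xs) \<in> model_params n" using D(1) len unfolding std_def model_params_def by simp
   show "std r (xs @ [W, \<one>])" by (rule std_append[OF D(1)]) (simp add: Wc one_cent)
   show "((xs @ [W, \<one>]) ! i) [^] modulus p n (length xs) i = \<one>" if "i \<le> n" for i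
   proof -
    have "(xs @ [W, \<one>]) ! i = (if i < length xs then xs ! i else if i = length xs then W else \<one>)"
     using that len by (auto simp: nth_append le_Suc_eq)
    then show ?thesis using i[OF that] by simp
   qed
   show "((xs @ [W, \<one>]) ! length xs) [^] central_step p n (length xs) = z"
    using len W(2) by (simp add: nth_append central_step_def)
   show "carrier L \<subseteq> T" if "sub T" "set (xs @ [W, \<one>]) \<subseteq> T" for T
    by (rule TC(3)[OF that(1) D(3)[OF that(1)]]) (use that(2) in auto)
  qed (simp add: len)
 next
  case nocen: False
  obtain y0 where y0: "y0 \<in> carrier L" "y0 [^] p ~= \<one>" using False by blast
  obtain c :: nat where c: "(y0 [^] c) [^] p = z" by (rule pth_power_z[OF y0])
  define y where "y = y0 [^] c"
  have y: "y \<in> carrier L" "y [^] p = z" unfolding y_def using y0(1) c by auto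
  obtain x where x: "x \<in> carrier L" "rel x y 1" "!!g. g \<in> carrier L ==> rel x g 0 ==> g \<in> torsion"
   by (rule torsion_dual_element[OF y]) (use nocen in blast)+
  define M' where "M' = carrier L \<inter> cent {y, x}"
  note H = hyperbolic_pair[OF sub_carrier y(1) x(1,2), folded M'_def]
  \<comment> \<open>Elements of \<open>M'\<close> commute with \<open>x\<close>, and whatever
    commutes with \<open>x\<close> is torsion.\<close>
  have M't: "g [^] p = \<one>" if "g \<in> M'" for g using that x(3) unfolding M'_def cent_def torsion_def by auto
  have xp: "x [^] p = \<one>" using x(3)[OF x(1) rel_refl[OF x(1)]] unfolding torsion_def by simp
  obtain r xs where "decomp M' r xs" using symplectic_decomposition[OF H(1)] by blast
  note D = decompD[OF this]
  have "p ^ (n + 1) = p ^ Suc (Suc (Suc (length xs)))"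
   unfolding card[symmetric] H(3) D(4) by (simp only: power_Suc mult.assoc)
  then have len: "n = Suc (Suc (length xs))" using exponent_length by fastforce
  show thesis
  \<comment> \<open>The pair \<open>y\<close>, \<open>x\<close> comes first, so that the element
    with \<open>p\<close>-th power \<open>z\<close> has position 0; the identity again fills
    coordinate \<open>n\<close>.\<close>
  proof (rule that[of "Suc r" 0 "y # x # xs @ [\<one>]"])
   show "(Suc r, 0) \<in> model_params n" using D(1) len unfolding std_def model_params_def by simp
   have "std (Suc r) (y # x # xs)" by (rule std_Cons[OF D(1) y(1) x(1,2)]) (use D(2) in \<open>auto simp: M'_def\<close>)
   then show "std (Suc r) (y # x # xs @ [\<one>])" using std_append[of "Suc r" "y # x # xs" "[\<one>]"] one_cent by simp
   show "((y # x # xs @ [\<one>]) ! i) [^] modulus p n 0 i = \<one>" if i: "i \<le> n" for i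
   proof -
    consider "i = 0" | "i = 1" | j where "i = Suc (Suc j)" "j < length xs" | "i = n"
    proof (cases "i = 0 \<or> i = 1 \<or> i = n")
     case False
     then have "i = Suc (Suc (i - 2))" "i - 2 < length xs" using i len by linarith+
     then show ?thesis using that(3) by blast
    qed (use that in blast)
    then show ?thesis
    proof cases
     case 1
     then show ?thesis using len pow_p2[OF y(1)] by (simp add: modulus_def central_step_def)
    next
     case 2
     then show ?thesis using len xp by (simp add: modulus_def)
    next
     case 3
     have "xs ! j \<in> M'" using 3(2) D(2) nth_mem by blast
     then show ?thesis using 3 len M't by (simp add: modulus_def nth_append)
    next
     case 4
     then show ?thesis using len by (simp add: modulus_def nth_append)
    qed
   qed
   show "((y # x # xs @ [\<one>]) ! 0) [^] central_step p n 0 = z" using len y(2) by (simp add: central_step_def)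
   show "carrier L \<subseteq> T" if "sub T" "set (y # x # xs @ [\<one>]) \<subseteq> T" for T
    by (rule H(4)[OF that(1) D(3)[OF that(1)]]) (use that(2) in auto)
  qed (simp add: len)
 qed
qed

theorem iso_model_group:
 assumes card: "card (carrier L) = p ^ (n + 1)"
 shows "\<exists>(r, k) \<in> model_params n. model_group p n r k \<cong> L"
proof -
 obtain r k xs where N: "(r, k) \<in> model_params n" "std r xs" "length xs = Suc n"
  "!!i. i \<le> n ==> (xs ! i) [^] modulus p n k i = \<one>" "(xs ! k) [^] central_step p n k = z"
  "!!T. sub T ==> set xs \<subseteq> T ==> carrier L \<subseteq> T" by (rule normal_form[OF card]) blast
 interpret M: model p n r k by (intro model.intro prime_p odd_p N)
 have xc: "set xs \<subseteq> carrier L" using N(2) unfolding std_def by blast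
 have "model_target p n r k L z (%i. xs ! i)"
 proof (intro model_target.intro M.model_axioms central_element_axioms model_target_axioms.intro)
  show "xs ! i \<in> carrier L" if "i \<le> n" for i using that xc N(3) nth_mem[of i xs] by auto
  show "rel (xs ! j) (xs ! i) (if odd j \<and> j < 2 * r \<and> Suc i = j then 1 else 0)" if "i < j" "j \<le> n" for i j
   using N(2,3) that unfolding std_def by simp
 qed (use N(4,5) in auto)
 then interpret T: model_target p n r k L z "%i. xs ! i" .
 have "model_group p n r k \<cong> L"
 proof (rule T.\<Phi>_iso[OF _ card])
  fix T assume T: "subgroup T L" "!!i. i \<le> n ==> xs ! i \<in> T"
  have s: "set xs \<subseteq> T" using T(2) N(3) by (auto simp: in_set_conv_nth)
  interpret S: subgroup T L by (rule T(1))
  have "(xs ! k) [^] (j::nat) \<in> T" for j using T(2)[OF M.k_le] by (induction j) auto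
  from this[of "central_step p n k"] have "sub T" unfolding sub_def using T(1) N(5) by simp
  then show "carrier L \<subseteq> T" using N(6) s by blast
 qed
 then show ?thesis using N(1) by blast
qed

end

text \<open>By Lagrange the kernel has prime order \<open>p\<close>, so any element of it other than
  the identity generates it.\<close>

lemma cyclic_kernel_generator:
 assumes L: "group L" "finite (carrier L)" and G: "group G" and q: "q \<in> hom L G" "q ` carrier L = carrier G"
  and card: "card (carrier L) = card (carrier G) * p" and p: "Factorial_Ring.prime p"
 obtains z where "z \<in> carrier L" "z [^]\<^bsub>L\<^esub> p = \<one>\<^bsub>L\<^esub>" "z ~= \<one>\<^bsub>L\<^esub>"
  "!!x. x \<in> carrier L ==> q x = \<one>\<^bsub>G\<^esub> \<longleftrightarrow> (\<exists>j<p. x = z [^]\<^bsub>L\<^esub> j)" "inj_on (%j. z [^]\<^bsub>L\<^esub> j) {..<p}"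
proof -
 interpret L: group L by fact
 interpret q: group_hom L G q by (intro group_hom.intro L G group_hom_axioms.intro q)
 have p1: "1 < p" using p by (rule prime_gt_1_nat)
 let ?K = "kernel L G q"
 have K: "subgroup ?K L" by (rule q.subgroup_kernel)
 interpret KG: group "L\<lparr>carrier := ?K\<rparr>" by (rule subgroup.subgroup_is_group[OF K L(1)])
 have fK: "finite ?K" by (rule finite_subset[OF subgroup.subset[OF K] L(2)])
 have "bij_betw (%Y. the_elem (q ` Y)) (rcosets\<^bsub>L\<^esub> ?K) (carrier G)"
  using q.FactGroup_iso_set[OF q(2)] by (simp add: iso_def FactGroup_def)
 then have "card (rcosets\<^bsub>L\<^esub> ?K) = card (carrier G)" by (rule bij_betw_same_card)
 then have "card (carrier G) * card ?K = card (carrier G) * p"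
  using L.lagrange[OF K] card unfolding order_def by simp
 moreover have "finite (carrier G)" unfolding q(2)[symmetric] using L(2) by (rule finite_imageI)
 then have "card (carrier G) > 0" using q.H.one_closed by (auto simp: card_gt_0_iff)
 ultimately have cK: "card ?K = p" by simp
 have "?K ~= {\<one>\<^bsub>L\<^esub>}" using cK p1 by auto
 then obtain z where z: "z \<in> ?K" "z ~= \<one>\<^bsub>L\<^esub>" using subgroup.one_closed[OF K] by blast
 have zc: "z \<in> carrier L" using z subgroup.subset[OF K] by blast
 have zp: "z [^]\<^bsub>L\<^esub> p = \<one>\<^bsub>L\<^esub>"
  using KG.pow_order_eq_1[of z] z(1) cK L.nat_pow_consistent[of z p ?K] by (simp add: order_def)
 have "L.ord z dvd p" using L.pow_eq_id[OF zc, of p] zp by simp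
 moreover have "L.ord z ~= 1" using L.pow_eq_id[OF zc, of 1] z(2) zc by auto
 ultimately have o: "L.ord z = p" using p[unfolded prime_nat_iff] by blast
 have "{..<p} = {0..L.ord z - 1}" unfolding o using p1 by auto
 then have inj: "inj_on (%j. z [^]\<^bsub>L\<^esub> j) {..<p}" using L.ord_inj[OF zc] by simp
 have zK: "z [^]\<^bsub>L\<^esub> j \<in> ?K" for j :: nat using KG.nat_pow_closed[of z j] z(1) L.nat_pow_consistent[of z j ?K] by simp
 have "(%j. z [^]\<^bsub>L\<^esub> j) ` {..<p} = ?K"
  by (rule card_subset_eq[OF fK]) (use zK cK card_image[OF inj] in auto)
 then have "q x = \<one>\<^bsub>G\<^esub> \<longleftrightarrow> (\<exists>j<p. x = z [^]\<^bsub>L\<^esub> j)" if "x \<in> carrier L" for x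
  using that unfolding kernel_def by blast
 then show thesis using that zc zp z(2) inj by blast
qed

text \<open>Commutators and \<open>p\<close>-th powers die in \<open>G\<close> and so are powers of
  \<open>z\<close>; the point is that \<open>z\<close> is central.\<close>

lemma central_extension_of_elementary_abelian:
 assumes L: "group L" "finite (carrier L)" and G: "comm_group G" "!!x. x \<in> carrier G ==> x [^]\<^bsub>G\<^esub> p = \<one>\<^bsub>G\<^esub>"
  and q: "q \<in> hom L G" "q ` carrier L = carrier G"
  and card: "card (carrier L) = card (carrier G) * p" and p: "Factorial_Ring.prime p" "odd p"
 obtains z where "central_extension L z p" "q z = \<one>\<^bsub>G\<^esub>"
proof -
 interpret L: group L by fact
 interpret G: comm_group G by fact
 interpret q: group_hom L G q by (intro group_hom.intro L G.is_group group_hom_axioms.intro q)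
 obtain z where z: "z \<in> carrier L" "z [^]\<^bsub>L\<^esub> p = \<one>\<^bsub>L\<^esub>" "z ~= \<one>\<^bsub>L\<^esub>"
  and ker: "!!x. x \<in> carrier L ==> q x = \<one>\<^bsub>G\<^esub> \<longleftrightarrow> (\<exists>j<p. x = z [^]\<^bsub>L\<^esub> j)"
  and inj: "inj_on (%j. z [^]\<^bsub>L\<^esub> j) {..<p}"
  by (rule cyclic_kernel_generator[OF L G.is_group q card p(1)], rule that)
 have p1: "1 < p" using p(1) by (rule prime_gt_1_nat)
 have "\<exists>j<p. z = z [^]\<^bsub>L\<^esub> j" using p1 z(1) by (intro exI[of _ 1]) simp
 then have qz: "q z = \<one>\<^bsub>G\<^esub>" unfolding ker[OF z(1)] .
 have qe: "\<exists>j. a = z [^]\<^bsub>L\<^esub> (j::nat) \<otimes>\<^bsub>L\<^esub> b" if ab: "a \<in> carrier L" "b \<in> carrier L" "q a = q b" for a b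
 proof -
  have "q (a \<otimes>\<^bsub>L\<^esub> inv\<^bsub>L\<^esub> b) = \<one>\<^bsub>G\<^esub>" using ab by simp
  then obtain j where "a \<otimes>\<^bsub>L\<^esub> inv\<^bsub>L\<^esub> b = z [^]\<^bsub>L\<^esub> (j::nat)" using ker[of "a \<otimes>\<^bsub>L\<^esub> inv\<^bsub>L\<^esub> b"] ab by auto
  then have "(a \<otimes>\<^bsub>L\<^esub> inv\<^bsub>L\<^esub> b) \<otimes>\<^bsub>L\<^esub> b = z [^]\<^bsub>L\<^esub> j \<otimes>\<^bsub>L\<^esub> b" by simp
  then show ?thesis using ab by (auto simp: L.m_assoc)
 qed
 have pow: "\<exists>j::nat. x [^]\<^bsub>L\<^esub> p = z [^]\<^bsub>L\<^esub> j" if x: "x \<in> carrier L" for x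
  using ker[of "x [^]\<^bsub>L\<^esub> p"] q.hom_nat_pow[OF x, of p] G(2)[of "q x"] x by auto
 \<comment> \<open>Conjugation by \<open>x\<close> sends \<open>z\<close> to its \<open>j\<close>-th
   power. The \<open>p\<close>-th power of \<open>x\<close> is a power of \<open>z\<close> and
   commutes with \<open>z\<close>, so \<open>j ^ p\<close> is 1 modulo \<open>p\<close>, and by
   Fermat so is \<open>j\<close>.\<close>
 have cen: "x \<otimes>\<^bsub>L\<^esub> z = z \<otimes>\<^bsub>L\<^esub> x" if x: "x \<in> carrier L" for x
 proof -
  have "q (x \<otimes>\<^bsub>L\<^esub> z) = q x" using x z(1) qz by simp
  from qe[OF _ x this] obtain j :: nat where j: "x \<otimes>\<^bsub>L\<^esub> z = z [^]\<^bsub>L\<^esub> j \<otimes>\<^bsub>L\<^esub> x" using x z(1) by auto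
  have ji: "x \<otimes>\<^bsub>L\<^esub> z [^]\<^bsub>L\<^esub> i = z [^]\<^bsub>L\<^esub> (i * j) \<otimes>\<^bsub>L\<^esub> x" for i :: nat
  proof (induction i)
   case (Suc i)
   have "x \<otimes>\<^bsub>L\<^esub> z [^]\<^bsub>L\<^esub> Suc i = z [^]\<^bsub>L\<^esub> (i * j) \<otimes>\<^bsub>L\<^esub> (x \<otimes>\<^bsub>L\<^esub> z)"
    using Suc x z(1) by (simp add: L.m_assoc[symmetric])
   then show ?case unfolding j using x z(1) by (simp add: L.m_assoc[symmetric] L.nat_pow_mult add.commute)
  qed (use x in simp)
  have jm: "x [^]\<^bsub>L\<^esub> i \<otimes>\<^bsub>L\<^esub> z = z [^]\<^bsub>L\<^esub> (j ^ i) \<otimes>\<^bsub>L\<^esub> x [^]\<^bsub>L\<^esub> i" for i :: nat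
  proof (induction i)
   case (Suc i)
   have "x [^]\<^bsub>L\<^esub> Suc i \<otimes>\<^bsub>L\<^esub> z = x \<otimes>\<^bsub>L\<^esub> (x [^]\<^bsub>L\<^esub> i \<otimes>\<^bsub>L\<^esub> z)"
    using x z(1) L.nat_pow_Suc2[OF x, of i] by (simp add: L.m_assoc del: L.nat_pow_Suc)
   also have "... = (x \<otimes>\<^bsub>L\<^esub> z [^]\<^bsub>L\<^esub> (j ^ i)) \<otimes>\<^bsub>L\<^esub> x [^]\<^bsub>L\<^esub> i" unfolding Suc using x z(1) by (simp add: L.m_assoc)
   also have "... = z [^]\<^bsub>L\<^esub> (j ^ i * j) \<otimes>\<^bsub>L\<^esub> x [^]\<^bsub>L\<^esub> Suc i"
    unfolding ji using x z(1) L.nat_pow_Suc2[OF x, of i] by (simp add: L.m_assoc del: L.nat_pow_Suc)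
   finally show ?case by (simp add: mult.commute)
  qed (use z(1) in simp)
  obtain i :: nat where i: "x [^]\<^bsub>L\<^esub> p = z [^]\<^bsub>L\<^esub> i" using pow[OF x] by blast
  have "z [^]\<^bsub>L\<^esub> Suc i = z [^]\<^bsub>L\<^esub> (j ^ p) \<otimes>\<^bsub>L\<^esub> z [^]\<^bsub>L\<^esub> i" using jm[of p] unfolding i by simp
  then have "z [^]\<^bsub>L\<^esub> (1 + i) = z [^]\<^bsub>L\<^esub> (j ^ p + i)" using z(1) by (simp add: L.nat_pow_mult)
  then have "z [^]\<^bsub>L\<^esub> ((1 + i) mod p) = z [^]\<^bsub>L\<^esub> ((j ^ p + i) mod p)" by (simp only: L.pow_mod[OF z(1,2)])
  then have "(1 + i) mod p = (j ^ p + i) mod p" using inj_onD[OF inj] p1 by simp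
  then have "[j ^ p + i = 1 + i] (mod p)" unfolding cong_def by (rule sym)
  then have jp: "[j ^ p = 1] (mod p)" by (simp only: cong_add_rcancel_nat)
  have "\<not> p dvd j"
  proof
   assume "p dvd j"
   then have "p dvd j ^ p" by (rule dvd_trans[OF _ dvd_power]) (use p1 in simp)
   then show False using jp p1 by (simp add: cong_def mod_eq_0_iff_dvd)
  qed
  from fermat_theorem[OF p(1) this] have "[j ^ (p - 1) * j = 1 * j] (mod p)" by (rule cong_scalar_right)
  moreover have "j ^ (p - 1) * j = j ^ p" by (rule power_minus_mult) (use p1 in simp)
  ultimately have "j mod p = 1" using jp p1 by (simp add: cong_def)
  then have "z [^]\<^bsub>L\<^esub> j = z" using L.pow_mod[OF z(1,2), of j] z(1) by simp
  then show ?thesis using j by simp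
 qed
 interpret Z: central_element L z by unfold_locales (use z cen in auto)
 have "central_extension L z p"
 proof unfold_locales
  show "\<exists>i. Z.rel x y i" if "x \<in> carrier L" "y \<in> carrier L" for x y
   unfolding Z.rel_def using that by (intro qe) (simp_all add: G.m_comm)
 qed (use p L(2) z pow in auto)
 then show thesis by (rule that[OF _ qz])
qed

text \<open>A basis of \<open>G\<close> is read off from the group theory at hand: the direct
  product of the cyclic group with \<open>G\<close> is a central extension of \<open>G\<close>, and
  its symplectic decomposition is projected to \<open>G\<close>.\<close>

lemma elementary_abelian_basis:
 assumes G: "comm_group G" "!!x. x \<in> carrier G ==> x [^]\<^bsub>G\<^esub> p = \<one>\<^bsub>G\<^esub>" and card: "card (carrier G) = p ^ n"
  and p: "Factorial_Ring.prime p" "odd p"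
 obtains ys where "length ys = n" "set ys \<subseteq> carrier G" "!!T. subgroup T G ==> set ys \<subseteq> T ==> carrier G \<subseteq> T"
proof -
 interpret G: comm_group G by fact
 have p1: "1 < p" using p(1) by (rule prime_gt_1_nat)
 have fG: "finite (carrier G)" using card p1 by (intro card_ge_0_finite) simp
 let ?C = "integer_mod_group p"
 let ?L = "?C \<times>\<times> G"
 have C: "carrier ?C = {0..<int p}" using p1 by (simp add: carrier_integer_mod_group)
 have L: "group ?L" by (intro DirProd_group group_integer_mod_group G.is_group)
 have fL: "finite (carrier ?L)" using fG by (simp add: C)
 have cL: "card (carrier ?L) = p ^ n * p" using card by (simp add: C card_cartesian_product)
 have sh: "snd \<in> hom ?L G" by (rule homI) (auto simp: mult_DirProd')
 have si: "snd ` carrier ?L = carrier G" using p1 by (simp add: C)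
 obtain z where z: "central_extension ?L z p" "snd z = \<one>\<^bsub>G\<^esub>"
  by (rule central_extension_of_elementary_abelian[OF L fL G sh si _ p]) (use cL card in simp_all)
 interpret E: central_extension ?L z p by (rule z(1))
 obtain r xs where "E.decomp (carrier ?L) r xs" using E.symplectic_decomposition[OF E.sub_carrier] by blast
 note D = E.decompD[OF this]
 have "p ^ Suc n = p ^ Suc (length xs)" using trans[OF cL[symmetric] D(4)] by (simp only: power_Suc mult.commute)
 then have "length xs = n" using E.exponent_length by fastforce
 moreover have "set (map snd xs) \<subseteq> carrier G" using D(2) by auto
 moreover have "carrier G \<subseteq> T" if T: "subgroup T G" "set (map snd xs) \<subseteq> T" for T
 proof -
  interpret T: subgroup T G by (rule T(1))
  have S: "subgroup (carrier ?C \<times> T) ?L"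
   by (intro DirProd_subgroups group_integer_mod_group G.is_group group.subgroup_self T(1))
  have zT: "z \<in> carrier ?C \<times> T" using E.z_closed z(2) by (auto simp: mem_Times_iff)
  have "set xs \<subseteq> carrier ?C \<times> T" using D(2) T(2) by (auto simp: mem_Times_iff)
  then have "carrier ?L \<subseteq> carrier ?C \<times> T" using D(3) S zT unfolding E.sub_def by blast
  moreover have "(0, g) \<in> carrier ?L" if "g \<in> carrier G" for g using that by simp
  ultimately show ?thesis by blast
 qed
 ultimately show thesis using that[of "map snd xs"] by simp
qed

section \<open>Counting isomorphism types\<close>

text \<open>The count is made among Hopf algebras whose elements are functions on
  \<open>nat\<close>, so the model groups have to be transported to \<open>nat\<close>.\<close>

lemma finite_group_nat_copy:
 assumes "group E" "finite (carrier E)"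
 shows "\<exists>L :: nat monoid. group L \<and> finite (carrier L) \<and> E \<cong> L"
proof -
 interpret E: group E by fact
 obtain f :: "_ => nat" where f: "inj_on f (carrier E)"
  using ex_bij_betw_finite_nat[OF assms(2)] unfolding bij_betw_def by blast
 define H :: "nat monoid" where
  "H = \<lparr>carrier = UNIV, monoid.mult = (%a b. f (inv_into (carrier E) f a \<otimes>\<^bsub>E\<^esub> inv_into (carrier E) f b)), one = 0\<rparr>"
 let ?L = "H\<lparr>carrier := f ` carrier E, one := f \<one>\<^bsub>E\<^esub>\<rparr>"
 have "f \<in> hom E H" by (rule homI) (simp_all add: H_def inv_into_f_f[OF f])
 from E.hom_imp_img_group[OF this] have "group ?L" .
 moreover have "f \<in> iso E ?L"
  unfolding iso_def bij_betw_def using f by (auto intro!: homI simp: H_def inv_into_f_f[OF f])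
 ultimately show ?thesis using assms(2) unfolding is_iso_def by (intro exI[of _ ?L]) auto
qed

lemma card_model_params: "card (model_params n) = nat \<lfloor>(3 * real n + 2) / 2\<rfloor>"
proof -
 \<comment> \<open>For \<open>n = 0\<close> the truncated difference \<open>n - 1\<close> does no
   harm, because \<open>?B\<close> is then empty.\<close>
 let ?A = "(%r. (r, n)) ` {..n div 2}" and ?B = "(%r. (r, n - 1)) ` {..<(n + 1) div 2}"
  and ?C = "(%r. (r, 0 :: nat)) ` {1..n div 2}"
 have "model_params n = ?A \<union> (?B \<union> ?C)"
 proof (rule Set.set_eqI)
  fix u show "u \<in> model_params n \<longleftrightarrow> u \<in> ?A \<union> (?B \<union> ?C)"
   by (cases u) (auto simp: model_params_def image_iff)
 qed
 moreover have "?A \<inter> (?B \<union> ?C) = {}" "?B \<inter> ?C = {}" by auto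
 moreover have "card ?A = n div 2 + 1" "card ?B = (n + 1) div 2" "card ?C = n div 2"
  by (simp_all add: card_image inj_on_def)
 ultimately have "card (model_params n) = n div 2 + 1 + ((n + 1) div 2 + n div 2)"
  by (simp add: card_Un_disjoint)
 also have "... = (3 * n + 2) div 2" by presburger
 also have "... = nat \<lfloor>real (3 * n + 2) / real 2\<rfloor>" unfolding floor_divide_of_nat_eq by simp
 finally show ?thesis by (simp add: add.commute)
qed

locale elementary_abelian_kernel =
 fixes K :: "('k, 'm) ring_scheme" and G :: "('g, 'n) monoid_scheme" and p n :: nat
 assumes alg_closed: "algebraically_closed K"
  and char_0: "!!m :: nat. m > 0 ==> [m] \<cdot>\<^bsub>K\<^esub> \<one>\<^bsub>K\<^esub> ~= \<zero>\<^bsub>K\<^esub>"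
  and prime_p: "Factorial_Ring.prime p" and odd_p: "odd p"
  and comm_G: "comm_group G" and exponent_G: "!!x. x \<in> carrier G ==> x [^]\<^bsub>G\<^esub> p = \<one>\<^bsub>G\<^esub>"
  and order_G: "order G = p ^ n"
begin

lemma field_K: "field K"
proof -
 interpret algebraically_closed K by (rule alg_closed)
 show ?thesis by (rule field_axioms)
qed

lemma p_pos: "p > 0" using prime_p by (rule prime_gt_0_nat)

lemma card_G: "card (carrier G) = p ^ n" using order_G by (simp add: order_def)

lemma finite_G: "finite (carrier G)" using card_G p_pos by (intro card_ge_0_finite) simp

lemma group_G: "group G" using comm_G by (rule comm_group.axioms(2))

lemma group_functions: "group L ==> finite (carrier L) ==> group_functions K L"
 by (intro group_functions.intro field_K group_functions_axioms.intro)

lemma model: "(r, k) \<in> model_params n ==> model p n r k"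
 by (intro model.intro prime_p odd_p)

text \<open>With trivial \<open>z\<close> the group \<open>G\<close> itself satisfies the relations
  of the model group: a basis supplies the first \<open>n\<close> generators and the identity the
  last. The moduli at the basis elements are multiples of \<open>p\<close>, so the orders
  fit.\<close>

lemma model_to_G:
 assumes "(r, k) \<in> model_params n"
 obtains q where "q \<in> hom (model_group p n r k) G" "q ` carrier (model_group p n r k) = carrier G"
proof -
 interpret M: model p n r k by (rule model[OF assms])
 interpret G: comm_group G by (rule comm_G)
 obtain ys where ys: "length ys = n" "set ys \<subseteq> carrier G" "!!T. subgroup T G ==> set ys \<subseteq> T ==> carrier G \<subseteq> T"
  by (rule elementary_abelian_basis[OF comm_G exponent_G card_G prime_p odd_p], assumption, rule that)
 interpret C: central_element G "\<one>\<^bsub>G\<^esub>" by unfold_locales simp_all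
 let ?x = "%i. if i < n then ys ! i else \<one>\<^bsub>G\<^esub>"
 have xc: "?x i \<in> carrier G" for i using ys(1,2) nth_mem[of i ys] by auto
 have xp: "?x i [^]\<^bsub>G\<^esub> (p * d) = \<one>\<^bsub>G\<^esub>" for i and d :: nat
  using G.nat_pow_pow[OF xc[of i], of p d] exponent_G[OF xc[of i]] by simp
 have "model_target p n r k G \<one>\<^bsub>G\<^esub> ?x"
 proof (intro model_target.intro M.model_axioms C.central_element_axioms model_target_axioms.intro)
  show "?x i \<in> carrier G" for i by (rule xc)
  show "C.rel (?x j) (?x i) l" for i j l
   unfolding C.rel_def G.nat_pow_one using G.m_comm[OF xc[of j] xc[of i]] xc[of i] xc[of j] by simp
  show "?x i [^]\<^bsub>G\<^esub> modulus p n k i = \<one>\<^bsub>G\<^esub>" if "i \<le> n" for i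
  proof (cases "i < n")
   case True
   from M.p_dvd_m[OF this] obtain d where "modulus p n k i = p * d" by (elim dvdE)
   then show ?thesis using xp[of i d] by simp
  qed simp
  show "?x k [^]\<^bsub>G\<^esub> central_step p n k = \<one>\<^bsub>G\<^esub>"
   using xp[of k 1] M.k_le by (cases "k = n") (simp_all add: central_step_def)
 qed
 then interpret T: model_target p n r k G "\<one>\<^bsub>G\<^esub>" ?x .
 have "T.\<Phi> ` carrier M.E = carrier G"
 proof (rule T.\<Phi>_surj)
  fix T assume T: "subgroup T G" "!!i. i \<le> n ==> ?x i \<in> T"
  have "ys ! i \<in> T" if "i < n" for i using T(2)[of i] that by simp
  then have "set ys \<subseteq> T" using ys(1) by (auto simp: in_set_conv_nth)
  then show "carrier G \<subseteq> T" by (rule ys(3)[OF T(1)])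
 qed
 then show thesis using that[OF T.\<Phi>_hom] by blast
qed

lemma extension_of_model:
 assumes rk: "(r, k) \<in> model_params n" and L: "group L" and iso: "model_group p n r k \<cong> L"
 shows "function_hopf K L \<in> commutative_extensions K G p"
proof -
 interpret M: model p n r k by (rule model[OF rk])
 obtain q where q: "q \<in> hom M.E G" "q ` carrier M.E = carrier G" by (rule model_to_G[OF rk])
 obtain h where h: "h \<in> iso L M.E" using M.E.iso_sym[OF iso] unfolding is_iso_def by blast
 then have h': "h \<in> hom L M.E" "h ` carrier L = carrier M.E" unfolding iso_def bij_betw_def by auto
 have fL: "finite (carrier L)" using iso_finite[OF iso] M.finite_E by blast
 have cL: "card (carrier L) = card (carrier G) * p" using iso_same_card[OF iso] M.card_E card_G by (simp add: mult.commute)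
 have qh: "q \<circ> h \<in> hom L G" "(q \<circ> h) ` carrier L = carrier G"
  using hom_compose[OF h'(1) q(1)] h'(2) q(2) by (simp_all only: image_comp[symmetric])
 obtain z where z: "z \<in> carrier L" "z [^]\<^bsub>L\<^esub> p = \<one>\<^bsub>L\<^esub>" "z ~= \<one>\<^bsub>L\<^esub>"
  "!!x. x \<in> carrier L ==> (q \<circ> h) x = \<one>\<^bsub>G\<^esub> \<longleftrightarrow> (\<exists>j<p. x = z [^]\<^bsub>L\<^esub> j)" "inj_on (%j. z [^]\<^bsub>L\<^esub> j) {..<p}"
  by (rule cyclic_kernel_generator[OF L fL group_G qh cL prime_p], rule that)
 obtain \<zeta> where \<zeta>: "root_of_unity_field K p \<zeta>"
  by (rule root_of_unity_field_exists[OF alg_closed char_0 prime_p], assumption, rule that)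
 interpret cyclic_kernel K p \<zeta> L G "q \<circ> h" z
  by (intro cyclic_kernel.intro \<zeta> group_functions L fL group_G finite_G cyclic_kernel_axioms.intro qh z)
 show ?thesis by (rule function_hopf_extension)
qed

lemma model_of_extension:
 assumes H: "H \<in> commutative_extensions K G p"
 shows "\<exists>(r, k) \<in> model_params n. \<exists>L :: ('h => 'k) monoid. group L \<and> finite (carrier L) \<and>
  model_group p n r k \<cong> L \<and> hopf_isomorphic K (H :: ('k, 'h) hopf_data) (function_hopf K L)"
proof -
 obtain L :: "('h => 'k) monoid" and q where L: "group L" "card (carrier L) = card (carrier G) * p"
  "hopf_isomorphic K H (function_hopf K L)" "q \<in> hom L G" "q ` carrier L = carrier G"
  by (rule commutative_extension_structure[OF alg_closed char_0 prime_p group_G finite_G H], assumption, rule that)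
 have fL: "finite (carrier L)" using L(2) card_G p_pos by (intro card_ge_0_finite) simp
 obtain z where "central_extension L z p"
  by (rule central_extension_of_elementary_abelian[OF L(1) fL comm_G exponent_G L(4,5,2) prime_p odd_p],
    assumption, rule that)
 then interpret E: central_extension L z p .
 have "card (carrier L) = p ^ (n + 1)" using L(2) card_G by simp
 from E.iso_model_group[OF this] show ?thesis using L(1,3) fL by blast
qed

definition nat_model :: "nat => nat => nat monoid" where
 "nat_model r k = (SOME L. group L \<and> finite (carrier L) \<and> model_group p n r k \<cong> L)"

lemma nat_model:
 assumes "(r, k) \<in> model_params n"
 shows "group (nat_model r k)" "finite (carrier (nat_model r k))" "model_group p n r k \<cong> nat_model r k"
proof -
 interpret M: model p n r k by (rule model[OF assms])
 from someI_ex[OF finite_group_nat_copy[OF M.group_E M.finite_E]]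
 show "group (nat_model r k)" "finite (carrier (nat_model r k))" "model_group p n r k \<cong> nat_model r k"
  unfolding nat_model_def by simp_all
qed

abbreviation model_hopf :: "nat \<times> nat => ('k, nat => 'k) hopf_data" where
 "model_hopf u \<equiv> function_hopf K (nat_model (fst u) (snd u))"

lemma model_hopf_extension:
 assumes "u \<in> model_params n"
 shows "model_hopf u \<in> commutative_extensions K G p"
proof -
 have u: "(fst u, snd u) \<in> model_params n" using assms by simp
 show ?thesis by (rule extension_of_model[OF u nat_model(1,3)[OF u]])
qed

lemma classification:
 fixes H :: "('k, 'h) hopf_data"
 assumes "H \<in> commutative_extensions K G p"
 shows "\<exists>u \<in> model_params n. hopf_isomorphic K H (model_hopf u)"
proof -
 obtain r k and L :: "('h => 'k) monoid" where rk: "(r, k) \<in> model_params n" and L: "group L" "finite (carrier L)"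
  "model_group p n r k \<cong> L" "hopf_isomorphic K H (function_hopf K L)"
  using model_of_extension[OF assms] by blast
 interpret M: model p n r k by (rule model[OF rk])
 note N = nat_model[OF rk]
 have "L \<cong> nat_model r k" by (rule iso_trans[OF M.E.iso_sym[OF L(3)] N(3)])
 then have "hopf_isomorphic K (function_hopf K L) (function_hopf K (nat_model r k))"
  by (rule function_hopf_iso[OF group_functions[OF L(1,2)] group_functions[OF N(1,2)]])
 from hopf_isomorphic_trans[OF L(4) this] show ?thesis using rk by (intro bexI[of _ "(r, k)"]) simp_all
qed

lemma model_hopf_distinct:
 assumes u: "u \<in> model_params n" and v: "v \<in> model_params n" and iso: "hopf_isomorphic K (model_hopf u) (model_hopf v)"
 shows "u = v"
proof -
 have u': "(fst u, snd u) \<in> model_params n" and v': "(fst v, snd v) \<in> model_params n" using u v by simp_all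
 interpret V: model p n "fst v" "snd v" by (rule model[OF v'])
 note U = nat_model[OF u'] and W = nat_model[OF v']
 have "nat_model (fst u) (snd u) \<cong> nat_model (fst v) (snd v)"
  by (rule group_iso_of_hopf_iso[OF group_functions[OF U(1,2)] group_functions[OF W(1,2)] iso])
 then have "model_group p n (fst u) (snd u) \<cong> model_group p n (fst v) (snd v)"
  using iso_trans[OF U(3) iso_trans[OF _ group.iso_sym[OF V.group_E W(3)]]] by blast
 from model_groups_not_iso[OF model[OF u'] model[OF v'] this] show ?thesis by (simp add: prod_eq_iff)
qed

lemma iso_class_eqI:
 fixes A B :: "('k, 'h) hopf_data"
 assumes "hopf_isomorphic K A B"
 shows "hopf_iso_rel K `` {A} = hopf_iso_rel K `` {B}"
proof (rule Set.set_eqI)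
 fix D :: "('k, 'h) hopf_data"
 have "hopf_isomorphic K A D \<longleftrightarrow> hopf_isomorphic K B D"
  using hopf_isomorphic_trans[OF hopf_isomorphic_sym[OF assms], of D] hopf_isomorphic_trans[OF assms, of D] by argo
 then show "D \<in> hopf_iso_rel K `` {A} \<longleftrightarrow> D \<in> hopf_iso_rel K `` {B}" unfolding hopf_iso_rel_def by simp
qed

lemma card_iso_classes:
 "card ((commutative_extensions K G p :: ('k, nat => 'k) hopf_data set) // hopf_iso_rel K) = card (model_params n)"
proof -
 let ?c = "%u. hopf_iso_rel K `` {model_hopf u}"
 let ?E = "commutative_extensions K G p :: ('k, nat => 'k) hopf_data set"
 have q: "?E // hopf_iso_rel K = ?c ` model_params n"
 proof (intro equalityI subsetI)
  fix D assume "D \<in> ?E // hopf_iso_rel K"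
  then obtain H where H: "H \<in> ?E" "D = hopf_iso_rel K `` {H}" by (rule quotientE)
  obtain u where u: "u \<in> model_params n" "hopf_isomorphic K H (model_hopf u)" using classification[OF H(1)] by blast
  show "D \<in> ?c ` model_params n" unfolding H(2) iso_class_eqI[OF u(2)] using u(1) by (rule imageI)
 next
  fix D assume "D \<in> ?c ` model_params n"
  then obtain u where u: "u \<in> model_params n" "D = ?c u" by (rule imageE)
  show "D \<in> ?E // hopf_iso_rel K" unfolding u(2) by (rule quotientI[OF model_hopf_extension[OF u(1)]])
 qed
 have "inj_on ?c (model_params n)"
 proof (rule inj_onI)
  fix u v assume u: "u \<in> model_params n" and v: "v \<in> model_params n" and eq: "?c u = ?c v"
  \<comment> \<open>\<open>hopf_isomorphic\<close> includes the Hopf axioms, so it is not reflexive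
    outright; reflexivity at \<open>model_hopf v\<close> comes from going to an isomorphic model and
    back.\<close>
  obtain w where w: "hopf_isomorphic K (model_hopf v) (model_hopf w)" using classification[OF model_hopf_extension[OF v]] by blast
  have "model_hopf v \<in> ?c v"
   unfolding hopf_iso_rel_def using hopf_isomorphic_trans[OF w hopf_isomorphic_sym[OF w]] by simp
  then have "model_hopf v \<in> ?c u" unfolding eq .
  then have "hopf_isomorphic K (model_hopf u) (model_hopf v)" unfolding hopf_iso_rel_def by simp
  then show "u = v" by (rule model_hopf_distinct[OF u v])
 qed
 then show ?thesis unfolding q by (rule card_image)
qed

end

theorem proposition5p4:
  fixes K :: "('k, 'm) ring_scheme"
    and G :: "('g, 'n) monoid_scheme"
    and p n :: nat
  assumes "algebraically_closed K"
    and "\<And>m :: nat. m > 0 \<Longrightarrow> [m] \<cdot>\<^bsub>K\<^esub> \<one>\<^bsub>K\<^esub> \<noteq> \<zero>\<^bsub>K\<^esub>"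
    and "Factorial_Ring.prime p" and "odd p"
    and "comm_group G" and "\<And>x. x \<in> carrier G \<Longrightarrow> x [^]\<^bsub>G\<^esub> p = \<one>\<^bsub>G\<^esub>"
    and "order G = p ^ n"
  shows "card ((commutative_extensions K G p :: ('k, nat \<Rightarrow> 'k) hopf_data set) // hopf_iso_rel K)
           = nat \<lfloor>(3 * real n + 2) / 2\<rfloor> \<and>
         (\<forall>H \<in> (commutative_extensions K G p :: ('k, 'h) hopf_data set).
            \<exists>H' \<in> (commutative_extensions K G p :: ('k, nat \<Rightarrow> 'k) hopf_data set).
              hopf_isomorphic K H H')"
proof -
 interpret elementary_abelian_kernel K G p n by (intro elementary_abelian_kernel.intro assms)
 \<comment> \<open>Functions on \<open>nat\<close> form a large enough type: an extension over any
   element type is isomorphic to one of the model algebras.\<close>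
 have "\<exists>H' \<in> (commutative_extensions K G p :: ('k, nat => 'k) hopf_data set). hopf_isomorphic K H H'"
  if H: "H \<in> commutative_extensions K G p" for H :: "('k, 'h) hopf_data"
 proof -
  obtain u where u: "u \<in> model_params n" "hopf_isomorphic K H (model_hopf u)" using classification[OF H] by blast
  show ?thesis by (intro bexI[of _ "model_hopf u"] u(2) model_hopf_extension[OF u(1)])
 qed
 then show ?thesis using card_iso_classes card_model_params by simp
qed

end
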